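(* Let $\mathcal C$ be a small $\mathbb C$-linear category and let $\{\rho_t:\mathcal C\to SHilb_2\}_{t\in[0,1]}$ be a family of $\mathbb C$-linear functors such that for each $X\in Ob(\mathcal C)$ we have $\rho_t(X)=\rho_{t'}(X)=:\rho(X)$ for all $t,t'\in[0,1]$. For $t\in[0,1]$ set $\tilde\rho_t:=i\circ\rho_t$, where $i:SHilb_2\to SHilb_{\mathbb Z_2}$ is the functor $i(\mathcal H)=\mathcal H\oplus\mathcal H$, $i(T)=T$. Let $p$ be an even positive integer. For each $t\in[0,1]$ let $$\mathcal F_t=\left\{\mathcal F_t(X)=\begin{pmatrix}0&\mathcal Q_t(X)\\ \mathcal P_t(X)&0\end{pmatrix}:\rho(X)\oplus\rho(X)\to\rho(X)\oplus\rho(X)\right\}_{X\in Ob(\mathcal C)},\qquad \mathcal P_t(X)=\mathcal Q_t(X)^{-1},$$ be such that $(\tilde\rho_t,\mathcal F_t)$ is a $p$-summable even Fredholm module over $\mathcal C$. For $f\in Hom_{\mathcal C}(X,Y)$ write $\tilde\rho_t(f)=\begin{pmatrix}\tilde\rho_t^+(f)&0\\0&\tilde\rho_t^-(f)\end{pmatrix}$ and $\mathcal Q_t\tilde\rho_t^-(f)\mathcal P_t:=\mathcal Q_t(Y)\tilde\rho_t^-(f)\mathcal P_t(X)$. Assume that for every $f\in Hom_{\mathcal C}(X,Y)$: (1) $t\mapsto\tilde\rho_t^+(f)-\mathcal Q_t\tilde\rho_t^-(f)\mathcal P_t$ is a continuous map from $[0,1]$ to $\mathcal B^p(\rho(X),\rho(Y))$;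 (2) $t\mapsto\tilde\rho_t^+(f)$ and $t\mapsto\mathcal Q_t\tilde\rho_t^-(f)\mathcal P_t$ are piecewise strongly $C^1$ maps from $[0,1]$ to $\mathcal B(\rho(X),\rho(Y))$. Then $ch^{p+2}(\tilde\rho_t,\mathcal F_t)\in H^{p+2}_\lambda(\mathcal C)$ is independent of $t\in[0,1]$.
   Context: **Categories.** $SHilb_2$ has separable Hilbert spaces as objects and $SHilb_2(\mathcal H,\mathcal H')=\mathcal B(\mathcal H\oplus\mathcal H,\mathcal H'\oplus\mathcal H')$ (bounded operators). $SHilb_{\mathbb Z_2}$ has $\mathbb Z_2$-graded separable Hilbert spaces as objects and bounded linear maps as morphisms; $i(\mathcal H)=\mathcal H\oplus\mathcal H$ has first summand even and second summand odd. $\mathcal B^q$ denotes the $q$-th Schatten class with its Schatten norm, and $Tr$ the usual trace. **Even Fredholm modules.** A $p$-summable even Fredholm module over $\mathcal C$ is a pair $(\mathscr H,\mathcal F)$, where $\mathscr H:\mathcal C\to SHilb_{\mathbb Z_2}$ is a $\mathbb C$-linear functor with every $\mathscr H(f)$ of degree $0$, and $\mathcal F=\{\mathcal F_X:\mathscr H(X)\to\mathscr H(X)\}_X$ is a family of bounded operators of degree $1$ with $\mathcal F_X^2=id$, such that $[\mathcal F,f]:=\mathcal F_Y\mathscr H(f)-\mathscr H(f)\mathcal F_X\in\mathcal B^p(\mathscr H(X),\mathscr H(Y))$ for all $f\in Hom_{\mathcal C}(X,Y)$. Let $\epsilon$ be the grading operator; for homogeneous $T\in\mathcal B(\mathscr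 H(X),\mathscr H(X))$ with $[\mathcal F,T]:=\mathcal F_XT-(-1)^{|T|}T\mathcal F_X$ trace class, $Tr_s(T):=\frac12Tr(\epsilon\mathcal F_X[\mathcal F,T])$. For an even integer $2k\ge p-1$, the $2k$-dimensional character of $(\mathscr H,\mathcal F)$ is the cyclic cocycle $\phi^{2k}(f^0\otimes\cdots\otimes f^{2k})=Tr_s(\mathscr H(f^0)[\mathcal F,f^1]\cdots[\mathcal F,f^{2k}])$, and $ch^{2k}(\mathscr H,\mathcal F)$ is its class in $H^{2k}_\lambda(\mathcal C)$. **Strongly $C^1$.** A map $t\mapsto T_t$ into bounded operators is strongly $C^1$ if it is continuously differentiable for the strong operator topology, i.e. $t\mapsto T_t\xi$ is norm-$C^1$ for each vector $\xi$; it is piecewise strongly $C^1$ if there is a finite partition of $[0,1]$ into closed subintervals on each of which it is strongly $C^1$. **Cyclic cohomology.** $CN_n(\mathcal C)=\bigoplus_{(X_0,\dots,X_n)}Hom_{\mathcal C}(X_1,X_0)\otimes Hom_{\mathcal C}(X_2,X_1)\otimes\cdots\otimes Hom_{\mathcal C}(X_0,X_n)$, $CN^n(\mathcal C)$ is its linear dual, $(b\phi)(f^0\otimes\cdots\otimes f^{n+1})=\sum_{i=0}^n(-1)^i\phi(\cdots\otimes f^if^{i+1}\otimes\cdots)+(-1)^{n+1}\phi(f^{n+1}f^0\otimes f^1\otimes\cdots\otimes f^n)$, $(\lambda\phi)(f^0\otimes\cdots\otimes f^n)=(-1)^n\phi(f^n\otimes f^0\otimes\cdots\otimes f^{n-1})$,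 $C^n_\lambda(\mathcal C)=Ker(1-\lambda)$, and $H^n_\lambda(\mathcal C)$ is the $n$-th cohomology of $(C^\bullet_\lambda(\mathcal C),b)$. *)

theory Defs
  imports "HOL-Analysis.Analysis"
begin

section \<open>Complex inner product spaces\<close>

text \<open>
  A complex inner product, conjugate-linear in the first argument, on top of the library's
  \<^class>\<open>real_inner\<close>, whose inner product, norm and topology are the ones it induces.
\<close>

class complex_inner = real_inner +
  fixes scaleC :: "complex \<Rightarrow> 'a \<Rightarrow> 'a"  (infixr \<open>*\<^sub>C\<close> 75)
    and cinner :: "'a \<Rightarrow> 'a \<Rightarrow> complex"
  assumes scaleC_add_right: "a *\<^sub>C (x + y) = a *\<^sub>C x + a *\<^sub>C y"
    and scaleC_add_left: "(a + b) *\<^sub>C x = a *\<^sub>C x + b *\<^sub>C x"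
    and scaleC_scaleC: "a *\<^sub>C (b *\<^sub>C x) = (a * b) *\<^sub>C x"
    and scaleC_of_real: "complex_of_real r *\<^sub>C x = r *\<^sub>R x"
    and cinner_commute: "cinner x y = cnj (cinner y x)"
    and cinner_add_right: "cinner x (y + z) = cinner x y + cinner x z"
    and cinner_scaleC_right: "cinner x (a *\<^sub>C y) = a * cinner x y"
    and Re_cinner: "Re (cinner x y) = inner x y"

global_interpretation complex_vector: vector_space "scaleC :: complex \<Rightarrow> 'a \<Rightarrow> 'a::complex_inner"
proof
  show "1 *\<^sub>C x = x" for x :: 'a
    using scaleC_of_real[of 1 x] by simp
qed (simp_all add: scaleC_add_right scaleC_add_left scaleC_scaleC)

instantiation complex :: complex_inner
begin

definition "a *\<^sub>C (x::complex) = a * x"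
definition "cinner (x::complex) y = cnj x * y"

instance
  by standard
    (auto simp: scaleC_complex_def cinner_complex_def algebra_simps scaleR_conv_of_real
      inner_complex_def)

end

instantiation prod :: (complex_inner, complex_inner) complex_inner
begin

definition "a *\<^sub>C (x :: 'a \<times> 'b) = (a *\<^sub>C fst x, a *\<^sub>C snd x)"
definition "cinner (x :: 'a \<times> 'b) y = cinner (fst x) (fst y) + cinner (snd x) (snd y)"

instance
proof
  fix x y :: "'a \<times> 'b"
  show "cinner x y = cnj (cinner y x)"
    unfolding cinner_prod_def complex_cnj_add
    by (metis cinner_commute)
qed (auto simp: scaleC_prod_def cinner_prod_def scaleC_add_right scaleC_add_left scaleC_scaleC
      scaleC_of_real cinner_add_right cinner_scaleC_right Re_cinner inner_prod_def
      algebra_simps prod_eq_iff)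

end


section \<open>Hilbert spaces and bounded operators\<close>

text \<open>
  The spaces attached to the objects of a category have different dimensions, so a Hilbert space
  is a complete linear subspace of a type of class \<^class>\<open>complex_inner\<close> (which need not be
  complete itself).  Every set-indexed family of Hilbert spaces arises in this way up to unitary
  equivalence, for instance inside its direct sum.  An operator is a function of which only
  the values on its domain matter.
\<close>

definition separable_hilbert :: "'a::complex_inner set \<Rightarrow> bool" where
  "separable_hilbert V \<longleftrightarrow>
     complex_vector.subspace V \<and> complete V \<and> separable_space (top_of_set V)"

definition bounded_ops :: "'a::complex_inner set \<Rightarrow> 'b::complex_inner set \<Rightarrow> ('a \<Rightarrow> 'b) set" where
  "bounded_ops V W = {T. T ` V \<subseteq> W
     \<and> (\<forall>x\<in>V. \<forall>y\<in>V. T (x + y) = T x + T y)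
     \<and> (\<forall>a. \<forall>x\<in>V. T (a *\<^sub>C x) = a *\<^sub>C T x)
     \<and> (\<exists>K. \<forall>x\<in>V. norm (T x) \<le> K * norm x)}"

definition op_norm :: "'a::complex_inner set \<Rightarrow> ('a \<Rightarrow> 'b::complex_inner) \<Rightarrow> real" where
  "op_norm V T = (SUP x\<in>{x\<in>V. norm x \<le> 1}. norm (T x))"


section \<open>Schatten classes and the trace\<close>

definition rank_le :: "'a::complex_inner set \<Rightarrow> ('a \<Rightarrow> 'b::complex_inner) \<Rightarrow> nat \<Rightarrow> bool" where
  "rank_le V T n \<longleftrightarrow> (\<exists>B. finite B \<and> card B \<le> n \<and> T ` V \<subseteq> complex_vector.span B)"

text \<open>
  The singular numbers, counted from 0, as distances to the operators of rank at most \<open>n\<close>.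
  This makes sense for every bounded operator; \<open>singular_number_eq\<close> below confirms that they are
  the coefficients of a singular value decomposition.
\<close>

definition singular_number ::
  "'a::complex_inner set \<Rightarrow> 'b::complex_inner set \<Rightarrow> ('a \<Rightarrow> 'b) \<Rightarrow> nat \<Rightarrow> real" where
  "singular_number V W T n =
     (INF R\<in>{R \<in> bounded_ops V W. rank_le V R n}. op_norm V (\<lambda>x. T x - R x))"

lemma cinner_sum_right: "cinner x (\<Sum>i\<in>A. g i) = (\<Sum>i\<in>A. cinner x (g i))"
proof (induction A rule: infinite_finite_induct)
  case empty
  then show ?case using cinner_scaleC_right[of x 0 0] by simp
next
  case (infinite A)
  then show ?case using cinner_scaleC_right[of x 0 0] by simp
qed (simp add: cinner_add_right)

lemma cinner_sum_left: "cinner (\<Sum>i\<in>A. g i) x = (\<Sum>i\<in>A. cinner (g i) x)"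
  by (subst cinner_commute, subst cinner_sum_right, subst cnj_sum)
     (intro sum.cong refl, subst cinner_commute, simp)

lemma cinner_scaleC_left: "cinner (a *\<^sub>C x) y = cnj a * cinner x y"
  by (subst cinner_commute, subst cinner_scaleC_right, subst (2) cinner_commute) simp

lemma norm_scaleC: "norm (a *\<^sub>C x) = cmod a * norm (x::'a::complex_inner)"
proof -
  have "cinner (a *\<^sub>C x) (a *\<^sub>C x) = (cnj a * a) * cinner x x"
    by (simp add: cinner_scaleC_left cinner_scaleC_right)
  also have "cnj a * a = of_real ((cmod a)\<^sup>2)"
    using complex_norm_square[of a] by (simp add: mult.commute)
  finally have "Re (cinner (a *\<^sub>C x) (a *\<^sub>C x)) = (cmod a)\<^sup>2 * Re (cinner x x)"
    by simp
  then show ?thesis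
    by (simp add: Re_cinner norm_eq_sqrt_inner real_sqrt_mult)
qed

lemma norm_orthonormal_sum:
  assumes "finite A" "\<And>i j. i \<in> A \<Longrightarrow> j \<in> A \<Longrightarrow> cinner (f i) (f j) = of_bool (i = j)"
  shows "(norm (\<Sum>i\<in>A. c i *\<^sub>C f i))\<^sup>2 = (\<Sum>i\<in>A. (cmod (c i))\<^sup>2)"
proof -
  have "cinner (\<Sum>i\<in>A. c i *\<^sub>C f i) (\<Sum>j\<in>A. c j *\<^sub>C f j)
        = (\<Sum>i\<in>A. cnj (c i) * (\<Sum>j\<in>A. c j * cinner (f i) (f j)))"
    unfolding cinner_sum_left cinner_scaleC_left by (simp add: cinner_sum_right cinner_scaleC_right)
  also have "\<dots> = (\<Sum>i\<in>A. cnj (c i) * (\<Sum>j\<in>A. if j = i then c j else 0))"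
    by (intro sum.cong refl arg_cong2[of _ _ _ _ "(*)"]) (auto simp: assms(2))
  also have "\<dots> = (\<Sum>i\<in>A. of_real ((cmod (c i))\<^sup>2))"
    using assms(1) by (intro sum.cong refl) (simp add: complex_norm_square mult.commute del: of_real_power)
  finally have "Re (cinner (\<Sum>i\<in>A. c i *\<^sub>C f i) (\<Sum>i\<in>A. c i *\<^sub>C f i)) = (\<Sum>i\<in>A. (cmod (c i))\<^sup>2)"
    by simp
  then show ?thesis
    by (simp add: Re_cinner power2_norm_eq_inner)
qed

lemma bessel_inequality:
  assumes "finite A" "\<And>i j. i \<in> A \<Longrightarrow> j \<in> A \<Longrightarrow> cinner (e i) (e j) = of_bool (i = j)"
  shows "(\<Sum>i\<in>A. (cmod (cinner (e i) x))\<^sup>2) \<le> (norm x)\<^sup>2"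
proof -
  define y where "y = (\<Sum>i\<in>A. cinner (e i) x *\<^sub>C e i)"
  have y: "(norm y)\<^sup>2 = (\<Sum>i\<in>A. (cmod (cinner (e i) x))\<^sup>2)"
    unfolding y_def using assms by (rule norm_orthonormal_sum)
  have "cinner y x = (\<Sum>i\<in>A. of_real ((cmod (cinner (e i) x))\<^sup>2))"
    unfolding y_def cinner_sum_left cinner_scaleC_left
    by (intro sum.cong refl) (simp only: complex_norm_square mult.commute)
  then have "inner y x = (norm y)\<^sup>2"
    unfolding y Re_cinner[symmetric] by simp
  then have "norm y * norm y \<le> norm y * norm x"
    using norm_cauchy_schwarz[of y x] by (simp add: power2_eq_square)
  then have "norm y \<le> norm x"
    by (metis mult_le_cancel_left_pos norm_ge_zero order_le_less)
  then show ?thesis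
    unfolding y[symmetric] by (simp add: power_mono)
qed

lemma op_norm_upper:
  assumes "\<And>x. x \<in> V \<Longrightarrow> norm (T x) \<le> K * norm x" "x \<in> V" "norm x \<le> 1"
  shows "norm (T x) \<le> op_norm V T"
  unfolding op_norm_def
proof (rule cSUP_upper)
  show "bdd_above ((\<lambda>x. norm (T x)) ` {x \<in> V. norm x \<le> 1})"
  proof (rule bdd_aboveI2)
    fix x assume x: "x \<in> {x \<in> V. norm x \<le> 1}"
    have "K * norm x \<le> \<bar>K\<bar> * 1"
      using x by (intro mult_mono) auto
    then show "norm (T x) \<le> \<bar>K\<bar>" using assms(1)[of x] x by simp
  qed
qed (use assms in auto)

lemma bounded_ops_bound: "T \<in> bounded_ops V W \<Longrightarrow> \<exists>K. \<forall>x\<in>V. norm (T x) \<le> K * norm x"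
  unfolding bounded_ops_def by simp

lemma singular_number_eq:
  fixes T :: "'a::complex_inner \<Rightarrow> 'b::complex_inner" and s :: "nat \<Rightarrow> real"
  assumes V: "complex_vector.subspace V" and W: "complex_vector.subspace W"
    and T: "T \<in> bounded_ops V W"
    and s_nonneg: "\<And>i. 0 \<le> s i" and s_mono: "antimono s"
    and eV: "\<And>i. 0 < s i \<Longrightarrow> e i \<in> V" and fW: "\<And>i. 0 < s i \<Longrightarrow> f i \<in> W"
    and e: "\<And>i j. 0 < s i \<Longrightarrow> 0 < s j \<Longrightarrow> cinner (e i) (e j) = of_bool (i = j)"
    and f: "\<And>i j. 0 < s i \<Longrightarrow> 0 < s j \<Longrightarrow> cinner (f i) (f j) = of_bool (i = j)"
    and svd: "\<And>x. x \<in> V \<Longrightarrow> (\<lambda>i. (s i * cinner (e i) x) *\<^sub>C f i) sums T x"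
  shows "singular_number V W T n = s n"
proof (rule antisym)
  let ?S = "{R \<in> bounded_ops V W. rank_le V R n}"
  have bdd: "bdd_below ((\<lambda>R. op_norm V (\<lambda>x. T x - R x)) ` ?S)"
  proof (rule bdd_belowI2)
    fix R assume R: "R \<in> ?S"
    obtain K L where K: "\<forall>x\<in>V. norm (T x) \<le> K * norm x"
      and L: "\<forall>x\<in>V. norm (R x) \<le> L * norm x"
      using bounded_ops_bound[OF T] bounded_ops_bound[of R V W] R by auto
    have "norm (T 0 - R 0) \<le> op_norm V (\<lambda>x. T x - R x)"
    proof (rule op_norm_upper[where K = "K + L"])
      show "norm (T x - R x) \<le> (K + L) * norm x" if "x \<in> V" for x
        using norm_triangle_ineq4[of "T x" "R x"] bspec[OF K that] bspec[OF L that]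
        unfolding distrib_right by linarith
    qed (use complex_vector.subspace_0[OF V] in auto)
    then show "0 \<le> op_norm V (\<lambda>x. T x - R x)"
      by (rule order_trans[OF norm_ge_zero])
  qed
  define g where "g x i = (s i * cinner (e i) x) *\<^sub>C f i" for x i
  have g_bound: "norm (\<Sum>i\<in>{m..<k}. g x i) \<le> s m * norm x" for x m k
  proof -
    let ?A = "{i \<in> {m..<k}. 0 < s i}"
    have "(\<Sum>i\<in>{m..<k}. g x i) = (\<Sum>i\<in>?A. g x i)"
    proof (rule sum.mono_neutral_right)
      show "\<forall>i\<in>{m..<k} - ?A. g x i = 0"
      proof
        fix i assume "i \<in> {m..<k} - ?A"
        then have "s i = 0" using s_nonneg[of i] by simp
        then show "g x i = 0" by (simp add: g_def)
      qed
    qed auto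
    moreover have "(norm (\<Sum>i\<in>?A. g x i))\<^sup>2 = (\<Sum>i\<in>?A. (cmod (s i * cinner (e i) x))\<^sup>2)"
      unfolding g_def by (rule norm_orthonormal_sum) (simp_all add: f)
    ultimately have "(norm (\<Sum>i\<in>{m..<k}. g x i))\<^sup>2
        = (\<Sum>i\<in>?A. (cmod (s i * cinner (e i) x))\<^sup>2)"
      by simp
    also have "\<dots> \<le> (\<Sum>i\<in>?A. (s m)\<^sup>2 * (cmod (cinner (e i) x))\<^sup>2)"
    proof (rule sum_mono)
      fix i assume "i \<in> ?A"
      then have "s i \<le> s m" using s_mono by (auto dest: antimonoD)
      then show "(cmod (s i * cinner (e i) x))\<^sup>2 \<le> (s m)\<^sup>2 * (cmod (cinner (e i) x))\<^sup>2"
        using s_nonneg by (auto simp: norm_mult power_mult_distrib intro!: mult_right_mono power_mono)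
    qed
    also have "\<dots> \<le> (s m)\<^sup>2 * (norm x)\<^sup>2"
      unfolding sum_distrib_left[symmetric]
      using e by (intro mult_left_mono bessel_inequality) auto
    finally have "(norm (\<Sum>i\<in>{m..<k}. g x i))\<^sup>2 \<le> (s m * norm x)\<^sup>2"
      by (simp only: power_mult_distrib)
    then show ?thesis
      by (rule power2_le_imp_le) (simp add: s_nonneg)
  qed

  show "singular_number V W T n \<le> s n"
  proof -
    define R where "R x = (\<Sum>i<n. g x i)" for x
    have gW: "g x i \<in> W" for x i
    proof (cases "0 < s i")
      case True
      then show ?thesis unfolding g_def using fW complex_vector.subspace_scale[OF W] by blast
    next
      case False
      then have "s i = 0" using s_nonneg[of i] by simp
      then show ?thesis using complex_vector.subspace_0[OF W] by (simp add: g_def)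
    qed
    have "R \<in> bounded_ops V W"
      unfolding bounded_ops_def
    proof (intro CollectI conjI ballI allI)
      show "R ` V \<subseteq> W"
        using gW by (auto simp: R_def intro!: complex_vector.subspace_sum[OF W])
      show "\<exists>K. \<forall>x\<in>V. norm (R x) \<le> K * norm x"
        using g_bound[where m = 0 and k = n] unfolding R_def lessThan_atLeast0 by blast
    qed (simp_all add: R_def g_def cinner_add_right cinner_scaleC_right distrib_left
        scaleC_add_left sum.distrib complex_vector.scale_sum_right scaleC_scaleC mult.left_commute)
    moreover have "rank_le V R n"
      unfolding rank_le_def
    proof (intro exI conjI)
      show "card (f ` {..<n}) \<le> n"
        using card_image_le[of "{..<n}" f] by simp
      show "R ` V \<subseteq> complex_vector.span (f ` {..<n})"
      proof (rule image_subsetI)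
        show "R x \<in> complex_vector.span (f ` {..<n})" for x
          unfolding R_def g_def
          by (rule complex_vector.span_sum, rule complex_vector.span_scale,
              rule complex_vector.span_base) simp
      qed
    qed simp
    ultimately have "singular_number V W T n \<le> op_norm V (\<lambda>x. T x - R x)"
      unfolding singular_number_def by (intro cINF_lower[OF bdd]) simp
    also have "\<dots> \<le> s n"
      unfolding op_norm_def
    proof (rule cSUP_least)
      have "0 \<in> {x \<in> V. norm x \<le> 1}"
        using complex_vector.subspace_0[OF V] by simp
      then show "{x \<in> V. norm x \<le> 1} \<noteq> {}" by blast
      fix x assume x: "x \<in> {x \<in> V. norm x \<le> 1}"
      have "(\<lambda>k. (\<Sum>i<k. g x i) - R x) \<longlonglongrightarrow> T x - R x"
        by (rule tendsto_diff[OF _ tendsto_const]) (use svd[of x] x in \<open>simp add: sums_def g_def\<close>)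
      then have "(\<lambda>k. norm ((\<Sum>i<k. g x i) - R x)) \<longlonglongrightarrow> norm (T x - R x)"
        by (rule tendsto_norm)
      moreover have "norm ((\<Sum>i<k. g x i) - R x) \<le> s n" if "n \<le> k" for k
      proof -
        have "(\<Sum>i<k. g x i) = R x + (\<Sum>i\<in>{n..<k}. g x i)"
          unfolding R_def lessThan_atLeast0 using that
          by (simp add: sum.atLeastLessThan_concat)
        moreover have "s n * norm x \<le> s n"
          using x s_nonneg[of n] by (simp add: mult_left_le)
        ultimately show ?thesis using g_bound[where m = n and k = k and x = x] by simp
      qed
      ultimately show "norm (T x - R x) \<le> s n"
        using LIMSEQ_le_const2 by blast
    qed
    finally show ?thesis .
  qed

  show "s n \<le> singular_number V W T n"
    unfolding singular_number_def
  proof (rule cINF_greatest)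
    have "(\<lambda>_. 0) \<in> ?S"
      using complex_vector.subspace_0[OF W]
      by (auto simp: bounded_ops_def rank_le_def intro!: exI[of _ 0] exI[of _ "{}"])
    then show "?S \<noteq> {}" by blast
    fix R assume "R \<in> ?S"
    then have R: "R \<in> bounded_ops V W" and "rank_le V R n" by auto
    obtain K L where K: "\<forall>x\<in>V. norm (T x) \<le> K * norm x"
      and L: "\<forall>x\<in>V. norm (R x) \<le> L * norm x"
      using bounded_ops_bound[OF T] bounded_ops_bound[of R V W] R by auto
    have upper: "norm (T x - R x) \<le> op_norm V (\<lambda>x. T x - R x)" if "x \<in> V" "norm x \<le> 1" for x
    proof (rule op_norm_upper[where K = "K + L" and T = "\<lambda>x. T x - R x"])
      show "norm (T x - R x) \<le> (K + L) * norm x" if "x \<in> V" for x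
        using norm_triangle_ineq4[of "T x" "R x"] bspec[OF K that] bspec[OF L that]
        unfolding distrib_right by linarith
    qed (use that in auto)
    show "s n \<le> op_norm V (\<lambda>x. T x - R x)"
    proof (cases "s n = 0")
      case True
      have "0 \<le> norm (T 0 - R 0)" by simp
      also have "\<dots> \<le> op_norm V (\<lambda>x. T x - R x)"
        using complex_vector.subspace_0[OF V] by (intro upper) auto
      finally show ?thesis using True by simp
    next
      case False
      have pos: "0 < s i" if "i \<le> n" for i
        using antimonoD[OF s_mono that] s_nonneg[of n] False by linarith
      obtain B where B: "finite B" "card B \<le> n" "R ` V \<subseteq> complex_vector.span B"
        using \<open>rank_le V R n\<close> unfolding rank_le_def by blast
      obtain c k where c: "(\<Sum>i\<le>n. c i *\<^sub>C R (e i)) = 0" and k: "k \<le> n" "c k \<noteq> 0"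
      proof (cases "inj_on (\<lambda>i. R (e i)) {..n}")
        case True
        let ?E = "(\<lambda>i. R (e i)) ` {..n}"
        have "?E \<subseteq> complex_vector.span B"
          using B(3) eV pos by auto
        then have "complex_vector.dependent ?E"
          using complex_vector.independent_span_bound[of B ?E] B card_image[OF True] by auto
        then obtain u v where u: "(\<Sum>v\<in>?E. u v *\<^sub>C v) = 0" "v \<in> ?E" "u v \<noteq> 0"
          using complex_vector.dependent_finite[of ?E] by auto
        then show ?thesis
          using that[of "\<lambda>i. u (R (e i))"] by (auto simp: sum.reindex[OF True])
      next
        case False
        then obtain i j where ij: "i \<le> n" "j \<le> n" "i \<noteq> j" "R (e i) = R (e j)"
          by (auto simp: inj_on_def)
        define c :: "nat \<Rightarrow> complex" where "c l = (if l = i then 1 else 0) - (if l = j then 1 else 0)" for l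
        have "(\<Sum>l\<le>n. c l *\<^sub>C R (e l))
              = (\<Sum>l\<le>n. if l = i then R (e l) else 0) - (\<Sum>l\<le>n. if l = j then R (e l) else 0)"
          unfolding sum_subtractf[symmetric] by (rule sum.cong) (auto simp: c_def)
        then have "(\<Sum>l\<le>n. c l *\<^sub>C R (e l)) = 0" using ij by simp
        then show ?thesis using that[of c i] ij by (simp add: c_def)
      qed
      define x where "x = (\<Sum>i\<le>n. c i *\<^sub>C e i)"
      have xV: "x \<in> V"
        unfolding x_def using eV pos
        by (intro complex_vector.subspace_sum[OF V] complex_vector.subspace_scale[OF V]) auto
      have norm_x: "(norm x)\<^sup>2 = (\<Sum>i\<le>n. (cmod (c i))\<^sup>2)"
        unfolding x_def using e pos by (intro norm_orthonormal_sum) auto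
      have "0 < (cmod (c k))\<^sup>2" using k by simp
      also have "\<dots> \<le> (\<Sum>i\<le>n. (cmod (c i))\<^sup>2)" using k by (intro member_le_sum) auto
      finally have x0: "0 < norm x" using norm_x by (metis norm_eq_zero not_less_iff_gr_or_eq
            power_zero_numeral zero_less_norm_iff)
      have R_sum: "R (\<Sum>i\<in>A. c i *\<^sub>C e i) = (\<Sum>i\<in>A. c i *\<^sub>C R (e i))" if "A \<subseteq> {..n}" for A
        using finite_subset[OF that finite_atMost] that
      proof (induction A rule: finite_induct)
        case empty
        have "R (0 *\<^sub>C 0) = 0 *\<^sub>C R 0"
          using R complex_vector.subspace_0[OF V] unfolding bounded_ops_def by blast
        then show ?case by simp
      next
        case (insert i A)
        have "c i *\<^sub>C e i \<in> V" "(\<Sum>i\<in>A. c i *\<^sub>C e i) \<in> V" "e i \<in> V"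
          using insert.prems eV pos
          by (auto intro!: complex_vector.subspace_sum[OF V] complex_vector.subspace_scale[OF V])
        then show ?case using insert R unfolding bounded_ops_def by auto
      qed
      have Rx: "R x = 0" using R_sum[of "{..n}"] c by (simp add: x_def)
      have ex: "cinner (e i) x = (if i \<le> n then c i else 0)" if "0 < s i" for i
      proof -
        have "cinner (e i) x = (\<Sum>j\<le>n. c j * of_bool (i = j))"
          unfolding x_def cinner_sum_right cinner_scaleC_right using e pos that
          by (intro sum.cong) auto
        also have "\<dots> = (\<Sum>j\<le>n. if j = i then c j else 0)"
          by (intro sum.cong) auto
        finally show ?thesis by simp
      qed
      have "(\<lambda>i. g x i) sums (\<Sum>i\<le>n. g x i)"
      proof (rule sums_finite)
        show "g x i = 0" if "i \<notin> {..n}" for i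
          using ex[of i] that s_nonneg[of i] by (cases "s i = 0") (auto simp: g_def)
      qed simp
      then have "T x = (\<Sum>i\<le>n. g x i)"
        using svd[OF xV] unfolding g_def by (rule sums_unique2[symmetric])
      also have "\<dots> = (\<Sum>i\<le>n. (s i * c i) *\<^sub>C f i)"
        using ex pos by (intro sum.cong) (auto simp: g_def)
      finally have "(norm (T x))\<^sup>2 = (\<Sum>i\<le>n. (cmod (s i * c i))\<^sup>2)"
        using f pos norm_orthonormal_sum[of "{..n}" f "\<lambda>i. s i * c i"] by simp
      also have "\<dots> \<ge> (\<Sum>i\<le>n. (s n)\<^sup>2 * (cmod (c i))\<^sup>2)"
      proof (rule sum_mono)
        fix i assume "i \<in> {..n}"
        then have "s n \<le> s i" using s_mono by (auto dest: antimonoD)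
        then show "(s n)\<^sup>2 * (cmod (c i))\<^sup>2 \<le> (cmod (s i * c i))\<^sup>2"
          using s_nonneg by (auto simp: norm_mult power_mult_distrib intro!: mult_right_mono power_mono)
      qed
      finally have "(s n * norm x)\<^sup>2 \<le> (norm (T x))\<^sup>2"
        by (simp add: power_mult_distrib norm_x sum_distrib_left)
      then have Tx: "s n * norm x \<le> norm (T x)" by (rule power2_le_imp_le) simp
      define r where "r = complex_of_real (1 / norm x)"
      have rx: "r *\<^sub>C x \<in> V" using xV complex_vector.subspace_scale[OF V] by blast
      have "norm (r *\<^sub>C x) = 1" using x0 by (simp add: r_def norm_scaleC norm_divide)
      then have "norm (T (r *\<^sub>C x) - R (r *\<^sub>C x)) \<le> op_norm V (\<lambda>x. T x - R x)"
        using rx by (intro upper) auto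
      also have "T (r *\<^sub>C x) - R (r *\<^sub>C x) = r *\<^sub>C T x"
        using T R xV Rx unfolding bounded_ops_def by auto
      also have "norm (r *\<^sub>C T x) = norm (T x) / norm x"
        by (simp add: r_def norm_scaleC norm_divide)
      finally have "norm (T x) / norm x \<le> op_norm V (\<lambda>x. T x - R x)" .
      moreover have "s n \<le> norm (T x) / norm x"
        using Tx x0 by (simp add: pos_le_divide_eq)
      ultimately show ?thesis by linarith
    qed
  qed
qed

definition schatten ::
  "real \<Rightarrow> 'a::complex_inner set \<Rightarrow> 'b::complex_inner set \<Rightarrow> ('a \<Rightarrow> 'b) set" where
  "schatten q V W =
     {T \<in> bounded_ops V W. summable (\<lambda>n. singular_number V W T n powr q)}"

definition schatten_norm ::
  "real \<Rightarrow> 'a::complex_inner set \<Rightarrow> 'b::complex_inner set \<Rightarrow> ('a \<Rightarrow> 'b) \<Rightarrow> real" where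
  "schatten_norm q V W T = (\<Sum>n. singular_number V W T n powr q) powr (1 / q)"

definition orthonormal :: "'a::complex_inner set \<Rightarrow> bool" where
  "orthonormal B \<longleftrightarrow> (\<forall>e\<in>B. \<forall>f\<in>B. cinner e f = (if e = f then 1 else 0))"

definition orthonormal_basis :: "'a::complex_inner set \<Rightarrow> 'a set \<Rightarrow> bool" where
  "orthonormal_basis V B \<longleftrightarrow>
     B \<subseteq> V \<and> orthonormal B \<and> V \<subseteq> closure (complex_vector.span B)"

text \<open>The common value of the diagonal sums over all orthonormal bases.\<close>

definition op_trace :: "'a::complex_inner set \<Rightarrow> ('a \<Rightarrow> 'a) \<Rightarrow> complex" where
  "op_trace V T =
     (THE s. \<forall>B. orthonormal_basis V B \<longrightarrow> ((\<lambda>e. cinner e (T e)) has_sum s) B)"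


section \<open>Small complex-linear categories\<close>

record ('o, 'm) linear_cat =
  Obj :: "'o set"
  Arr :: "'m set"
  Dom :: "'m \<Rightarrow> 'o"
  Cod :: "'m \<Rightarrow> 'o"
  Idn :: "'o \<Rightarrow> 'm"
  Comp :: "'m \<Rightarrow> 'm \<Rightarrow> 'm"  \<comment> \<open>\<open>Comp C g f\<close> is \<open>g\<close> after \<open>f\<close>\<close>
  Zero :: "'o \<Rightarrow> 'o \<Rightarrow> 'm"
  Plus :: "'m \<Rightarrow> 'm \<Rightarrow> 'm"
  Scale :: "complex \<Rightarrow> 'm \<Rightarrow> 'm"

definition Hom :: "('o, 'm) linear_cat \<Rightarrow> 'o \<Rightarrow> 'o \<Rightarrow> 'm set" where
  "Hom C X Y = {f \<in> Arr C. Dom C f = X \<and> Cod C f = Y}"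

locale linear_category =
  fixes C :: "('o, 'm) linear_cat"
  assumes dom_obj: "f \<in> Arr C \<Longrightarrow> Dom C f \<in> Obj C"
    and cod_obj: "f \<in> Arr C \<Longrightarrow> Cod C f \<in> Obj C"
    and idn_hom: "X \<in> Obj C \<Longrightarrow> Idn C X \<in> Hom C X X"
    and comp_hom: "f \<in> Hom C X Y \<Longrightarrow> g \<in> Hom C Y Z \<Longrightarrow> Comp C g f \<in> Hom C X Z"
    and comp_idn_left: "f \<in> Hom C X Y \<Longrightarrow> Comp C (Idn C Y) f = f"
    and comp_idn_right: "f \<in> Hom C X Y \<Longrightarrow> Comp C f (Idn C X) = f"
    and comp_assoc: "f \<in> Hom C X Y \<Longrightarrow> g \<in> Hom C Y Z \<Longrightarrow> h \<in> Hom C Z W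
          \<Longrightarrow> Comp C h (Comp C g f) = Comp C (Comp C h g) f"
    and zero_hom: "X \<in> Obj C \<Longrightarrow> Y \<in> Obj C \<Longrightarrow> Zero C X Y \<in> Hom C X Y"
    and plus_hom: "f \<in> Hom C X Y \<Longrightarrow> g \<in> Hom C X Y \<Longrightarrow> Plus C f g \<in> Hom C X Y"
    and scale_hom: "f \<in> Hom C X Y \<Longrightarrow> Scale C a f \<in> Hom C X Y"
    and plus_assoc: "f \<in> Hom C X Y \<Longrightarrow> g \<in> Hom C X Y \<Longrightarrow> h \<in> Hom C X Y
          \<Longrightarrow> Plus C (Plus C f g) h = Plus C f (Plus C g h)"
    and plus_commute: "f \<in> Hom C X Y \<Longrightarrow> g \<in> Hom C X Y \<Longrightarrow> Plus C f g = Plus C g f"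
    and plus_zero: "f \<in> Hom C X Y \<Longrightarrow> Plus C f (Zero C X Y) = f"
    and plus_inverse: "f \<in> Hom C X Y \<Longrightarrow> \<exists>g\<in>Hom C X Y. Plus C f g = Zero C X Y"
    and scale_one: "f \<in> Hom C X Y \<Longrightarrow> Scale C 1 f = f"
    and scale_scale: "f \<in> Hom C X Y \<Longrightarrow> Scale C a (Scale C b f) = Scale C (a * b) f"
    and scale_plus: "f \<in> Hom C X Y \<Longrightarrow> g \<in> Hom C X Y
          \<Longrightarrow> Scale C a (Plus C f g) = Plus C (Scale C a f) (Scale C a g)"
    and scale_add: "f \<in> Hom C X Y
          \<Longrightarrow> Scale C (a + b) f = Plus C (Scale C a f) (Scale C b f)"
    and comp_plus_right: "f \<in> Hom C X Y \<Longrightarrow> f' \<in> Hom C X Y \<Longrightarrow> g \<in> Hom C Y Z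
          \<Longrightarrow> Comp C g (Plus C f f') = Plus C (Comp C g f) (Comp C g f')"
    and comp_plus_left: "f \<in> Hom C X Y \<Longrightarrow> g \<in> Hom C Y Z \<Longrightarrow> g' \<in> Hom C Y Z
          \<Longrightarrow> Comp C (Plus C g g') f = Plus C (Comp C g f) (Comp C g' f)"
    and comp_scale_right: "f \<in> Hom C X Y \<Longrightarrow> g \<in> Hom C Y Z
          \<Longrightarrow> Comp C g (Scale C a f) = Scale C a (Comp C g f)"
    and comp_scale_left: "f \<in> Hom C X Y \<Longrightarrow> g \<in> Hom C Y Z
          \<Longrightarrow> Comp C (Scale C a g) f = Scale C a (Comp C g f)"


section \<open>Cyclic cohomology\<close>

text \<open>
  The generators \<open>f\<^sup>0 \<otimes> \<dots> \<otimes> f\<^sup>n\<close> of the cyclic nerve in degree \<open>n\<close>: here \<open>X\<^sub>i = Cod C (fs ! i)\<close>,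
  so that \<open>f\<^sup>i\<close> lies in \<open>Hom C X\<^sub>i\<^sub>+\<^sub>1 X\<^sub>i\<close> and \<open>f\<^sup>n\<close> in \<open>Hom C X\<^sub>0 X\<^sub>n\<close>.
\<close>

definition cyclic_tuples :: "('o, 'm) linear_cat \<Rightarrow> nat \<Rightarrow> 'm list set" where
  "cyclic_tuples C n = {fs. length fs = Suc n \<and> set fs \<subseteq> Arr C
     \<and> (\<forall>i<n. Dom C (fs ! i) = Cod C (fs ! Suc i)) \<and> Dom C (fs ! n) = Cod C (fs ! 0)}"

text \<open>
  The linear dual of the direct sum of the tensor products: by their universal properties, the
  families of multilinear forms, here extended by zero to all lists.
\<close>

definition cochains :: "('o, 'm) linear_cat \<Rightarrow> nat \<Rightarrow> ('m list \<Rightarrow> complex) set" where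
  "cochains C n = {\<phi>.
     (\<forall>fs. fs \<notin> cyclic_tuples C n \<longrightarrow> \<phi> fs = 0)
     \<and> (\<forall>fs\<in>cyclic_tuples C n. \<forall>i\<le>n. \<forall>g\<in>Hom C (Dom C (fs ! i)) (Cod C (fs ! i)).
          \<phi> (fs[i := Plus C (fs ! i) g]) = \<phi> fs + \<phi> (fs[i := g]))
     \<and> (\<forall>fs\<in>cyclic_tuples C n. \<forall>i\<le>n. \<forall>a.
          \<phi> (fs[i := Scale C a (fs ! i)]) = a * \<phi> fs)}"

definition coboundary ::
  "('o, 'm) linear_cat \<Rightarrow> nat \<Rightarrow> ('m list \<Rightarrow> complex) \<Rightarrow> 'm list \<Rightarrow> complex" where
  "coboundary C n \<phi> fs = (if fs \<in> cyclic_tuples C (Suc n)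
     then (\<Sum>i\<le>n. (-1) ^ i *
             \<phi> (take i fs @ [Comp C (fs ! i) (fs ! Suc i)] @ drop (Suc (Suc i)) fs))
          + (-1) ^ Suc n * \<phi> (Comp C (last fs) (hd fs) # butlast (tl fs))
     else 0)"

definition cyclic_op ::
  "('o, 'm) linear_cat \<Rightarrow> nat \<Rightarrow> ('m list \<Rightarrow> complex) \<Rightarrow> 'm list \<Rightarrow> complex" where
  "cyclic_op C n \<phi> fs = (if fs \<in> cyclic_tuples C n
     then (-1) ^ n * \<phi> (last fs # butlast fs) else 0)"

definition cyclic_cochains :: "('o, 'm) linear_cat \<Rightarrow> nat \<Rightarrow> ('m list \<Rightarrow> complex) set" where
  "cyclic_cochains C n = {\<phi> \<in> cochains C n. cyclic_op C n \<phi> = \<phi>}"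

definition cyclic_cocycles :: "('o, 'm) linear_cat \<Rightarrow> nat \<Rightarrow> ('m list \<Rightarrow> complex) set" where
  "cyclic_cocycles C n = {\<phi> \<in> cyclic_cochains C n. coboundary C n \<phi> = (\<lambda>_. 0)}"

definition cyclic_coboundaries :: "('o, 'm) linear_cat \<Rightarrow> nat \<Rightarrow> ('m list \<Rightarrow> complex) set" where
  "cyclic_coboundaries C n =
     (case n of 0 \<Rightarrow> {\<lambda>_. 0} | Suc m \<Rightarrow> coboundary C m ` cyclic_cochains C m)"

definition cohomologous ::
  "('o, 'm) linear_cat \<Rightarrow> nat \<Rightarrow> (('m list \<Rightarrow> complex) \<times> ('m list \<Rightarrow> complex)) set" where
  "cohomologous C n = {(\<phi>, \<psi>). \<phi> \<in> cyclic_cocycles C n \<and> \<psi> \<in> cyclic_cocycles C n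
     \<and> (\<lambda>fs. \<phi> fs - \<psi> fs) \<in> cyclic_coboundaries C n}"

definition cyclic_cohomology :: "('o, 'm) linear_cat \<Rightarrow> nat \<Rightarrow> ('m list \<Rightarrow> complex) set set" where
  "cyclic_cohomology C n = cyclic_cocycles C n // cohomologous C n"


section \<open>Functors to categories of Hilbert spaces\<close>

definition linear_op_functor ::
  "('o, 'm) linear_cat \<Rightarrow> ('o \<Rightarrow> 'a::complex_inner set) \<Rightarrow> ('m \<Rightarrow> 'a \<Rightarrow> 'a) \<Rightarrow> bool" where
  "linear_op_functor C V R \<longleftrightarrow>
     (\<forall>X\<in>Obj C. \<forall>Y\<in>Obj C. \<forall>f\<in>Hom C X Y. R f \<in> bounded_ops (V X) (V Y))
     \<and> (\<forall>X\<in>Obj C. \<forall>v\<in>V X. R (Idn C X) v = v)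
     \<and> (\<forall>X\<in>Obj C. \<forall>Y\<in>Obj C. \<forall>Z\<in>Obj C. \<forall>f\<in>Hom C X Y. \<forall>g\<in>Hom C Y Z.
          \<forall>v\<in>V X. R (Comp C g f) v = R g (R f v))
     \<and> (\<forall>X\<in>Obj C. \<forall>Y\<in>Obj C. \<forall>f\<in>Hom C X Y. \<forall>g\<in>Hom C X Y.
          \<forall>v\<in>V X. R (Plus C f g) v = R f v + R g v)
     \<and> (\<forall>X\<in>Obj C. \<forall>Y\<in>Obj C. \<forall>f\<in>Hom C X Y. \<forall>a.
          \<forall>v\<in>V X. R (Scale C a f) v = a *\<^sub>C R f v)"

text \<open>
  A functor to \<open>SHilb\<^sub>2\<close>: an object \<open>X\<close> goes to the separable Hilbert space \<open>H X\<close>, a morphism to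
  a bounded operator between the doubled spaces.
\<close>

definition functor_SHilb2 ::
  "('o, 'm) linear_cat \<Rightarrow> ('o \<Rightarrow> 'h::complex_inner set) \<Rightarrow> ('m \<Rightarrow> 'h \<times> 'h \<Rightarrow> 'h \<times> 'h) \<Rightarrow> bool" where
  "functor_SHilb2 C H R \<longleftrightarrow>
     (\<forall>X\<in>Obj C. separable_hilbert (H X)) \<and> linear_op_functor C (\<lambda>X. H X \<times> H X) R"

text \<open>
  A graded Hilbert space is the pair of its even and its odd part; the space itself is their
  direct sum.
\<close>

type_synonym 'h graded = "'h set \<times> 'h set"

definition total :: "'h graded \<Rightarrow> ('h \<times> 'h) set" where
  "total G = fst G \<times> snd G"

definition grading :: "'h::complex_inner \<times> 'h \<Rightarrow> 'h \<times> 'h" where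
  "grading v = (fst v, - snd v)"

definition degree0 :: "'h::complex_inner graded \<Rightarrow> ('h \<times> 'h \<Rightarrow> 'h \<times> 'h) \<Rightarrow> bool" where
  "degree0 G T \<longleftrightarrow> (\<forall>x\<in>fst G. snd (T (x, 0)) = 0) \<and> (\<forall>y\<in>snd G. fst (T (0, y)) = 0)"

definition degree1 :: "'h::complex_inner graded \<Rightarrow> ('h \<times> 'h \<Rightarrow> 'h \<times> 'h) \<Rightarrow> bool" where
  "degree1 G T \<longleftrightarrow> (\<forall>x\<in>fst G. fst (T (x, 0)) = 0) \<and> (\<forall>y\<in>snd G. snd (T (0, y)) = 0)"

definition op_degree :: "'h::complex_inner graded \<Rightarrow> ('h \<times> 'h \<Rightarrow> 'h \<times> 'h) \<Rightarrow> nat" where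
  "op_degree G T = (if degree0 G T then 0 else 1)"

definition functor_SHilbZ2 ::
  "('o, 'm) linear_cat \<Rightarrow> ('o \<Rightarrow> 'h::complex_inner graded) \<Rightarrow> ('m \<Rightarrow> 'h \<times> 'h \<Rightarrow> 'h \<times> 'h) \<Rightarrow> bool" where
  "functor_SHilbZ2 C G R \<longleftrightarrow>
     (\<forall>X\<in>Obj C. separable_hilbert (fst (G X)) \<and> separable_hilbert (snd (G X)))
     \<and> linear_op_functor C (\<lambda>X. total (G X)) R"

text \<open>The functor \<open>i\<close> from \<open>SHilb\<^sub>2\<close> on objects; it does not change the operators.\<close>

definition double :: "'h set \<Rightarrow> 'h graded" where
  "double H = (H, H)"


section \<open>Even Fredholm modules and their characters\<close>

definition fredholm_comm ::
  "('o, 'm) linear_cat \<Rightarrow> ('m \<Rightarrow> 'a \<Rightarrow> 'a::complex_inner) \<Rightarrow> ('o \<Rightarrow> 'a \<Rightarrow> 'a) \<Rightarrow> 'm \<Rightarrow> 'a \<Rightarrow> 'a" where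
  "fredholm_comm C R F f v = F (Cod C f) (R f v) - R f (F (Dom C f) v)"

definition even_fredholm_module ::
  "('o, 'm) linear_cat \<Rightarrow> real \<Rightarrow> ('o \<Rightarrow> 'h::complex_inner graded)
    \<Rightarrow> ('m \<Rightarrow> 'h \<times> 'h \<Rightarrow> 'h \<times> 'h) \<Rightarrow> ('o \<Rightarrow> 'h \<times> 'h \<Rightarrow> 'h \<times> 'h) \<Rightarrow> bool" where
  "even_fredholm_module C p G R F \<longleftrightarrow>
     functor_SHilbZ2 C G R
     \<and> (\<forall>f\<in>Arr C. degree0 (G (Dom C f)) (R f))
     \<and> (\<forall>X\<in>Obj C. F X \<in> bounded_ops (total (G X)) (total (G X))
          \<and> degree1 (G X) (F X) \<and> (\<forall>v\<in>total (G X). F X (F X v) = v))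
     \<and> (\<forall>f\<in>Arr C. fredholm_comm C R F f
          \<in> schatten p (total (G (Dom C f))) (total (G (Cod C f))))"

definition supertrace ::
  "'h::complex_inner graded \<Rightarrow> ('h \<times> 'h \<Rightarrow> 'h \<times> 'h) \<Rightarrow> ('h \<times> 'h \<Rightarrow> 'h \<times> 'h) \<Rightarrow> complex" where
  "supertrace G F T =
     1 / 2 * op_trace (total G)
       (\<lambda>v. grading (F (F (T v) - (-1) ^ op_degree G T *\<^sub>R T (F v))))"

definition fredholm_character ::
  "('o, 'm) linear_cat \<Rightarrow> nat \<Rightarrow> ('o \<Rightarrow> 'h::complex_inner graded)
    \<Rightarrow> ('m \<Rightarrow> 'h \<times> 'h \<Rightarrow> 'h \<times> 'h) \<Rightarrow> ('o \<Rightarrow> 'h \<times> 'h \<Rightarrow> 'h \<times> 'h)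
    \<Rightarrow> 'm list \<Rightarrow> complex" where
  "fredholm_character C n G R F fs = (if fs \<in> cyclic_tuples C n
     then supertrace (G (Cod C (hd fs))) (F (Cod C (hd fs)))
            (foldr (\<circ>) (R (hd fs) # map (fredholm_comm C R F) (tl fs)) id)
     else 0)"

definition chern_character ::
  "('o, 'm) linear_cat \<Rightarrow> nat \<Rightarrow> ('o \<Rightarrow> 'h::complex_inner graded)
    \<Rightarrow> ('m \<Rightarrow> 'h \<times> 'h \<Rightarrow> 'h \<times> 'h) \<Rightarrow> ('o \<Rightarrow> 'h \<times> 'h \<Rightarrow> 'h \<times> 'h)
    \<Rightarrow> ('m list \<Rightarrow> complex) set" where
  "chern_character C n G R F = cohomologous C n `` {fredholm_character C n G R F}"


section \<open>Families of operators\<close>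

definition plus_part :: "('h::complex_inner \<times> 'h \<Rightarrow> 'h \<times> 'h) \<Rightarrow> 'h \<Rightarrow> 'h" where
  "plus_part T x = fst (T (x, 0))"

definition minus_part :: "('h::complex_inner \<times> 'h \<Rightarrow> 'h \<times> 'h) \<Rightarrow> 'h \<Rightarrow> 'h" where
  "minus_part T y = snd (T (0, y))"

text \<open>The block matrix with zero diagonal, \<open>Q\<close> in the upper and \<open>P\<close> in the lower row.\<close>

definition offdiag :: "('h \<Rightarrow> 'h) \<Rightarrow> ('h \<Rightarrow> 'h) \<Rightarrow> 'h \<times> 'h \<Rightarrow> 'h \<times> 'h" where
  "offdiag Q P v = (Q (snd v), P (fst v))"

definition schatten_continuous_on ::
  "real \<Rightarrow> 'a::complex_inner set \<Rightarrow> 'b::complex_inner set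
    \<Rightarrow> real set \<Rightarrow> (real \<Rightarrow> 'a \<Rightarrow> 'b) \<Rightarrow> bool" where
  "schatten_continuous_on q V W I T \<longleftrightarrow>
     (\<forall>t\<in>I. T t \<in> schatten q V W)
     \<and> (\<forall>t\<in>I. ((\<lambda>s. schatten_norm q V W (\<lambda>v. T s v - T t v)) \<longlongrightarrow> 0) (at t within I))"

definition strongly_C1_on ::
  "'a::complex_inner set \<Rightarrow> real set \<Rightarrow> (real \<Rightarrow> 'a \<Rightarrow> 'b::complex_inner) \<Rightarrow> bool" where
  "strongly_C1_on V I T \<longleftrightarrow> (\<forall>\<xi>\<in>V. \<exists>D. continuous_on I D \<and>
     (\<forall>t\<in>I. ((\<lambda>s. T s \<xi>) has_vector_derivative D t) (at t within I)))"

text \<open>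
  One-sided derivatives at the break points, unlike the library's
  \<^const>\<open>piecewise_C1_differentiable_on\<close>, which puts no condition on the derivative near them.
\<close>

definition piecewise_strongly_C1 ::
  "'a::complex_inner set \<Rightarrow> (real \<Rightarrow> 'a \<Rightarrow> 'b::complex_inner) \<Rightarrow> bool" where
  "piecewise_strongly_C1 V T \<longleftrightarrow> (\<exists>m (a :: nat \<Rightarrow> real). a 0 = 0 \<and> a m = 1
     \<and> (\<forall>i<m. a i < a (Suc i) \<and> strongly_C1_on V {a i..a (Suc i)} T))"

end

theory Submission
  imports Defs
begin

text \<open>
  Write \<open>a\<close> and \<open>b\<close> for the functors \<open>\<rho>\<^sup>+\<close> and \<open>Q \<rho>\<^sup>- P\<close>, and \<open>\<delta> = a - b\<close>. Since a commutator with \<open>F\<close> is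
  off-diagonal with entries \<open>- \<delta> Q\<close> and \<open>P \<delta>\<close>, the even character in degree \<open>n\<close> equals, up to sign, the
  form \<open>Tr (\<delta> f\<^sup>0 \<dots> \<delta> f\<^sup>n)\<close>. Its derivative in \<open>t\<close> is the cyclic sum of \<open>Tr ((a' - b') f\<^sup>0 \<delta> f\<^sup>1 \<dots> \<delta> f\<^sup>n)\<close>,
  which is the coboundary of the cyclic sum of \<open>Tr ((a' + b') f\<^sup>0 \<delta> f\<^sup>1 \<dots> \<delta> f\<^sup>n\<^sup>-\<^sup>1)\<close>; integrating over \<open>t\<close>
  gives a cyclic cochain bounding the difference of two characters. The derivatives \<open>a'\<close> and \<open>b'\<close> exist only
  strongly, but a strongly convergent bounded factor next to a factor converging in trace norm makes
  the trace converge, and for \<open>n = p + 2\<close> at least \<open>p\<close> factors \<open>\<delta>\<close> remain in every word.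
\<close>

section \<open>Bounded operators\<close>

text \<open>No spectral theorem or polar decomposition enters. Singular numbers are approximation
  numbers, so their inequalities for sums and products come from adding and composing approximants.
  Differences of approximants of rank \<open>2^k - 1\<close> write an operator with summable
  singular numbers as a series of rank-one pieces. The same series computes the traces of
  \<open>A T\<close> and \<open>T A\<close>; this gives existence, basis independence, cyclicity and
  a bound of the trace together. The bound has a constant 18, but only convergence matters, so crude
  forms of the triangle and Hoelder inequalities suffice. The obstacle is that difference quotients
  of \<open>\<delta>\<close> converge only strongly, while the other letters converge in Schatten
  norm. The increment of a trace is therefore telescoped letter by letter, and cyclicity moves the
  changed letter to the front of a trace class word. Moreover, strong differentiability bounds
  difference quotients only vector by vector; completeness and uniform boundedness yield a Lipschitz
  constant for the operators, which supplies the domination needed in the series and under the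
  integral.\<close>

lemma bounded_ops_mem: "T \<in> bounded_ops V W \<Longrightarrow> x \<in> V \<Longrightarrow> T x \<in> W"
  unfolding bounded_ops_def by blast

lemma bounded_ops_add: "T \<in> bounded_ops V W \<Longrightarrow> x \<in> V \<Longrightarrow> y \<in> V \<Longrightarrow> T (x + y) = T x + T y"
  unfolding bounded_ops_def by blast

lemma bounded_ops_scaleC: "T \<in> bounded_ops V W \<Longrightarrow> x \<in> V \<Longrightarrow> T (a *\<^sub>C x) = a *\<^sub>C T x"
  unfolding bounded_ops_def by blast

lemma bounded_ops_nonneg_bound:
  assumes "T \<in> bounded_ops V W"
  obtains K where "K \<ge> 0" "\<And>x. x \<in> V \<Longrightarrow> norm (T x) \<le> K * norm x"
proof -
  obtain K where K: "\<forall>x\<in>V. norm (T x) \<le> K * norm x"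
    using bounded_ops_bound[OF assms] by blast
  have "norm (T x) \<le> \<bar>K\<bar> * norm x" if "x \<in> V" for x
    using K that by (meson abs_ge_self mult_right_mono norm_ge_zero order_trans)
  then show ?thesis using that[of "\<bar>K\<bar>"] by simp
qed

lemma bounded_opsI:
  assumes "\<And>x. x \<in> V \<Longrightarrow> T x \<in> W"
    and "\<And>x y. x \<in> V \<Longrightarrow> y \<in> V \<Longrightarrow> T (x + y) = T x + T y"
    and "\<And>a x. x \<in> V \<Longrightarrow> T (a *\<^sub>C x) = a *\<^sub>C T x"
    and "\<And>x. x \<in> V \<Longrightarrow> norm (T x) \<le> K * norm x"
  shows "T \<in> bounded_ops V W"
  unfolding bounded_ops_def using assms by blast

lemma scaleR_eq_scaleC: "r *\<^sub>R x = complex_of_real r *\<^sub>C x"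
  by (simp add: scaleC_of_real)

lemma scaleC_scaleR_commute: "a *\<^sub>C r *\<^sub>R x = r *\<^sub>R a *\<^sub>C x"
  unfolding scaleR_eq_scaleC scaleC_scaleC by (simp only: mult.commute)

lemma subspace_scaleR: "complex_vector.subspace V \<Longrightarrow> x \<in> V \<Longrightarrow> r *\<^sub>R x \<in> V"
  by (simp add: scaleR_eq_scaleC complex_vector.subspace_scale)

lemma bounded_ops_zero:
  assumes "T \<in> bounded_ops V W" "complex_vector.subspace V"
  shows "T 0 = 0"
  using bounded_ops_scaleC[OF assms(1) complex_vector.subspace_0[OF assms(2)], of 0] by simp

lemma bounded_ops_scaleR: "T \<in> bounded_ops V W \<Longrightarrow> x \<in> V \<Longrightarrow> T (r *\<^sub>R x) = r *\<^sub>R T x"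
  by (simp add: scaleR_eq_scaleC bounded_ops_scaleC)

lemma bounded_ops_minus:
  assumes "T \<in> bounded_ops V W" "x \<in> V"
  shows "T (- x) = - T x"
  using bounded_ops_scaleR[OF assms, of "- 1"] by simp

lemma subspace_uminus: "complex_vector.subspace V \<Longrightarrow> x \<in> V \<Longrightarrow> - x \<in> V"
  using complex_vector.subspace_neg by blast

lemma bounded_ops_diff:
  assumes "T \<in> bounded_ops V W" "complex_vector.subspace V" "x \<in> V" "y \<in> V"
  shows "T (x - y) = T x - T y"
  using bounded_ops_add[OF assms(1,3) subspace_uminus[OF assms(2,4)]]
    bounded_ops_minus[OF assms(1,4)] by simp

lemma bounded_ops_sum:
  assumes "T \<in> bounded_ops V W" "complex_vector.subspace V" "\<And>i. i \<in> A \<Longrightarrow> f i \<in> V"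
  shows "T (\<Sum>i\<in>A. f i) = (\<Sum>i\<in>A. T (f i))"
  using assms(3)
proof (induction A rule: infinite_finite_induct)
  case (insert i A)
  then show ?case
    using bounded_ops_add[OF assms(1), of "f i" "\<Sum>i\<in>A. f i"]
      complex_vector.subspace_sum[OF assms(2), of A f] by simp
qed (simp_all add: bounded_ops_zero[OF assms(1,2)])

lemma bounded_ops_comp:
  assumes S: "S \<in> bounded_ops W U" and T: "T \<in> bounded_ops V W"
  shows "(\<lambda>x. S (T x)) \<in> bounded_ops V U"
proof -
  obtain K where K: "K \<ge> 0" "\<And>x. x \<in> W \<Longrightarrow> norm (S x) \<le> K * norm x"
    using bounded_ops_nonneg_bound[OF S] by blast
  obtain L where L: "L \<ge> 0" "\<And>x. x \<in> V \<Longrightarrow> norm (T x) \<le> L * norm x"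
    using bounded_ops_nonneg_bound[OF T] by blast
  show ?thesis
  proof (rule bounded_opsI[where K = "K * L"])
    fix x assume x: "x \<in> V"
    have "norm (S (T x)) \<le> K * norm (T x)"
      using K(2) bounded_ops_mem[OF T x] .
    also have "\<dots> \<le> K * (L * norm x)"
      using K(1) L(2)[OF x] by (rule mult_left_mono[rotated])
    finally show "norm (S (T x)) \<le> K * L * norm x" by (simp add: mult.assoc)
  qed (use S T in \<open>simp_all add: bounded_ops_add bounded_ops_scaleC bounded_ops_mem\<close>)
qed

text \<open>The real factor \<open>r\<close> covers three uses with one proof: sums
  (\<open>r = 1\<close>), differences (\<open>r = -1\<close>) and, with \<open>S\<close> zero,
  difference quotients (\<open>r = 1 / (s - t)\<close>).\<close>

lemma bounded_ops_add_scaleR: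
  assumes S: "S \<in> bounded_ops V W" and T: "T \<in> bounded_ops V W"
    and W: "complex_vector.subspace W"
  shows "(\<lambda>x. S x + r *\<^sub>R T x) \<in> bounded_ops V W"
proof -
  obtain K where K: "K \<ge> 0" "\<And>x. x \<in> V \<Longrightarrow> norm (S x) \<le> K * norm x"
    using bounded_ops_nonneg_bound[OF S] by blast
  obtain L where L: "L \<ge> 0" "\<And>x. x \<in> V \<Longrightarrow> norm (T x) \<le> L * norm x"
    using bounded_ops_nonneg_bound[OF T] by blast
  show ?thesis
  proof (rule bounded_opsI[where K = "K + \<bar>r\<bar> * L"])
    fix x assume x: "x \<in> V"
    show "S x + r *\<^sub>R T x \<in> W"
      using bounded_ops_mem[OF S x] bounded_ops_mem[OF T x]
      by (simp add: complex_vector.subspace_add[OF W] subspace_scaleR[OF W])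
    have "norm (S x + r *\<^sub>R T x) \<le> norm (S x) + \<bar>r\<bar> * norm (T x)"
      using norm_triangle_ineq[of "S x" "r *\<^sub>R T x"] by simp
    also have "\<dots> \<le> K * norm x + \<bar>r\<bar> * (L * norm x)"
      using K(2)[OF x] L(2)[OF x] by (intro add_mono mult_left_mono) auto
    finally show "norm (S x + r *\<^sub>R T x) \<le> (K + \<bar>r\<bar> * L) * norm x"
      by (simp add: algebra_simps)
  next
    show "S (a *\<^sub>C x) + r *\<^sub>R T (a *\<^sub>C x) = a *\<^sub>C (S x + r *\<^sub>R T x)" if "x \<in> V" for a x
      unfolding bounded_ops_scaleC[OF S that] bounded_ops_scaleC[OF T that] scaleC_add_right
        scaleC_scaleR_commute ..
  qed (use S T in \<open>simp_all add: bounded_ops_add scaleR_add_right\<close>)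
qed

lemma bounded_ops_plus_op:
  assumes "S \<in> bounded_ops V W" "T \<in> bounded_ops V W" "complex_vector.subspace W"
  shows "(\<lambda>x. S x + T x) \<in> bounded_ops V W"
  using bounded_ops_add_scaleR[OF assms, of 1] by simp

lemma bounded_ops_diff_op:
  assumes "S \<in> bounded_ops V W" "T \<in> bounded_ops V W" "complex_vector.subspace W"
  shows "(\<lambda>x. S x - T x) \<in> bounded_ops V W"
  using bounded_ops_add_scaleR[OF assms, of "-1"] by simp

lemma bounded_ops_zero_op: "complex_vector.subspace W \<Longrightarrow> (\<lambda>_. 0) \<in> bounded_ops V W"
  by (rule bounded_opsI[where K = 0]) (auto simp: complex_vector.subspace_0)

lemma bounded_ops_id: "(\<lambda>x. x) \<in> bounded_ops V V"
  by (rule bounded_opsI[where K = 1]) auto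

lemma bounded_ops_cong:
  assumes "T \<in> bounded_ops V W" "complex_vector.subspace V" "\<And>x. x \<in> V \<Longrightarrow> S x = T x"
  shows "S \<in> bounded_ops V W"
proof -
  obtain K where K: "K \<ge> 0" "\<And>x. x \<in> V \<Longrightarrow> norm (T x) \<le> K * norm x"
    using bounded_ops_nonneg_bound[OF assms(1)] by blast
  show ?thesis
    by (rule bounded_opsI[where K = K])
      (use assms K in \<open>simp_all add: bounded_ops_mem bounded_ops_add bounded_ops_scaleC
        complex_vector.subspace_add complex_vector.subspace_scale\<close>)
qed

lemma op_norm_le:
  assumes "complex_vector.subspace V" "0 \<le> K" "\<And>x. x \<in> V \<Longrightarrow> norm (T x) \<le> K * norm x"
  shows "op_norm V T \<le> K"
  unfolding op_norm_def
proof (rule cSUP_least)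
  show "{x \<in> V. norm x \<le> 1} \<noteq> {}"
    using complex_vector.subspace_0[OF assms(1)] by (metis (mono_tags, lifting) empty_iff
        mem_Collect_eq norm_zero zero_le_one)
  fix x assume x: "x \<in> {x \<in> V. norm x \<le> 1}"
  then show "norm (T x) \<le> K"
    using assms(2) assms(3)[of x] mult_left_le[of "norm x" K] by auto
qed

lemma op_norm_nonneg:
  assumes "T \<in> bounded_ops V W" "complex_vector.subspace V"
  shows "0 \<le> op_norm V T"
proof -
  obtain K where "\<And>x. x \<in> V \<Longrightarrow> norm (T x) \<le> K * norm x"
    using bounded_ops_nonneg_bound[OF assms(1)] by blast
  then have "norm (T 0) \<le> op_norm V T"
    using complex_vector.subspace_0[OF assms(2)] by (intro op_norm_upper) auto
  then show ?thesis using norm_ge_zero order_trans by blast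
qed

lemma norm_le_op_norm:
  assumes T: "T \<in> bounded_ops V W" and V: "complex_vector.subspace V" and x: "x \<in> V"
  shows "norm (T x) \<le> op_norm V T * norm x"
proof (cases "x = 0")
  case True
  then show ?thesis using bounded_ops_zero[OF T V] by simp
next
  case False
  obtain K where K: "\<And>x. x \<in> V \<Longrightarrow> norm (T x) \<le> K * norm x"
    using bounded_ops_nonneg_bound[OF T] by blast
  have "norm (T ((1 / norm x) *\<^sub>R x)) \<le> op_norm V T"
    using subspace_scaleR[OF V x] False by (intro op_norm_upper[where K = K] K) auto
  then show ?thesis
    using False by (simp add: bounded_ops_scaleR[OF T x] field_simps)
qed

section \<open>Orthonormal systems\<close>

lemma cinner_zero_right [simp]: "cinner x 0 = 0"
  using cinner_scaleC_right[of x 0 0] by simp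

lemma cinner_minus_right: "cinner x (- y) = - cinner x y"
  using cinner_scaleC_right[of x "-1" y] by simp

lemma cinner_diff_right: "cinner x (y - z) = cinner x y - cinner x z"
  using cinner_add_right[of x y "-z"] by (simp add: cinner_minus_right)

lemma cinner_self: "cinner x x = complex_of_real ((norm x)\<^sup>2)"
proof (rule complex_eqI)
  have "Im (cinner x x) = Im (cnj (cinner x x))" using cinner_commute[of x x] by simp
  then show "Im (cinner x x) = Im (complex_of_real ((norm x)\<^sup>2))" by simp
qed (simp add: Re_cinner power2_norm_eq_inner)

text \<open>Bessel's inequality for the one-element system \<open>x / norm x\<close>. The
  Cauchy-Schwarz inequality of \<open>real_inner\<close> controls only the real part of
  \<open>cinner\<close>.\<close>

lemma cmod_cinner_le: "cmod (cinner x y) \<le> norm x * norm y"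
proof (cases "x = 0")
  case True
  then show ?thesis using cinner_commute[of 0 y] by simp
next
  case False
  define e where "e = complex_of_real (1 / norm x) *\<^sub>C x"
  have "norm e = 1"
    using False by (simp add: e_def norm_scaleC norm_divide)
  then have "cinner e e = 1" by (simp add: cinner_self)
  then have "(cmod (cinner e y))\<^sup>2 \<le> (norm y)\<^sup>2"
    using bessel_inequality[of "{()}" "\<lambda>_. e" y] by simp
  then have "cmod (cinner e y) \<le> norm y"
    by (rule power2_le_imp_le) simp
  then show ?thesis
    using False by (simp add: e_def cinner_scaleC_left norm_mult norm_divide divide_simps mult.commute)
qed

text \<open>Functionals are treated as bounded operators into the space \<open>UNIV\<close> of
  complex numbers, so that the rules for linearity and composition apply to them unchanged.\<close>

lemma bounded_ops_cinner: "cinner e \<in> bounded_ops V UNIV"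
  by (rule bounded_opsI[where K = "norm e"])
    (auto simp: cinner_add_right cinner_scaleC_right scaleC_complex_def cmod_cinner_le)

lemma orthonormal_subset: "orthonormal B \<Longrightarrow> A \<subseteq> B \<Longrightarrow> orthonormal A"
  unfolding orthonormal_def by blast

lemma orthonormal_norm: "orthonormal B \<Longrightarrow> e \<in> B \<Longrightarrow> norm e = 1"
  unfolding orthonormal_def
  by (metis (mono_tags, lifting) Re_cinner norm_eq_sqrt_inner one_complex.sel(1) real_sqrt_one)

lemma norm_sum_orthonormal:
  assumes "finite B" "orthonormal B"
  shows "(norm (\<Sum>e\<in>B. c e *\<^sub>C e))\<^sup>2 = (\<Sum>e\<in>B. (cmod (c e))\<^sup>2)"
  using norm_orthonormal_sum[of B "\<lambda>e. e" c] assms unfolding orthonormal_def by simp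

lemma bessel_orthonormal:
  assumes "finite B" "orthonormal B"
  shows "(\<Sum>e\<in>B. (cmod (cinner e x))\<^sup>2) \<le> (norm x)\<^sup>2"
  using bessel_inequality[of B "\<lambda>e. e" x] assms unfolding orthonormal_def by simp

lemma norm_orthonormal_projection_le:
  assumes "finite B" "orthonormal B"
  shows "norm (\<Sum>e\<in>B. cinner e x *\<^sub>C e) \<le> norm x"
  by (rule power2_le_imp_le)
    (use norm_sum_orthonormal[OF assms] bessel_orthonormal[OF assms] in auto)

lemma cinner_orthonormal_projection:
  assumes "finite B" "orthonormal B" "d \<in> B"
  shows "cinner d (\<Sum>e\<in>B. c e *\<^sub>C e) = c d"
proof -
  have "cinner d (\<Sum>e\<in>B. c e *\<^sub>C e) = (\<Sum>e\<in>B. if d = e then c e else 0)"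
    using assms(2,3) unfolding cinner_sum_right cinner_scaleC_right orthonormal_def
    by (intro sum.cong) auto
  then show ?thesis using assms(1,3) by simp
qed

lemma orthonormal_expansion:
  assumes "finite B" "orthonormal B" "x \<in> complex_vector.span B"
  shows "(\<Sum>e\<in>B. cinner e x *\<^sub>C e) = x"
proof -
  obtain c where c: "x = (\<Sum>e\<in>B. c e *\<^sub>C e)"
    using assms(1,3) complex_vector.span_finite[of B] by auto
  then have "cinner d x = c d" if "d \<in> B" for d
    using cinner_orthonormal_projection[OF assms(1,2) that] by simp
  then show ?thesis unfolding c by simp
qed

text \<open>The remainder of \<open>v\<close> after projection to the span is normalised and added.
  At most one vector is new, which keeps track of ranks, and \<open>B \<subseteq> B'\<close> allows
  steps to be chained into an increasing sequence.\<close>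

lemma gram_schmidt_step:
  assumes B: "finite B" "orthonormal B" "B \<subseteq> V" and V: "complex_vector.subspace V" and v: "v \<in> V"
  obtains B' where "finite B'" "orthonormal B'" "B' \<subseteq> V" "B \<subseteq> B'"
    "v \<in> complex_vector.span B'" "card B' \<le> Suc (card B)"
proof -
  define w where "w = v - (\<Sum>e\<in>B. cinner e v *\<^sub>C e)"
  have sumB: "(\<Sum>e\<in>B. cinner e v *\<^sub>C e) \<in> complex_vector.span B"
    by (intro complex_vector.span_sum complex_vector.span_scale complex_vector.span_base)
  show ?thesis
  proof (cases "w = 0")
    case True
    then have "v \<in> complex_vector.span B" using sumB by (simp add: w_def)
    then show ?thesis using that[of B] B by simp
  next
    case False
    have wV: "w \<in> V" unfolding w_def
      using B(3) v by (intro complex_vector.subspace_diff[OF V] complex_vector.subspace_sum[OF V]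
          complex_vector.subspace_scale[OF V]) auto
    define e where "e = complex_of_real (1 / norm w) *\<^sub>C w"
    have "cinner d w = 0" if "d \<in> B" for d
      using cinner_orthonormal_projection[OF B(1,2) that] by (simp add: w_def cinner_diff_right)
    then have orth: "cinner d e = 0" "cinner e d = 0" if "d \<in> B" for d
      using that cinner_commute[of e d] by (simp_all add: e_def cinner_scaleC_right)
    have "norm e = 1"
      using False by (simp add: e_def norm_scaleC norm_divide)
    then have "cinner e e = 1" by (simp add: cinner_self)
    then have "orthonormal (insert e B)"
      using B(2) orth unfolding orthonormal_def by auto
    moreover have "v \<in> complex_vector.span (insert e B)"
    proof -
      have "w = complex_of_real (norm w) *\<^sub>C e"
        using False unfolding e_def scaleC_scaleC by (simp add: scaleC_of_real flip: of_real_mult)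
      then have "w \<in> complex_vector.span (insert e B)"
        by (metis complex_vector.span_base complex_vector.span_scale insertI1)
      moreover have "(\<Sum>e\<in>B. cinner e v *\<^sub>C e) \<in> complex_vector.span (insert e B)"
        using sumB complex_vector.span_mono[of B "insert e B"] by auto
      ultimately show ?thesis
        using complex_vector.span_add[of w _ "\<Sum>e\<in>B. cinner e v *\<^sub>C e"] unfolding w_def by simp
    qed
    moreover have "e \<in> V" unfolding e_def using complex_vector.subspace_scale[OF V wV] .
    ultimately show ?thesis
      using that[of "insert e B"] B card_insert_le_m1[of "Suc (card B)" B e] by (auto simp: card_insert_if)
  qed
qed

lemma gram_schmidt_finite:
  assumes "finite A" "A \<subseteq> V" "complex_vector.subspace V"
  obtains B where "finite B" "orthonormal B" "B \<subseteq> V" "A \<subseteq> complex_vector.span B" "card B \<le> card A"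
proof -
  have "\<exists>B. finite B \<and> orthonormal B \<and> B \<subseteq> V \<and> A \<subseteq> complex_vector.span B \<and> card B \<le> card A"
    using assms(1,2)
  proof (induction A rule: finite_induct)
    case empty
    show ?case by (rule exI[of _ "{}"]) (simp add: orthonormal_def)
  next
    case (insert v A)
    then obtain B where B: "finite B" "orthonormal B" "B \<subseteq> V" "A \<subseteq> complex_vector.span B"
      "card B \<le> card A" by auto
    obtain B' where B': "finite B'" "orthonormal B'" "B' \<subseteq> V" "B \<subseteq> B'"
      "v \<in> complex_vector.span B'" "card B' \<le> Suc (card B)"
      using gram_schmidt_step[OF B(1-3) assms(3), of v] insert.prems by auto
    have "A \<subseteq> complex_vector.span B'"
      using B(4) complex_vector.span_mono[OF B'(4)] by blast
    then show ?case using B' B(5) insert.hyps by (intro exI[of _ B']) auto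
  qed
  then show ?thesis using that by blast
qed

text \<open>Gram-Schmidt along an enumeration of the dense set; the union of the increasing finite
  systems spans that set.\<close>

lemma orthonormal_basis_exists:
  assumes V: "complex_vector.subspace V" and D: "countable D" "D \<subseteq> V" "V \<subseteq> closure D"
  obtains B where "orthonormal_basis V B"
proof -
  have "D \<noteq> {}" using D(3) complex_vector.subspace_0[OF V] by auto
  define d where "d = from_nat_into D"
  have d: "d n \<in> V" for n
    using from_nat_into[OF \<open>D \<noteq> {}\<close>] D(2) by (auto simp: d_def)
  let ?P = "\<lambda>B. finite B \<and> orthonormal B \<and> B \<subseteq> V"
  have "\<exists>f. \<forall>n. ?P (f n) \<and> (f n \<subseteq> f (Suc n) \<and> d n \<in> complex_vector.span (f (Suc n)))"
  proof (rule dependent_nat_choice)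
    show "\<exists>B. ?P B" by (rule exI[of _ "{}"]) (simp add: orthonormal_def)
    show "\<exists>B'. ?P B' \<and> (B \<subseteq> B' \<and> d n \<in> complex_vector.span B')" if "?P B" for B n
      using gram_schmidt_step[of B V "d n"] that V d by metis
  qed
  then obtain f where f: "\<And>n. ?P (f n)" "\<And>n. f n \<subseteq> f (Suc n)"
    "\<And>n. d n \<in> complex_vector.span (f (Suc n))" by blast
  have mono: "f m \<subseteq> f n" if "m \<le> n" for m n
    using lift_Suc_mono_le[of f, OF f(2) that] .
  define B where "B = (\<Union>n. f n)"
  have "orthonormal B"
    unfolding orthonormal_def
  proof (intro ballI)
    fix x y assume "x \<in> B" "y \<in> B"
    then obtain m n where "x \<in> f m" "y \<in> f n" by (auto simp: B_def)
    then have "x \<in> f (max m n)" "y \<in> f (max m n)"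
      using mono[of m "max m n"] mono[of n "max m n"] by auto
    then show "cinner x y = (if x = y then 1 else 0)"
      using f(1)[of "max m n"] unfolding orthonormal_def by blast
  qed
  moreover have "D \<subseteq> complex_vector.span B"
  proof
    fix x assume "x \<in> D"
    then obtain n where "x = d n"
      using from_nat_into_surj[OF D(1)] by (metis d_def)
    then show "x \<in> complex_vector.span B"
      using f(3)[of n] complex_vector.span_mono[of "f (Suc n)" B] by (auto simp: B_def)
  qed
  then have "V \<subseteq> closure (complex_vector.span B)"
    using D(3) closure_mono by blast
  moreover have "B \<subseteq> V" using f(1) by (auto simp: B_def)
  ultimately show ?thesis using that by (simp add: orthonormal_basis_def)
qed

lemma separable_hilbert_dense:
  assumes "separable_hilbert V"
  obtains D where "countable D" "D \<subseteq> V" "V \<subseteq> closure D"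
proof -
  obtain D where D: "countable D" "D \<subseteq> V" "top_of_set V closure_of D = V"
    using assms unfolding separable_hilbert_def separable_space_def by auto
  have "V \<inter> closure (V \<inter> D) = V"
    using D(3) by (simp add: closure_of_subtopology closure_of_def[symmetric])
  then have "V \<subseteq> closure D" using closure_mono[of "V \<inter> D" D] by blast
  then show ?thesis using that D by blast
qed

lemma subspace_Times:
  "complex_vector.subspace V \<Longrightarrow> complex_vector.subspace W \<Longrightarrow> complex_vector.subspace (V \<times> W)"
  by (auto simp: complex_vector.subspace_def scaleC_prod_def zero_prod_def)

text \<open>This is all that the trace needs: it yields an orthonormal basis and passes to products.
  Completeness enters elsewhere, through uniform boundedness and through limits of difference
  quotients.\<close>

definition dense_countable :: "'a::complex_inner set \<Rightarrow> bool" where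
  "dense_countable V \<longleftrightarrow> complex_vector.subspace V \<and> (\<exists>D. countable D \<and> D \<subseteq> V \<and> V \<subseteq> closure D)"

lemma dense_countable_separable_hilbert:
  assumes "separable_hilbert V"
  shows "dense_countable V"
proof -
  obtain D where "countable D" "D \<subseteq> V" "V \<subseteq> closure D"
    using separable_hilbert_dense[OF assms] .
  then show ?thesis
    using assms unfolding dense_countable_def separable_hilbert_def by auto
qed

lemma dense_countable_Times:
  assumes "dense_countable V" "dense_countable W"
  shows "dense_countable (V \<times> W)"
proof -
  obtain D E where "countable D" "D \<subseteq> V" "V \<subseteq> closure D" "countable E" "E \<subseteq> W" "W \<subseteq> closure E"
    using assms unfolding dense_countable_def by blast
  then have "countable (D \<times> E)" "D \<times> E \<subseteq> V \<times> W" "V \<times> W \<subseteq> closure (D \<times> E)"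
    by (auto simp: closure_Times)
  then show ?thesis
    using assms subspace_Times unfolding dense_countable_def by blast
qed

lemma dense_countable_subspace: "dense_countable V \<Longrightarrow> complex_vector.subspace V"
  by (simp add: dense_countable_def)

lemma dense_countable_basis: "dense_countable V \<Longrightarrow> \<exists>B. orthonormal_basis V B"
  using orthonormal_basis_exists unfolding dense_countable_def by metis

section \<open>The trace of nuclear operators\<close>

text \<open>Testing \<open>g\<close> on the vector with coefficients \<open>cnj (g e)\<close> gives
  \<open>s \<le> c * sqrt s\<close> for the sum of squares \<open>s\<close>. This replaces a Riesz
  vector of \<open>g\<close>, which may fail to exist as \<open>V\<close> is not assumed
  complete.\<close>

lemma functional_square_sum_le:
  assumes g: "g \<in> bounded_ops V UNIV" "0 \<le> c" "\<And>x. x \<in> V \<Longrightarrow> cmod (g x) \<le> c * norm x"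
    and V: "complex_vector.subspace V"
    and F: "finite F" "orthonormal F" "F \<subseteq> V"
  shows "(\<Sum>e\<in>F. (cmod (g e))\<^sup>2) \<le> c\<^sup>2"
proof -
  define s where "s = (\<Sum>e\<in>F. (cmod (g e))\<^sup>2)"
  define x where "x = (\<Sum>e\<in>F. cnj (g e) *\<^sub>C e)"
  have s0: "0 \<le> s" unfolding s_def by (intro sum_nonneg) auto
  have term_in: "cnj (g e) *\<^sub>C e \<in> V" if "e \<in> F" for e
    using F(3) that complex_vector.subspace_scale[OF V] by blast
  have xV: "x \<in> V" unfolding x_def using term_in by (intro complex_vector.subspace_sum[OF V])
  have "g x = (\<Sum>e\<in>F. g (cnj (g e) *\<^sub>C e))"
    unfolding x_def by (rule bounded_ops_sum[OF g(1) V term_in])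
  also have "\<dots> = (\<Sum>e\<in>F. complex_of_real ((cmod (g e))\<^sup>2))"
    using F(3) by (intro sum.cong refl)
      (auto simp: bounded_ops_scaleC[OF g(1)] scaleC_complex_def complex_norm_square mult.commute
        simp del: of_real_power)
  finally have gx: "g x = complex_of_real s" by (simp add: s_def)
  have "(norm x)\<^sup>2 = s"
    unfolding x_def norm_sum_orthonormal[OF F(1,2)] s_def by simp
  then have nx: "norm x = sqrt s" using real_sqrt_unique by force
  have "s \<le> c * sqrt s" using g(3)[OF xV] s0 by (simp add: gx nx)
  then have "sqrt s * sqrt s \<le> c * sqrt s" using s0 by simp
  then have "sqrt s \<le> c"
    using s0 g(2) by (cases "s = 0") (auto simp del: real_sqrt_mult_self dest!: mult_right_le_imp_le)
  then have "(sqrt s)\<^sup>2 \<le> c\<^sup>2" using s0 by (intro power_mono) auto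
  then show ?thesis using s0 by (simp add: s_def)
qed

text \<open>Cauchy-Schwarz over \<open>F\<close>, with the previous bound for one factor and
  Bessel's inequality for the other. The bound is independent of \<open>F\<close>, so it gives
  absolute summability over a whole basis.\<close>

lemma functional_cinner_sum_le:
  assumes g: "g \<in> bounded_ops V UNIV" "0 \<le> c" "\<And>x. x \<in> V \<Longrightarrow> cmod (g x) \<le> c * norm x"
    and V: "complex_vector.subspace V"
    and F: "finite F" "orthonormal F" "F \<subseteq> V"
  shows "(\<Sum>e\<in>F. cmod (g e * cinner e v)) \<le> c * norm v"
proof -
  have "(\<Sum>e\<in>F. cmod (g e * cinner e v)) = (\<Sum>e\<in>F. \<bar>cmod (g e)\<bar> * \<bar>cmod (cinner e v)\<bar>)"
    by (simp add: norm_mult)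
  also have "\<dots> \<le> L2_set (\<lambda>e. cmod (g e)) F * L2_set (\<lambda>e. cmod (cinner e v)) F"
    by (rule L2_set_mult_ineq)
  also have "\<dots> \<le> c * norm v"
  proof (rule mult_mono)
    show "L2_set (\<lambda>e. cmod (g e)) F \<le> c"
      unfolding L2_set_def using functional_square_sum_le[OF g V F] g(2) by (rule real_le_lsqrt[rotated])
    show "L2_set (\<lambda>e. cmod (cinner e v)) F \<le> norm v"
      unfolding L2_set_def using bessel_orthonormal[OF F(1,2)] by (intro real_le_lsqrt) auto
  qed (use g in \<open>auto simp: L2_set_nonneg\<close>)
  finally show ?thesis .
qed

text \<open>A Parseval formula. If a finite \<open>F\<close> spans a vector \<open>y\<close> close
  to \<open>v\<close>, then the projection \<open>p\<close> of \<open>v\<close> satisfies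
  \<open>norm (p - y) \<le> norm (v - y)\<close>, so \<open>p\<close> is close to \<open>v\<close>,
  and this persists for every larger finite subset of the basis.\<close>

lemma functional_has_sum:
  assumes g: "g \<in> bounded_ops V UNIV" and V: "complex_vector.subspace V"
    and B: "orthonormal_basis V B" and v: "v \<in> V"
  shows "((\<lambda>e. g e * cinner e v) has_sum g v) B"
  unfolding has_sum_def tendsto_iff eventually_finite_subsets_at_top
proof (intro allI impI)
  fix r :: real assume r: "r > 0"
  obtain c where c: "c \<ge> 0" "\<And>x. x \<in> V \<Longrightarrow> norm (g x) \<le> c * norm x"
    using bounded_ops_nonneg_bound[OF g] by blast
  have "v \<in> closure (complex_vector.span B)"
    using B v unfolding orthonormal_basis_def by blast
  \<comment> \<open>The factor 2 pays for passing from \<open>y\<close> to the projection of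
    \<open>v\<close>; \<open>c + 1\<close> instead of \<open>c\<close> avoids a division by
    zero.\<close>
  then obtain y where y: "y \<in> complex_vector.span B" "dist y v < r / (2 * (c + 1))"
    using r c(1) unfolding closure_approachable
    by (metis add_nonneg_pos divide_pos_pos mult_pos_pos zero_less_numeral zero_less_one)
  obtain A where A: "finite A" "A \<subseteq> B" "y \<in> complex_vector.span A"
    using y(1) complex_vector.span_explicit[of B] complex_vector.span_sum complex_vector.span_scale
      complex_vector.span_base by (smt (verit) mem_Collect_eq)
  show "\<exists>X. finite X \<and> X \<subseteq> B \<and> (\<forall>Y. finite Y \<and> X \<subseteq> Y \<and> Y \<subseteq> B
      \<longrightarrow> dist (\<Sum>e\<in>Y. g e * cinner e v) (g v) < r)"
  proof (intro exI conjI allI impI)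
    fix F assume F: "finite F \<and> A \<subseteq> F \<and> F \<subseteq> B"
    have FV: "F \<subseteq> V" and oF: "orthonormal F"
      using F B orthonormal_subset unfolding orthonormal_basis_def by blast+
    have yF: "y \<in> complex_vector.span F"
      using A(3) F complex_vector.span_mono by blast
    define p where "p = (\<Sum>e\<in>F. cinner e v *\<^sub>C e)"
    have tV: "cinner e v *\<^sub>C e \<in> V" if "e \<in> F" for e
      using FV that complex_vector.subspace_scale[OF V] by blast
    have pV: "p \<in> V" unfolding p_def using tV by (intro complex_vector.subspace_sum[OF V])
    have "g p = (\<Sum>e\<in>F. g (cinner e v *\<^sub>C e))"
      unfolding p_def by (rule bounded_ops_sum[OF g V tV])
    also have "\<dots> = (\<Sum>e\<in>F. g e * cinner e v)"
      using FV by (intro sum.cong refl) (auto simp: bounded_ops_scaleC[OF g] scaleC_complex_def)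
    finally have gp: "(\<Sum>e\<in>F. g e * cinner e v) = g p" ..
    have "p - y = (\<Sum>e\<in>F. cinner e v *\<^sub>C e) - (\<Sum>e\<in>F. cinner e y *\<^sub>C e)"
      using orthonormal_expansion[OF _ oF yF] F by (simp add: p_def)
    also have "\<dots> = (\<Sum>e\<in>F. cinner e (v - y) *\<^sub>C e)"
      by (simp add: cinner_diff_right complex_vector.scale_left_diff_distrib sum_subtractf)
    finally have "norm (p - y) \<le> norm (v - y)"
      using norm_orthonormal_projection_le[OF _ oF, of "v - y"] F by simp
    then have "norm (p - v) \<le> 2 * dist y v"
      using norm_triangle_ineq[of "p - y" "y - v"] by (simp add: dist_norm norm_minus_commute)
    moreover have "2 * dist y v < r / (c + 1)" using y(2) c(1) by (simp add: field_simps)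
    ultimately have npv: "norm (p - v) < r / (c + 1)" by simp
    have "dist (g p) (g v) = norm (g (p - v))"
      by (simp add: dist_norm bounded_ops_diff[OF g V pV v])
    also have "\<dots> \<le> c * norm (p - v)"
      by (rule c(2)) (rule complex_vector.subspace_diff[OF V pV v])
    also have "\<dots> \<le> (c + 1) * norm (p - v)" by (simp add: mult_right_mono)
    also have "\<dots> < r" using npv c(1) by (simp add: field_simps)
    finally show "dist (\<Sum>e\<in>F. g e * cinner e v) (g v) < r" by (simp add: gp)
  qed (use A in auto)
qed

lemma summable_on_norm_dominated:
  fixes c :: "'i \<Rightarrow> real"
  assumes "c summable_on A" "\<And>x. norm (f x) \<le> c x"
  shows "(\<lambda>x. norm (f x)) summable_on A"
  using assms by (rule summable_on_comparison_test) auto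

text \<open>\<open>op_trace\<close> is a definite description and says nothing unless a common value
  exists. This predicate carries existence and value together, so that linearity needs no side
  conditions; uniqueness of the value comes from the existence of some orthonormal basis.\<close>

definition has_trace :: "'a::complex_inner set \<Rightarrow> ('a \<Rightarrow> 'a) \<Rightarrow> complex \<Rightarrow> bool" where
  "has_trace V T s \<longleftrightarrow> (\<forall>B. orthonormal_basis V B \<longrightarrow> ((\<lambda>e. cinner e (T e)) has_sum s) B)"

lemma has_trace_op_trace:
  assumes "has_trace V T s" "dense_countable V"
  shows "op_trace V T = s"
proof -
  obtain B where B: "orthonormal_basis V B" using dense_countable_basis[OF assms(2)] ..
  show ?thesis unfolding op_trace_def
  proof (rule the_equality)
    show "\<forall>B. orthonormal_basis V B \<longrightarrow> ((\<lambda>e. cinner e (T e)) has_sum s) B"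
      using assms(1) by (simp add: has_trace_def)
    show "s' = s" if "\<forall>B. orthonormal_basis V B \<longrightarrow> ((\<lambda>e. cinner e (T e)) has_sum s') B" for s'
      using that assms(1) B has_sum_unique unfolding has_trace_def by blast
  qed
qed

text \<open>The two definite descriptions have the same defining property, since bases lie in
  \<open>V\<close>; the equation therefore holds even where no trace exists.\<close>

lemma op_trace_cong:
  assumes "\<And>x. x \<in> V \<Longrightarrow> S x = T x"
  shows "op_trace V S = op_trace V T"
proof -
  have "((\<lambda>e. cinner e (S e)) has_sum s) B = ((\<lambda>e. cinner e (T e)) has_sum s) B"
    if "orthonormal_basis V B" for B s
    using that assms by (intro has_sum_cong) (auto simp: orthonormal_basis_def)
  then show ?thesis unfolding op_trace_def by metis
qed

lemma has_trace_add: "has_trace V S s \<Longrightarrow> has_trace V T t \<Longrightarrow> has_trace V (\<lambda>x. S x + T x) (s + t)"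
  unfolding has_trace_def cinner_add_right using has_sum_add by blast

lemma has_trace_scaleC: "has_trace V T t \<Longrightarrow> has_trace V (\<lambda>x. a *\<^sub>C T x) (a * t)"
  unfolding has_trace_def cinner_scaleC_right using has_sum_cmult_right by blast

lemma has_trace_zero: "has_trace V (\<lambda>_. 0) 0"
  unfolding has_trace_def by simp

text \<open>
  Summing the diagonal coefficients first over \<open>e\<close> and then over \<open>j\<close> removes the basis from the
  result.
\<close>

lemma has_trace_functional_sum:
  fixes g :: "'i \<Rightarrow> 'a::complex_inner \<Rightarrow> complex"
  assumes V: "complex_vector.subspace V"
    and g: "\<And>j. g j \<in> bounded_ops V UNIV" "\<And>j x. x \<in> V \<Longrightarrow> cmod (g j x) \<le> c j * norm x"
    and c: "\<And>j. 0 \<le> c j" "c summable_on UNIV"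
    and v: "\<And>j. v j \<in> V" "\<And>j. norm (v j) \<le> M"
    and S: "\<And>e. e \<in> V \<Longrightarrow> ((\<lambda>j. g j e * cinner e (v j)) has_sum cinner e (S e)) UNIV"
  shows "has_trace V S (\<Sum>\<^sub>\<infinity>j. g j (v j))"
  unfolding has_trace_def
proof (intro allI impI)
  fix B assume B: "orthonormal_basis V B"
  have BV: "B \<subseteq> V" and oB: "orthonormal B" using B by (auto simp: orthonormal_basis_def)
  let ?f = "\<lambda>(j, e). g j e * cinner e (v j)"
  have "(\<lambda>x. norm (?f x)) summable_on (UNIV \<times> B)"
    unfolding Infinite_Sum.abs_summable_on_Sigma_iff
  proof (intro conjI ballI)
    fix j
    have le: "(\<Sum>e\<in>F. cmod (g j e * cinner e (v j))) \<le> c j * norm (v j)"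
      if "finite F" "F \<subseteq> B" for F
      using functional_cinner_sum_le[OF g(1) c(1) g(2) V that(1)]
        orthonormal_subset[OF oB] that(2) BV by blast
    show "(\<lambda>e. norm (?f (j, e))) summable_on B"
      unfolding Infinite_Sum.abs_summable_iff_bdd_above using le by (auto intro!: bdd_aboveI2)
  next
    show "(\<lambda>j. norm (\<Sum>\<^sub>\<infinity>e\<in>B. norm (?f (j, e)))) summable_on UNIV"
    proof (rule summable_on_norm_dominated[where c = "\<lambda>j. c j * M"])
      show "(\<lambda>j. c j * M) summable_on UNIV" using c(2) by (rule summable_on_cmult_left)
      fix j
      have "(\<Sum>\<^sub>\<infinity>e\<in>B. norm (?f (j, e))) \<le> c j * norm (v j)"
      proof (rule infsum_le_finite_sums)
        show "(\<lambda>e. norm (?f (j, e))) summable_on B"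
        proof (rule nonneg_bdd_above_summable_on)
          show "bdd_above (sum (\<lambda>e. norm (?f (j, e))) ` {F. F \<subseteq> B \<and> finite F})"
            using functional_cinner_sum_le[OF g(1) c(1) g(2) V]
              orthonormal_subset[OF oB] BV by (intro bdd_aboveI2[where M = "c j * norm (v j)"]) auto
        qed auto
        show "(\<Sum>e\<in>F. norm (?f (j, e))) \<le> c j * norm (v j)" if "finite F" "F \<subseteq> B" for F
          using functional_cinner_sum_le[OF g(1) c(1) g(2) V that(1)]
            orthonormal_subset[OF oB] that(2) BV by auto
      qed
      also have "\<dots> \<le> c j * M" using c(1) v(2) by (intro mult_left_mono)
      finally show "norm (\<Sum>\<^sub>\<infinity>e\<in>B. norm (?f (j, e))) \<le> c j * M"
        by (simp add: infsum_nonneg)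
    qed
  qed
  then have sum: "?f summable_on (UNIV \<times> B)" by (rule Infinite_Sum.abs_summable_summable)
  then obtain t where t: "(?f has_sum t) (UNIV \<times> B)" by (auto simp: summable_on_def)
  have "((\<lambda>j. g j (v j)) has_sum t) UNIV"
    using t by (rule has_sum_SigmaD) (simp add: functional_has_sum[OF g(1) V B v(1)])
  then have "t = (\<Sum>\<^sub>\<infinity>j. g j (v j))" by (simp add: infsumI)
  moreover have "((\<lambda>e. cinner e (S e)) has_sum t) B"
  proof (rule has_sum_SigmaD)
    show "((\<lambda>(e, j). g j e * cinner e (v j)) has_sum t) (B \<times> UNIV)"
      using t unfolding has_sum_swap[of _ _ UNIV] by (simp add: case_prod_unfold)
  qed (use S BV in auto)
  ultimately show "((\<lambda>e. cinner e (S e)) has_sum (\<Sum>\<^sub>\<infinity>j. g j (v j))) B" by simp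
qed

text \<open>
  A weak form of \<open>T = \<Sum>j. g j \<otimes> v j\<close>, with scalar series only, as the spaces need not be complete.
\<close>

definition nuclear_rep ::
  "'a::complex_inner set \<Rightarrow> 'b::complex_inner set \<Rightarrow> ('a \<Rightarrow> 'b)
    \<Rightarrow> ('i \<Rightarrow> 'a \<Rightarrow> complex) \<Rightarrow> ('i \<Rightarrow> 'b) \<Rightarrow> ('i \<Rightarrow> real) \<Rightarrow> bool" where
  "nuclear_rep V W T g v c \<longleftrightarrow>
     (\<forall>j. g j \<in> bounded_ops V UNIV \<and> (\<forall>x\<in>V. cmod (g j x) \<le> c j * norm x))
     \<and> (\<forall>j. v j \<in> W \<and> norm (v j) \<le> 1) \<and> (\<forall>j. 0 \<le> c j) \<and> c summable_on UNIV
     \<and> (\<forall>h\<in>bounded_ops W UNIV. \<forall>x\<in>V. ((\<lambda>j. g j x * h (v j)) has_sum h (T x)) UNIV)"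

text \<open>Here \<open>A\<close> acts on the vectors \<open>v j\<close>. The resulting series is
  the one of \<open>nuclear_trace_right\<close>, and this coincidence is the cyclicity of the
  trace.\<close>

lemma nuclear_trace_left:
  assumes n: "nuclear_rep V W T g v c" and V: "complex_vector.subspace V"
    and A: "A \<in> bounded_ops W V"
  shows "has_trace V (\<lambda>x. A (T x)) (\<Sum>\<^sub>\<infinity>j. g j (A (v j)))"
proof -
  note n = n[unfolded nuclear_rep_def]
  obtain K where K: "K \<ge> 0" "\<And>x. x \<in> W \<Longrightarrow> norm (A x) \<le> K * norm x"
    using bounded_ops_nonneg_bound[OF A] by blast
  show ?thesis
  proof (rule has_trace_functional_sum[OF V, where c = c and M = K])
    fix j
    have "v j \<in> W" "norm (v j) \<le> 1" using n by auto
    then show "norm (A (v j)) \<le> K"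
      using K(2)[of "v j"] mult_left_le[of "norm (v j)" K] K(1) by linarith
    show "A (v j) \<in> V" using \<open>v j \<in> W\<close> by (rule bounded_ops_mem[OF A])
  next
    fix e assume "e \<in> V"
    have "\<forall>x\<in>V. ((\<lambda>j. g j x * cinner e (A (v j))) has_sum cinner e (A (T x))) UNIV"
      using n bounded_ops_comp[OF bounded_ops_cinner[of e] A] by meson
    then show "((\<lambda>j. g j e * cinner e (A (v j))) has_sum cinner e (A (T e))) UNIV"
      using \<open>e \<in> V\<close> by blast
  qed (use n in auto)
qed

text \<open>Here \<open>A\<close> is absorbed into the functionals, as \<open>g j\<close> after
  \<open>A\<close>; evaluated at \<open>v j\<close> this gives again
  \<open>g j (A (v j))\<close>.\<close>

lemma nuclear_trace_right:
  assumes n: "nuclear_rep V W T g v c" and W: "complex_vector.subspace W"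
    and A: "A \<in> bounded_ops W V"
  shows "has_trace W (\<lambda>x. T (A x)) (\<Sum>\<^sub>\<infinity>j. g j (A (v j)))"
proof -
  note n = n[unfolded nuclear_rep_def]
  obtain K where K: "K \<ge> 0" "\<And>x. x \<in> W \<Longrightarrow> norm (A x) \<le> K * norm x"
    using bounded_ops_nonneg_bound[OF A] by blast
  show ?thesis
  proof (rule has_trace_functional_sum[OF W, where c = "\<lambda>j. c j * K" and M = 1
        and g = "\<lambda>j x. g j (A x)"])
    show "(\<lambda>x. g j (A x)) \<in> bounded_ops W UNIV" for j
      using n bounded_ops_comp[OF _ A, of "g j"] by blast
    show "cmod (g j (A x)) \<le> c j * K * norm x" if "x \<in> W" for j x
    proof -
      have "cmod (g j (A x)) \<le> c j * norm (A x)" using n bounded_ops_mem[OF A that] by blast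
      also have "\<dots> \<le> c j * (K * norm x)" using n K(2)[OF that] by (intro mult_left_mono) auto
      finally show ?thesis by (simp add: mult.assoc)
    qed
    show "(\<lambda>j. c j * K) summable_on UNIV" using n by (intro summable_on_cmult_left) auto
    show "((\<lambda>j. g j (A e) * cinner e (v j)) has_sum cinner e (T (A e))) UNIV" if "e \<in> W" for e
      using n bounded_ops_mem[OF A that] bounded_ops_cinner[of e] by blast
  qed (use n K in auto)
qed

lemma nuclear_pairing_abs_summable:
  assumes n: "nuclear_rep V W T g v c"
    and A: "\<And>x. x \<in> W \<Longrightarrow> A x \<in> V" "\<And>x. x \<in> W \<Longrightarrow> norm (A x) \<le> K * norm x" "0 \<le> K"
  shows "cmod (g j (A (v j))) \<le> K * c j"
proof -
  note n = n[unfolded nuclear_rep_def]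
  have "cmod (g j (A (v j))) \<le> c j * norm (A (v j))" using n A(1) by blast
  also have "\<dots> \<le> c j * (K * norm (v j))" using n A(2) by (intro mult_left_mono) auto
  also have "\<dots> \<le> c j * (K * 1)" using n A(3) by (intro mult_left_mono) auto
  finally show ?thesis by (simp add: mult.commute)
qed

lemma nuclear_pairing_le:
  assumes n: "nuclear_rep V W T g v c"
    and A: "\<And>x. x \<in> W \<Longrightarrow> A x \<in> V" "\<And>x. x \<in> W \<Longrightarrow> norm (A x) \<le> K * norm x" "0 \<le> K"
  shows "cmod (\<Sum>\<^sub>\<infinity>j. g j (A (v j))) \<le> K * (\<Sum>\<^sub>\<infinity>j. c j)"
proof -
  have c: "c summable_on UNIV" using n by (simp add: nuclear_rep_def)
  then have s: "((\<lambda>j. K * c j) has_sum (K * (\<Sum>\<^sub>\<infinity>j. c j))) UNIV"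
    by (intro has_sum_cmult_right has_sum_infsum)
  have "(\<lambda>j. norm (g j (A (v j)))) summable_on UNIV"
    using has_sum_imp_summable[OF s] nuclear_pairing_abs_summable[OF n A]
    by (rule summable_on_norm_dominated)
  then have "((\<lambda>j. g j (A (v j))) has_sum (\<Sum>\<^sub>\<infinity>j. g j (A (v j)))) UNIV"
    by (rule has_sum_infsum[OF Infinite_Sum.abs_summable_summable])
  then show ?thesis
    using s by (rule norm_infsum_le) (use nuclear_pairing_abs_summable[OF n A] in auto)
qed

text \<open>Dominated convergence for unordered sums along an arbitrary filter: outside a finite
  \<open>X\<close> both sums are bounded by the tail of \<open>c\<close>, and on \<open>X\<close>
  there are only finitely many limits.\<close>

lemma infsum_dominated_convergence:
  fixes f :: "'s \<Rightarrow> 'i \<Rightarrow> complex"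
  assumes c: "c summable_on UNIV" and le: "\<forall>\<^sub>F s in Fl. \<forall>j. cmod (f s j) \<le> c j"
    and lim: "\<And>j. ((\<lambda>s. f s j) \<longlongrightarrow> f0 j) Fl" and le0: "\<And>j. cmod (f0 j) \<le> c j"
  shows "((\<lambda>s. \<Sum>\<^sub>\<infinity>j. f s j) \<longlongrightarrow> (\<Sum>\<^sub>\<infinity>j. f0 j)) Fl"
  unfolding tendsto_iff
proof (intro allI impI)
  fix r :: real assume r: "r > 0"
  have abs: "h summable_on UNIV" if "\<And>j. cmod (h j) \<le> c j" for h :: "'i \<Rightarrow> complex"
    using summable_on_norm_dominated[OF c that] by (rule Infinite_Sum.abs_summable_summable)
  obtain X where X: "finite X" "dist (sum c X) (\<Sum>\<^sub>\<infinity>j. c j) \<le> r / 8"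
    using has_sum_finite_approximation[OF has_sum_infsum[OF c], of "r / 8"] r by auto
  have sumc: "(\<Sum>\<^sub>\<infinity>j\<in>-X. c j) \<le> r / 8"
  proof -
    have "(\<Sum>\<^sub>\<infinity>j. c j) = infsum c (X \<union> - X)" by simp
    also have "\<dots> = sum c X + (\<Sum>\<^sub>\<infinity>j\<in>-X. c j)"
      using c summable_on_subset_banach[OF c] X(1) by (subst infsum_Un_disjoint) auto
    finally show ?thesis using X(2) by (auto simp: dist_real_def)
  qed
  have tail: "cmod ((\<Sum>\<^sub>\<infinity>j. h j) - sum h X) \<le> r / 8" if h: "\<And>j. cmod (h j) \<le> c j" for h
  proof -
    have "(\<Sum>\<^sub>\<infinity>j. h j) = infsum h (X \<union> - X)" by simp
    also have "\<dots> = sum h X + (\<Sum>\<^sub>\<infinity>j\<in>-X. h j)"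
      using summable_on_subset_banach[OF abs[OF h]] X(1) by (subst infsum_Un_disjoint) auto
    finally have "(\<Sum>\<^sub>\<infinity>j. h j) - sum h X = (\<Sum>\<^sub>\<infinity>j\<in>-X. h j)" by simp
    moreover have "cmod (\<Sum>\<^sub>\<infinity>j\<in>-X. h j) \<le> (\<Sum>\<^sub>\<infinity>j\<in>-X. c j)"
      using summable_on_subset_banach[OF abs[OF h]] summable_on_subset_banach[OF c] h
      by (intro norm_infsum_le[OF has_sum_infsum has_sum_infsum]) auto
    ultimately show ?thesis using sumc by simp
  qed
  have "((\<lambda>s. \<Sum>j\<in>X. f s j) \<longlongrightarrow> sum f0 X) Fl" by (intro tendsto_sum lim)
  then have "\<forall>\<^sub>F s in Fl. dist (\<Sum>j\<in>X. f s j) (sum f0 X) < r / 8"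
    using tendstoD[of _ "sum f0 X" Fl "r / 8"] r by simp
  with le show "\<forall>\<^sub>F s in Fl. dist (\<Sum>\<^sub>\<infinity>j. f s j) (\<Sum>\<^sub>\<infinity>j. f0 j) < r"
  proof eventually_elim
    case (elim s)
    have "cmod ((\<Sum>\<^sub>\<infinity>j. f s j) - (\<Sum>\<^sub>\<infinity>j. f0 j))
      \<le> cmod ((\<Sum>\<^sub>\<infinity>j. f s j) - sum (f s) X) + cmod (sum (f s) X - sum f0 X)
        + cmod ((\<Sum>\<^sub>\<infinity>j. f0 j) - sum f0 X)"
      by norm
    then show ?case
      using tail[of "f s"] tail[of f0] elim le0 r by (simp add: dist_norm)
  qed
qed

text \<open>Strong convergence suffices because each term sees \<open>A s\<close> only at the single
  vector \<open>v j\<close>; the uniform bound \<open>K\<close> supplies the dominating series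
  \<open>K * c j\<close>.\<close>

lemma nuclear_pairing_tendsto:
  assumes n: "nuclear_rep V W T g v c" and V: "complex_vector.subspace V" and K: "0 \<le> K"
    and A: "\<forall>\<^sub>F s in Fl. A s \<in> bounded_ops W V \<and> (\<forall>x\<in>W. norm (A s x) \<le> K * norm x)"
    and A0: "A0 \<in> bounded_ops W V" "\<And>x. x \<in> W \<Longrightarrow> norm (A0 x) \<le> K * norm x"
    and lim: "\<And>x. x \<in> W \<Longrightarrow> ((\<lambda>s. A s x) \<longlongrightarrow> A0 x) Fl"
  shows "((\<lambda>s. \<Sum>\<^sub>\<infinity>j. g j (A s (v j))) \<longlongrightarrow> (\<Sum>\<^sub>\<infinity>j. g j (A0 (v j)))) Fl"
proof (rule infsum_dominated_convergence)
  note n' = n[unfolded nuclear_rep_def]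
  show "(\<lambda>j. K * c j) summable_on UNIV" using n' by (intro summable_on_cmult_right) auto
  show "\<forall>\<^sub>F s in Fl. \<forall>j. cmod (g j (A s (v j))) \<le> K * c j"
    using A by eventually_elim
      (use nuclear_pairing_abs_summable[OF n] K bounded_ops_mem in metis)
  show "cmod (g j (A0 (v j))) \<le> K * c j" for j
    using nuclear_pairing_abs_summable[OF n bounded_ops_mem[OF A0(1)] A0(2) K] .
  fix j
  have vj: "v j \<in> W" using n' by blast
  have "((\<lambda>s. g j (A s (v j)) - g j (A0 (v j))) \<longlongrightarrow> 0) Fl"
  proof (rule Lim_null_comparison)
    show "\<forall>\<^sub>F s in Fl. norm (g j (A s (v j)) - g j (A0 (v j))) \<le> c j * norm (A s (v j) - A0 (v j))"
      using A
    proof eventually_elim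
      case (elim s)
      have in_V: "A s (v j) \<in> V" "A0 (v j) \<in> V"
        using elim A0(1) vj bounded_ops_mem by blast+
      have g: "g j \<in> bounded_ops V UNIV" "\<And>x. x \<in> V \<Longrightarrow> cmod (g j x) \<le> c j * norm x"
        using n' by auto
      show ?case
        using g(2)[OF complex_vector.subspace_diff[OF V in_V]]
        by (simp add: bounded_ops_diff[OF g(1) V in_V])
    qed
    have "((\<lambda>s. A s (v j) - A0 (v j)) \<longlongrightarrow> 0) Fl" using lim[OF vj] by (rule LIM_zero)
    then show "((\<lambda>s. c j * norm (A s (v j) - A0 (v j))) \<longlongrightarrow> 0) Fl"
      by (intro tendsto_mult_right_zero tendsto_norm_zero)
  qed
  then show "((\<lambda>s. g j (A s (v j))) \<longlongrightarrow> g j (A0 (v j))) Fl" by (rule LIM_zero_cancel)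
qed

section \<open>Singular numbers\<close>

text \<open>The spanning set in \<open>rank_le\<close> may lie outside \<open>W\<close>. A maximal
  independent subset of the range is no larger, lies in \<open>W\<close>, and can be orthonormalised
  there.\<close>

lemma rank_le_basis:
  assumes T: "T \<in> bounded_ops V W" and V: "complex_vector.subspace V"
    and W: "complex_vector.subspace W" and rank: "rank_le V T n"
  obtains B where "finite B" "card B \<le> n" "orthonormal B" "B \<subseteq> W" "T ` V \<subseteq> complex_vector.span B"
proof -
  obtain B0 where B0: "finite B0" "card B0 \<le> n" "T ` V \<subseteq> complex_vector.span B0"
    using rank unfolding rank_le_def by blast
  obtain A where A: "A \<subseteq> T ` V" "complex_vector.independent A" "T ` V \<subseteq> complex_vector.span A"
    using complex_vector.maximal_independent_subset by blast
  have fA: "finite A" "card A \<le> card B0"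
    using complex_vector.independent_span_bound[OF B0(1) A(2)] A(1) B0(3) by auto
  have AW: "A \<subseteq> W" using A(1) bounded_ops_mem[OF T] by blast
  obtain B where B: "finite B" "orthonormal B" "B \<subseteq> W" "A \<subseteq> complex_vector.span B" "card B \<le> card A"
    using gram_schmidt_finite[OF fA(1) AW W] by blast
  have "complex_vector.span A \<subseteq> complex_vector.span B"
    using B(4) by (simp add: complex_vector.span_minimal)
  then show ?thesis using that[of B] B A(3) fA(2) B0(2) by auto
qed

lemma rank_le_add_scaleR:
  assumes "rank_le V S m" "rank_le V T n"
  shows "rank_le V (\<lambda>x. S x + r *\<^sub>R T x) (m + n)"
proof -
  obtain A B where A: "finite A" "card A \<le> m" "S ` V \<subseteq> complex_vector.span A"
    and B: "finite B" "card B \<le> n" "T ` V \<subseteq> complex_vector.span B"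
    using assms unfolding rank_le_def by blast
  have sub: "complex_vector.span A \<subseteq> complex_vector.span (A \<union> B)"
    "complex_vector.span B \<subseteq> complex_vector.span (A \<union> B)"
    by (auto intro!: complex_vector.span_mono)
  have "S x + r *\<^sub>R T x \<in> complex_vector.span (A \<union> B)" if "x \<in> V" for x
  proof -
    have "S x \<in> complex_vector.span (A \<union> B)" "T x \<in> complex_vector.span (A \<union> B)"
      using A(3) B(3) sub that by blast+
    then show ?thesis
      by (simp add: complex_vector.span_add subspace_scaleR complex_vector.subspace_span)
  qed
  then show ?thesis
    using A B card_Un_le[of A B] unfolding rank_le_def by (intro exI[of _ "A \<union> B"]) auto
qed

text \<open>The new spanning set is the image of a basis inside \<open>W\<close>, since
  \<open>S\<close> is known to be linear only there.\<close>

lemma rank_le_comp_left: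
  assumes S: "S \<in> bounded_ops W U" and T: "T \<in> bounded_ops V W" and rank: "rank_le V T n"
    and V: "complex_vector.subspace V" and W: "complex_vector.subspace W"
  shows "rank_le V (\<lambda>x. S (T x)) n"
proof -
  obtain B where B: "finite B" "card B \<le> n" "orthonormal B" "B \<subseteq> W" "T ` V \<subseteq> complex_vector.span B"
    using rank_le_basis[OF T V W rank] by blast
  have "S (T x) \<in> complex_vector.span (S ` B)" if "x \<in> V" for x
  proof -
    have "T x = (\<Sum>e\<in>B. cinner e (T x) *\<^sub>C e)"
      using orthonormal_expansion[OF B(1,3)] B(5) that by force
    then have "S (T x) = S (\<Sum>e\<in>B. cinner e (T x) *\<^sub>C e)" by simp
    also have "\<dots> = (\<Sum>e\<in>B. S (cinner e (T x) *\<^sub>C e))"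
      using B(4) complex_vector.subspace_scale[OF W] by (intro bounded_ops_sum[OF S W]) blast
    also have "\<dots> = (\<Sum>e\<in>B. cinner e (T x) *\<^sub>C S e)"
      using B(4) by (intro sum.cong) (auto simp: bounded_ops_scaleC[OF S])
    also have "\<dots> \<in> complex_vector.span (S ` B)"
      by (intro complex_vector.span_sum complex_vector.span_scale complex_vector.span_base) simp
    finally show ?thesis .
  qed
  then show ?thesis
    using B(1,2) card_image_le[OF B(1), of S] unfolding rank_le_def
    by (intro exI[of _ "S ` B"]) auto
qed

lemma rank_le_comp_right:
  assumes "rank_le W S n" "T \<in> bounded_ops V W"
  shows "rank_le V (\<lambda>x. S (T x)) n"
  using assms(1) bounded_ops_mem[OF assms(2)] unfolding rank_le_def by blast

lemma rank_le_mono: "rank_le V T m \<Longrightarrow> m \<le> n \<Longrightarrow> rank_le V T n"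
  unfolding rank_le_def by (meson order_trans)

lemma rank_le_zero: "rank_le V (\<lambda>_. 0) n"
  unfolding rank_le_def
  by (intro exI[of _ "{}"]) (auto simp: complex_vector.span_zero)

context
  fixes V :: "'a::complex_inner set" and W :: "'b::complex_inner set"
  assumes V: "complex_vector.subspace V" and W: "complex_vector.subspace W"
begin

lemma singular_number_le:
  assumes T: "T \<in> bounded_ops V W" and R: "R \<in> bounded_ops V W" "rank_le V R n"
  shows "singular_number V W T n \<le> op_norm V (\<lambda>x. T x - R x)"
  unfolding singular_number_def
proof (rule cINF_lower)
  show "bdd_below ((\<lambda>R. op_norm V (\<lambda>x. T x - R x)) ` {R \<in> bounded_ops V W. rank_le V R n})"
    by (rule bdd_belowI2[where m = 0]) (use op_norm_nonneg[OF bounded_ops_diff_op[OF T _ W] V] in auto)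
qed (use R in simp)

lemma singular_number_nonneg:
  assumes T: "T \<in> bounded_ops V W"
  shows "0 \<le> singular_number V W T n"
  unfolding singular_number_def
proof (rule cINF_greatest)
  show "{R \<in> bounded_ops V W. rank_le V R n} \<noteq> {}"
    using bounded_ops_zero_op[OF W] rank_le_zero by blast
qed (use op_norm_nonneg[OF bounded_ops_diff_op[OF T _ W] V] in auto)

text \<open>The infimum need not be attained, so every choice of an approximant costs an
  \<open>\<epsilon>\<close>.\<close>

lemma singular_number_approx:
  assumes T: "T \<in> bounded_ops V W" and "\<epsilon> > 0"
  obtains R where "R \<in> bounded_ops V W" "rank_le V R n"
    "op_norm V (\<lambda>x. T x - R x) < singular_number V W T n + \<epsilon>"
proof -
  let ?X = "(\<lambda>R. op_norm V (\<lambda>x. T x - R x)) ` {R \<in> bounded_ops V W. rank_le V R n}"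
  have "?X \<noteq> {}" using bounded_ops_zero_op[OF W] rank_le_zero by blast
  moreover have "Inf ?X < singular_number V W T n + \<epsilon>"
    using assms(2) by (simp add: singular_number_def)
  ultimately obtain z where "z \<in> ?X" "z < singular_number V W T n + \<epsilon>"
    using cInf_lessD[of ?X] by meson
  then show ?thesis using that by auto
qed

lemma singular_number_antimono:
  assumes T: "T \<in> bounded_ops V W"
  shows "antimono (singular_number V W T)"
proof (rule antimonoI)
  fix m n :: nat assume "m \<le> n"
  show "singular_number V W T n \<le> singular_number V W T m"
  proof (rule field_le_epsilon)
    fix e :: real assume "e > 0"
    then obtain R where R: "R \<in> bounded_ops V W" "rank_le V R m"
      "op_norm V (\<lambda>x. T x - R x) < singular_number V W T m + e"
      using singular_number_approx[OF T] by blast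
    then show "singular_number V W T n \<le> singular_number V W T m + e"
      using singular_number_le[OF T R(1) rank_le_mono[OF R(2) \<open>m \<le> n\<close>]] by simp
  qed
qed

lemma singular_number_le_op_norm:
  assumes T: "T \<in> bounded_ops V W"
  shows "singular_number V W T n \<le> op_norm V T"
  using singular_number_le[OF T bounded_ops_zero_op[OF W] rank_le_zero] by simp

text \<open>Ky Fan's inequality: approximants of rank at most \<open>m\<close> and \<open>n\<close>
  combine to one of rank at most \<open>m + n\<close>.\<close>

lemma singular_number_add_scaleR:
  assumes S: "S \<in> bounded_ops V W" and T: "T \<in> bounded_ops V W"
  shows "singular_number V W (\<lambda>x. S x + r *\<^sub>R T x) (m + n)
    \<le> singular_number V W S m + \<bar>r\<bar> * singular_number V W T n"
proof (rule field_le_epsilon)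
  fix e :: real assume e: "e > 0"
  \<comment> \<open>Chosen so that the slack of both approximants,
    \<open>d + \<bar>r\<bar> * d\<close>, is exactly \<open>e\<close>.\<close>
  define d where "d = e / (1 + \<bar>r\<bar>)"
  have "d * (1 + \<bar>r\<bar>) = e"
    using abs_ge_zero[of r] by (simp add: d_def)
  moreover have "d > 0" using e by (simp add: d_def)
  ultimately have d: "d > 0" "d + \<bar>r\<bar> * d = e"
    by (simp_all add: algebra_simps)
  obtain A where A: "A \<in> bounded_ops V W" "rank_le V A m"
    "op_norm V (\<lambda>x. S x - A x) < singular_number V W S m + d"
    using singular_number_approx[OF S d(1)] by blast
  obtain B where B: "B \<in> bounded_ops V W" "rank_le V B n"
    "op_norm V (\<lambda>x. T x - B x) < singular_number V W T n + d"
    using singular_number_approx[OF T d(1)] by blast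
  note SA = bounded_ops_diff_op[OF S A(1) W] and TB = bounded_ops_diff_op[OF T B(1) W]
  have "singular_number V W (\<lambda>x. S x + r *\<^sub>R T x) (m + n)
    \<le> op_norm V (\<lambda>x. (S x + r *\<^sub>R T x) - (A x + r *\<^sub>R B x))"
    by (intro singular_number_le bounded_ops_add_scaleR S T W A B rank_le_add_scaleR)
  also have "\<dots> \<le> op_norm V (\<lambda>x. S x - A x) + \<bar>r\<bar> * op_norm V (\<lambda>x. T x - B x)"
  proof (rule op_norm_le[OF V])
    show "0 \<le> op_norm V (\<lambda>x. S x - A x) + \<bar>r\<bar> * op_norm V (\<lambda>x. T x - B x)"
      using op_norm_nonneg[OF SA V] op_norm_nonneg[OF TB V] by simp
    fix x assume x: "x \<in> V"
    have "norm ((S x + r *\<^sub>R T x) - (A x + r *\<^sub>R B x)) = norm ((S x - A x) + r *\<^sub>R (T x - B x))"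
      by (simp add: algebra_simps)
    also have "\<dots> \<le> norm (S x - A x) + \<bar>r\<bar> * norm (T x - B x)"
      using norm_triangle_ineq[of "S x - A x" "r *\<^sub>R (T x - B x)"] by simp
    also have "\<dots> \<le> op_norm V (\<lambda>x. S x - A x) * norm x
        + \<bar>r\<bar> * (op_norm V (\<lambda>x. T x - B x) * norm x)"
      using norm_le_op_norm[OF SA V x] norm_le_op_norm[OF TB V x]
      by (intro add_mono mult_left_mono) auto
    finally show "norm ((S x + r *\<^sub>R T x) - (A x + r *\<^sub>R B x))
        \<le> (op_norm V (\<lambda>x. S x - A x) + \<bar>r\<bar> * op_norm V (\<lambda>x. T x - B x)) * norm x"
      by (simp add: algebra_simps)
  qed
  also have "\<dots> \<le> (singular_number V W S m + d) + \<bar>r\<bar> * (singular_number V W T n + d)"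
    using A(3) B(3) by (intro add_mono mult_left_mono) auto
  also have "\<dots> = singular_number V W S m + \<bar>r\<bar> * singular_number V W T n + (d + \<bar>r\<bar> * d)"
    by (simp add: algebra_simps)
  finally show "singular_number V W (\<lambda>x. S x + r *\<^sub>R T x) (m + n)
      \<le> singular_number V W S m + \<bar>r\<bar> * singular_number V W T n + e"
    by (simp only: d(2))
qed

end

text \<open>From \<open>S T - (A T + (S - A) B) = (S - A) (T - B)\<close>, where \<open>A T\<close>
  has rank at most \<open>m\<close> and \<open>(S - A) B\<close> has rank at most
  \<open>n\<close>.\<close>

lemma singular_number_comp:
  fixes U :: "'c::complex_inner set"
  assumes V: "complex_vector.subspace V" and W: "complex_vector.subspace W"
    and U: "complex_vector.subspace U"
    and S: "S \<in> bounded_ops W U" and T: "T \<in> bounded_ops V W"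
  shows "singular_number V U (\<lambda>x. S (T x)) (m + n)
    \<le> singular_number W U S m * singular_number V W T n"
proof -
  let ?s = "singular_number W U S m" and ?t = "singular_number V W T n"
  have s0: "0 \<le> ?s" "0 \<le> ?t"
    using singular_number_nonneg[OF W U S] singular_number_nonneg[OF V W T] by auto
  have *: "singular_number V U (\<lambda>x. S (T x)) (m + n) \<le> (?s + e) * (?t + e)" if e: "e > 0" for e
  proof -
    obtain A where A: "A \<in> bounded_ops W U" "rank_le W A m" "op_norm W (\<lambda>x. S x - A x) < ?s + e"
      using singular_number_approx[OF W U S e] by blast
    obtain B where B: "B \<in> bounded_ops V W" "rank_le V B n" "op_norm V (\<lambda>x. T x - B x) < ?t + e"
      using singular_number_approx[OF V W T e] by blast
    note SA = bounded_ops_diff_op[OF S A(1) U] and TB = bounded_ops_diff_op[OF T B(1) W]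
    note AT = bounded_ops_comp[OF A(1) T] and SAB = bounded_ops_comp[OF SA B(1)]
    define R where "R x = A (T x) + 1 *\<^sub>R (S (B x) - A (B x))" for x
    have "singular_number V U (\<lambda>x. S (T x)) (m + n) \<le> op_norm V (\<lambda>x. S (T x) - R x)"
    proof (rule singular_number_le[OF V U])
      show "R \<in> bounded_ops V U" unfolding R_def by (rule bounded_ops_add_scaleR[OF AT SAB U])
      show "rank_le V R (m + n)" unfolding R_def
        by (intro rank_le_add_scaleR rank_le_comp_right[OF A(2) T]
            rank_le_comp_left[OF SA B(1,2) V W])
      show "(\<lambda>x. S (T x)) \<in> bounded_ops V U" by (rule bounded_ops_comp[OF S T])
    qed
    also have "\<dots> \<le> op_norm W (\<lambda>x. S x - A x) * op_norm V (\<lambda>x. T x - B x)"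
    proof (rule op_norm_le[OF V])
      show "0 \<le> op_norm W (\<lambda>x. S x - A x) * op_norm V (\<lambda>x. T x - B x)"
        using op_norm_nonneg[OF SA W] op_norm_nonneg[OF TB V] by simp
      fix x assume x: "x \<in> V"
      have mem: "T x \<in> W" "B x \<in> W" using x bounded_ops_mem T B(1) by blast+
      have d: "T x - B x \<in> W" using complex_vector.subspace_diff[OF W mem] .
      have "S (T x) - R x = S (T x - B x) - A (T x - B x)"
        unfolding R_def bounded_ops_diff[OF S W mem] bounded_ops_diff[OF A(1) W mem] by simp
      then have "norm (S (T x) - R x) \<le> op_norm W (\<lambda>x. S x - A x) * norm (T x - B x)"
        using norm_le_op_norm[OF SA W d] by simp
      also have "\<dots> \<le> op_norm W (\<lambda>x. S x - A x) * (op_norm V (\<lambda>x. T x - B x) * norm x)"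
        by (intro mult_left_mono norm_le_op_norm[OF TB V x] op_norm_nonneg[OF SA W])
      finally show "norm (S (T x) - R x)
          \<le> op_norm W (\<lambda>x. S x - A x) * op_norm V (\<lambda>x. T x - B x) * norm x"
        by (simp add: mult.assoc)
    qed
    also have "\<dots> \<le> (?s + e) * (?t + e)"
      using A(3) B(3) s0 e op_norm_nonneg[OF TB V] by (intro mult_mono) auto
    finally show ?thesis .
  qed
  have "((\<lambda>e. (?s + e) * (?t + e)) \<longlongrightarrow> (?s + 0) * (?t + 0)) (at_right 0)"
    by (intro tendsto_intros)
  then have "singular_number V U (\<lambda>x. S (T x)) (m + n) \<le> (?s + 0) * (?t + 0)"
    by (rule tendsto_lowerbound)
      (auto simp: eventually_at_right_field intro!: exI[of _ 1] *)
  then show ?thesis by simp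
qed

text \<open>Expanding \<open>D x\<close> in an orthonormal system \<open>v\<close> that spans the
  range gives the functionals \<open>g i x = cinner (v i) (D x)\<close>.\<close>

lemma finite_rank_rep:
  assumes D: "D \<in> bounded_ops V W" and V: "complex_vector.subspace V"
    and W: "complex_vector.subspace W" and rank: "rank_le V D n"
    and d: "\<And>x. x \<in> V \<Longrightarrow> norm (D x) \<le> d * norm x"
  obtains g v where "\<And>i. i < n \<Longrightarrow> g i \<in> bounded_ops V UNIV"
    "\<And>i x. i < n \<Longrightarrow> x \<in> V \<Longrightarrow> cmod (g i x) \<le> d * norm x"
    "\<And>i. i < n \<Longrightarrow> v i \<in> W" "\<And>i. i < n \<Longrightarrow> norm (v i) \<le> 1"
    "\<And>h x. h \<in> bounded_ops W UNIV \<Longrightarrow> x \<in> V \<Longrightarrow> (\<Sum>i<n. g i x * h (v i)) = h (D x)"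
proof -
  obtain B where B: "finite B" "card B \<le> n" "orthonormal B" "B \<subseteq> W" "D ` V \<subseteq> complex_vector.span B"
    using rank_le_basis[OF D V W rank] by blast
  obtain f where f: "bij_betw f {0..<card B} B"
    using ex_bij_betw_nat_finite[OF B(1)] by blast
  \<comment> \<open>Zero vectors pad the system to exactly \<open>n\<close> terms.\<close>
  define v where "v i = (if i < card B then f i else 0)" for i
  define g where "g i x = cinner (v i) (D x)" for i x
  have fB: "f i \<in> B" if "i < card B" for i using f that by (auto simp: bij_betw_def)
  have v: "v i \<in> W" "norm (v i) \<le> 1" for i
    using fB B(4) orthonormal_norm[OF B(3)] complex_vector.subspace_0[OF W] by (auto simp: v_def)
  have sum: "(\<Sum>i<n. g i x * h (v i)) = h (D x)" if h: "h \<in> bounded_ops W UNIV" and x: "x \<in> V" for h x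
  proof -
    have "D x = (\<Sum>e\<in>B. cinner e (D x) *\<^sub>C e)"
      using orthonormal_expansion[OF B(1,3)] B(5) x by force
    then have "h (D x) = h (\<Sum>e\<in>B. cinner e (D x) *\<^sub>C e)" by simp
    also have "\<dots> = (\<Sum>e\<in>B. h (cinner e (D x) *\<^sub>C e))"
      using B(4) complex_vector.subspace_scale[OF W] by (intro bounded_ops_sum[OF h W]) blast
    also have "\<dots> = (\<Sum>e\<in>B. cinner e (D x) * h e)"
      using B(4) by (intro sum.cong) (auto simp: bounded_ops_scaleC[OF h] scaleC_complex_def)
    also have "\<dots> = (\<Sum>i\<in>{0..<card B}. cinner (f i) (D x) * h (f i))"
      using sum.reindex_bij_betw[OF f, of "\<lambda>e. cinner e (D x) * h e"] by simp
    also have "\<dots> = (\<Sum>i\<in>{0..<card B}. g i x * h (v i))"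
      by (intro sum.cong) (auto simp: g_def v_def)
    also have "\<dots> = (\<Sum>i<n. g i x * h (v i))"
      using B(2) by (intro sum.mono_neutral_left) (auto simp: v_def bounded_ops_zero[OF h W])
    finally show ?thesis ..
  qed
  show ?thesis
  proof (rule that[of g v])
    show "g i \<in> bounded_ops V UNIV" for i
      unfolding g_def by (rule bounded_ops_comp[OF bounded_ops_cinner D])
    show "cmod (g i x) \<le> d * norm x" if "x \<in> V" for i x
    proof -
      have "cmod (g i x) \<le> norm (v i) * norm (D x)" unfolding g_def by (rule cmod_cinner_le)
      also have "\<dots> \<le> 1 * norm (D x)" using v(2) by (intro mult_right_mono) auto
      finally show ?thesis using d[OF that] by simp
    qed
  qed (use v sum in auto)
qed

text \<open>Cauchy condensation: the block from \<open>2^K - 1\<close> up to but excluding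
  \<open>2^(K+1) - 1\<close> has \<open>2^K\<close> entries, each at least
  \<open>s (2^(K+1) - 1)\<close>. The shift by one suits singular numbers counted from 0.\<close>

lemma antimono_dyadic_sum_le:
  fixes s :: "nat \<Rightarrow> real"
  assumes "antimono s"
  shows "(\<Sum>k\<le>K. 2 ^ k * s (2 ^ k - 1)) \<le> s 0 + 2 * (\<Sum>n<2 ^ K - 1. s n)"
proof (induction K)
  case (Suc K)
  let ?A = "{2 ^ K - 1..<2 ^ Suc K - 1 :: nat}"
  have "2 ^ K * s (2 ^ Suc K - 1) = (\<Sum>n\<in>?A. s (2 ^ Suc K - 1))"
    by (simp add: of_nat_diff)
  also have "\<dots> \<le> (\<Sum>n\<in>?A. s n)"
    by (intro sum_mono antimonoD[OF assms]) simp
  also have "(\<Sum>n<2 ^ K - 1. s n) + (\<Sum>n\<in>?A. s n) = (\<Sum>n<2 ^ Suc K - 1. s n)"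
  proof -
    have "2 ^ K - 1 \<le> (2 ^ Suc K - 1 :: nat)" by (intro diff_le_mono power_increasing) auto
    then show ?thesis unfolding lessThan_atLeast0 by (intro sum.atLeastLessThan_concat) auto
  qed
  ultimately show ?case
    using Suc.IH by (simp add: algebra_simps)
qed simp

text \<open>Telescoping approximants of rank at most \<open>2^k - 1\<close> gives \<open>T\<close>
  as a sum of pieces of rank at most \<open>3 * 2^k\<close> and norm at most twice the approximation
  error. By condensation the total cost is at most \<open>6 * (3 * S + 2 * \<eta>)\<close>, where
  \<open>S\<close> is the sum of the singular numbers; hence the constant 18.\<close>

lemma nuclear_rep_exists:
  fixes T :: "'a::complex_inner \<Rightarrow> 'b::complex_inner"
  assumes T: "T \<in> bounded_ops V W" and V: "complex_vector.subspace V"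
    and W: "complex_vector.subspace W"
    and s: "summable (singular_number V W T)" and \<eta>: "\<eta> > 0"
  obtains g :: "nat \<times> nat \<Rightarrow> _" and v c where "nuclear_rep V W T g v c"
    "(\<Sum>\<^sub>\<infinity>j. c j) \<le> 18 * ((\<Sum>n. singular_number V W T n) + \<eta>)"
proof -
  let ?s = "singular_number V W T"
  have s0: "0 \<le> ?s n" for n by (rule singular_number_nonneg[OF V W T])
  have mono: "antimono ?s" by (rule singular_number_antimono[OF V W T])
  \<comment> \<open>The ranks start at 0, so that \<open>R 0\<close> vanishes on \<open>V\<close>
    and the telescoping sum has no initial term.\<close>
  define r where "r k = (2::nat) ^ k - 1" for k
  \<comment> \<open>Slack for infima that are not attained; the ratio 1/4 keeps
    \<open>2^k * q k\<close> summable, with sum \<open>2 * \<eta>\<close>.\<close>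
  define q where "q k = \<eta> * (1 / 4) ^ k" for k :: nat
  have q: "q k > 0" "q (Suc k) \<le> q k" for k using \<eta> by (auto simp: q_def)
  have "\<exists>R. R \<in> bounded_ops V W \<and> rank_le V R (r k) \<and> op_norm V (\<lambda>x. T x - R x) < ?s (r k) + q k" for k
    using singular_number_approx[OF V W T q(1)] by metis
  then obtain R where R: "\<And>k. R k \<in> bounded_ops V W" "\<And>k. rank_le V (R k) (r k)"
    "\<And>k. op_norm V (\<lambda>x. T x - R k x) < ?s (r k) + q k" by metis
  have TR: "norm (T x - R k x) \<le> (?s (r k) + q k) * norm x" if "x \<in> V" for x k
    using norm_le_op_norm[OF bounded_ops_diff_op[OF T R(1) W] V that, of k] R(3)[of k]
    by (meson less_imp_le mult_right_mono norm_ge_zero order_trans)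
  define D where "D k x = R (Suc k) x - R k x" for k x
  define d where "d k = 2 * (?s (r k) + q k)" for k
  have d0: "0 \<le> d k" for k using s0 q(1)[of k] by (simp add: d_def add_nonneg_nonneg less_imp_le)
  have Dk: "D k \<in> bounded_ops V W" for k
    unfolding D_def by (rule bounded_ops_diff_op[OF R(1) R(1) W])
  \<comment> \<open>The ranks of two consecutive approximants add up to
    \<open>3 * 2^k - 2\<close>.\<close>
  define m where "m k = 3 * (2::nat) ^ k" for k
  have rankD: "rank_le V (D k) (m k)" for k
  proof -
    have "rank_le V (\<lambda>x. R (Suc k) x + (-1) *\<^sub>R R k x) (r (Suc k) + r k)"
      by (rule rank_le_add_scaleR[OF R(2) R(2)])
    moreover have "r (Suc k) + r k \<le> m k" by (simp add: r_def m_def)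
    ultimately show ?thesis using rank_le_mono unfolding D_def by auto
  qed
  have normD: "norm (D k x) \<le> d k * norm x" if x: "x \<in> V" for k x
  proof -
    have "norm (D k x) \<le> norm (T x - R k x) + norm (T x - R (Suc k) x)"
      unfolding D_def using norm_triangle_ineq4[of "T x - R k x" "T x - R (Suc k) x"] by simp
    also have "\<dots> \<le> (?s (r k) + q k) * norm x + (?s (r (Suc k)) + q (Suc k)) * norm x"
      using TR[OF x] by (intro add_mono) auto
    also have "\<dots> \<le> (?s (r k) + q k) * norm x + (?s (r k) + q k) * norm x"
    proof (intro add_left_mono mult_right_mono add_mono q(2))
      show "?s (r (Suc k)) \<le> ?s (r k)"
        using mono by (rule antimonoD) (auto simp: r_def intro!: diff_le_mono)
    qed simp
    finally show ?thesis by (simp add: d_def algebra_simps)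
  qed
  \<comment> \<open>Bundled into one predicate so that the representations can be chosen for all
    \<open>k\<close> at once.\<close>
  define \<Phi> where "\<Phi> k g v \<longleftrightarrow> (\<forall>i<m k. g i \<in> bounded_ops V UNIV) \<and> (\<forall>i<m k. \<forall>x\<in>V. cmod (g i x) \<le> d k * norm x)
      \<and> (\<forall>i<m k. v i \<in> W) \<and> (\<forall>i<m k. norm (v i) \<le> 1)
      \<and> (\<forall>h\<in>bounded_ops W UNIV. \<forall>x\<in>V. (\<Sum>i<m k. g i x * h (v i)) = h (D k x))"
    for k g and v :: "nat \<Rightarrow> 'b"
  have "\<exists>g v. \<Phi> k g v" for k
  proof (rule finite_rank_rep[OF Dk V W rankD normD])
    fix g and v :: "nat \<Rightarrow> 'b"
    assume "\<And>i. i < m k \<Longrightarrow> g i \<in> bounded_ops V UNIV"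
      "\<And>i x. i < m k \<Longrightarrow> x \<in> V \<Longrightarrow> cmod (g i x) \<le> d k * norm x"
      "\<And>i. i < m k \<Longrightarrow> v i \<in> W" "\<And>i. i < m k \<Longrightarrow> norm (v i) \<le> 1"
      "\<And>h x. h \<in> bounded_ops W UNIV \<Longrightarrow> x \<in> V \<Longrightarrow> (\<Sum>i<m k. g i x * h (v i)) = h (D k x)"
    then show ?thesis by (intro exI[of _ g] exI[of _ v]) (simp add: \<Phi>_def)
  qed
  then obtain g v where \<Phi>: "\<And>k. \<Phi> k (g k) (v k)" by metis
  have gv: "i < m k \<Longrightarrow> g k i \<in> bounded_ops V UNIV"
    "i < m k \<Longrightarrow> x \<in> V \<Longrightarrow> cmod (g k i x) \<le> d k * norm x"
    "i < m k \<Longrightarrow> v k i \<in> W" "i < m k \<Longrightarrow> norm (v k i) \<le> 1"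
    "h \<in> bounded_ops W UNIV \<Longrightarrow> x \<in> V \<Longrightarrow> (\<Sum>i<m k. g k i x * h (v k i)) = h (D k x)"
    for i k x h
    using \<Phi>[of k] by (simp_all add: \<Phi>_def)
  \<comment> \<open>The finite representations are put on one index type of pairs
    \<open>(k, i)\<close>, with zero entries for \<open>i\<close> beyond the rank bound
    \<open>m k\<close>.\<close>
  define G where "G j = (if snd j < m (fst j) then g (fst j) (snd j) else (\<lambda>_. 0))" for j
  define U where "U j = (if snd j < m (fst j) then v (fst j) (snd j) else 0)" for j
  define c where "c j = (if snd j < m (fst j) then d (fst j) else 0)" for j
  have G: "G j \<in> bounded_ops V UNIV" "x \<in> V \<Longrightarrow> cmod (G j x) \<le> c j * norm x" for j x
    using gv(1,2) bounded_ops_zero_op[OF complex_vector.subspace_UNIV] by (auto simp: G_def c_def)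
  have U: "U j \<in> W" "norm (U j) \<le> 1" for j
    using gv(3,4) complex_vector.subspace_0[OF W] by (auto simp: U_def)
  have c0: "0 \<le> c j" for j using d0 by (simp add: c_def)
  have sum_q: "(\<lambda>k. 2 ^ k * q k) sums (2 * \<eta>)"
  proof -
    have "(\<lambda>k. \<eta> * (1 / 2) ^ k) sums (\<eta> * (1 / (1 - 1 / 2)))"
      by (intro sums_mult geometric_sums) simp
    moreover have "2 ^ k * q k = \<eta> * (1 / 2) ^ k" for k
    proof -
      have "(2::real) ^ k * (1 / 4) ^ k = (1 / 2) ^ k" by (simp flip: power_mult_distrib)
      then show ?thesis by (simp add: q_def mult.left_commute)
    qed
    ultimately show ?thesis by (simp add: mult.commute)
  qed
  \<comment> \<open>The first singular number and the partial sum are each at most the whole sum,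
    which makes the factor 3.\<close>
  have dyad: "(\<Sum>k<K. 2 ^ k * ?s (r k)) \<le> 3 * (\<Sum>n. ?s n)" for K
  proof -
    have "(\<Sum>k<K. 2 ^ k * ?s (r k)) \<le> (\<Sum>k\<le>K. 2 ^ k * ?s (2 ^ k - 1))"
      unfolding r_def using s0 by (intro sum_mono2) auto
    also have "\<dots> \<le> ?s 0 + 2 * (\<Sum>n<2 ^ K - 1. ?s n)" by (rule antimono_dyadic_sum_le[OF mono])
    also have "\<dots> \<le> (\<Sum>n. ?s n) + 2 * (\<Sum>n. ?s n)"
      using sum_le_suminf[OF s, of "{0}"] sum_le_suminf[OF s, of "{..<2 ^ K - 1}"] s0
      by (intro add_mono mult_left_mono) auto
    finally show ?thesis by simp
  qed
  have sum_s: "summable (\<lambda>k. 2 ^ k * ?s (r k))"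
    using s0 dyad by (intro summableI_nonneg_bounded[where x = "3 * (\<Sum>n. ?s n)"]) auto
  have suminf_s: "(\<Sum>k. 2 ^ k * ?s (r k)) \<le> 3 * (\<Sum>n. ?s n)"
    using dyad by (intro suminf_le_const[OF sum_s]) auto
  have md: "m k * d k = 6 * (2 ^ k * ?s (r k)) + 6 * (2 ^ k * q k)" for k
    by (simp add: m_def d_def algebra_simps)
  have sums_md: "(\<lambda>k. m k * d k) sums (6 * (\<Sum>k. 2 ^ k * ?s (r k)) + 6 * (2 * \<eta>))"
    unfolding md by (intro sums_add sums_mult summable_sums sum_s sum_q)
  have md_has: "((\<lambda>k. m k * d k) has_sum (6 * (\<Sum>k. 2 ^ k * ?s (r k)) + 6 * (2 * \<eta>))) UNIV"
    using sums_md d0 by (intro norm_summable_imp_has_sum) (auto simp: sums_iff)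
  have c_in: "((\<lambda>i. c (k, i)) has_sum (m k * d k)) UNIV" for k
    by (rule has_sum_finite_neutralI[of "{..<m k}"]) (auto simp: c_def)
  have c_sum: "c summable_on (UNIV \<times> UNIV)"
    using c_in has_sum_imp_summable[OF md_has] by (rule summable_on_SigmaI) (rule c0)
  have c_has: "(c has_sum (6 * (\<Sum>k. 2 ^ k * ?s (r k)) + 6 * (2 * \<eta>))) (UNIV \<times> UNIV)"
    using c_in md_has c_sum by (rule has_sum_SigmaI)
  have "(\<Sum>\<^sub>\<infinity>j. c j) = 6 * (\<Sum>k. 2 ^ k * ?s (r k)) + 6 * (2 * \<eta>)"
    using infsumI[OF c_has] by simp
  then have c_le: "(\<Sum>\<^sub>\<infinity>j. c j) \<le> 18 * ((\<Sum>n. ?s n) + \<eta>)"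
    using suminf_s \<eta> by simp
  have rep: "((\<lambda>j. G j x * h (U j)) has_sum h (T x)) UNIV"
    if h: "h \<in> bounded_ops W UNIV" and x: "x \<in> V" for h x
  proof -
    obtain K where K: "K \<ge> 0" "\<And>y. y \<in> W \<Longrightarrow> norm (h y) \<le> K * norm y"
      using bounded_ops_nonneg_bound[OF h] by blast
    have mem: "R k x \<in> W" "T x \<in> W" for k using x bounded_ops_mem R(1) T by blast+
    have R0: "R 0 x = 0"
      using R(2)[of 0] x unfolding rank_le_def r_def by auto
    have inner: "((\<lambda>i. G (k, i) x * h (U (k, i))) has_sum h (D k x)) UNIV" for k
      by (rule has_sum_finite_neutralI[of "{..<m k}"])
        (auto simp: G_def U_def gv(5)[OF h x, symmetric])
    have term_le: "cmod (G j x * h (U j)) \<le> c j * (norm x * K)" for j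
    proof -
      have "cmod (h (U j)) \<le> K * 1"
        using K(2)[OF U(1), of j] mult_left_mono[OF U(2) K(1), of j] by linarith
      then have "cmod (G j x) * cmod (h (U j)) \<le> (c j * norm x) * K"
        using G(2)[OF x, of j] K(1) c0[of j] by (intro mult_mono) auto
      then show ?thesis by (simp add: norm_mult mult.assoc)
    qed
    have total: "(\<lambda>j. G j x * h (U j)) summable_on (UNIV \<times> UNIV)"
      using summable_on_norm_dominated[OF summable_on_cmult_left[OF c_sum] term_le]
      by (rule Infinite_Sum.abs_summable_summable)
    have hD_le: "cmod (h (D k x)) \<le> m k * d k * (norm x * K)" for k
      using inner has_sum_cmult_left[OF c_in] term_le by (rule norm_infsum_le)
    have "(\<lambda>K. \<Sum>k<K. h (D k x)) \<longlonglongrightarrow> h (T x)"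
    proof -
      have "(\<Sum>k<K. h (D k x)) = h (R K x)" for K
        by (induction K)
          (simp_all add: R0 bounded_ops_zero[OF h W] D_def bounded_ops_diff[OF h W mem(1) mem(1)])
      moreover have "(\<lambda>k. h (R k x)) \<longlonglongrightarrow> h (T x)"
      proof (rule LIM_zero_cancel, rule Lim_null_comparison)
        show "\<forall>\<^sub>F k in sequentially. norm (h (R k x) - h (T x)) \<le> K * ((?s (r k) + q k) * norm x)"
        proof (rule always_eventually, rule allI)
          fix k
          have "norm (h (R k x) - h (T x)) = norm (h (T x - R k x))"
            by (simp add: bounded_ops_diff[OF h W mem(2) mem(1)] norm_minus_commute)
          also have "\<dots> \<le> K * norm (T x - R k x)"
            by (rule K(2)[OF complex_vector.subspace_diff[OF W mem(2) mem(1)]])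
          also have "\<dots> \<le> K * ((?s (r k) + q k) * norm x)"
            by (rule mult_left_mono[OF TR[OF x] K(1)])
          finally show "norm (h (R k x) - h (T x)) \<le> K * ((?s (r k) + q k) * norm x)" .
        qed
        have "filterlim r at_top sequentially"
        proof (rule filterlim_at_top_mono[OF filterlim_ident])
          show "\<forall>\<^sub>F k in sequentially. k \<le> r k"
          proof (rule always_eventually, rule allI)
            show "k \<le> r k" for k using less_exp[of k] unfolding r_def by linarith
          qed
        qed
        then have "(\<lambda>k. ?s (r k)) \<longlonglongrightarrow> 0"
          by (rule filterlim_compose[OF summable_LIMSEQ_zero[OF s]])
        moreover have "q \<longlonglongrightarrow> 0"
          unfolding q_def by (rule tendsto_mult_right_zero, rule LIMSEQ_power_zero) simp
        ultimately have "(\<lambda>k. K * ((?s (r k) + q k) * norm x)) \<longlonglongrightarrow> K * ((0 + 0) * norm x)"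
          by (intro tendsto_intros)
        then show "(\<lambda>k. K * ((?s (r k) + q k) * norm x)) \<longlonglongrightarrow> 0" by simp
      qed
      ultimately show ?thesis by simp
    qed
    then have sums: "(\<lambda>k. h (D k x)) sums h (T x)" by (simp add: sums_def)
    have "summable (\<lambda>k. m k * d k * (norm x * K))"
      using sums_md by (intro summable_mult2) (simp add: sums_iff)
    then have "summable (\<lambda>k. norm (h (D k x)))"
      by (rule summable_comparison_test'[where N = 0]) (simp add: hD_le)
    then have "((\<lambda>k. h (D k x)) has_sum h (T x)) UNIV"
      using sums by (rule norm_summable_imp_has_sum)
    with inner have "((\<lambda>j. G j x * h (U j)) has_sum h (T x)) (UNIV \<times> UNIV)"
      using total by (rule has_sum_SigmaI)
    then show ?thesis by simp
  qed
  have "nuclear_rep V W T G U c"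
    unfolding nuclear_rep_def using G U c0 c_sum rep by auto
  then show ?thesis using that c_le by blast
qed

section \<open>Trace class operators\<close>

text \<open>The Schatten class with \<open>q = 1\<close>, written without the power, which acts
  trivially on nonnegative numbers.\<close>

definition trace_class :: "'a::complex_inner set \<Rightarrow> 'b::complex_inner set \<Rightarrow> ('a \<Rightarrow> 'b) set" where
  "trace_class V W = {T \<in> bounded_ops V W. summable (singular_number V W T)}"

definition traceable :: "'a::complex_inner set \<Rightarrow> ('a \<Rightarrow> 'a) \<Rightarrow> bool" where
  "traceable V T \<longleftrightarrow> (\<exists>s. has_trace V T s)"

lemma traceable_has_trace:
  assumes "traceable V T" "dense_countable V"
  shows "has_trace V T (op_trace V T)"
  using assms has_trace_op_trace[OF _ assms(2)] unfolding traceable_def by blast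

lemma has_trace_unique:
  assumes "has_trace V T s" "has_trace V T t" "dense_countable V"
  shows "s = t"
  using has_trace_op_trace[OF assms(1,3)] has_trace_op_trace[OF assms(2,3)] by simp

lemma op_trace_add:
  assumes "dense_countable V" "traceable V S" "traceable V T"
  shows "op_trace V (\<lambda>x. S x + T x) = op_trace V S + op_trace V T"
  using has_trace_add[OF traceable_has_trace[OF assms(2,1)] traceable_has_trace[OF assms(3,1)]]
  by (rule has_trace_op_trace[OF _ assms(1)])

lemma op_trace_scaleC:
  assumes "dense_countable V" "traceable V T"
  shows "op_trace V (\<lambda>x. a *\<^sub>C T x) = a * op_trace V T"
  using has_trace_scaleC[OF traceable_has_trace[OF assms(2,1)]]
  by (rule has_trace_op_trace[OF _ assms(1)])

lemma traceable_add: "traceable V S \<Longrightarrow> traceable V T \<Longrightarrow> traceable V (\<lambda>x. S x + T x)"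
  unfolding traceable_def using has_trace_add by blast

lemma traceable_scaleC: "traceable V T \<Longrightarrow> traceable V (\<lambda>x. a *\<^sub>C T x)"
  unfolding traceable_def using has_trace_scaleC by blast

lemma op_trace_diff:
  assumes "dense_countable V" "traceable V S" "traceable V T"
  shows "op_trace V (\<lambda>x. S x - T x) = op_trace V S - op_trace V T"
proof -
  have "(\<lambda>x. S x - T x) = (\<lambda>x. S x + (- 1) *\<^sub>C T x)" by simp
  then show ?thesis
    using op_trace_add[OF assms(1,2) traceable_scaleC[OF assms(3), of "- 1"]]
      op_trace_scaleC[OF assms(1,3), of "- 1"] by simp
qed

text \<open>One nuclear representation gives both traces by the same series, hence a common
  \<open>s\<close>. The representation depends on \<open>\<eta>\<close> but the trace does not, so
  the bound survives letting \<open>\<eta>\<close> tend to 0.\<close>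

lemma trace_class_cyclic:
  assumes T: "T \<in> trace_class V W" and V: "dense_countable V" and W: "dense_countable W"
    and A: "A \<in> bounded_ops W V" "0 \<le> K" "\<And>x. x \<in> W \<Longrightarrow> norm (A x) \<le> K * norm x"
  obtains s where "has_trace V (\<lambda>x. A (T x)) s" "has_trace W (\<lambda>x. T (A x)) s"
    "cmod s \<le> 18 * K * (\<Sum>n. singular_number V W T n)"
proof -
  note V' = dense_countable_subspace[OF V] and W' = dense_countable_subspace[OF W]
  have T': "T \<in> bounded_ops V W" "summable (singular_number V W T)"
    using T by (auto simp: trace_class_def)
  let ?S = "\<Sum>n. singular_number V W T n"
  have *: "\<exists>s. has_trace V (\<lambda>x. A (T x)) s \<and> has_trace W (\<lambda>x. T (A x)) s \<and> cmod s \<le> K * (18 * (?S + \<eta>))"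
    if \<eta>: "\<eta> > 0" for \<eta>
  proof -
    obtain g :: "nat \<times> nat \<Rightarrow> _" and v c where n: "nuclear_rep V W T g v c"
      and c: "(\<Sum>\<^sub>\<infinity>j. c j) \<le> 18 * (?S + \<eta>)"
      using nuclear_rep_exists[OF T'(1) V' W' T'(2) \<eta>] by blast
    have "cmod (\<Sum>\<^sub>\<infinity>j. g j (A (v j))) \<le> K * (\<Sum>\<^sub>\<infinity>j. c j)"
      by (rule nuclear_pairing_le[OF n bounded_ops_mem[OF A(1)] A(3) A(2)])
    also have "\<dots> \<le> K * (18 * (?S + \<eta>))" using c A(2) by (rule mult_left_mono)
    finally show ?thesis
      using nuclear_trace_left[OF n V' A(1)] nuclear_trace_right[OF n W' A(1)] by blast
  qed
  obtain s where s: "has_trace V (\<lambda>x. A (T x)) s" "has_trace W (\<lambda>x. T (A x)) s"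
    using *[of 1] by auto
  have "cmod s \<le> K * (18 * (?S + \<eta>))" if "\<eta> > 0" for \<eta>
    using *[OF that] has_trace_unique[OF s(1) _ V] by blast
  moreover have "((\<lambda>\<eta>. K * (18 * (?S + \<eta>))) \<longlongrightarrow> K * (18 * (?S + 0))) (at_right 0)"
    by (intro tendsto_intros)
  ultimately have "cmod s \<le> K * (18 * (?S + 0))"
    by (intro tendsto_lowerbound) (auto simp: eventually_at_right_field intro!: exI[of _ 1])
  then show ?thesis using that s by (simp add: mult_ac)
qed

lemma trace_class_traceable:
  assumes "T \<in> trace_class V W" "dense_countable V" "dense_countable W" "A \<in> bounded_ops W V"
  shows "traceable V (\<lambda>x. A (T x))" "traceable W (\<lambda>x. T (A x))"
proof -
  obtain K where "0 \<le> K" "\<And>x. x \<in> W \<Longrightarrow> norm (A x) \<le> K * norm x"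
    using bounded_ops_nonneg_bound[OF assms(4)] by blast
  then obtain s where "has_trace V (\<lambda>x. A (T x)) s" "has_trace W (\<lambda>x. T (A x)) s"
    using trace_class_cyclic[OF assms] by blast
  then show "traceable V (\<lambda>x. A (T x))" "traceable W (\<lambda>x. T (A x))"
    by (auto simp: traceable_def)
qed

lemma op_trace_cyclic:
  assumes "T \<in> trace_class V W" "dense_countable V" "dense_countable W" "A \<in> bounded_ops W V"
  shows "op_trace V (\<lambda>x. A (T x)) = op_trace W (\<lambda>x. T (A x))"
proof -
  obtain K where "0 \<le> K" "\<And>x. x \<in> W \<Longrightarrow> norm (A x) \<le> K * norm x"
    using bounded_ops_nonneg_bound[OF assms(4)] by blast
  then obtain s where "has_trace V (\<lambda>x. A (T x)) s" "has_trace W (\<lambda>x. T (A x)) s"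
    using trace_class_cyclic[OF assms] by blast
  then show ?thesis using has_trace_op_trace assms(2,3) by metis
qed

lemma op_trace_le:
  assumes "T \<in> trace_class V W" "dense_countable V" "dense_countable W" "A \<in> bounded_ops W V"
    and "0 \<le> K" "\<And>x. x \<in> W \<Longrightarrow> norm (A x) \<le> K * norm x"
  shows "cmod (op_trace V (\<lambda>x. A (T x))) \<le> 18 * K * (\<Sum>n. singular_number V W T n)"
proof -
  obtain s where "has_trace V (\<lambda>x. A (T x)) s"
    "cmod s \<le> 18 * K * (\<Sum>n. singular_number V W T n)"
    using trace_class_cyclic[OF assms] by blast
  then show ?thesis using has_trace_op_trace[OF _ assms(2)] by metis
qed

text \<open>A nuclear representation of the fixed \<open>T\<close> turns all these traces into
  series over the same index set, to which dominated convergence applies.\<close>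

lemma op_trace_strong_tendsto:
  assumes T: "T \<in> trace_class V W" and V: "dense_countable V" and W: "dense_countable W"
    and K: "0 \<le> K"
    and A: "\<forall>\<^sub>F s in Fl. A s \<in> bounded_ops W V \<and> (\<forall>x\<in>W. norm (A s x) \<le> K * norm x)"
    and A0: "A0 \<in> bounded_ops W V" "\<And>x. x \<in> W \<Longrightarrow> norm (A0 x) \<le> K * norm x"
    and lim: "\<And>x. x \<in> W \<Longrightarrow> ((\<lambda>s. A s x) \<longlongrightarrow> A0 x) Fl"
  shows "((\<lambda>s. op_trace V (\<lambda>x. A s (T x))) \<longlongrightarrow> op_trace V (\<lambda>x. A0 (T x))) Fl"
proof -
  note V' = dense_countable_subspace[OF V] and W' = dense_countable_subspace[OF W]
  have T': "T \<in> bounded_ops V W" "summable (singular_number V W T)"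
    using T by (auto simp: trace_class_def)
  obtain g :: "nat \<times> nat \<Rightarrow> _" and v c where n: "nuclear_rep V W T g v c"
    using nuclear_rep_exists[OF T'(1) V' W' T'(2) zero_less_one] by blast
  have tr: "op_trace V (\<lambda>x. B (T x)) = (\<Sum>\<^sub>\<infinity>j. g j (B (v j)))" if "B \<in> bounded_ops W V" for B
    using nuclear_trace_left[OF n V' that] by (rule has_trace_op_trace[OF _ V])
  have "((\<lambda>s. \<Sum>\<^sub>\<infinity>j. g j (A s (v j))) \<longlongrightarrow> (\<Sum>\<^sub>\<infinity>j. g j (A0 (v j)))) Fl"
    by (rule nuclear_pairing_tendsto[OF n V' K A A0 lim])
  then have "((\<lambda>s. \<Sum>\<^sub>\<infinity>j. g j (A s (v j))) \<longlongrightarrow> op_trace V (\<lambda>x. A0 (T x))) Fl"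
    by (simp add: tr[OF A0(1)])
  then show ?thesis
    by (rule Lim_transform_eventually) (use A tr in \<open>auto elim: eventually_mono\<close>)
qed

section \<open>Schatten classes\<close>

text \<open>The inequalities for sums and products control only every \<open>m\<close>-th singular
  number; monotonicity bounds each block of length \<open>m\<close> by its first entry.\<close>

lemma antimono_block_sum:
  fixes u :: "nat \<Rightarrow> real"
  assumes u: "antimono u" "\<And>n. 0 \<le> u n" and m: "0 < m" and s: "summable (\<lambda>k. u (m * k))"
  shows "summable u" "suminf u \<le> m * (\<Sum>k. u (m * k))"
proof -
  have le: "(\<Sum>n<N. u n) \<le> m * (\<Sum>k. u (m * k))" for N
  proof -
    have "N \<le> N * m" using m by simp
    then have "(\<Sum>n<N. u n) \<le> (\<Sum>n<N * m. u n)" using u(2) by (intro sum_mono2) auto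
    also have "\<dots> = (\<Sum>k<N. \<Sum>n\<in>{k * m..<k * m + m}. u n)" by (simp only: sum.nat_group)
    also have "\<dots> \<le> (\<Sum>k<N. \<Sum>n\<in>{k * m..<k * m + m}. u (m * k))"
      by (intro sum_mono antimonoD[OF u(1)]) (simp add: mult.commute)
    also have "\<dots> = m * (\<Sum>k<N. u (m * k))" by (simp add: sum_distrib_left)
    also have "\<dots> \<le> m * (\<Sum>k. u (m * k))" by (intro mult_left_mono sum_le_suminf s) (auto simp: u)
    finally show ?thesis .
  qed
  show "summable u" using u(2) le by (rule summableI_nonneg_bounded)
  then show "suminf u \<le> m * (\<Sum>k. u (m * k))" using le by (rule suminf_le_const)
qed

lemma schatten_bounded: "T \<in> schatten q V W \<Longrightarrow> T \<in> bounded_ops V W"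
  by (simp add: schatten_def)

context
  fixes q :: real
  assumes q: "0 < q"
begin

text \<open>At index \<open>2 * k\<close> the singular number of the sum is at most twice the larger
  of the two at index \<open>k\<close>; this accounts for \<open>2 powr q\<close>. The other factor
  2 comes from passing from even indices to all.\<close>

lemma schatten_add_scaleR:
  assumes V: "complex_vector.subspace V" and W: "complex_vector.subspace W"
    and S: "S \<in> schatten q V W" and T: "T \<in> schatten q V W" and r: "\<bar>r\<bar> \<le> 1"
  shows "(\<lambda>x. S x + r *\<^sub>R T x) \<in> schatten q V W"
    "(\<Sum>n. singular_number V W (\<lambda>x. S x + r *\<^sub>R T x) n powr q)
      \<le> 2 * 2 powr q * ((\<Sum>n. singular_number V W S n powr q) + (\<Sum>n. singular_number V W T n powr q))"
proof -
  let ?s = "singular_number V W S" and ?t = "singular_number V W T"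
    and ?u = "singular_number V W (\<lambda>x. S x + r *\<^sub>R T x)"
  note Sb = schatten_bounded[OF S] and Tb = schatten_bounded[OF T]
  note STb = bounded_ops_add_scaleR[OF Sb Tb W, of r]
  have sums: "summable (\<lambda>n. ?s n powr q)" "summable (\<lambda>n. ?t n powr q)"
    using S T by (auto simp: schatten_def)
  have s0: "0 \<le> ?s n" "0 \<le> ?t n" "0 \<le> ?u n" for n
    using singular_number_nonneg[OF V W Sb] singular_number_nonneg[OF V W Tb]
      singular_number_nonneg[OF V W STb] by auto
  have le: "?u (2 * k) powr q \<le> 2 powr q * (?s k powr q + ?t k powr q)" for k
  proof -
    have "?u (2 * k) \<le> ?s k + \<bar>r\<bar> * ?t k"
      using singular_number_add_scaleR[OF V W Sb Tb, of r k k] by (simp add: mult_2)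
    also have "\<bar>r\<bar> * ?t k \<le> ?t k" using r s0(2) by (simp add: mult_left_le_one_le)
    finally have "?u (2 * k) \<le> 2 * max (?s k) (?t k)" by simp
    then have "?u (2 * k) powr q \<le> (2 * max (?s k) (?t k)) powr q"
      using q s0 by (intro powr_mono2) auto
    also have "\<dots> = 2 powr q * max (?s k) (?t k) powr q"
      using s0 by (simp add: powr_mult max_def)
    also have "\<dots> \<le> 2 powr q * (?s k powr q + ?t k powr q)"
      by (intro mult_left_mono) (auto simp: max_def)
    finally show ?thesis .
  qed
  have sum_le: "summable (\<lambda>k. 2 powr q * (?s k powr q + ?t k powr q))"
    by (intro summable_mult summable_add sums)
  have sum2: "summable (\<lambda>k. ?u (2 * k) powr q)"
    using sum_le by (rule summable_comparison_test'[where N = 0]) (simp add: le)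
  have anti: "antimono (\<lambda>n. ?u n powr q)"
    using q s0 antimonoD[OF singular_number_antimono[OF V W STb]]
    by (intro antimonoI powr_mono2) auto
  note block = antimono_block_sum[OF anti, of 2]
  have "summable (\<lambda>n. ?u n powr q)" using block(1) sum2 by simp
  then show "(\<lambda>x. S x + r *\<^sub>R T x) \<in> schatten q V W"
    using STb by (simp add: schatten_def)
  have "(\<Sum>n. ?u n powr q) \<le> 2 * (\<Sum>k. ?u (2 * k) powr q)" using block(2) sum2 by simp
  also have "\<dots> \<le> 2 * (\<Sum>k. 2 powr q * (?s k powr q + ?t k powr q))"
    using suminf_le[OF le sum2 sum_le] by simp
  also have "\<dots> = 2 * 2 powr q * ((\<Sum>n. ?s n powr q) + (\<Sum>n. ?t n powr q))"
    using sums by (simp add: suminf_mult suminf_add summable_add)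
  finally show "(\<Sum>n. ?u n powr q) \<le> 2 * 2 powr q * ((\<Sum>n. ?s n powr q) + (\<Sum>n. ?t n powr q))" .
qed

lemma schatten_diff:
  assumes "complex_vector.subspace V" "complex_vector.subspace W"
    "S \<in> schatten q V W" "T \<in> schatten q V W"
  shows "(\<lambda>x. S x - T x) \<in> schatten q V W"
  using schatten_add_scaleR(1)[OF assms, of "- 1"] by simp

lemma schatten_norm_powr:
  assumes "T \<in> schatten q V W" "complex_vector.subspace V" "complex_vector.subspace W"
  shows "schatten_norm q V W T powr q = (\<Sum>n. singular_number V W T n powr q)"
proof -
  have "0 \<le> (\<Sum>n. singular_number V W T n powr q)"
    using assms(1) by (intro suminf_nonneg) (auto simp: schatten_def)
  then show ?thesis unfolding schatten_norm_def using q by (simp add: powr_powr)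
qed

lemma schatten_norm_nonneg: "0 \<le> schatten_norm q V W T"
  unfolding schatten_norm_def by simp

lemma singular_number_le_schatten_norm:
  assumes T: "T \<in> schatten q V W" and V: "complex_vector.subspace V" and W: "complex_vector.subspace W"
  shows "singular_number V W T n \<le> schatten_norm q V W T"
proof -
  let ?s = "singular_number V W T"
  have s0: "0 \<le> ?s k" for k using singular_number_nonneg[OF V W schatten_bounded[OF T]] .
  have "?s n powr q \<le> (\<Sum>n. ?s n powr q)"
    using T sum_le_suminf[of "\<lambda>n. ?s n powr q" "{n}"] by (auto simp: schatten_def)
  then have "?s n powr q \<le> schatten_norm q V W T powr q"
    by (simp add: schatten_norm_powr[OF T V W])
  then show ?thesis
    using powr_less_mono2[OF q schatten_norm_nonneg, of V W T "?s n"] by linarith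
qed

text \<open>Only local boundedness of the norm is needed, not the triangle inequality.\<close>

lemma schatten_norm_le_of_diff:
  assumes V: "complex_vector.subspace V" and W: "complex_vector.subspace W"
    and S: "S \<in> schatten q V W" and T: "T \<in> schatten q V W"
    and d: "schatten_norm q V W (\<lambda>x. S x - T x) \<le> 1"
  shows "schatten_norm q V W S \<le> (2 * 2 powr q * (1 + schatten_norm q V W T powr q)) powr (1 / q)"
proof -
  note D = schatten_diff[OF V W S T]
  have "(\<Sum>n. singular_number V W S n powr q)
      \<le> 2 * 2 powr q * (schatten_norm q V W (\<lambda>x. S x - T x) powr q + schatten_norm q V W T powr q)"
    using schatten_add_scaleR(2)[OF V W D T, of 1]
    by (simp add: schatten_norm_powr[OF D V W] schatten_norm_powr[OF T V W])
  also have "\<dots> \<le> 2 * 2 powr q * (1 + schatten_norm q V W T powr q)"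
    using d q by (intro mult_left_mono add_right_mono powr_le1) (auto simp: schatten_norm_nonneg)
  finally show ?thesis
    unfolding schatten_norm_def[of q V W S] using q S
    by (intro powr_mono2 suminf_nonneg) (auto simp: schatten_def)
qed

end

section \<open>Words of operators\<close>

text \<open>The composite of \<open>T 0\<close>, \<open>T 1\<close>, ..., \<open>T (m - 1)\<close>,
  the last of which is applied first. The recursion splits off that innermost letter, so the target
  space stays fixed while the source moves along the chain.\<close>

primrec word :: "(nat \<Rightarrow> 'a \<Rightarrow> 'a) \<Rightarrow> nat \<Rightarrow> 'a \<Rightarrow> 'a" where
  "word T 0 x = x"
| "word T (Suc m) x = word T m (T m x)"

lemma word_cong: "(\<And>i. i < m \<Longrightarrow> S i = T i) \<Longrightarrow> word S m = word T m"
  by (induction m) (auto simp: fun_eq_iff)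

text \<open>The product is at most the \<open>m\<close>-th power of its largest factor, and for a
  number in \<open>[0, 1]\<close> this is at most the \<open>q\<close>-th power. It takes the place
  of Hoelder's inequality after normalisation.\<close>

lemma prod_le_sum_powr:
  fixes x :: "nat \<Rightarrow> real"
  assumes m: "0 < m" "q \<le> real m" and x: "\<And>i. i < m \<Longrightarrow> 0 \<le> x i" "\<And>i. i < m \<Longrightarrow> x i \<le> 1"
  shows "(\<Prod>i<m. x i) \<le> (\<Sum>i<m. x i powr q)"
proof -
  have "Max (x ` {..<m}) \<in> x ` {..<m}" using m by (intro Max_in) auto
  then obtain j where j: "j < m" "x j = Max (x ` {..<m})" by auto
  have le: "x i \<le> x j" if "i < m" for i using that j by simp
  have "(\<Prod>i<m. x i) \<le> (\<Prod>i<m. x j)" using x(1) le by (intro prod_mono) auto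
  also have "\<dots> = x j ^ m" by simp
  also have "\<dots> = x j powr m"
    using x(1)[OF j(1)] m(1) by (cases "x j = 0") (auto simp: powr_realpow)
  also have "\<dots> \<le> x j powr q" using x[OF j(1)] m(2) by (intro powr_mono') auto
  also have "\<dots> \<le> (\<Sum>i<m. x i powr q)" using j(1) by (intro member_le_sum) auto
  finally show ?thesis .
qed

context
  fixes Vs :: "nat \<Rightarrow> 'h::complex_inner set" and q :: real
  assumes Vs: "\<And>i. dense_countable (Vs i)" and q: "0 < q"
begin

lemma Vs_subspace: "complex_vector.subspace (Vs i)"
  using dense_countable_subspace[OF Vs] .

lemma word_bounded:
  assumes "\<And>i. i < m \<Longrightarrow> T i \<in> bounded_ops (Vs (Suc i)) (Vs i)"
  shows "word T m \<in> bounded_ops (Vs m) (Vs 0)"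
  using assms
proof (induction m)
  case 0
  have "word T 0 = (\<lambda>x. x)" by (simp add: fun_eq_iff)
  then show ?case using bounded_ops_id by metis
next
  case (Suc m)
  have "word T (Suc m) = (\<lambda>x. word T m (T m x))" by (simp add: fun_eq_iff)
  then show ?case
    using bounded_ops_comp[OF Suc.IH Suc.prems[of m]] Suc.prems by simp
qed

text \<open>Submultiplicativity with the same index \<open>k\<close> for every letter; the indices
  add up to \<open>m * k\<close>.\<close>

lemma singular_number_word_le:
  assumes "\<And>i. i < m \<Longrightarrow> T i \<in> bounded_ops (Vs (Suc i)) (Vs i)"
  shows "singular_number (Vs m) (Vs 0) (word T m) (m * k)
    \<le> (\<Prod>i<m. singular_number (Vs (Suc i)) (Vs i) (T i) k)"
  using assms
proof (induction m)
  case 0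
  have "op_norm (Vs 0) (word T 0) \<le> 1"
    by (rule op_norm_le[OF Vs_subspace]) auto
  with singular_number_le_op_norm[OF Vs_subspace Vs_subspace word_bounded[of 0 T]]
  have "singular_number (Vs 0) (Vs 0) (word T 0) 0 \<le> 1" by (rule order_trans) simp
  then show ?case by (simp del: word.simps)
next
  case (Suc m)
  have b: "word T m \<in> bounded_ops (Vs m) (Vs 0)" using Suc.prems by (intro word_bounded) simp
  have Tm: "T m \<in> bounded_ops (Vs (Suc m)) (Vs m)" using Suc.prems by simp
  have "word T (Suc m) = (\<lambda>x. word T m (T m x))" by (simp add: fun_eq_iff)
  then have "singular_number (Vs (Suc m)) (Vs 0) (word T (Suc m)) (m * k + k)
      \<le> singular_number (Vs m) (Vs 0) (word T m) (m * k) * singular_number (Vs (Suc m)) (Vs m) (T m) k"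
    using singular_number_comp[OF Vs_subspace Vs_subspace Vs_subspace b Tm] by simp
  also have "\<dots> \<le> (\<Prod>i<m. singular_number (Vs (Suc i)) (Vs i) (T i) k)
      * singular_number (Vs (Suc m)) (Vs m) (T m) k"
    using Suc.IH Suc.prems singular_number_nonneg[OF Vs_subspace Vs_subspace Tm]
    by (intro mult_right_mono) auto
  finally show ?case by (simp add: add.commute del: word.simps)
qed

text \<open>A crude Hoelder inequality. Dividing each letter by its norm makes its singular numbers
  at most 1, so their product is at most the sum of their \<open>q\<close>-th powers, and each of
  these has total at most 1. One factor \<open>m\<close> counts the letters, the other comes from
  controlling only every \<open>m\<close>-th singular number.\<close>

lemma word_trace_class:
  assumes T: "\<And>i. i < m \<Longrightarrow> T i \<in> schatten q (Vs (Suc i)) (Vs i)"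
    and m: "0 < m" "q \<le> real m"
  shows "word T m \<in> trace_class (Vs m) (Vs 0)"
    "(\<Sum>n. singular_number (Vs m) (Vs 0) (word T m) n)
      \<le> real m * real m * (\<Prod>i<m. schatten_norm q (Vs (Suc i)) (Vs i) (T i))"
proof -
  define s where "s i = singular_number (Vs (Suc i)) (Vs i) (T i)" for i
  define \<sigma> where "\<sigma> i = schatten_norm q (Vs (Suc i)) (Vs i) (T i)" for i
  let ?w = "singular_number (Vs m) (Vs 0) (word T m)"
  have b: "word T m \<in> bounded_ops (Vs m) (Vs 0)"
    using T schatten_bounded by (intro word_bounded) blast
  have s0: "0 \<le> s i k" if "i < m" for i k
    unfolding s_def by (rule singular_number_nonneg[OF Vs_subspace Vs_subspace schatten_bounded[OF T[OF that]]])
  have s\<sigma>: "s i k \<le> \<sigma> i" if "i < m" for i k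
    unfolding s_def \<sigma>_def by (rule singular_number_le_schatten_norm[OF q T[OF that] Vs_subspace Vs_subspace])
  have \<sigma>0: "0 \<le> \<sigma> i" for i unfolding \<sigma>_def by (rule schatten_norm_nonneg[OF q])
  have ratio: "0 \<le> s i k / \<sigma> i" "s i k / \<sigma> i \<le> 1" if "i < m" for i k
    using s0[OF that, of k] s\<sigma>[OF that, of k] \<sigma>0[of i] by (auto simp: divide_le_eq_1)
  have le: "?w (m * k) \<le> (\<Prod>i<m. \<sigma> i) * (\<Sum>i<m. (s i k / \<sigma> i) powr q)" for k
  proof -
    have "?w (m * k) \<le> (\<Prod>i<m. s i k)"
      unfolding s_def using T schatten_bounded by (intro singular_number_word_le) blast
    also have "\<dots> \<le> (\<Prod>i<m. \<sigma> i) * (\<Prod>i<m. s i k / \<sigma> i)"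
    \<comment> \<open>If some norm vanishes, the singular numbers of that letter vanish and both
      products are 0; otherwise the norms cancel.\<close>
    proof (cases "\<exists>i<m. \<sigma> i = 0")
      case True
      then obtain i where i: "i < m" "\<sigma> i = 0" by blast
      then have "s i k = 0" using s0 s\<sigma> by (metis order_antisym)
      with i have z: "(\<Prod>i<m. s i k) = 0" "(\<Prod>i<m. \<sigma> i) = 0" by (auto intro: prod_zero)
      show ?thesis unfolding z by simp
    next
      case False
      then show ?thesis by (subst prod.distrib[symmetric]) (intro eq_refl prod.cong, auto)
    qed
    also have "\<dots> \<le> (\<Prod>i<m. \<sigma> i) * (\<Sum>i<m. (s i k / \<sigma> i) powr q)"
      using m ratio \<sigma>0 by (intro mult_left_mono prod_le_sum_powr prod_nonneg) auto
    finally show ?thesis .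
  qed
  have part: "summable (\<lambda>k. (s i k / \<sigma> i) powr q)" "(\<Sum>k. (s i k / \<sigma> i) powr q) \<le> 1" if i: "i < m" for i
  proof -
    have eq: "(s i k / \<sigma> i) powr q = s i k powr q / \<sigma> i powr q" for k
      using s0[OF i] \<sigma>0 by (simp add: powr_divide)
    have sm: "summable (\<lambda>k. s i k powr q)" using T[OF i] by (simp add: schatten_def s_def)
    then show "summable (\<lambda>k. (s i k / \<sigma> i) powr q)" unfolding eq by (rule summable_divide)
    have "(\<Sum>k. s i k powr q) = \<sigma> i powr q"
      unfolding s_def \<sigma>_def by (rule schatten_norm_powr[OF q T[OF i] Vs_subspace Vs_subspace, symmetric])
    then show "(\<Sum>k. (s i k / \<sigma> i) powr q) \<le> 1"
      unfolding eq suminf_divide[OF sm] by simp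
  qed
  have sum_rhs: "summable (\<lambda>k. (\<Prod>i<m. \<sigma> i) * (\<Sum>i<m. (s i k / \<sigma> i) powr q))"
    using part(1) by (intro summable_mult summable_sum) auto
  have w0: "0 \<le> ?w n" for n by (rule singular_number_nonneg[OF Vs_subspace Vs_subspace b])
  have sum_w: "summable (\<lambda>k. ?w (m * k))"
    using sum_rhs by (rule summable_comparison_test'[where N = 0]) (use le w0 in auto)
  note block = antimono_block_sum[OF singular_number_antimono[OF Vs_subspace Vs_subspace b] w0 m(1) sum_w]
  show "word T m \<in> trace_class (Vs m) (Vs 0)" using block(1) b by (simp add: trace_class_def)
  have "(\<Sum>k. ?w (m * k)) \<le> (\<Sum>k. (\<Prod>i<m. \<sigma> i) * (\<Sum>i<m. (s i k / \<sigma> i) powr q))"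
    by (rule suminf_le[OF le sum_w sum_rhs])
  also have "\<dots> = (\<Prod>i<m. \<sigma> i) * (\<Sum>i<m. \<Sum>k. (s i k / \<sigma> i) powr q)"
  proof -
    have "summable (\<lambda>k. \<Sum>i<m. (s i k / \<sigma> i) powr q)" using part(1) by (intro summable_sum) auto
    moreover have "(\<Sum>k. \<Sum>i<m. (s i k / \<sigma> i) powr q) = (\<Sum>i<m. \<Sum>k. (s i k / \<sigma> i) powr q)"
      using part(1) by (intro suminf_sum) auto
    ultimately show ?thesis by (simp add: suminf_mult)
  qed
  also have "\<dots> \<le> (\<Prod>i<m. \<sigma> i) * (\<Sum>i<m. 1)"
    using part(2) \<sigma>0 by (intro mult_left_mono sum_mono prod_nonneg) auto
  finally have "m * (\<Sum>k. ?w (m * k)) \<le> m * ((\<Prod>i<m. \<sigma> i) * m)"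
    by (intro mult_left_mono) auto
  then show "(\<Sum>n. ?w n) \<le> real m * real m * (\<Prod>i<m. schatten_norm q (Vs (Suc i)) (Vs i) (T i))"
    using block(2) unfolding \<sigma>_def by (simp add: mult_ac)
qed

text \<open>Linearity of a word in a single letter, by recursion down to the position of that
  letter.\<close>

lemma word_update_diff:
  assumes T: "\<And>j. j < m \<Longrightarrow> j \<noteq> i \<Longrightarrow> T j \<in> bounded_ops (Vs (Suc j)) (Vs j)"
    and S: "S \<in> bounded_ops (Vs (Suc i)) (Vs i)" and S': "S' \<in> bounded_ops (Vs (Suc i)) (Vs i)"
    and i: "i < m" and x: "x \<in> Vs m"
  shows "word (T(i := S)) m x - word (T(i := S')) m x = word (T(i := \<lambda>x. S x - S' x)) m x"
  using T i x
proof (induction m arbitrary: x)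
  case (Suc m)
  show ?case
  proof (cases "i = m")
    case True
    have eq: "word (T(i := A)) m = word T m" for A using True by (intro word_cong) auto
    have b: "word T m \<in> bounded_ops (Vs m) (Vs 0)" using Suc.prems(1) True by (intro word_bounded) auto
    have "S x \<in> Vs m" "S' x \<in> Vs m"
      using bounded_ops_mem[OF S] bounded_ops_mem[OF S'] Suc.prems(3) True by auto
    then show ?thesis
      unfolding word.simps eq using True bounded_ops_diff[OF b Vs_subspace] by simp
  next
    case False
    then have "i < m" "T m x \<in> Vs m"
      using Suc.prems(2,3) bounded_ops_mem[OF Suc.prems(1)[of m]] by auto
    then show ?thesis using Suc.IH[of "T m x"] Suc.prems(1) False by simp
  qed
qed simp

lemma op_trace_word_telescope:
  assumes S: "\<And>i. i < m \<Longrightarrow> S i \<in> schatten q (Vs (Suc i)) (Vs i)"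
    and T: "\<And>i. i < m \<Longrightarrow> T i \<in> schatten q (Vs (Suc i)) (Vs i)"
    and m: "0 < m" "q \<le> real m" and A: "A \<in> bounded_ops (Vs 0) (Vs m)"
  shows "op_trace (Vs m) (\<lambda>x. A (word S m x)) - op_trace (Vs m) (\<lambda>x. A (word T m x))
    = (\<Sum>i<m. op_trace (Vs m) (\<lambda>x. A (word ((\<lambda>j. if j < i then S j else T j)(i := \<lambda>x. S i x - T i x)) m x)))"
proof -
  \<comment> \<open>In \<open>M i\<close> the letters before position \<open>i\<close> are already
    exchanged; consecutive words differ in one letter.\<close>
  define M where "M i = (\<lambda>j. if j < i then S j else T j)" for i :: nat
  have M: "M i j \<in> schatten q (Vs (Suc j)) (Vs j)" if "j < m" for i j
    using S T that by (simp add: M_def)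
  note tr = trace_class_traceable(1)[OF word_trace_class(1)[OF _ m] Vs Vs A]
  have step: "op_trace (Vs m) (\<lambda>x. A (word (M (Suc i)) m x)) - op_trace (Vs m) (\<lambda>x. A (word (M i) m x))
      = op_trace (Vs m) (\<lambda>x. A (word ((M i)(i := \<lambda>x. S i x - T i x)) m x))" if i: "i < m" for i
  proof -
    have eq: "M (Suc i) = (M i)(i := S i)" "M i = (M i)(i := T i)"
      by (auto simp: M_def fun_eq_iff less_Suc_eq)
    have b: "word (M k) m \<in> bounded_ops (Vs m) (Vs 0)" for k
      using M schatten_bounded by (intro word_bounded) blast
    have "op_trace (Vs m) (\<lambda>x. A (word (M (Suc i)) m x)) - op_trace (Vs m) (\<lambda>x. A (word (M i) m x))
        = op_trace (Vs m) (\<lambda>x. A (word (M (Suc i)) m x) - A (word (M i) m x))"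
      by (rule op_trace_diff[OF Vs tr[OF M] tr[OF M], symmetric])
    also have "\<dots> = op_trace (Vs m) (\<lambda>x. A (word ((M i)(i := \<lambda>x. S i x - T i x)) m x))"
    proof (rule op_trace_cong)
      fix x assume x: "x \<in> Vs m"
      have "A (word (M (Suc i)) m x) - A (word (M i) m x) = A (word (M (Suc i)) m x - word (M i) m x)"
        using bounded_ops_mem[OF b x] by (intro bounded_ops_diff[OF A Vs_subspace, symmetric])
      also have "word (M (Suc i)) m x - word (M i) m x
          = word ((M i)(i := S i)) m x - word ((M i)(i := T i)) m x"
        using eq by metis
      also have "\<dots> = word ((M i)(i := \<lambda>x. S i x - T i x)) m x"
        using M S T i x schatten_bounded by (intro word_update_diff) blast+
      finally show "A (word (M (Suc i)) m x) - A (word (M i) m x)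
          = A (word ((M i)(i := \<lambda>x. S i x - T i x)) m x)" .
    qed
    finally show ?thesis .
  qed
  have "word (M m) m = word S m" "word (M 0) m = word T m"
    by (auto intro!: word_cong simp: M_def)
  then have "op_trace (Vs m) (\<lambda>x. A (word S m x)) - op_trace (Vs m) (\<lambda>x. A (word T m x))
      = (\<Sum>i<m. op_trace (Vs m) (\<lambda>x. A (word (M (Suc i)) m x)) - op_trace (Vs m) (\<lambda>x. A (word (M i) m x)))"
    using sum_lessThan_telescope[of "\<lambda>i. op_trace (Vs m) (\<lambda>x. A (word (M i) m x))" m] by simp
  also have "\<dots> = (\<Sum>i<m. op_trace (Vs m) (\<lambda>x. A (word ((M i)(i := \<lambda>x. S i x - T i x)) m x)))"
    by (intro sum.cong) (auto simp: step)
  finally show ?thesis unfolding M_def .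
qed

text \<open>First the limit word is kept fixed while \<open>A s\<close> converges strongly; then the
  words are exchanged letter by letter, each error having one factor that tends to 0 in Schatten
  norm. Thus strong convergence is asked only of the factor outside the word.\<close>

lemma op_trace_word_tendsto:
  assumes T: "\<And>i. i < m \<Longrightarrow> \<forall>\<^sub>F s in Fl. T s i \<in> schatten q (Vs (Suc i)) (Vs i)"
    and T0: "\<And>i. i < m \<Longrightarrow> T0 i \<in> schatten q (Vs (Suc i)) (Vs i)"
    and lim: "\<And>i. i < m \<Longrightarrow>
      ((\<lambda>s. schatten_norm q (Vs (Suc i)) (Vs i) (\<lambda>x. T s i x - T0 i x)) \<longlongrightarrow> 0) Fl"
    and m: "0 < m" "q \<le> real m" and K: "0 \<le> K"
    and A: "\<forall>\<^sub>F s in Fl. A s \<in> bounded_ops (Vs 0) (Vs m) \<and> (\<forall>x\<in>Vs 0. norm (A s x) \<le> K * norm x)"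
    and A0: "A0 \<in> bounded_ops (Vs 0) (Vs m)" "\<And>x. x \<in> Vs 0 \<Longrightarrow> norm (A0 x) \<le> K * norm x"
    and A_lim: "\<And>x. x \<in> Vs 0 \<Longrightarrow> ((\<lambda>s. A s x) \<longlongrightarrow> A0 x) Fl"
  shows "((\<lambda>s. op_trace (Vs m) (\<lambda>x. A s (word (T s) m x)))
    \<longlongrightarrow> op_trace (Vs m) (\<lambda>x. A0 (word T0 m x))) Fl"
proof -
  let ?N = "\<lambda>i. schatten_norm q (Vs (Suc i)) (Vs i)"
  \<comment> \<open>A common bound for the limit letters and for all letters at distance at most 1
    from them, the latter by \<open>schatten_norm_le_of_diff\<close>.\<close>
  define B where "B = Max ((\<lambda>i. max (?N i (T0 i)) ((2 * 2 powr q * (1 + ?N i (T0 i) powr q)) powr (1 / q))) ` {..<m})"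
  have B: "?N i (T0 i) \<le> B" "(2 * 2 powr q * (1 + ?N i (T0 i) powr q)) powr (1 / q) \<le> B" if "i < m" for i
  proof -
    have "max (?N i (T0 i)) ((2 * 2 powr q * (1 + ?N i (T0 i) powr q)) powr (1 / q)) \<le> B"
      unfolding B_def using that by (intro Max_ge) auto
    then show "?N i (T0 i) \<le> B" "(2 * 2 powr q * (1 + ?N i (T0 i) powr q)) powr (1 / q) \<le> B" by auto
  qed
  have "((\<lambda>s. op_trace (Vs m) (\<lambda>x. A s (word T0 m x)))
      \<longlongrightarrow> op_trace (Vs m) (\<lambda>x. A0 (word T0 m x))) Fl"
    by (rule op_trace_strong_tendsto[OF word_trace_class(1)[OF T0 m] Vs Vs K A A0 A_lim])
  moreover have "((\<lambda>s. op_trace (Vs m) (\<lambda>x. A s (word (T s) m x))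
      - op_trace (Vs m) (\<lambda>x. A s (word T0 m x))) \<longlongrightarrow> 0) Fl"
  proof (rule Lim_null_comparison)
    have ev: "\<forall>\<^sub>F s in Fl. \<forall>i\<in>{..<m}. T s i \<in> schatten q (Vs (Suc i)) (Vs i)
        \<and> ?N i (\<lambda>x. T s i x - T0 i x) < 1"
      using T order_tendstoD(2)[OF lim, of _ 1]
      by (intro eventually_ball_finite) (auto intro: eventually_conj)
    show "\<forall>\<^sub>F s in Fl. norm (op_trace (Vs m) (\<lambda>x. A s (word (T s) m x))
        - op_trace (Vs m) (\<lambda>x. A s (word T0 m x)))
      \<le> (\<Sum>i<m. 18 * K * (real m * real m * (B ^ (m - 1) * ?N i (\<lambda>x. T s i x - T0 i x))))"
      using A ev
    proof eventually_elim
      case (elim s)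
      have Ts: "T s i \<in> schatten q (Vs (Suc i)) (Vs i)" "?N i (T s i) \<le> B" if "i < m" for i
      proof -
        show "T s i \<in> schatten q (Vs (Suc i)) (Vs i)" using elim that by auto
        then show "?N i (T s i) \<le> B"
          using schatten_norm_le_of_diff[OF q Vs_subspace Vs_subspace _ T0[OF that], of "T s i"]
            elim that B(2)[OF that] by force
      qed
      define Y where "Y i = (\<lambda>j. if j < i then T s j else T0 j)(i := \<lambda>x. T s i x - T0 i x)" for i
      have le: "cmod (op_trace (Vs m) (\<lambda>x. A s (word (Y i) m x)))
          \<le> 18 * K * (real m * real m * (B ^ (m - 1) * ?N i (\<lambda>x. T s i x - T0 i x)))" if i: "i < m" for i
      proof -
        have Yi: "Y i j \<in> schatten q (Vs (Suc j)) (Vs j)" if "j < m" for j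
          using Ts(1) T0 that schatten_diff[OF q Vs_subspace Vs_subspace Ts(1)[OF i] T0[OF i]]
          by (auto simp: Y_def)
        have "(\<Prod>j<m. ?N j (Y i j)) = (\<Prod>j\<in>{..<m} - {i}. ?N j (Y i j)) * ?N i (Y i i)"
          using i by (subst prod.remove[of _ i]) auto
        also have "\<dots> \<le> (\<Prod>j\<in>{..<m} - {i}. B) * ?N i (Y i i)"
          using Ts(2) B(1) schatten_norm_nonneg[OF q]
          by (intro mult_right_mono prod_mono) (auto simp: Y_def)
        also have "\<dots> = B ^ (m - 1) * ?N i (\<lambda>x. T s i x - T0 i x)"
          using i by (simp add: Y_def)
        finally have prod: "(\<Prod>j<m. ?N j (Y i j)) \<le> B ^ (m - 1) * ?N i (\<lambda>x. T s i x - T0 i x)" .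
        have "cmod (op_trace (Vs m) (\<lambda>x. A s (word (Y i) m x)))
            \<le> 18 * K * (\<Sum>n. singular_number (Vs m) (Vs 0) (word (Y i) m) n)"
          using elim K by (intro op_trace_le[OF word_trace_class(1)[OF Yi m] Vs Vs]) auto
        also have "\<dots> \<le> 18 * K * (real m * real m * (\<Prod>j<m. ?N j (Y i j)))"
          using mult_left_mono[OF word_trace_class(2)[OF Yi m], of "18 * K"] K by simp
        also have "\<dots> \<le> 18 * K * (real m * real m * (B ^ (m - 1) * ?N i (\<lambda>x. T s i x - T0 i x)))"
          using K prod by (intro mult_left_mono) auto
        finally show ?thesis .
      qed
      have "op_trace (Vs m) (\<lambda>x. A s (word (T s) m x)) - op_trace (Vs m) (\<lambda>x. A s (word T0 m x))
          = (\<Sum>i<m. op_trace (Vs m) (\<lambda>x. A s (word (Y i) m x)))"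
        unfolding Y_def using elim Ts(1) T0 m by (intro op_trace_word_telescope) auto
      then show ?case using le by (auto intro!: order_trans[OF norm_sum] sum_mono)
    qed
    have "((\<lambda>s. \<Sum>i<m. 18 * K * (real m * real m * (B ^ (m - 1) * ?N i (\<lambda>x. T s i x - T0 i x))))
        \<longlongrightarrow> (\<Sum>i<m. 18 * K * (real m * real m * (B ^ (m - 1) * 0)))) Fl"
      by (intro tendsto_sum tendsto_mult tendsto_const lim) auto
    then show "((\<lambda>s. \<Sum>i<m. 18 * K * (real m * real m * (B ^ (m - 1) * ?N i (\<lambda>x. T s i x - T0 i x)))) \<longlongrightarrow> 0) Fl"
      by simp
  qed
  ultimately have "((\<lambda>s. op_trace (Vs m) (\<lambda>x. A s (word T0 m x))
      + (op_trace (Vs m) (\<lambda>x. A s (word (T s) m x)) - op_trace (Vs m) (\<lambda>x. A s (word T0 m x))))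
      \<longlongrightarrow> op_trace (Vs m) (\<lambda>x. A0 (word T0 m x)) + 0) Fl"
    by (rule tendsto_add)
  then show ?thesis by simp
qed

end

section \<open>Strongly differentiable families\<close>

text \<open>Since \<open>T (x + r z) - T (x - r z) = 2 r T z\<close>, one of the two points has an
  image of norm at least \<open>r * norm (T z)\<close>. The factor 2/3 allows for a supremum that is
  not attained.\<close>

lemma op_norm_near:
  assumes T: "T \<in> bounded_ops V W" and V: "complex_vector.subspace V" and x: "x \<in> V"
    and r: "r > 0" and N: "0 < op_norm V T"
  obtains y where "y \<in> V" "norm (y - x) \<le> r" "2 / 3 * r * op_norm V T \<le> norm (T y)"
proof -
  have "2 / 3 * op_norm V T < (SUP x\<in>{x \<in> V. norm x \<le> 1}. norm (T x))"
    using N by (simp add: op_norm_def[symmetric])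
  moreover have "{x \<in> V. norm x \<le> 1} \<noteq> {}"
    using complex_vector.subspace_0[OF V] by (metis (mono_tags, lifting) empty_iff
        mem_Collect_eq norm_zero zero_le_one)
  moreover have "bdd_above ((\<lambda>x. norm (T x)) ` {x \<in> V. norm x \<le> 1})"
  proof (rule bdd_aboveI2)
    fix x assume "x \<in> {x \<in> V. norm x \<le> 1}"
    then have x: "x \<in> V" "norm x \<le> 1" by auto
    have "op_norm V T * norm x \<le> op_norm V T" using x(2) N by (intro mult_left_le) auto
    then show "norm (T x) \<le> op_norm V T"
      using norm_le_op_norm[OF T V x(1)] by (rule order_trans[rotated])
  qed
  ultimately obtain z where z: "z \<in> V" "norm z \<le> 1" "2 / 3 * op_norm V T < norm (T z)"
    using less_cSUP_iff[of "{x \<in> V. norm x \<le> 1}" "\<lambda>x. norm (T x)" "2 / 3 * op_norm V T"] by blast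
  have rz: "r *\<^sub>R z \<in> V" by (rule subspace_scaleR[OF V z(1)])
  have mem: "x + r *\<^sub>R z \<in> V" "x - r *\<^sub>R z \<in> V"
    using complex_vector.subspace_add[OF V x rz] complex_vector.subspace_diff[OF V x rz] .
  have "T (x + r *\<^sub>R z) - T (x - r *\<^sub>R z) = (2 * r) *\<^sub>R T z"
    by (simp add: bounded_ops_add[OF T x rz] bounded_ops_diff[OF T V x rz]
        bounded_ops_scaleR[OF T z(1)] scaleR_add_left[symmetric] del: scaleR_add_left)
  then have "2 * r * norm (T z) \<le> norm (T (x + r *\<^sub>R z)) + norm (T (x - r *\<^sub>R z))"
    using norm_triangle_ineq4[of "T (x + r *\<^sub>R z)" "T (x - r *\<^sub>R z)"] r by simp
  then have "r * norm (T z) \<le> norm (T (x + r *\<^sub>R z)) \<or> r * norm (T z) \<le> norm (T (x - r *\<^sub>R z))"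
    by linarith
  moreover have "2 / 3 * r * op_norm V T \<le> r * norm (T z)"
    using z(3) r mult_left_mono[of "2 / 3 * op_norm V T" "norm (T z)" r] by (simp add: mult_ac)
  moreover have "norm (r *\<^sub>R z) \<le> r" using z(2) r by (simp add: mult_left_le)
  ultimately show ?thesis
    using that[OF mem(1)] that[OF mem(2)] by (auto simp: norm_minus_commute)
qed

text \<open>Sokal's gliding-hump proof, which avoids the Baire category theorem.\<close>

lemma uniform_boundedness:
  fixes \<T> :: "('a::complex_inner \<Rightarrow> 'b::complex_inner) set"
  assumes V: "complex_vector.subspace V" "complete V"
    and T: "\<And>T. T \<in> \<T> \<Longrightarrow> T \<in> bounded_ops V W"
    and bd: "\<And>x. x \<in> V \<Longrightarrow> \<exists>M. \<forall>T\<in>\<T>. norm (T x) \<le> M"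
  obtains M where "0 \<le> M" "\<And>T x. T \<in> \<T> \<Longrightarrow> x \<in> V \<Longrightarrow> norm (T x) \<le> M * norm x"
proof (cases "\<exists>M. \<forall>T\<in>\<T>. op_norm V T \<le> M")
  case True
  then obtain M where M: "\<And>T. T \<in> \<T> \<Longrightarrow> op_norm V T \<le> M" by blast
  have "norm (T x) \<le> max 0 M * norm x" if "T \<in> \<T>" "x \<in> V" for T x
    using norm_le_op_norm[OF T[OF that(1)] V(1) that(2)] M[OF that(1)]
    by (meson max.coboundedI2 mult_right_mono norm_ge_zero order_trans)
  then show ?thesis using that[of "max 0 M"] by simp
next
  case False
  then have "\<exists>T\<in>\<T>. 4 ^ n < op_norm V T" for n :: nat
    by (meson linorder_not_le)
  then obtain S where S: "\<And>n::nat. S n \<in> \<T>" "\<And>n. 4 ^ n < op_norm V (S n)" by metis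
  have Sb: "S n \<in> bounded_ops V W" for n using T S(1) .
  have pos: "0 < op_norm V (S n)" for n
    using S(2)[of n] zero_less_power[of "4::real" n] by linarith
  \<comment> \<open>Steps shrinking by 1/3 keep the limit within \<open>r n / 2\<close> of the point
    reached after step \<open>n\<close>. Of the gain \<open>2/3 * r n * op_norm V (S n)\<close> at
    that point at least the share 1/6 then survives at the limit, and norms above \<open>4^n\<close>
    outgrow \<open>3^n\<close>.\<close>
  define r where "r n = (1 / 3 :: real) ^ Suc n" for n
  have r: "r n > 0" for n by (simp add: r_def)
  have "\<exists>x. \<forall>n. x n \<in> V \<and> (norm (x (Suc n) - x n) \<le> r n
      \<and> 2 / 3 * r n * op_norm V (S n) \<le> norm (S n (x (Suc n))))"
  proof (rule dependent_nat_choice)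
    show "\<exists>x. x \<in> V" using complex_vector.subspace_0[OF V(1)] by blast
    show "\<exists>y. y \<in> V \<and> (norm (y - x) \<le> r n \<and> 2 / 3 * r n * op_norm V (S n) \<le> norm (S n y))"
      if "x \<in> V" for x n
      using op_norm_near[OF Sb V(1) that r pos] by metis
  qed
  then obtain x where x: "\<And>n. x n \<in> V" "\<And>n. norm (x (Suc n) - x n) \<le> r n"
    "\<And>n. 2 / 3 * r n * op_norm V (S n) \<le> norm (S n (x (Suc n)))" by metis
  have dist_le: "dist (x (m + k)) (x m) \<le> 1 / 2 * (1 / 3) ^ m * (1 - (1 / 3) ^ k)" for m k
  proof (induction k)
    case (Suc k)
    have "dist (x (m + Suc k)) (x m) \<le> r (m + k) + 1 / 2 * (1 / 3) ^ m * (1 - (1 / 3) ^ k)"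
      using dist_triangle[of "x (m + Suc k)" "x m" "x (m + k)"] Suc x(2)[of "m + k"]
      by (simp add: dist_norm)
    also have "\<dots> = 1 / 2 * (1 / 3) ^ m * (1 - (1 / 3) ^ Suc k)"
      by (simp add: r_def power_add field_simps)
    finally show ?case .
  qed simp
  have dist_le': "dist (x n) (x m) \<le> 1 / 2 * (1 / 3) ^ m" if "m \<le> n" for m n
  proof -
    have "1 / 2 * (1 / 3) ^ m * (1 - (1 / 3) ^ (n - m)) \<le> 1 / 2 * (1 / 3) ^ m * (1::real)"
      by (intro mult_left_mono) auto
    with dist_le[of m "n - m"] have "dist (x (m + (n - m))) (x m) \<le> 1 / 2 * (1 / 3) ^ m * 1"
      by (rule order_trans)
    then show ?thesis using that by simp
  qed
  have "Cauchy x"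
  proof (rule metric_CauchyI)
    fix e :: real assume e: "e > 0"
    obtain N where N: "(1 / 3 :: real) ^ N < e" using real_arch_pow_inv[OF e, of "1/3"] by auto
    have "dist (x m) (x n) < e" if "m \<ge> N" "n \<ge> N" for m n
      using dist_le'[OF that(1)] dist_le'[OF that(2)] dist_triangle2[of "x m" "x n" "x N"] N
      by simp
    then show "\<exists>M. \<forall>m\<ge>M. \<forall>n\<ge>M. dist (x m) (x n) < e" by blast
  qed
  then obtain l where l: "l \<in> V" "x \<longlonglongrightarrow> l"
    using V(2) x(1) unfolding complete_def by blast
  obtain M where M: "\<And>T. T \<in> \<T> \<Longrightarrow> norm (T l) \<le> M" using bd[OF l(1)] by blast
  have "(1 / 18) * (4 / 3) ^ n \<le> M" for n
  proof -
    have "dist l (x (Suc n)) \<le> 1 / 2 * (1 / 3) ^ Suc n"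
    proof (rule tendsto_upperbound)
      show "(\<lambda>k. dist (x k) (x (Suc n))) \<longlonglongrightarrow> dist l (x (Suc n))"
        by (intro tendsto_dist l(2) tendsto_const)
      show "\<forall>\<^sub>F k in sequentially. dist (x k) (x (Suc n)) \<le> 1 / 2 * (1 / 3) ^ Suc n"
        using eventually_ge_at_top[of "Suc n"] by eventually_elim (rule dist_le')
    qed simp
    then have d: "norm (x (Suc n) - l) \<le> 1 / 2 * r n"
      by (simp add: dist_norm norm_minus_commute r_def)
    have "norm (S n (x (Suc n) - l)) \<le> op_norm V (S n) * norm (x (Suc n) - l)"
      by (rule norm_le_op_norm[OF Sb V(1) complex_vector.subspace_diff[OF V(1) x(1) l(1)]])
    also have "\<dots> \<le> op_norm V (S n) * (1 / 2 * r n)"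
      using d pos[of n] by (intro mult_left_mono) auto
    finally have "norm (S n (x (Suc n))) - norm (S n l) \<le> op_norm V (S n) * (1 / 2 * r n)"
      using norm_triangle_ineq2[of "S n (x (Suc n))" "S n l"]
      by (simp add: bounded_ops_diff[OF Sb V(1) x(1) l(1)])
    then have "1 / 6 * r n * op_norm V (S n) \<le> M"
      using x(3)[of n] M[OF S(1), of n] by (simp add: algebra_simps)
    moreover have "1 / 6 * r n * 4 ^ n \<le> 1 / 6 * r n * op_norm V (S n)"
      using S(2)[of n] r[of n] by (intro mult_left_mono) auto
    moreover have "1 / 6 * r n * 4 ^ n = (1 / 18) * (4 / 3) ^ n"
      by (simp add: r_def power_divide)
    ultimately show ?thesis by simp
  qed
  moreover obtain n where "18 * M < (4 / 3) ^ n"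
    using real_arch_pow[of "4 / 3" "18 * M"] by auto
  ultimately have False by (metis linorder_not_le mult.commute divide_le_eq_numeral1(1) times_divide_eq_left mult_1)
  then show ?thesis ..
qed

text \<open>Derivatives as limits of difference quotients, the form in which strong limits can be
  taken under a trace.\<close>

lemma has_vector_derivative_iff_quotient:
  "(f has_vector_derivative D) (at t within X) \<longleftrightarrow> ((\<lambda>s. (1 / (s - t)) *\<^sub>R (f s - f t)) \<longlongrightarrow> D) (at t within X)"
proof -
  have "(f has_vector_derivative D) (at t within X)
      \<longleftrightarrow> ((\<lambda>s. norm ((f s - f t) - (s - t) *\<^sub>R D) / norm (s - t)) \<longlongrightarrow> 0) (at t within X)"
    unfolding has_vector_derivative_def has_derivative_iff_norm
    by (simp add: bounded_linear_scaleR_left)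
  also have "\<dots> \<longleftrightarrow> ((\<lambda>s. norm ((1 / (s - t)) *\<^sub>R (f s - f t) - D)) \<longlongrightarrow> 0) (at t within X)"
  proof (rule tendsto_cong)
    show "\<forall>\<^sub>F s in at t within X. norm ((f s - f t) - (s - t) *\<^sub>R D) / norm (s - t)
        = norm ((1 / (s - t)) *\<^sub>R (f s - f t) - D)"
    proof (rule eventually_mono[OF eventually_neq_at_within])
      fix s assume s: "s \<noteq> t"
      have "(1 / (s - t)) *\<^sub>R (f s - f t) - D = (1 / (s - t)) *\<^sub>R ((f s - f t) - (s - t) *\<^sub>R D)"
        using s by (simp add: scaleR_diff_right)
      then show "norm ((f s - f t) - (s - t) *\<^sub>R D) / norm (s - t)
          = norm ((1 / (s - t)) *\<^sub>R (f s - f t) - D)"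
        by (simp only: norm_scaleR) (simp add: divide_inverse abs_inverse mult.commute)
    qed
  qed
  also have "\<dots> \<longleftrightarrow> ((\<lambda>s. (1 / (s - t)) *\<^sub>R (f s - f t)) \<longlongrightarrow> D) (at t within X)"
    by (simp add: tendsto_norm_zero_iff LIM_zero_iff)
  finally show ?thesis .
qed

lemma C1_imp_lipschitz:
  fixes f :: "real \<Rightarrow> 'a::real_normed_vector"
  assumes D: "continuous_on {a..b} D" "\<And>t. t \<in> {a..b} \<Longrightarrow> (f has_vector_derivative D t) (at t within {a..b})"
  obtains L where "0 \<le> L" "\<And>s t. s \<in> {a..b} \<Longrightarrow> t \<in> {a..b} \<Longrightarrow> norm (f s - f t) \<le> L * \<bar>s - t\<bar>"
proof -
  have "bounded (D ` {a..b})"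
    by (intro compact_imp_bounded compact_continuous_image D(1)) auto
  then obtain L where L: "\<And>t. t \<in> {a..b} \<Longrightarrow> norm (D t) \<le> L" unfolding bounded_iff by (meson imageI)
  have "norm (f s - f t) \<le> max 0 L * norm (s - t)" if "s \<in> {a..b}" "t \<in> {a..b}" for s t
  proof (rule differentiable_bound[of "{a..b}" f "\<lambda>t h. h *\<^sub>R D t"])
    fix t assume t: "t \<in> {a..b}"
    show "(f has_derivative (\<lambda>h. h *\<^sub>R D t)) (at t within {a..b})"
      using D(2)[OF t] by (simp add: has_vector_derivative_def)
    show "onorm (\<lambda>h. h *\<^sub>R D t) \<le> max 0 L"
    proof (rule onorm_le)
      fix h :: real
      have "norm (D t) \<le> max 0 L" using L[OF t] by simp
      then show "norm (h *\<^sub>R D t) \<le> max 0 L * norm h"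
        using mult_left_mono[of "norm (D t)" "max 0 L" "\<bar>h\<bar>"] by (simp add: mult.commute)
    qed
  qed (use that in auto)
  then show ?thesis using that[of "max 0 L"] by simp
qed

text \<open>Points in different pieces are compared through the break point between them, where the
  distances add up exactly; hence the larger of the two constants suffices.\<close>

lemma lipschitz_concat_pieces:
  fixes f :: "real \<Rightarrow> 'a::real_normed_vector" and a :: "nat \<Rightarrow> real"
  assumes "\<And>i. i < m \<Longrightarrow> a i < a (Suc i)"
    and "\<And>i. i < m \<Longrightarrow> \<exists>L\<ge>0. \<forall>s\<in>{a i..a (Suc i)}. \<forall>t\<in>{a i..a (Suc i)}. norm (f s - f t) \<le> L * \<bar>s - t\<bar>"
  shows "\<exists>L\<ge>0. \<forall>s\<in>{a 0..a m}. \<forall>t\<in>{a 0..a m}. norm (f s - f t) \<le> L * \<bar>s - t\<bar>"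
  using assms
proof (induction m)
  case (Suc m)
  obtain L where L: "L \<ge> 0" "\<And>s t. s \<in> {a 0..a m} \<Longrightarrow> t \<in> {a 0..a m} \<Longrightarrow> norm (f s - f t) \<le> L * \<bar>s - t\<bar>"
    using Suc by (metis less_SucI)
  obtain K where K: "K \<ge> 0" "\<And>s t. s \<in> {a m..a (Suc m)} \<Longrightarrow> t \<in> {a m..a (Suc m)} \<Longrightarrow> norm (f s - f t) \<le> K * \<bar>s - t\<bar>"
    using Suc.prems(2)[of m] by auto
  define M where "M = max L K"
  have M: "norm (f s - f t) \<le> M * \<bar>s - t\<bar>"
    if "s \<in> {a 0..a m} \<and> t \<in> {a 0..a m} \<or> s \<in> {a m..a (Suc m)} \<and> t \<in> {a m..a (Suc m)}" for s t
  proof -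
    have "L * \<bar>s - t\<bar> \<le> M * \<bar>s - t\<bar>" "K * \<bar>s - t\<bar> \<le> M * \<bar>s - t\<bar>"
      by (auto simp: M_def intro!: mult_right_mono)
    then show ?thesis using L(2)[of s t] K(2)[of s t] that by fastforce
  qed
  have mixed: "norm (f s - f t) \<le> M * \<bar>s - t\<bar>" if "s \<in> {a 0..a m}" "t \<in> {a m..a (Suc m)}" for s t
  proof -
    have "a 0 \<le> a m" "a m \<le> a (Suc m)" using that by auto
    then have "norm (f s - f (a m)) \<le> M * \<bar>s - a m\<bar>" "norm (f (a m) - f t) \<le> M * \<bar>a m - t\<bar>"
      by (intro M; use that in auto)+
    then have "norm (f s - f t) \<le> M * \<bar>s - a m\<bar> + M * \<bar>a m - t\<bar>"
      using norm_triangle_ineq[of "f s - f (a m)" "f (a m) - f t"] by simp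
    also have "\<dots> = M * \<bar>s - t\<bar>" using that by (simp add: algebra_simps)
    finally show ?thesis .
  qed
  have "norm (f s - f t) \<le> M * \<bar>s - t\<bar>" if "s \<in> {a 0..a (Suc m)}" "t \<in> {a 0..a (Suc m)}" for s t
    using M[of s t] mixed[of s t] mixed[of t s] that
    by (cases "s \<le> a m"; cases "t \<le> a m") (auto simp: norm_minus_commute abs_minus_commute)
  moreover have "M \<ge> 0" using L(1) by (simp add: M_def)
  ultimately show ?case by blast
qed (auto intro!: exI[of _ 0])

lemma interval_piece:
  fixes a :: "nat \<Rightarrow> real"
  assumes "a 0 \<le> t" "t < a m"
  obtains i where "i < m" "a i \<le> t" "t < a (Suc i)"
proof -
  have "\<exists>i<m. a i \<le> t \<and> t < a (Suc i)" using assms(2)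
  proof (induction m)
    case (Suc m)
    then show ?case by (cases "t < a m") (auto intro: less_SucI simp: not_less)
  qed (use assms(1) in simp)
  then show ?thesis using that by blast
qed

definition op_deriv :: "(real \<Rightarrow> 'a \<Rightarrow> 'b::real_normed_vector) \<Rightarrow> real \<Rightarrow> 'a \<Rightarrow> 'b" where
  "op_deriv T t x = vector_derivative (\<lambda>s. T s x) (at_right t)"

text \<open>
  The right derivative exists everywhere. This matters because the exceptional set \<open>S\<close> depends on
  the family, so that identities between derivatives of different families could otherwise be stated
  only off a set depending on all of them.
\<close>

definition C1_family ::
  "'a::complex_inner set \<Rightarrow> 'b::complex_inner set \<Rightarrow> real \<Rightarrow> real set \<Rightarrow> (real \<Rightarrow> 'a \<Rightarrow> 'b) \<Rightarrow> bool" where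
  "C1_family V W L S T \<longleftrightarrow> 0 \<le> L \<and> finite S \<and> (\<forall>t\<in>{0..1}. T t \<in> bounded_ops V W)
     \<and> (\<forall>s\<in>{0..1}. \<forall>t\<in>{0..1}. \<forall>x\<in>V. norm (T s x - T t x) \<le> L * \<bar>s - t\<bar> * norm x)
     \<and> (\<forall>t\<in>{0..<1}. op_deriv T t \<in> bounded_ops V W
          \<and> (\<forall>x\<in>V. norm (op_deriv T t x) \<le> L * norm x
               \<and> ((\<lambda>s. T s x) has_vector_derivative op_deriv T t x) (at_right t)))
     \<and> (\<forall>t\<in>{0..1} - S. 0 < t \<and> t < 1
          \<and> (\<forall>x\<in>V. ((\<lambda>s. T s x) has_vector_derivative op_deriv T t x) (at t)
               \<and> isCont (\<lambda>s. op_deriv T s x) t))"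

lemma op_deriv_eq:
  assumes "((\<lambda>s. T s x) has_vector_derivative D) (at_right t)"
  shows "op_deriv T t x = D"
  unfolding op_deriv_def using assms by (intro vector_derivative_within) auto

lemma C1_family_add_scaleR:
  assumes A: "C1_family V W K S A" and B: "C1_family V W L S' B"
    and V: "complex_vector.subspace V" and W: "complex_vector.subspace W"
  shows "C1_family V W (K + \<bar>r\<bar> * L) (S \<union> S') (\<lambda>t x. A t x + r *\<^sub>R B t x)"
    and "t \<in> {0..<1} \<Longrightarrow> x \<in> V
      \<Longrightarrow> op_deriv (\<lambda>t x. A t x + r *\<^sub>R B t x) t x = op_deriv A t x + r *\<^sub>R op_deriv B t x"
proof -
  note A' = A[unfolded C1_family_def] and B' = B[unfolded C1_family_def]
  let ?T = "\<lambda>t x. A t x + r *\<^sub>R B t x"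
  have derR: "((\<lambda>s. ?T s x) has_vector_derivative op_deriv A t x + r *\<^sub>R op_deriv B t x) (at_right t)"
    if "t \<in> {0..<1}" "x \<in> V" for t x
    using A' B' that
    by (intro has_vector_derivative_add bounded_linear.has_vector_derivative[OF bounded_linear_scaleR_right])
      auto
  then have eq: "op_deriv ?T t x = op_deriv A t x + r *\<^sub>R op_deriv B t x"
    if "t \<in> {0..<1}" "x \<in> V" for t x
    using op_deriv_eq[of ?T] that by blast
  have der: "((\<lambda>s. ?T s x) has_vector_derivative op_deriv A t x + r *\<^sub>R op_deriv B t x) (at t)"
    if "t \<in> {0..1} - (S \<union> S')" "x \<in> V" for t x
    using A' B' that
    by (intro has_vector_derivative_add bounded_linear.has_vector_derivative[OF bounded_linear_scaleR_right])
      auto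
  show "t \<in> {0..<1} \<Longrightarrow> x \<in> V \<Longrightarrow> op_deriv ?T t x = op_deriv A t x + r *\<^sub>R op_deriv B t x"
    by (rule eq)
  show "C1_family V W (K + \<bar>r\<bar> * L) (S \<union> S') ?T"
    unfolding C1_family_def
  proof (intro conjI ballI)
    show "0 \<le> K + \<bar>r\<bar> * L" "finite (S \<union> S')" using A' B' by auto
    show "?T t \<in> bounded_ops V W" if "t \<in> {0..1}" for t
      using A' B' that W by (intro bounded_ops_add_scaleR) auto
    fix s t x assume st: "s \<in> {0..1::real}" "t \<in> {0..1::real}" and x: "x \<in> V"
    have diff: "?T s x - ?T t x = (A s x - A t x) + r *\<^sub>R (B s x - B t x)"
      by (simp add: algebra_simps)
    have "norm (?T s x - ?T t x) \<le> norm (A s x - A t x) + \<bar>r\<bar> * norm (B s x - B t x)"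
      unfolding diff by (rule order_trans[OF norm_triangle_ineq]) simp
    also have "\<dots> \<le> K * \<bar>s - t\<bar> * norm x + \<bar>r\<bar> * (L * \<bar>s - t\<bar> * norm x)"
      using A' B' st x by (intro add_mono mult_left_mono) auto
    finally show "norm (?T s x - ?T t x) \<le> (K + \<bar>r\<bar> * L) * \<bar>s - t\<bar> * norm x"
      by (simp add: algebra_simps)
  next
    fix t :: real assume t: "t \<in> {0..<1}"
    show "op_deriv ?T t \<in> bounded_ops V W"
      by (rule bounded_ops_cong[OF bounded_ops_add_scaleR[of "op_deriv A t" V W "op_deriv B t" r] V eq[OF t]])
        (use A' B' t W in auto)
    fix x assume x: "x \<in> V"
    have "norm (op_deriv ?T t x) \<le> norm (op_deriv A t x) + \<bar>r\<bar> * norm (op_deriv B t x)"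
      unfolding eq[OF t x] using norm_triangle_ineq[of "op_deriv A t x" "r *\<^sub>R op_deriv B t x"] by simp
    also have "\<dots> \<le> K * norm x + \<bar>r\<bar> * (L * norm x)"
      using A' B' t x by (intro add_mono mult_left_mono) auto
    finally show "norm (op_deriv ?T t x) \<le> (K + \<bar>r\<bar> * L) * norm x" by (simp add: algebra_simps)
    show "((\<lambda>s. ?T s x) has_vector_derivative op_deriv ?T t x) (at_right t)"
      unfolding eq[OF t x] by (rule derR[OF t x])
  next
    fix t assume t: "t \<in> {0..1} - (S \<union> S')"
    show t01: "0 < t" "t < 1" using A' t by auto
    fix x assume x: "x \<in> V"
    show "((\<lambda>s. ?T s x) has_vector_derivative op_deriv ?T t x) (at t)"
      using der[OF t x] eq[of t x] x t01 by simp
    have "isCont (\<lambda>s. op_deriv A s x + r *\<^sub>R op_deriv B s x) t"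
      using A' B' t x by (intro continuous_intros) auto
    moreover have "\<forall>\<^sub>F s in nhds t. op_deriv ?T s x = op_deriv A s x + r *\<^sub>R op_deriv B s x"
      using eventually_nhds_in_open[of "{0<..<1}" t] t01 x
      by (auto elim!: eventually_mono intro!: eq)
    ultimately show "isCont (\<lambda>s. op_deriv ?T s x) t" by (simp add: isCont_cong)
  qed
qed

text \<open>The Leibniz rule for the strong topology. The quotient splits into the quotient of
  \<open>A\<close> at the fixed vector \<open>B t x\<close>, the operator \<open>A t\<close> on the
  quotient of \<open>B\<close>, and a mixed term.\<close>

lemma op_deriv_comp:
  assumes A: "C1_family V W K S A" and B: "C1_family U V L S' B"
    and V: "complex_vector.subspace V" and t: "t \<in> {0..<1}" and x: "x \<in> U"
  shows "op_deriv (\<lambda>t x. A t (B t x)) t x = op_deriv A t (B t x) + A t (op_deriv B t x)"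
proof (rule op_deriv_eq)
  note A' = A[unfolded C1_family_def] and B' = B[unfolded C1_family_def]
  have ev: "\<forall>\<^sub>F s in at_right t. s \<in> {0..1} \<and> s \<noteq> t"
    using t by (auto simp: eventually_at_right_field intro!: exI[of _ 1])
  have tI: "t \<in> {0..1}" using t by simp
  have At: "A s \<in> bounded_ops V W" "B s \<in> bounded_ops U V" if "s \<in> {0..1}" for s using A' B' that by auto
  have mem: "B s x \<in> V" if "s \<in> {0..1}" for s using bounded_ops_mem[OF At(2)[OF that] x] .
  have Bd: "((\<lambda>s. (1 / (s - t)) *\<^sub>R (B s x - B t x)) \<longlongrightarrow> op_deriv B t x) (at_right t)"
    using B' t x by (simp add: has_vector_derivative_iff_quotient)
  have Ad: "((\<lambda>s. (1 / (s - t)) *\<^sub>R (A s (B t x) - A t (B t x))) \<longlongrightarrow> op_deriv A t (B t x)) (at_right t)"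
    using A' t mem[OF tI] by (simp add: has_vector_derivative_iff_quotient)
  have dB: "op_deriv B t x \<in> V" using B' t x bounded_ops_mem by blast
  obtain M where M: "M \<ge> 0" "\<And>y. y \<in> V \<Longrightarrow> norm (A t y) \<le> M * norm y"
    using bounded_ops_nonneg_bound[OF At(1)[OF tI]] by blast
  have one: "((\<lambda>s. A t ((1 / (s - t)) *\<^sub>R (B s x - B t x))) \<longlongrightarrow> A t (op_deriv B t x)) (at_right t)"
  proof (rule LIM_zero_cancel, rule Lim_null_comparison)
    show "\<forall>\<^sub>F s in at_right t. norm (A t ((1 / (s - t)) *\<^sub>R (B s x - B t x)) - A t (op_deriv B t x))
        \<le> M * norm ((1 / (s - t)) *\<^sub>R (B s x - B t x) - op_deriv B t x)"
      using ev
    proof eventually_elim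
      case (elim s)
      then have y: "(1 / (s - t)) *\<^sub>R (B s x - B t x) \<in> V"
        using mem tI by (intro subspace_scaleR V complex_vector.subspace_diff) auto
      show ?case
        using M(2)[OF complex_vector.subspace_diff[OF V y dB]]
        by (simp only: bounded_ops_diff[OF At(1)[OF tI] V y dB])
    qed
    show "((\<lambda>s. M * norm ((1 / (s - t)) *\<^sub>R (B s x - B t x) - op_deriv B t x)) \<longlongrightarrow> 0) (at_right t)"
      by (intro tendsto_mult_right_zero tendsto_norm_zero LIM_zero Bd)
  qed
  \<comment> \<open>Both increments are Lipschitz in operator norm, so the mixed term is of order
    \<open>\<bar>s - t\<bar>\<close>; differentiability of \<open>A\<close> at single vectors would
    not control it along the moving vector.\<close>
  have two: "((\<lambda>s. (1 / (s - t)) *\<^sub>R ((A s (B s x - B t x)) - A t (B s x - B t x))) \<longlongrightarrow> 0) (at_right t)"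
  proof (rule Lim_null_comparison)
    show "\<forall>\<^sub>F s in at_right t. norm ((1 / (s - t)) *\<^sub>R ((A s (B s x - B t x)) - A t (B s x - B t x)))
        \<le> K * (L * \<bar>s - t\<bar> * norm x)"
      using ev
    proof eventually_elim
      case (elim s)
      then have s: "s \<in> {0..1}" by simp
      have y: "B s x - B t x \<in> V" using mem[OF s] mem[OF tI] by (rule complex_vector.subspace_diff[OF V])
      have "norm (A s (B s x - B t x) - A t (B s x - B t x)) \<le> K * \<bar>s - t\<bar> * norm (B s x - B t x)"
        using A' s tI y by blast
      also have "\<dots> \<le> K * \<bar>s - t\<bar> * (L * \<bar>s - t\<bar> * norm x)"
        using A' B' s tI x by (intro mult_left_mono) auto
      finally have "norm (A s (B s x - B t x) - A t (B s x - B t x)) \<le> \<bar>s - t\<bar> * (K * (L * \<bar>s - t\<bar> * norm x))"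
        by (simp add: mult_ac)
      then have "norm (A s (B s x - B t x) - A t (B s x - B t x)) / \<bar>s - t\<bar> \<le> K * (L * \<bar>s - t\<bar> * norm x)"
        using elim by (simp add: divide_le_eq mult.commute)
      moreover have "norm ((1 / (s - t)) *\<^sub>R ((A s (B s x - B t x)) - A t (B s x - B t x)))
          = norm (A s (B s x - B t x) - A t (B s x - B t x)) / \<bar>s - t\<bar>" by simp
      ultimately show ?case by (simp only:)
    qed
    have "((\<lambda>s. K * (L * \<bar>s - t\<bar> * norm x)) \<longlongrightarrow> K * (L * \<bar>t - t\<bar> * norm x)) (at_right t)"
      by (intro tendsto_intros)
    then show "((\<lambda>s. K * (L * \<bar>s - t\<bar> * norm x)) \<longlongrightarrow> 0) (at_right t)" by simp
  qed
  have "((\<lambda>s. (1 / (s - t)) *\<^sub>R (A s (B t x) - A t (B t x)) + A t ((1 / (s - t)) *\<^sub>R (B s x - B t x))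
      + (1 / (s - t)) *\<^sub>R ((A s (B s x - B t x)) - A t (B s x - B t x)))
      \<longlongrightarrow> op_deriv A t (B t x) + A t (op_deriv B t x) + 0) (at_right t)"
    by (intro tendsto_add Ad one two)
  then have "((\<lambda>s. (1 / (s - t)) *\<^sub>R (A s (B s x) - A t (B t x)))
      \<longlongrightarrow> op_deriv A t (B t x) + A t (op_deriv B t x) + 0) (at_right t)"
  proof (rule Lim_transform_eventually)
    show "\<forall>\<^sub>F s in at_right t. (1 / (s - t)) *\<^sub>R (A s (B t x) - A t (B t x))
        + A t ((1 / (s - t)) *\<^sub>R (B s x - B t x))
        + (1 / (s - t)) *\<^sub>R ((A s (B s x - B t x)) - A t (B s x - B t x))
        = (1 / (s - t)) *\<^sub>R (A s (B s x) - A t (B t x))"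
      using ev
    proof eventually_elim
      case (elim s)
      then have s: "s \<in> {0..1}" by simp
      have y: "B s x - B t x \<in> V" using mem[OF s] mem[OF tI] by (rule complex_vector.subspace_diff[OF V])
      show ?case
        unfolding bounded_ops_scaleR[OF At(1)[OF tI] y]
          bounded_ops_diff[OF At(1)[OF s] V mem[OF s] mem[OF tI]]
        by (simp add: algebra_simps)
    qed
  qed
  then show "((\<lambda>s. A s (B s x)) has_vector_derivative op_deriv A t (B t x) + A t (op_deriv B t x)) (at_right t)"
    by (simp add: has_vector_derivative_iff_quotient)
qed

text \<open>For each vector the path is Lipschitz with a constant depending on the vector. Uniform
  boundedness of the family of all difference quotients gives one \<open>L\<close>, which also
  bounds the derivatives as their strong limits.\<close>

lemma piecewise_strongly_C1_family:
  assumes V: "complex_vector.subspace V" "complete V" and W: "complex_vector.subspace W" "complete W"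
    and T: "\<And>t. t \<in> {0..1} \<Longrightarrow> T t \<in> bounded_ops V W" and C1: "piecewise_strongly_C1 V T"
  obtains L S where "C1_family V W L S T"
proof -
  obtain m and a :: "nat \<Rightarrow> real" where a: "a 0 = 0" "a m = 1" "\<And>i. i < m \<Longrightarrow> a i < a (Suc i)"
    "\<And>i. i < m \<Longrightarrow> strongly_C1_on V {a i..a (Suc i)} T"
    using C1 unfolding piecewise_strongly_C1_def by blast
  define S where "S = a ` {..m}"
  have lip: "\<exists>L\<ge>0. \<forall>s\<in>{0..1}. \<forall>t\<in>{0..1}. norm (T s x - T t x) \<le> L * \<bar>s - t\<bar>" if x: "x \<in> V" for x
  proof -
    have "\<exists>L\<ge>0. \<forall>s\<in>{a i..a (Suc i)}. \<forall>t\<in>{a i..a (Suc i)}. norm (T s x - T t x) \<le> L * \<bar>s - t\<bar>"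
      if i: "i < m" for i
    proof -
      obtain D where D: "continuous_on {a i..a (Suc i)} D"
        "\<And>t. t \<in> {a i..a (Suc i)} \<Longrightarrow> ((\<lambda>s. T s x) has_vector_derivative D t) (at t within {a i..a (Suc i)})"
        using a(4)[OF i] x unfolding strongly_C1_on_def by blast
      show ?thesis using C1_imp_lipschitz[OF D] by metis
    qed
    from lipschitz_concat_pieces[of m a "\<lambda>s. T s x", OF a(3) this] show ?thesis by (simp add: a)
  qed
  \<comment> \<open>The summand 0 keeps the shape required by
    \<open>bounded_ops_add_scaleR\<close>.\<close>
  define \<T> where "\<T> = {(\<lambda>x. 0 + (1 / (s - t)) *\<^sub>R (T s x - T t x)) | s t. s \<in> {0..1} \<and> t \<in> {0..1} \<and> s \<noteq> t}"
  have "\<exists>M\<ge>0. \<forall>A\<in>\<T>. \<forall>x\<in>V. norm (A x) \<le> M * norm x"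
  proof -
    have b: "A \<in> bounded_ops V W" if "A \<in> \<T>" for A
      using that unfolding \<T>_def
      by (auto simp del: add_0 intro!: bounded_ops_add_scaleR bounded_ops_zero_op bounded_ops_diff_op T W)
    have "\<exists>M. \<forall>A\<in>\<T>. norm (A x) \<le> M" if x: "x \<in> V" for x
    proof -
      obtain L where L: "L \<ge> 0" "\<And>s t. s \<in> {0..1} \<Longrightarrow> t \<in> {0..1} \<Longrightarrow> norm (T s x - T t x) \<le> L * \<bar>s - t\<bar>"
        using lip[OF x] by blast
      have "norm (A x) \<le> L" if "A \<in> \<T>" for A
      proof -
        obtain s t where st: "s \<in> {0..1}" "t \<in> {0..1}" "s \<noteq> t"
          "A = (\<lambda>x. 0 + (1 / (s - t)) *\<^sub>R (T s x - T t x))"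
          using \<open>A \<in> \<T>\<close> unfolding \<T>_def by blast
        then have "norm (A x) = norm (T s x - T t x) / \<bar>s - t\<bar>" by simp
        then show ?thesis using L(2)[OF st(1,2)] st(3) by (simp add: divide_le_eq)
      qed
      then show ?thesis by blast
    qed
    then show ?thesis using uniform_boundedness[OF V b] by metis
  qed
  then obtain L where L: "L \<ge> 0" "\<And>A x. A \<in> \<T> \<Longrightarrow> x \<in> V \<Longrightarrow> norm (A x) \<le> L * norm x" by blast
  have quot: "norm ((1 / (s - t)) *\<^sub>R (T s x - T t x)) \<le> L * norm x"
    if "s \<in> {0..1}" "t \<in> {0..1}" "s \<noteq> t" "x \<in> V" for s t x
  proof -
    have "(\<lambda>x. 0 + (1 / (s - t)) *\<^sub>R (T s x - T t x)) \<in> \<T>" using that unfolding \<T>_def by blast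
    from L(2)[OF this that(4)] show ?thesis by simp
  qed
  have lips: "norm (T s x - T t x) \<le> L * \<bar>s - t\<bar> * norm x"
    if "s \<in> {0..1}" "t \<in> {0..1}" "x \<in> V" for s t x
  proof (cases "s = t")
    case False
    have "norm ((1 / (s - t)) *\<^sub>R (T s x - T t x)) = norm (T s x - T t x) / \<bar>s - t\<bar>"
      by simp
    then show ?thesis
      using quot[OF that(1,2) False that(3)] False by (simp add: divide_le_eq mult_ac)
  qed simp
  \<comment> \<open>At a break point the piece to its right is taken, so that the right derivative
    agrees with the derivative \<open>D\<close> of that piece.\<close>
  have piece: "\<exists>i<m. a i \<le> t \<and> t < a (Suc i)
      \<and> (\<exists>D. continuous_on {a i..a (Suc i)} D
        \<and> (\<forall>s\<in>{a i..<a (Suc i)}. ((\<lambda>s. T s x) has_vector_derivative D s) (at_right s) \<and> op_deriv T s x = D s)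
        \<and> (\<forall>s\<in>{a i<..<a (Suc i)}. ((\<lambda>s. T s x) has_vector_derivative D s) (at s)))"
    if t: "t \<in> {0..<1}" and x: "x \<in> V" for t x
  proof -
    obtain i where i: "i < m" "a i \<le> t" "t < a (Suc i)"
      using interval_piece[of a t m] t a by auto
    obtain D where D: "continuous_on {a i..a (Suc i)} D"
      "\<And>t. t \<in> {a i..a (Suc i)} \<Longrightarrow> ((\<lambda>s. T s x) has_vector_derivative D t) (at t within {a i..a (Suc i)})"
      using a(4)[OF i(1)] x unfolding strongly_C1_on_def by blast
    have right: "((\<lambda>s. T s x) has_vector_derivative D s) (at_right s)" if "s \<in> {a i..<a (Suc i)}" for s
    proof -
      have "((\<lambda>s. T s x) has_vector_derivative D s) (at s within {s..a (Suc i)})"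
        using D(2)[of s] that by (auto intro: has_vector_derivative_within_subset)
      then show ?thesis using that at_within_Icc_at_right[of s "a (Suc i)"] by simp
    qed
    have "((\<lambda>s. T s x) has_vector_derivative D s) (at s)" if "s \<in> {a i<..<a (Suc i)}" for s
      using D(2)[of s] that at_within_Icc_at[of "a i" s "a (Suc i)"] by auto
    then show ?thesis using i D(1) right op_deriv_eq[where T = T and x = x, OF right] by blast
  qed
  have derR: "((\<lambda>s. T s x) has_vector_derivative op_deriv T t x) (at_right t)"
    if "t \<in> {0..<1}" "x \<in> V" for t x
    using piece[OF that] by fastforce
  \<comment> \<open>Off the break points \<open>t\<close> is interior to one piece, and near
    \<open>t\<close> the function \<open>op_deriv\<close> coincides with the continuous
    \<open>D\<close> of that piece.\<close>
  have der: "0 < t \<and> t < 1 \<and> ((\<lambda>s. T s x) has_vector_derivative op_deriv T t x) (at t)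
      \<and> isCont (\<lambda>s. op_deriv T s x) t" if t: "t \<in> {0..1} - S" and x: "x \<in> V" for t x
  proof -
    have "t \<noteq> a 0" "t \<noteq> a m" using t by (auto simp: S_def)
    then have t01: "0 < t" "t < 1" using t a by auto
    obtain i D where i: "i < m" "a i \<le> t" "t < a (Suc i)" and D: "continuous_on {a i..a (Suc i)} D"
      "\<And>s. s \<in> {a i..<a (Suc i)} \<Longrightarrow> op_deriv T s x = D s"
      "\<And>s. s \<in> {a i<..<a (Suc i)} \<Longrightarrow> ((\<lambda>s. T s x) has_vector_derivative D s) (at s)"
      using piece[of t x] t01 x by auto
    have "a i \<noteq> t" using t i by (auto simp: S_def)
    then have ti: "t \<in> {a i<..<a (Suc i)}" using i by auto
    have "isCont D t"
      using continuous_on_interior[OF D(1), of t] ti by simp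
    moreover have "\<forall>\<^sub>F s in nhds t. op_deriv T s x = D s"
      using eventually_nhds_in_open[OF open_greaterThanLessThan ti]
      by eventually_elim (rule D(2), auto)
    ultimately show ?thesis using D(3)[OF ti] D(2)[of t] ti t01 by (simp add: isCont_cong)
  qed
  have opd: "op_deriv T t \<in> bounded_ops V W \<and> (\<forall>x\<in>V. norm (op_deriv T t x) \<le> L * norm x)"
    if t: "t \<in> {0..<1}" for t
  proof -
    have ev: "\<forall>\<^sub>F s in at_right t. s \<in> {0<..<1} \<and> s \<noteq> t"
      using t by (auto simp: eventually_at_right_field intro!: exI[of _ 1])
    have lim: "((\<lambda>s. (1 / (s - t)) *\<^sub>R (T s x - T t x)) \<longlongrightarrow> op_deriv T t x) (at_right t)" if "x \<in> V" for x
      using derR[OF t that] by (simp only: has_vector_derivative_iff_quotient)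
    have bound: "norm (op_deriv T t x) \<le> L * norm x" if x: "x \<in> V" for x
    proof (rule tendsto_upperbound[OF tendsto_norm[OF lim[OF x]]])
      show "\<forall>\<^sub>F s in at_right t. norm ((1 / (s - t)) *\<^sub>R (T s x - T t x)) \<le> L * norm x"
        using ev by eventually_elim (use quot t x in auto)
    qed simp
    have unique: "op_deriv T t x = d" if "x \<in> V" "((\<lambda>s. (1 / (s - t)) *\<^sub>R (T s x - T t x)) \<longlongrightarrow> d) (at_right t)" for x d
      using tendsto_unique[OF _ lim[OF that(1)] that(2)] by simp
    have "op_deriv T t \<in> bounded_ops V W"
    proof (rule bounded_opsI[where K = L])
      fix x assume x: "x \<in> V"
      show "op_deriv T t x \<in> W"
      proof (rule Lim_in_closed_set[OF complete_imp_closed[OF W(2)] _ _ lim[OF x]])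
        show "\<forall>\<^sub>F s in at_right t. (1 / (s - t)) *\<^sub>R (T s x - T t x) \<in> W"
          using ev
        proof eventually_elim
          case (elim s)
          have "T s x \<in> W" "T t x \<in> W" using bounded_ops_mem[OF T x] elim t by auto
          then show ?case by (intro subspace_scaleR W complex_vector.subspace_diff)
        qed
      qed simp
    next
      fix x y assume xy: "x \<in> V" "y \<in> V"
      show "op_deriv T t (x + y) = op_deriv T t x + op_deriv T t y"
      proof (rule unique)
        have "\<forall>\<^sub>F s in at_right t. (1 / (s - t)) *\<^sub>R (T s x - T t x) + (1 / (s - t)) *\<^sub>R (T s y - T t y)
            = (1 / (s - t)) *\<^sub>R (T s (x + y) - T t (x + y))"
          using ev
        proof eventually_elim
          case (elim s)
          have "T s (x + y) = T s x + T s y" "T t (x + y) = T t x + T t y"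
            using bounded_ops_add[OF T xy] elim t by auto
          then show ?case by (simp add: algebra_simps)
        qed
        then show "((\<lambda>s. (1 / (s - t)) *\<^sub>R (T s (x + y) - T t (x + y)))
            \<longlongrightarrow> op_deriv T t x + op_deriv T t y) (at_right t)"
          by (rule Lim_transform_eventually[OF tendsto_add[OF lim[OF xy(1)] lim[OF xy(2)]]])
      qed (rule complex_vector.subspace_add[OF V(1) xy])
    next
      fix c x assume x: "x \<in> V"
      have "bounded_linear (\<lambda>y. c *\<^sub>C (y::'b))"
        by (rule bounded_linear_intro[where K = "cmod c"])
          (auto simp: scaleC_add_right scaleC_scaleR_commute norm_scaleC mult.commute)
      from bounded_linear.tendsto[OF this lim[OF x]]
      have lim': "((\<lambda>s. c *\<^sub>C (1 / (s - t)) *\<^sub>R (T s x - T t x)) \<longlongrightarrow> c *\<^sub>C op_deriv T t x) (at_right t)" .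
      show "op_deriv T t (c *\<^sub>C x) = c *\<^sub>C op_deriv T t x"
      proof (rule unique)
        have "\<forall>\<^sub>F s in at_right t. c *\<^sub>C (1 / (s - t)) *\<^sub>R (T s x - T t x)
            = (1 / (s - t)) *\<^sub>R (T s (c *\<^sub>C x) - T t (c *\<^sub>C x))"
          using ev
        proof eventually_elim
          case (elim s)
          have "T s (c *\<^sub>C x) = c *\<^sub>C T s x" "T t (c *\<^sub>C x) = c *\<^sub>C T t x"
            using bounded_ops_scaleC[OF T x] elim t by auto
          then show ?case
            by (simp add: scaleC_scaleR_commute complex_vector.scale_right_diff_distrib)
        qed
        then show "((\<lambda>s. (1 / (s - t)) *\<^sub>R (T s (c *\<^sub>C x) - T t (c *\<^sub>C x)))
            \<longlongrightarrow> c *\<^sub>C op_deriv T t x) (at_right t)"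
          by (rule Lim_transform_eventually[OF lim'])
      qed (rule complex_vector.subspace_scale[OF V(1) x])
    qed (rule bound)
    then show ?thesis using bound by blast
  qed
  have "C1_family V W L S T"
    unfolding C1_family_def
  proof (intro conjI ballI)
    fix t :: real assume t: "t \<in> {0..<1}"
    show "op_deriv T t \<in> bounded_ops V W" using opd[OF t] ..
    fix x assume x: "x \<in> V"
    show "norm (op_deriv T t x) \<le> L * norm x" using opd[OF t] x by blast
    show "((\<lambda>s. T s x) has_vector_derivative op_deriv T t x) (at_right t)" by (rule derR[OF t x])
  next
    fix t assume t: "t \<in> {0..1} - S"
    show "0 < t" "t < 1" using der[OF t complex_vector.subspace_0[OF V(1)]] by auto
    fix x assume x: "x \<in> V"
    show "((\<lambda>s. T s x) has_vector_derivative op_deriv T t x) (at t)"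
      "isCont (\<lambda>s. op_deriv T s x) t" using der[OF t x] by auto
  qed (use L(1) lips T in \<open>auto simp: S_def\<close>)
  then show ?thesis using that by blast
qed

section \<open>Cyclic sums\<close>

text \<open>Cyclic composability, written as one equation between lists, commutes with
  \<open>rotate1\<close>; invariance under rotation is then immediate.\<close>

lemma cyclic_tuples_iff:
  "fs \<in> cyclic_tuples C n \<longleftrightarrow> length fs = Suc n \<and> set fs \<subseteq> Arr C
     \<and> map (Dom C) fs = rotate1 (map (Cod C) fs)"
proof -
  have "map (Dom C) fs = rotate1 (map (Cod C) fs)
      \<longleftrightarrow> (\<forall>i<n. Dom C (fs ! i) = Cod C (fs ! Suc i)) \<and> Dom C (fs ! n) = Cod C (fs ! 0)"
    if len: "length fs = Suc n"
  proof -
    have "map (Dom C) fs = rotate1 (map (Cod C) fs)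
        \<longleftrightarrow> (\<forall>i<Suc n. Dom C (fs ! i) = Cod C (fs ! (Suc i mod Suc n)))"
      using len by (auto simp: list_eq_iff_nth_eq nth_rotate1 nth_map)
    moreover have "Suc i mod Suc n = (if i < n then Suc i else 0)" if "i < Suc n" for i
      using that by (cases "i = n") auto
    ultimately show ?thesis by (auto simp: less_Suc_eq)
  qed
  then show ?thesis unfolding cyclic_tuples_def by auto
qed

lemma cyclic_tuples_length: "fs \<in> cyclic_tuples C n \<Longrightarrow> length fs = Suc n"
  by (simp add: cyclic_tuples_def)

lemma cyclic_tuples_rotate1: "fs \<in> cyclic_tuples C n \<Longrightarrow> rotate1 fs \<in> cyclic_tuples C n"
  by (simp add: cyclic_tuples_iff rotate1_map[symmetric])

lemma cyclic_tuples_rotate: "fs \<in> cyclic_tuples C n \<Longrightarrow> rotate j fs \<in> cyclic_tuples C n"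
  by (induction j) (simp_all add: cyclic_tuples_rotate1)

lemma cyclic_tuples_replace:
  assumes "us @ f # vs \<in> cyclic_tuples C n" "g \<in> Hom C (Dom C f) (Cod C f)"
  shows "us @ g # vs \<in> cyclic_tuples C n"
  using assms by (auto simp: cyclic_tuples_iff Hom_def)

text \<open>The inner faces of the cyclic nerve as they occur in \<open>coboundary\<close>, named so
  that they can be commuted with rotations.\<close>

definition contract :: "('o, 'm) linear_cat \<Rightarrow> nat \<Rightarrow> 'm list \<Rightarrow> 'm list" where
  "contract C i fs = take i fs @ [Comp C (fs ! i) (fs ! Suc i)] @ drop (Suc (Suc i)) fs"

lemma contract_append: "contract C (length us) (us @ f # g # vs) = us @ Comp C f g # vs"
  by (simp add: contract_def nth_append)

lemma contract_0: "contract C 0 (f # g # gs) = Comp C f g # gs"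
  by (simp add: contract_def)

lemma contract_Suc: "contract C (Suc k) (f # gs) = f # contract C k gs"
  by (simp add: contract_def)

lemma split_at_two:
  assumes "Suc i < length fs"
  obtains us f g vs where "fs = us @ f # g # vs" "length us = i"
proof -
  have "fs = take i fs @ fs ! i # fs ! Suc i # drop (Suc (Suc i)) fs"
    using assms by (metis Cons_nth_drop_Suc Suc_lessD append_take_drop_id)
  then show ?thesis using that assms by (metis Suc_lessD length_take min.absorb4)
qed

text \<open>The rotation stops before the merged pair, which only moves \<open>j\<close> places
  towards the front.\<close>

lemma rotate_contract_le:
  assumes "j \<le> i" "Suc i < length fs"
  shows "rotate j (contract C i fs) = contract C (i - j) (rotate j fs)"
proof -
  obtain xs f g vs where fs: "fs = xs @ f # g # vs" and xs: "length xs = i"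
    using split_at_two[OF assms(2)] .
  define us ws where "us = take j xs" and "ws = drop j xs"
  have eq: "xs = us @ ws" "length us = j" "length ws = i - j"
    using assms(1) xs by (auto simp: us_def ws_def)
  have "rotate j (contract C i fs) = rotate (length us) (us @ (ws @ Comp C f g # vs))"
    using contract_append[of C xs f g vs] xs fs eq by simp
  also have "\<dots> = ws @ Comp C f g # vs @ us" by (subst rotate_append) simp
  also have "\<dots> = contract C (length ws) (ws @ f # g # vs @ us)" by (simp add: contract_append)
  also have "ws @ f # g # vs @ us = rotate (length us) (us @ (ws @ f # g # vs))"
    by (subst rotate_append) simp
  finally show ?thesis using eq fs by simp
qed

text \<open>The rotation carries the merged entry to the back; in the unmerged list this takes one
  step more, as the pair occupies two places.\<close>

lemma rotate_contract_gt:
  assumes "i < j" "length fs = Suc (Suc N)" "j \<le> N"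
  shows "rotate j (contract C i fs) = contract C (Suc N + i - j) (rotate (Suc j) fs)"
proof -
  have "Suc i < length fs" using assms by simp
  then obtain us f g xs where fs: "fs = us @ f # g # xs" and us: "length us = i"
    by (rule split_at_two)
  define vs ws where "vs = take (j - i - 1) xs" and "ws = drop (j - i - 1) xs"
  have len: "length xs = N - i" using fs us assms by auto
  have eq: "xs = vs @ ws" "length vs = j - i - 1" "length ws = Suc N - j"
    using assms len by (auto simp: vs_def ws_def)
  have "rotate j (contract C i fs) = rotate (length (us @ Comp C f g # vs)) ((us @ Comp C f g # vs) @ ws)"
    using contract_append[of C us f g xs] us fs eq assms(1) by simp
  also have "\<dots> = ws @ us @ Comp C f g # vs" by (subst rotate_append) simp
  also have "\<dots> = contract C (length (ws @ us)) ((ws @ us) @ f # g # vs)"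
    unfolding contract_append by simp
  also have "(ws @ us) @ f # g # vs = rotate (length (us @ f # g # vs)) ((us @ f # g # vs) @ ws)"
    by (subst rotate_append) simp
  finally show ?thesis using eq fs us assms by (simp add: add.commute)
qed

text \<open>The last face merges across the end of the list. For \<open>j = 0\<close> the last entry
  is brought to the front and the face becomes the contraction at 0; for \<open>j > 0\<close> the
  rotation itself puts the two entries side by side.\<close>

lemma rotate_contract_last:
  assumes len: "length fs = Suc (Suc N)" and j: "j \<le> N"
  shows "rotate j (Comp C (last fs) (hd fs) # butlast (tl fs)) = (if j = 0 then contract C 0 (rotate (Suc N) fs)
    else contract C (Suc N - j) (rotate j fs))"
proof -
  obtain h ys where hy: "fs = h # ys" using len by (cases fs) auto
  then have "ys \<noteq> []" using len by auto
  then obtain ms l where fs: "fs = h # ms @ [l]" using hy by (metis append_butlast_last_id)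
  have ms: "length ms = N" using fs len by simp
  have X: "Comp C (last fs) (hd fs) # butlast (tl fs) = Comp C l h # ms" by (simp add: fs)
  show ?thesis
  proof (cases "j = 0")
    case True
    have "rotate (Suc N) fs = rotate (length (h # ms)) ((h # ms) @ [l])" using fs ms by simp
    also have "\<dots> = l # h # ms" by (subst rotate_append) simp
    finally show ?thesis using True X by (simp add: contract_0)
  next
    case False
    define us ws where "us = take (j - 1) ms" and "ws = drop (j - 1) ms"
    have eq: "ms = us @ ws" "length us = j - 1" "length ws = Suc N - j"
      using False j ms by (auto simp: us_def ws_def)
    have "rotate j (Comp C l h # ms) = rotate (length (Comp C l h # us)) ((Comp C l h # us) @ ws)"
      using eq False by simp
    also have "\<dots> = ws @ Comp C l h # us" by (subst rotate_append) simp
    also have "\<dots> = contract C (length ws) (ws @ l # h # us)" by (simp add: contract_append)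
    also have "ws @ l # h # us = rotate (length (h # us)) ((h # us) @ (ws @ [l]))"
      by (subst rotate_append) simp
    also have "\<dots> = rotate j fs" using eq fs False by simp
    finally show ?thesis unfolding X using False eq by simp
  qed
qed

lemma minus_one_power_cong: "even (a + b) \<Longrightarrow> (-1 :: complex) ^ a = (-1) ^ b"
  by (simp add: minus_one_power_iff)

text \<open>
  The identity \<open>b N = N b'\<close>, where \<open>N\<close> is the signed sum over all rotations and \<open>b'\<close> the Hochschild
  coboundary without its last term.
\<close>

lemma coboundary_cyclic_sum:
  fixes \<kappa> :: "'m list \<Rightarrow> complex"
  assumes len: "length fs = Suc (Suc N)"
    and \<psi>: "\<And>gs. length gs = Suc N \<Longrightarrow> \<psi> gs = (\<Sum>j\<le>N. (-1) ^ (j * N) * \<kappa> (rotate j gs))"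
  shows "(\<Sum>i\<le>N. (-1) ^ i * \<psi> (contract C i fs))
      + (-1) ^ Suc N * \<psi> (Comp C (last fs) (hd fs) # butlast (tl fs))
    = (\<Sum>r\<le>Suc N. (-1) ^ (r * Suc N) * (\<Sum>k\<le>N. (-1) ^ k * \<kappa> (contract C k (rotate r fs))))"
proof -
  let ?X = "Comp C (last fs) (hd fs) # butlast (tl fs)"
  \<comment> \<open>The cyclic face receives the index \<open>Suc N\<close>, so that all faces form
    a single sum.\<close>
  define Y where "Y i = (if i = Suc N then ?X else contract C i fs)" for i
  have lenY: "length (Y i) = Suc N" if "i \<le> Suc N" for i
    using that len by (auto simp: Y_def contract_def min_def)
  let ?S = "{..Suc N} \<times> {..N}"
  \<comment> \<open>Rotation \<open>j\<close> of face \<open>i\<close> is contraction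
    \<open>k\<close> of rotation \<open>r\<close> for \<open>(r, k) = ?f (i, j)\<close>, by the
    rules commuting rotations with faces; \<open>?g\<close> is the inverse map.\<close>
  let ?f = "\<lambda>(i, j). if i = Suc N \<and> j = 0 then (Suc N, 0)
      else if j \<le> i then (j, i - j) else (Suc j, Suc N + i - j)"
  let ?g = "\<lambda>(r, k). if r = Suc N \<and> k = 0 then (Suc N, 0)
      else if r + k \<le> Suc N then (r + k, r) else (r + k - Suc (Suc N), r - 1)"
  have "(\<Sum>i\<le>N. (-1) ^ i * \<psi> (contract C i fs)) + (-1) ^ Suc N * \<psi> ?X
      = (\<Sum>i\<le>Suc N. (-1) ^ i * \<psi> (Y i))"
    by (simp add: Y_def)
  also have "\<dots> = (\<Sum>i\<le>Suc N. \<Sum>j\<le>N. (-1) ^ (i + j * N) * \<kappa> (rotate j (Y i)))"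
    by (intro sum.cong refl, subst \<psi>[OF lenY]) (simp_all add: sum_distrib_left power_add mult.assoc)
  also have "\<dots> = (\<Sum>(i, j)\<in>?S. (-1) ^ (i + j * N) * \<kappa> (rotate j (Y i)))"
    by (rule sum.cartesian_product)
  also have "\<dots> = (\<Sum>(r, k)\<in>?S. (-1) ^ (r * Suc N + k) * \<kappa> (contract C k (rotate r fs)))"
  proof (rule sum.reindex_bij_witness[of _ ?g ?f])
    fix p assume "p \<in> ?S"
    then obtain i j where p: "p = (i, j)" "i \<le> Suc N" "j \<le> N" by auto
    show "?g (?f p) = p" "?f p \<in> ?S" "?f (?g p) = p" "?g p \<in> ?S"
      using p by (auto split: if_splits)
    show "(case ?f p of (r, k) \<Rightarrow> (-1) ^ (r * Suc N + k) * \<kappa> (contract C k (rotate r fs)))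
        = (case p of (i, j) \<Rightarrow> (-1) ^ (i + j * N) * \<kappa> (rotate j (Y i)))"
    proof -
      consider "i = Suc N" "j = 0" | "i = Suc N" "j \<noteq> 0" | "i \<le> N" "j \<le> i" | "i \<le> N" "i < j"
        using p by linarith
      then show ?thesis
      proof cases
        case 1
        have "(-1 :: complex) ^ (Suc N * Suc N) = (-1) ^ Suc N"
          by (rule minus_one_power_cong) simp
        then show ?thesis
          using 1 p rotate_contract_last[OF len p(3), of C] by (simp add: Y_def)
      next
        case 2
        have "even (j * Suc N + (Suc N - j) + (Suc N + j * N))" using p by auto
        then have "(-1 :: complex) ^ (j * Suc N + (Suc N - j)) = (-1) ^ (Suc N + j * N)"
          by (rule minus_one_power_cong)
        then show ?thesis
          using 2 p rotate_contract_last[OF len p(3), of C] by (simp add: Y_def)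
      next
        case 3
        have "even (j * Suc N + (i - j) + (i + j * N))" using 3 by auto
        then have "(-1 :: complex) ^ (j * Suc N + (i - j)) = (-1) ^ (i + j * N)"
          by (rule minus_one_power_cong)
        then show ?thesis
          using 3 p rotate_contract_le[OF 3(2), of fs C] len by (simp add: Y_def)
      next
        case 4
        have "even (Suc j * Suc N + (Suc N + i - j) + (i + j * N))" using 4 p by auto
        then have "(-1 :: complex) ^ (Suc j * Suc N + (Suc N + i - j)) = (-1) ^ (i + j * N)"
          by (rule minus_one_power_cong)
        then show ?thesis
          using 4 p rotate_contract_gt[OF 4(2) len p(3), of C] by (simp add: Y_def)
      qed
    qed
  qed
  also have "\<dots> = (\<Sum>r\<le>Suc N. \<Sum>k\<le>N. (-1) ^ (r * Suc N + k) * \<kappa> (contract C k (rotate r fs)))"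
    by (rule sum.cartesian_product[symmetric])
  also have "\<dots> = (\<Sum>r\<le>Suc N. (-1) ^ (r * Suc N) * (\<Sum>k\<le>N. (-1) ^ k * \<kappa> (contract C k (rotate r fs))))"
    by (simp add: sum_distrib_left power_add mult.assoc)
  finally show ?thesis .
qed

lemma sum_rotate_shift:
  fixes F :: "'m list \<Rightarrow> 'b::ab_group_add"
  assumes "length fs = Suc n"
  shows "(\<Sum>r\<le>n. F (rotate (Suc r) fs)) = (\<Sum>r\<le>n. F (rotate r fs))"
proof -
  have "rotate (Suc n) fs = rotate 0 fs" using assms by (simp only: rotate_id mod_self mod_0)
  then show ?thesis
    using sum.atMost_Suc_shift[of "\<lambda>r. F (rotate r fs)" n] by simp
qed

section \<open>Multilinear forms on cyclic tuples\<close>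

text \<open>The linearity conditions of \<open>cochains\<close> with the list split at the entry
  instead of updated at an index. In this form a rotation needs only a case distinction on
  \<open>us\<close>, and the recursion of operator products matches it.\<close>

definition multilinear :: "('o, 'm) linear_cat \<Rightarrow> nat \<Rightarrow> ('m list \<Rightarrow> complex) \<Rightarrow> bool" where
  "multilinear C n \<phi> \<longleftrightarrow>
     (\<forall>us f g vs. us @ f # vs \<in> cyclic_tuples C n \<longrightarrow> g \<in> Hom C (Dom C f) (Cod C f)
        \<longrightarrow> \<phi> (us @ Plus C f g # vs) = \<phi> (us @ f # vs) + \<phi> (us @ g # vs))
     \<and> (\<forall>us f vs a. us @ f # vs \<in> cyclic_tuples C n
        \<longrightarrow> \<phi> (us @ Scale C a f # vs) = a * \<phi> (us @ f # vs))"

lemma cochains_multilinear: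
  assumes m: "multilinear C n \<phi>" and z: "\<And>fs. fs \<notin> cyclic_tuples C n \<Longrightarrow> \<phi> fs = 0"
  shows "\<phi> \<in> cochains C n"
  unfolding cochains_def
proof (intro CollectI conjI allI impI ballI)
  fix fs i assume fs: "fs \<in> cyclic_tuples C n" and i: "i \<le> n"
  have len: "i < length fs" using cyclic_tuples_length[OF fs] i by simp
  have split: "fs = take i fs @ fs ! i # drop (Suc i) fs" using len by (rule id_take_nth_drop)
  have upd: "fs[i := x] = take i fs @ x # drop (Suc i) fs" for x
    using len by (rule upd_conv_take_nth_drop)
  show "\<phi> (fs[i := Plus C (fs ! i) g]) = \<phi> fs + \<phi> (fs[i := g])"
    if "g \<in> Hom C (Dom C (fs ! i)) (Cod C (fs ! i))" for g
    using m fs that split unfolding multilinear_def upd by metis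
  show "\<phi> (fs[i := Scale C a (fs ! i)]) = a * \<phi> fs" for a
    using m fs split unfolding multilinear_def upd by metis
qed (rule z)

lemma multilinear_rotate1:
  assumes m: "multilinear C n \<phi>"
  shows "multilinear C n (\<lambda>fs. \<phi> (rotate1 fs))"
  unfolding multilinear_def
proof (intro conjI allI impI)
  fix us f vs assume "us @ f # vs \<in> cyclic_tuples C n"
  then have r: "rotate1 (us @ f # vs) \<in> cyclic_tuples C n" by (rule cyclic_tuples_rotate1)
  show "\<phi> (rotate1 (us @ Plus C f g # vs)) = \<phi> (rotate1 (us @ f # vs)) + \<phi> (rotate1 (us @ g # vs))"
    if "g \<in> Hom C (Dom C f) (Cod C f)" for g
    using m r that unfolding multilinear_def by (cases us) auto
  show "\<phi> (rotate1 (us @ Scale C a f # vs)) = a * \<phi> (rotate1 (us @ f # vs))" for a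
    using m r unfolding multilinear_def by (cases us) auto
qed

lemma multilinear_rotate: "multilinear C n \<phi> \<Longrightarrow> multilinear C n (\<lambda>fs. \<phi> (rotate j fs))"
proof (induction j)
  case (Suc j)
  from multilinear_rotate1[OF Suc.IH[OF Suc.prems]] show ?case
    by (simp add: rotate1_rotate_swap)
qed simp

lemma multilinear_sum:
  assumes "\<And>i. i \<in> A \<Longrightarrow> multilinear C n (\<phi> i)"
  shows "multilinear C n (\<lambda>fs. \<Sum>i\<in>A. c i * \<phi> i fs)"
  using assms unfolding multilinear_def
  by (simp add: sum.distrib[symmetric] sum_distrib_left distrib_left mult.left_commute cong: sum.cong)

section \<open>Cyclic cocycles and cohomology classes\<close>

context linear_category
begin

lemma cyclic_tuples_hom:
  assumes "us @ f # vs \<in> cyclic_tuples C n"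
  shows "f \<in> Hom C (Dom C f) (Cod C f)"
  using assms by (auto simp: cyclic_tuples_iff Hom_def)

lemma cyclic_tuples_plus:
  assumes "us @ f # vs \<in> cyclic_tuples C n" "g \<in> Hom C (Dom C f) (Cod C f)"
  shows "us @ Plus C f g # vs \<in> cyclic_tuples C n"
  using cyclic_tuples_replace[OF assms(1) plus_hom[OF cyclic_tuples_hom[OF assms(1)] assms(2)]] .

lemma cyclic_tuples_scale:
  assumes "us @ f # vs \<in> cyclic_tuples C n"
  shows "us @ Scale C a f # vs \<in> cyclic_tuples C n"
  using cyclic_tuples_replace[OF assms scale_hom[OF cyclic_tuples_hom[OF assms]]] .

lemma cochains_restrict:
  assumes "multilinear C n \<phi>"
  shows "(\<lambda>fs. if fs \<in> cyclic_tuples C n then \<phi> fs else 0) \<in> cochains C n"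
proof (rule cochains_multilinear)
  show "multilinear C n (\<lambda>fs. if fs \<in> cyclic_tuples C n then \<phi> fs else 0)"
    using assms unfolding multilinear_def
    by (auto simp: cyclic_tuples_plus cyclic_tuples_scale dest: cyclic_tuples_replace)
qed simp

lemma comp_Hom:
  assumes "f \<in> Arr C" "g \<in> Arr C" "Dom C f = Cod C g"
  shows "Comp C f g \<in> Arr C" "Dom C (Comp C f g) = Dom C g" "Cod C (Comp C f g) = Cod C f"
  using comp_hom[of g "Dom C g" "Cod C g" f "Cod C f"] assms by (auto simp: Hom_def)

lemma contract_cyclic_tuples:
  assumes fs: "fs \<in> cyclic_tuples C (Suc n)" and i: "i \<le> n"
  shows "contract C i fs \<in> cyclic_tuples C n"
proof -
  have "Suc i < length fs" using cyclic_tuples_length[OF fs] i by simp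
  then obtain us f g vs where eq: "fs = us @ f # g # vs" and us: "length us = i"
    by (rule split_at_two)
  note cyc = fs[unfolded eq cyclic_tuples_iff]
  have fg: "f \<in> Arr C" "g \<in> Arr C" using cyc by auto
  have "Dom C f = Cod C g \<and> map (Dom C) us @ Dom C g # map (Dom C) vs
      = rotate1 (map (Cod C) us @ Cod C f # map (Cod C) vs)"
  proof (cases us)
    case Nil
    then show ?thesis using cyc by auto
  next
    case (Cons u us')
    have "map (Dom C) us @ (Dom C f # Dom C g # map (Dom C) vs)
        = (map (Cod C) us' @ [Cod C f]) @ (Cod C g # map (Cod C) vs @ [Cod C u])"
      using cyc Cons by simp
    then have "map (Dom C) us = map (Cod C) us' @ [Cod C f]
        \<and> Dom C f # Dom C g # map (Dom C) vs = Cod C g # map (Cod C) vs @ [Cod C u]"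
      by (subst (asm) append_eq_append_conv) (simp_all add: Cons)
    then show ?thesis using Cons by simp
  qed
  then show ?thesis
    using cyc comp_Hom[OF fg] us contract_append[of C us f g vs] by (auto simp: eq cyclic_tuples_iff)
qed

text \<open>The last face is an inner contraction of a rotated tuple, so the previous lemma covers
  it.\<close>

lemma contract_last_cyclic_tuples:
  assumes fs: "fs \<in> cyclic_tuples C (Suc n)"
  shows "Comp C (last fs) (hd fs) # butlast (tl fs) \<in> cyclic_tuples C n"
proof -
  have "Comp C (last fs) (hd fs) # butlast (tl fs) = contract C 0 (rotate (Suc n) fs)"
    using rotate_contract_last[OF cyclic_tuples_length[OF fs], of 0 C] by (simp del: rotate_Suc)
  then show ?thesis
    using contract_cyclic_tuples[OF cyclic_tuples_rotate[OF fs], of 0 "Suc n"]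
    by (simp del: rotate_Suc)
qed

lemma coboundary_eq:
  assumes "fs \<in> cyclic_tuples C (Suc n)"
  shows "coboundary C n \<phi> fs = (\<Sum>i\<le>n. (-1) ^ i * \<phi> (contract C i fs))
    + (-1) ^ Suc n * \<phi> (Comp C (last fs) (hd fs) # butlast (tl fs))"
  using assms by (simp add: coboundary_def contract_def)

lemma coboundary_scale: "coboundary C n (\<lambda>fs. c * \<phi> fs) fs = c * coboundary C n \<phi> fs"
  by (simp add: coboundary_def sum_distrib_left algebra_simps)

lemma coboundary_add:
  "coboundary C n (\<lambda>fs. \<phi> fs + \<psi> fs) fs = coboundary C n \<phi> fs + coboundary C n \<psi> fs"
  by (simp add: coboundary_def algebra_simps sum.distrib)

lemma cyclic_cochains_scale:
  assumes "\<phi> \<in> cyclic_cochains C n"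
  shows "(\<lambda>fs. c * \<phi> fs) \<in> cyclic_cochains C n"
  using assms unfolding cyclic_cochains_def cochains_def cyclic_op_def fun_eq_iff
  by (simp add: algebra_simps) (metis mult.left_commute mult_zero_right)

lemma cyclic_cochains_add:
  assumes "\<phi> \<in> cyclic_cochains C n" "\<psi> \<in> cyclic_cochains C n"
  shows "(\<lambda>fs. \<phi> fs + \<psi> fs) \<in> cyclic_cochains C n"
  using assms unfolding cyclic_cochains_def cochains_def cyclic_op_def fun_eq_iff
  by (simp add: algebra_simps) (metis add.right_neutral distrib_left)

lemma cyclic_cocycles_scale:
  assumes "\<phi> \<in> cyclic_cocycles C n"
  shows "(\<lambda>fs. c * \<phi> fs) \<in> cyclic_cocycles C n"
  using assms cyclic_cochains_scale coboundary_scale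
  unfolding cyclic_cocycles_def fun_eq_iff by simp

lemma cyclic_coboundaries_Suc:
  "\<phi> \<in> cyclic_coboundaries C (Suc n) \<longleftrightarrow> (\<exists>\<psi>\<in>cyclic_cochains C n. \<forall>fs. \<phi> fs = coboundary C n \<psi> fs)"
  unfolding cyclic_coboundaries_def by (auto simp: fun_eq_iff image_iff)

text \<open>Coboundaries form a linear space. The degree is written \<open>Suc n\<close> because
  \<open>cyclic_coboundaries\<close> treats degree 0 separately.\<close>

lemma equiv_cohomologous: "equiv (cyclic_cocycles C (Suc n)) (cohomologous C (Suc n))"
proof (rule equivI)
  let ?B = "cyclic_coboundaries C (Suc n)"
  have scale: "(\<lambda>fs. c * \<phi> fs) \<in> ?B" if h: "\<phi> \<in> ?B" for \<phi> c
  proof -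
    obtain \<alpha> where "\<alpha> \<in> cyclic_cochains C n" "\<And>fs. \<phi> fs = coboundary C n \<alpha> fs"
      using h unfolding cyclic_coboundaries_Suc by blast
    then show ?thesis
      unfolding cyclic_coboundaries_Suc
      by (intro bexI[of _ "\<lambda>fs. c * \<alpha> fs"]) (auto simp: coboundary_scale cyclic_cochains_scale)
  qed
  have add: "(\<lambda>fs. \<phi> fs + \<psi> fs) \<in> ?B" if h: "\<phi> \<in> ?B" "\<psi> \<in> ?B" for \<phi> \<psi>
  proof -
    obtain \<alpha> \<beta> where "\<alpha> \<in> cyclic_cochains C n" "\<And>fs. \<phi> fs = coboundary C n \<alpha> fs"
      "\<beta> \<in> cyclic_cochains C n" "\<And>fs. \<psi> fs = coboundary C n \<beta> fs"
      using h unfolding cyclic_coboundaries_Suc by blast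
    then show ?thesis
      unfolding cyclic_coboundaries_Suc
      by (intro bexI[of _ "\<lambda>fs. \<alpha> fs + \<beta> fs"]) (auto simp: coboundary_add cyclic_cochains_add)
  qed
  show "cohomologous C (Suc n) \<subseteq> cyclic_cocycles C (Suc n) \<times> cyclic_cocycles C (Suc n)"
    by (auto simp: cohomologous_def)
  have zero: "(\<lambda>_. 0) \<in> ?B"
  proof -
    have "(\<lambda>_. 0) \<in> cyclic_cochains C n"
      by (auto simp: cyclic_cochains_def cochains_def cyclic_op_def fun_eq_iff)
    moreover have "coboundary C n (\<lambda>_. 0) fs = 0" for fs by (simp add: coboundary_def)
    ultimately show ?thesis unfolding cyclic_coboundaries_Suc by force
  qed
  show "refl_on (cyclic_cocycles C (Suc n)) (cohomologous C (Suc n))"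
    using zero by (auto simp: refl_on_def cohomologous_def)
  show "sym (cohomologous C (Suc n))"
    using scale[of _ "- 1"] by (force simp: sym_def cohomologous_def)
  show "trans (cohomologous C (Suc n))"
  proof (rule transI)
    fix \<phi> \<psi> \<omega>
    assume 1: "(\<phi>, \<psi>) \<in> cohomologous C (Suc n)" "(\<psi>, \<omega>) \<in> cohomologous C (Suc n)"
    then have "(\<lambda>fs. (\<phi> fs - \<psi> fs) + (\<psi> fs - \<omega> fs)) \<in> ?B"
      by (intro add) (auto simp: cohomologous_def)
    then show "(\<phi>, \<omega>) \<in> cohomologous C (Suc n)" using 1 by (simp add: cohomologous_def)
  qed
qed

end

section \<open>Characters of pairs of functors\<close>

text \<open>Submultiplicativity with index 0 for \<open>S\<close>: the singular numbers of the
  composite are those of \<open>T\<close> times a constant.\<close>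

lemma trace_class_comp_right:
  assumes T: "T \<in> trace_class V W" and S: "S \<in> bounded_ops U V"
    and V: "complex_vector.subspace V" and W: "complex_vector.subspace W"
    and U: "complex_vector.subspace U"
  shows "(\<lambda>x. T (S x)) \<in> trace_class U W"
proof -
  have Tb: "T \<in> bounded_ops V W" and s: "summable (singular_number V W T)"
    using T by (auto simp: trace_class_def)
  note b = bounded_ops_comp[OF Tb S]
  have "summable (singular_number U W (\<lambda>x. T (S x)))"
  proof (rule summable_comparison_test'[where N = 0])
    show "summable (\<lambda>n. singular_number V W T n * singular_number U V S 0)"
      using s by (rule summable_mult2)
    show "norm (singular_number U W (\<lambda>x. T (S x)) n) \<le> singular_number V W T n * singular_number U V S 0" for n
      using singular_number_comp[OF U V W Tb S, of n 0] singular_number_nonneg[OF U W b] by simp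
  qed
  then show ?thesis using b by (simp add: trace_class_def)
qed

lemma op_trace_sum_scaleC:
  assumes V: "dense_countable V" and T: "\<And>i. i \<in> A \<Longrightarrow> traceable V (T i)"
  shows "traceable V (\<lambda>x. \<Sum>i\<in>A. r i *\<^sub>C T i x)
    \<and> op_trace V (\<lambda>x. \<Sum>i\<in>A. r i *\<^sub>C T i x) = (\<Sum>i\<in>A. r i * op_trace V (T i))"
  using T
proof (induction A rule: infinite_finite_induct)
  case (insert i A)
  have t: "traceable V (\<lambda>x. r i *\<^sub>C T i x)" "traceable V (\<lambda>x. \<Sum>i\<in>A. r i *\<^sub>C T i x)"
    using insert traceable_scaleC by blast+
  show ?case
    using insert traceable_add[OF t] op_trace_add[OF V t] op_trace_scaleC[OF V, of "T i" "r i"] by simp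
qed (use has_trace_op_trace[OF has_trace_zero V] has_trace_zero in \<open>auto simp: traceable_def\<close>)

text \<open>The list version of \<open>word\<close>, in the \<open>foldr\<close> form used by
  \<open>fredholm_character\<close>. Lists serve the algebra of faces and rotations, indexed words
  the analysis.\<close>

definition prod_op :: "('m \<Rightarrow> 'a \<Rightarrow> 'a) \<Rightarrow> 'm list \<Rightarrow> 'a \<Rightarrow> 'a" where
  "prod_op T fs = foldr (\<circ>) (map T fs) id"

lemma prod_op_Nil [simp]: "prod_op T [] x = x"
  by (simp add: prod_op_def)

lemma prod_op_Cons [simp]: "prod_op T (f # fs) x = T f (prod_op T fs x)"
  by (simp add: prod_op_def)

lemma prod_op_append [simp]: "prod_op T (fs @ gs) x = prod_op T fs (prod_op T gs x)"
  by (induction fs) auto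

lemma prod_op_eq_word: "prod_op T fs x = word (\<lambda>i. T (fs ! i)) (length fs) x"
proof (induction fs arbitrary: x rule: rev_induct)
  case (snoc f fs)
  have "word (\<lambda>i. T ((fs @ [f]) ! i)) (length fs) = word (\<lambda>i. T (fs ! i)) (length fs)"
    by (rule word_cong) (simp add: nth_append)
  then show ?case using snoc by simp
qed simp

text \<open>Open paths, as arise when a cyclic tuple is cut after its head.\<close>

fun composable :: "('o, 'm) linear_cat \<Rightarrow> 'm list \<Rightarrow> bool" where
  "composable C [] \<longleftrightarrow> True"
| "composable C [f] \<longleftrightarrow> f \<in> Arr C"
| "composable C (f # g # gs) \<longleftrightarrow> f \<in> Arr C \<and> Dom C f = Cod C g \<and> composable C (g # gs)"

lemma composable_iff_nth:
  "composable C gs \<longleftrightarrow> set gs \<subseteq> Arr C \<and> (\<forall>i. Suc i < length gs \<longrightarrow> Dom C (gs ! i) = Cod C (gs ! Suc i))"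
  by (induction C gs rule: composable.induct) (auto simp: nth_Cons split: nat.splits)

lemma cyclic_tuples_composable:
  assumes "fs \<in> cyclic_tuples C n"
  shows "composable C fs" "Dom C (last fs) = Cod C (hd fs)"
proof -
  have len: "length fs = Suc n" using assms by (rule cyclic_tuples_length)
  then show "composable C fs"
    using assms unfolding composable_iff_nth cyclic_tuples_def by auto
  have "fs \<noteq> []" using len by auto
  then show "Dom C (last fs) = Cod C (hd fs)"
    using assms len by (simp add: cyclic_tuples_def last_conv_nth hd_conv_nth)
qed

lemma composable_tl: "composable C (f # gs) \<Longrightarrow> composable C gs"
  by (cases gs) auto

lemma composable_append: "composable C (fs @ gs) \<Longrightarrow> composable C fs \<and> composable C gs"
proof (induction fs)
  case (Cons f fs)
  then show ?case by (cases fs; cases gs) auto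
qed simp

lemma composable_replace:
  assumes "composable C (us @ f # vs)" "g \<in> Hom C (Dom C f) (Cod C f)"
  shows "composable C (us @ g # vs)"
  using assms
proof (induction us)
  case Nil
  then show ?case by (cases vs) (auto simp: Hom_def)
next
  case (Cons u us)
  then show ?case by (cases us) (auto simp: Hom_def)
qed

lemma composable_contract:
  assumes "linear_category C" "composable C gs" "Suc k < length gs"
  shows "composable C (contract C k gs)" "Dom C (last (contract C k gs)) = Dom C (last gs)"
    "Cod C (hd (contract C k gs)) = Cod C (hd gs)"
proof -
  interpret linear_category C by fact
  have "composable C (contract C k gs) \<and> Dom C (last (contract C k gs)) = Dom C (last gs)
      \<and> Cod C (hd (contract C k gs)) = Cod C (hd gs)"
    using assms(2,3)
  proof (induction gs arbitrary: k)
    case (Cons f gs)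
    then obtain g hs where gs: "gs = g # hs" by (cases gs) auto
    have fg: "f \<in> Arr C" "g \<in> Arr C" "Dom C f = Cod C g"
      using Cons.prems(1) by (cases hs; simp add: gs)+
    show ?case
    proof (cases k)
      case 0
      then show ?thesis
        using Cons.prems(1) comp_Hom[OF fg] by (cases hs) (auto simp: gs contract_0)
    next
      case (Suc l)
      have IH: "composable C (contract C l gs)" "Dom C (last (contract C l gs)) = Dom C (last gs)"
        "Cod C (hd (contract C l gs)) = Cod C g"
        using Cons.IH[of l] Cons.prems Suc by (auto simp: gs)
      obtain y ys where y: "contract C l gs = y # ys" by (cases "contract C l gs") (auto simp: contract_def)
      have "last (f # gs) = last gs" using gs by simp
      then show ?thesis using IH fg by (simp add: Suc contract_Suc y)
    qed
  qed simp
  then show "composable C (contract C k gs)" "Dom C (last (contract C k gs)) = Dom C (last gs)"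
    "Cod C (hd (contract C k gs)) = Cod C (hd gs)" by auto
qed

text \<open>A quasi-homomorphism in the sense of Cuntz: two functors to the same ungraded spaces
  that agree modulo a Schatten class. Grading and \<open>F\<close> have disappeared from the
  data.\<close>

locale quasi_hom = linear_category C
  for C :: "('o, 'm) linear_cat" +
  fixes H :: "'o \<Rightarrow> 'h::complex_inner set" and a b :: "'m \<Rightarrow> 'h \<Rightarrow> 'h" and q :: real
  assumes H: "X \<in> Obj C \<Longrightarrow> dense_countable (H X)"
    and functor_a: "linear_op_functor C H a" and functor_b: "linear_op_functor C H b"
    and q: "0 < q"
    and diff_schatten: "f \<in> Arr C \<Longrightarrow> (\<lambda>x. a f x - b f x) \<in> schatten q (H (Dom C f)) (H (Cod C f))"
begin

definition \<delta> :: "'m \<Rightarrow> 'h \<Rightarrow> 'h" where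
  "\<delta> f x = a f x - b f x"

text \<open>What may stand in a distinguished slot of a trace form. Linearity in the morphism makes
  the form multilinear; differences and derivatives of functors, which are not multiplicative, are
  included.\<close>

definition letter :: "('m \<Rightarrow> 'h \<Rightarrow> 'h) \<Rightarrow> bool" where
  "letter c \<longleftrightarrow> (\<forall>f\<in>Arr C. c f \<in> bounded_ops (H (Dom C f)) (H (Cod C f))
     \<and> (\<forall>g\<in>Hom C (Dom C f) (Cod C f). \<forall>x\<in>H (Dom C f). c (Plus C f g) x = c f x + c g x)
     \<and> (\<forall>r. \<forall>x\<in>H (Dom C f). c (Scale C r f) x = r *\<^sub>C c f x))"

lemma H_Dom: "f \<in> Arr C \<Longrightarrow> dense_countable (H (Dom C f))"
  and H_Cod: "f \<in> Arr C \<Longrightarrow> dense_countable (H (Cod C f))"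
  using H dom_obj cod_obj by auto

lemma H_Dom_subspace: "f \<in> Arr C \<Longrightarrow> complex_vector.subspace (H (Dom C f))"
  and H_Cod_subspace: "f \<in> Arr C \<Longrightarrow> complex_vector.subspace (H (Cod C f))"
  using H_Dom H_Cod dense_countable_subspace by auto

lemma letter_bounded: "letter c \<Longrightarrow> f \<in> Arr C \<Longrightarrow> c f \<in> bounded_ops (H (Dom C f)) (H (Cod C f))"
  by (simp add: letter_def)

lemma letter_mem: "letter c \<Longrightarrow> f \<in> Arr C \<Longrightarrow> x \<in> H (Dom C f) \<Longrightarrow> c f x \<in> H (Cod C f)"
  using bounded_ops_mem[OF letter_bounded] .

lemma letter_functor: "linear_op_functor C H c \<Longrightarrow> letter c"
  unfolding letter_def
proof (intro ballI conjI allI)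
  fix f assume c: "linear_op_functor C H c" and f: "f \<in> Arr C"
  have f': "f \<in> Hom C (Dom C f) (Cod C f)" "Dom C f \<in> Obj C" "Cod C f \<in> Obj C"
    using f dom_obj cod_obj by (auto simp: Hom_def)
  note c = c[unfolded linear_op_functor_def]
  show "c f \<in> bounded_ops (H (Dom C f)) (H (Cod C f))"
    by (rule c[THEN conjunct1, rule_format, OF f'(2,3,1)])
  fix x assume x: "x \<in> H (Dom C f)"
  show "c (Plus C f g) x = c f x + c g x" if "g \<in> Hom C (Dom C f) (Cod C f)" for g
    by (rule c[THEN conjunct2, THEN conjunct2, THEN conjunct2, THEN conjunct1, rule_format,
          OF f'(2,3,1) that x])
  show "c (Scale C r f) x = r *\<^sub>C c f x" for r
    by (rule c[THEN conjunct2, THEN conjunct2, THEN conjunct2, THEN conjunct2, rule_format,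
          OF f'(2,3,1) x])
qed

lemma functor_comp:
  assumes "linear_op_functor C H c" "f \<in> Arr C" "g \<in> Arr C" "Dom C f = Cod C g" "x \<in> H (Dom C g)"
  shows "c (Comp C f g) x = c f (c g x)"
proof -
  have "g \<in> Hom C (Dom C g) (Cod C g)" "f \<in> Hom C (Cod C g) (Cod C f)"
    using assms by (auto simp: Hom_def)
  then show ?thesis
    using assms(1,5) dom_obj[OF assms(3)] cod_obj[OF assms(3)] cod_obj[OF assms(2)]
    unfolding linear_op_functor_def by blast
qed

lemmas a_letter = letter_functor[OF functor_a]
lemmas b_letter = letter_functor[OF functor_b]

lemma letter_add:
  assumes "letter c" "letter d"
  shows "letter (\<lambda>f x. c f x + d f x)"
  using assms unfolding letter_def
  by (auto simp: scaleC_add_right Hom_def intro!: bounded_ops_plus_op H_Cod_subspace)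

lemma letter_diff:
  assumes "letter c" "letter d"
  shows "letter (\<lambda>f x. c f x - d f x)"
  using assms unfolding letter_def
  by (auto simp: complex_vector.scale_right_diff_distrib Hom_def
      intro!: bounded_ops_diff_op H_Cod_subspace)

lemma \<delta>_letter: "letter \<delta>"
  using letter_diff[OF a_letter b_letter] by (simp add: \<delta>_def[abs_def])

lemma \<delta>_schatten: "f \<in> Arr C \<Longrightarrow> \<delta> f \<in> schatten q (H (Dom C f)) (H (Cod C f))"
  using diff_schatten by (simp add: \<delta>_def[abs_def])

text \<open>A difference of functors is a derivation with \<open>a\<close> acting on the left and
  \<open>b\<close> on the right; the boundary computations for \<open>\<delta>\<close> rest on this
  rule.\<close>

lemma \<delta>_comp:
  assumes "f \<in> Arr C" "g \<in> Arr C" "Dom C f = Cod C g" "x \<in> H (Dom C g)"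
  shows "\<delta> (Comp C f g) x = a f (\<delta> g x) + \<delta> f (b g x)"
proof -
  have mem: "a g x \<in> H (Dom C f)" "b g x \<in> H (Dom C f)"
    using letter_mem[OF a_letter assms(2,4)] letter_mem[OF b_letter assms(2,4)] assms(3) by auto
  show ?thesis
    using bounded_ops_diff[OF letter_bounded[OF a_letter assms(1)] H_Dom_subspace[OF assms(1)] mem]
    unfolding \<delta>_def functor_comp[OF functor_a assms] functor_comp[OF functor_b assms] by simp
qed

text \<open>The arrow \<open>u\<close> in front names the target space even when \<open>ws\<close>
  is empty.\<close>

lemma prod_op_mem_tail:
  assumes "letter c" "composable C (u # ws)" "x \<in> H (Dom C (last (u # ws)))"
  shows "prod_op c ws x \<in> H (Dom C u)"
  using assms(2,3)
proof (induction ws arbitrary: u)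
  case (Cons w ws)
  then have "prod_op c ws x \<in> H (Dom C w)" by simp
  then show ?case
    using letter_mem[OF assms(1), of w] Cons.prems(1) by (cases ws) auto
qed simp

lemma prod_op_trace_class:
  assumes gs: "composable C gs" "gs \<noteq> []" and len: "q \<le> real (length gs)"
  shows "prod_op \<delta> gs \<in> trace_class (H (Dom C (last gs))) (H (Cod C (hd gs)))"
proof -
  have Arr: "gs ! i \<in> Arr C" if "i < length gs" for i
    using gs(1) that by (auto simp: composable_iff_nth)
  have last: "last gs = gs ! (length gs - 1)" using gs(2) by (rule last_conv_nth)
  have hd: "hd gs = gs ! 0" using gs(2) by (rule hd_conv_nth)
  \<comment> \<open>The spaces along the path, continued as a constant beyond its end so that every
    \<open>Vs i\<close> is admissible.\<close>
  define Vs where "Vs i = (if i < length gs then H (Cod C (gs ! i)) else H (Dom C (last gs)))" for i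
  have dc: "dense_countable (Vs i)" for i
    using Arr gs(2) by (auto simp: Vs_def last intro!: H_Cod H_Dom)
  have "\<delta> (gs ! i) \<in> schatten q (Vs (Suc i)) (Vs i)" if i: "i < length gs" for i
  proof (cases "Suc i < length gs")
    case True
    then show ?thesis
      using \<delta>_schatten[OF Arr[OF i]] gs(1) i by (simp add: Vs_def composable_iff_nth)
  next
    case False
    have "last gs = gs ! i" unfolding last using False i by (intro arg_cong[of _ _ "(!) gs"]) simp
    then show ?thesis using \<delta>_schatten[OF Arr[OF i]] i False by (simp add: Vs_def)
  qed
  from word_trace_class(1)[where m = "length gs" and Vs = Vs, OF dc q this _ len]
  have "word (\<lambda>i. \<delta> (gs ! i)) (length gs) \<in> trace_class (Vs (length gs)) (Vs 0)"
    using gs(2) by simp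
  moreover have "word (\<lambda>i. \<delta> (gs ! i)) (length gs) = prod_op \<delta> gs"
    by (simp add: fun_eq_iff prod_op_eq_word)
  ultimately show ?thesis using gs(2) by (simp add: Vs_def hd)
qed

lemma prod_op_traceable:
  assumes "composable C gs" "gs \<noteq> []" "q \<le> real (length gs)"
    and A: "A \<in> bounded_ops (H (Cod C (hd gs))) (H (Dom C (last gs)))"
  shows "traceable (H (Dom C (last gs))) (\<lambda>x. A (prod_op \<delta> gs x))"
proof -
  have "last gs \<in> Arr C" "hd gs \<in> Arr C" using assms(1,2) by (auto simp: composable_iff_nth)
  then show ?thesis
    using trace_class_traceable(1)[OF prod_op_trace_class[OF assms(1-3)] H_Dom H_Cod A] by blast
qed

text \<open>Induction: \<open>\<delta>_comp\<close> splits the first pair, and its term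
  \<open>\<delta> g (b h y)\<close> cancels against the inductive expression. If that expression
  begins with \<open>a\<close>, then \<open>a = b + \<delta>\<close> is used in both places and the
  terms with two \<open>\<delta>\<close> cancel, which leaves \<open>b\<close> in front.\<close>

lemma prod_op_contract_sum:
  assumes "composable C gs" "gs \<noteq> []" "x \<in> H (Dom C (last gs))"
  shows "(\<Sum>k<length gs - 1. (-1) ^ k *\<^sub>C prod_op \<delta> (contract C k gs) x)
    = (if even (length gs) then a (hd gs) (prod_op \<delta> (tl gs) x) + prod_op \<delta> (butlast gs) (b (last gs) x)
       else b (hd gs) (prod_op \<delta> (tl gs) x) - prod_op \<delta> (butlast gs) (b (last gs) x))"
  using assms
proof (induction gs rule: induct_list012)
  case (3 g h hs)
  have g: "g \<in> Arr C" "h \<in> Arr C" "Dom C g = Cod C h" "composable C (h # hs)"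
    using 3(3) by (cases hs; simp)+
  define y where "y = prod_op \<delta> hs x"
  define z where "z = prod_op \<delta> (butlast (h # hs)) (b (last (h # hs)) x)"
  have y: "y \<in> H (Dom C h)"
    unfolding y_def using prod_op_mem_tail[OF \<delta>_letter g(4)] 3(5) by simp
  have tail: "prod_op \<delta> (contract C k (h # hs)) x \<in> H (Dom C g)" if "k < length hs" for k
  proof -
    have k: "Suc k < length (h # hs)" using that by simp
    note c = composable_contract[OF linear_category_axioms g(4) k]
    obtain w ws where w: "contract C k (h # hs) = w # ws"
      by (cases "contract C k (h # hs)") (auto simp: contract_def)
    have "composable C (g # contract C k (h # hs))"
      using c g by (simp add: w)
    moreover have "x \<in> H (Dom C (last (g # contract C k (h # hs))))"
      using c(2) 3(5) by (simp add: w)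
    ultimately show ?thesis by (rule prod_op_mem_tail[OF \<delta>_letter])
  qed
  note \<delta>g = letter_bounded[OF \<delta>_letter g(1)]
  have sub: "complex_vector.subspace (H (Dom C g))" using H_Dom_subspace[OF g(1)] .
  let ?S = "\<Sum>k<length hs. (-1) ^ k *\<^sub>C prod_op \<delta> (contract C k (h # hs)) x"
  have "(\<Sum>k<length (g # h # hs) - 1. (-1) ^ k *\<^sub>C prod_op \<delta> (contract C k (g # h # hs)) x)
      = \<delta> (Comp C g h) y + (\<Sum>k<length hs. - ((-1) ^ k *\<^sub>C \<delta> g (prod_op \<delta> (contract C k (h # hs)) x)))"
  proof -
    have "length (g # h # hs) - 1 = Suc (length hs)" by simp
    then show ?thesis
      by (simp only: sum.lessThan_Suc_shift) (simp add: contract_0 contract_Suc y_def)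
  qed
  also have "(\<Sum>k<length hs. - ((-1) ^ k *\<^sub>C \<delta> g (prod_op \<delta> (contract C k (h # hs)) x)))
      = - (\<Sum>k<length hs. \<delta> g ((-1) ^ k *\<^sub>C prod_op \<delta> (contract C k (h # hs)) x))"
    using tail by (simp add: sum_negf bounded_ops_scaleC[OF \<delta>g])
  also have "(\<Sum>k<length hs. \<delta> g ((-1) ^ k *\<^sub>C prod_op \<delta> (contract C k (h # hs)) x)) = \<delta> g ?S"
    using tail complex_vector.subspace_scale[OF sub]
    by (intro bounded_ops_sum[OF \<delta>g sub, symmetric]) auto
  finally have eq: "(\<Sum>k<length (g # h # hs) - 1. (-1) ^ k *\<^sub>C prod_op \<delta> (contract C k (g # h # hs)) x)
      = a g (\<delta> h y) + \<delta> g (b h y) - \<delta> g ?S"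
    using \<delta>_comp[OF g(1-3) y] by simp
  have IH: "?S = (if even (length (h # hs)) then a h y + z else b h y - z)"
    using 3(2)[OF g(4)] 3(5) by (simp add: y_def z_def)
  have mem: "a h y \<in> H (Dom C g)" "b h y \<in> H (Dom C g)" "\<delta> h y \<in> H (Dom C g)"
    using letter_mem[OF _ g(2) y] a_letter b_letter \<delta>_letter g(3) by auto
  have z: "z \<in> H (Dom C g)"
  proof (cases "hs = []")
    case True
    then show ?thesis using letter_mem[OF b_letter g(2)] 3(5) g(3) by (simp add: z_def)
  next
    case False
    define w where "w = butlast hs"
    define l where "l = last hs"
    have hs: "hs = w @ [l]" using False by (simp add: w_def l_def)
    have l: "l \<in> Arr C" "composable C (g # h # w)" "Dom C (last (h # w)) = Cod C l"
    proof -
      have comp: "composable C ((g # h # w) @ [l])" using 3(3) by (simp add: hs)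
      then show "composable C (g # h # w)" using composable_append by blast
      show "l \<in> Arr C" using comp by (simp add: composable_iff_nth)
      have "Suc (length w) < length (h # w @ [l])" by simp
      then have "Dom C ((h # w @ [l]) ! length w) = Cod C ((h # w @ [l]) ! Suc (length w))"
        using g(4) unfolding composable_iff_nth hs by blast
      moreover have "(h # w @ [l]) ! length w = last (h # w)"
        by (cases w rule: rev_cases) (auto simp: nth_append)
      ultimately show "Dom C (last (h # w)) = Cod C l" by simp
    qed
    have "b l x \<in> H (Cod C l)" using letter_mem[OF b_letter l(1)] 3(5) by (simp add: hs)
    then have "prod_op \<delta> (h # w) (b l x) \<in> H (Dom C g)"
      using l(3) by (intro prod_op_mem_tail[OF \<delta>_letter l(2)]) simp
    moreover have "butlast (h # hs) = h # w" "last (h # hs) = l" by (simp_all add: hs)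
    ultimately show ?thesis by (simp only: z_def)
  qed
  have fin: "prod_op \<delta> (butlast (g # h # hs)) (b (last (g # h # hs)) x) = \<delta> g z"
    by (simp add: z_def)
  show ?case
  proof (cases "even (length (h # hs))")
    case True
    then have "\<delta> g ?S = \<delta> g (a h y) + \<delta> g z"
      unfolding IH using bounded_ops_add[OF \<delta>g mem(1) z] by simp
    moreover have "\<delta> g (a h y) = \<delta> g (b h y) + \<delta> g (\<delta> h y)"
      using bounded_ops_add[OF \<delta>g mem(2,3)] by (simp add: \<delta>_def[of h])
    moreover have "a g (\<delta> h y) = \<delta> g (\<delta> h y) + b g (\<delta> h y)" by (simp add: \<delta>_def[of g])
    ultimately show ?thesis
      unfolding eq fin using True by (simp add: y_def)
  next
    case False
    then have "\<delta> g ?S = \<delta> g (b h y) - \<delta> g z"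
      unfolding IH using bounded_ops_diff[OF \<delta>g sub mem(2) z] by simp
    then show ?thesis
      unfolding eq fin using False by (simp add: y_def)
  qed
qed (auto simp: contract_def)

end

text \<open>Cyclicity twice, so that only the middle factor has to be trace class while
  \<open>u\<close> and \<open>v\<close> pass through a third space.\<close>

lemma op_trace_conjugate:
  assumes T: "T \<in> trace_class V W" and u: "u \<in> bounded_ops W U" and v: "v \<in> bounded_ops U V"
    and dc: "dense_countable V" "dense_countable W" "dense_countable U"
  shows "op_trace U (\<lambda>x. u (T (v x))) = op_trace V (\<lambda>x. v (u (T x)))"
    and "traceable U (\<lambda>x. u (T (v x)))" and "traceable V (\<lambda>x. v (u (T x)))"
proof -
  note sub = dc[THEN dense_countable_subspace]
  note Tv = trace_class_comp_right[OF T v sub]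
  have "op_trace U (\<lambda>x. u (T (v x))) = op_trace W (\<lambda>x. T (v (u x)))"
    by (rule op_trace_cyclic[OF Tv dc(3,2) u])
  also have "\<dots> = op_trace V (\<lambda>x. v (u (T x)))"
    using op_trace_cyclic[OF T dc(1,2) bounded_ops_comp[OF v u]] by simp
  finally show "op_trace U (\<lambda>x. u (T (v x))) = op_trace V (\<lambda>x. v (u (T x)))" .
  show "traceable U (\<lambda>x. u (T (v x)))" by (rule trace_class_traceable(1)[OF Tv dc(3,2) u])
  show "traceable V (\<lambda>x. v (u (T x)))"
    using trace_class_traceable(1)[OF T dc(1,2) bounded_ops_comp[OF v u]] .
qed

text \<open>One rotation undone; this is the list at which \<open>cyclic_op\<close>
  evaluates.\<close>

lemma last_butlast_cyclic_tuples:
  assumes fs: "fs \<in> cyclic_tuples C n"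
  shows "last fs # butlast fs \<in> cyclic_tuples C n" "rotate1 (last fs # butlast fs) = fs"
proof -
  have "fs \<noteq> []" using cyclic_tuples_length[OF fs] by auto
  then obtain ms l where ms: "fs = ms @ [l]" by (metis append_butlast_last_id)
  have "rotate (length ms) fs = [l] @ ms" unfolding ms by (rule rotate_append)
  then show "last fs # butlast fs \<in> cyclic_tuples C n"
    using cyclic_tuples_rotate[OF fs, of "length ms"] by (simp add: ms)
  show "rotate1 (last fs # butlast fs) = fs" by (simp add: ms)
qed

text \<open>The relation \<open>(1 - \<lambda>) N = 0\<close> for the signed sum \<open>N\<close>
  over all rotations: the operator shifts the summands by one.\<close>

lemma (in linear_category) cyclic_sum_cyclic_cochain:
  assumes "multilinear C n \<kappa>"
  shows "(\<lambda>fs. if fs \<in> cyclic_tuples C n then \<Sum>j\<le>n. (-1) ^ (j * n) * \<kappa> (rotate j fs) else 0)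
    \<in> cyclic_cochains C n" (is "?\<psi> \<in> _")
  unfolding cyclic_cochains_def
proof (intro CollectI conjI)
  show "?\<psi> \<in> cochains C n"
    by (intro cochains_restrict multilinear_sum multilinear_rotate assms)
  show "cyclic_op C n ?\<psi> = ?\<psi>"
  proof
    fix fs
    show "cyclic_op C n ?\<psi> fs = ?\<psi> fs"
    proof (cases "fs \<in> cyclic_tuples C n")
      case True
      define gs where "gs = last fs # butlast fs"
      have gs: "gs \<in> cyclic_tuples C n" and rot: "rotate1 gs = fs"
        using last_butlast_cyclic_tuples[OF True] by (simp_all add: gs_def)
      define F where "F r = (-1) ^ (r * n) * \<kappa> (rotate r gs)" for r
      have "rotate (Suc n) gs = rotate 0 gs"
        using cyclic_tuples_length[OF gs] by (simp only: rotate_id mod_self mod_0)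
      \<comment> \<open>The term that wraps around keeps its sign, as \<open>n * (n + 1)\<close> is
        even.\<close>
      moreover have "(-1 :: complex) ^ (Suc n * n) = (-1) ^ (0 * n)" by (rule minus_one_power_cong) simp
      ultimately have F0: "F (Suc n) = F 0" by (simp only: F_def)
      have "?\<psi> fs = (\<Sum>j\<le>n. (-1) ^ n * F (Suc j))"
        unfolding F_def using True
      proof (simp only: if_True, intro sum.cong refl)
        fix j
        have "even (j * n + (n + Suc j * n))" by (cases "even n") auto
        then have "(-1 :: complex) ^ (j * n) = (-1) ^ (n + Suc j * n)" by (rule minus_one_power_cong)
        then show "(-1) ^ (j * n) * \<kappa> (rotate j fs)
            = (-1) ^ n * ((-1) ^ (Suc j * n) * \<kappa> (rotate (Suc j) gs))"
          by (simp only: power_add rot[symmetric] rotate1_rotate_swap rotate_Suc comp_apply mult.assoc)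
      qed
      also have "\<dots> = (-1) ^ n * (\<Sum>j\<le>n. F (Suc j))" by (rule sum_distrib_left[symmetric])
      also have "(\<Sum>j\<le>n. F (Suc j)) = (\<Sum>j\<le>n. F j)"
        using sum.atMost_Suc_shift[of F n] F0 by simp
      also have "(-1) ^ n * (\<Sum>j\<le>n. F j) = cyclic_op C n ?\<psi> fs"
        using True gs by (simp add: cyclic_op_def gs_def F_def)
      finally show ?thesis ..
    qed (simp add: cyclic_op_def)
  qed
qed

section \<open>Trace forms with distinguished letters\<close>

context quasi_hom
begin

definition letter_trace :: "('m \<Rightarrow> 'h \<Rightarrow> 'h) \<Rightarrow> 'm list \<Rightarrow> complex" where
  "letter_trace c fs = op_trace (H (Cod C (hd fs))) (\<lambda>x. c (hd fs) (prod_op \<delta> (tl fs) x))"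

text \<open>The normal form of the boundary terms: a composite in the distinguished slot, split by a
  Leibniz rule, leaves two adjacent distinguished letters.\<close>

definition letter_trace2 :: "('m \<Rightarrow> 'h \<Rightarrow> 'h) \<Rightarrow> ('m \<Rightarrow> 'h \<Rightarrow> 'h) \<Rightarrow> 'm list \<Rightarrow> complex" where
  "letter_trace2 u v fs = op_trace (H (Cod C (hd fs)))
     (\<lambda>x. u (hd fs) (v (hd (tl fs)) (prod_op \<delta> (tl (tl fs)) x)))"

lemma cyclic_Cons:
  assumes "f # gs \<in> cyclic_tuples C n" "gs \<noteq> []"
  shows "f \<in> Arr C" "composable C gs" "Dom C f = Cod C (hd gs)" "Dom C (last gs) = Cod C f"
    "length gs = n" "hd gs \<in> Arr C" "last gs \<in> Arr C"
proof -
  note c = cyclic_tuples_composable[OF assms(1)]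
  show "f \<in> Arr C" "composable C gs" "Dom C f = Cod C (hd gs)"
    using c(1) assms(2) by (cases gs; simp)+
  then show "hd gs \<in> Arr C" "last gs \<in> Arr C"
    using assms(2) by (auto simp: composable_iff_nth)
  show "Dom C (last gs) = Cod C f" using c(2) assms(2) by simp
  show "length gs = n" using cyclic_tuples_length[OF assms(1)] by simp
qed

lemma tail_not_Nil:
  assumes "f # gs \<in> cyclic_tuples C n" "q \<le> real n"
  shows "gs \<noteq> []"
  using cyclic_tuples_length[OF assms(1)] assms(2) q by auto

lemma letter_trace_traceable:
  assumes fs: "f # gs \<in> cyclic_tuples C n" and n: "q \<le> real n" and c: "letter c"
  shows "traceable (H (Cod C f)) (\<lambda>x. c f (prod_op \<delta> gs x))"
proof -
  note F = cyclic_Cons[OF fs tail_not_Nil[OF fs n]]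
  show ?thesis
    using prod_op_traceable[OF F(2) tail_not_Nil[OF fs n], of "c f"] letter_bounded[OF c F(1)] F n by simp
qed

lemma prod_op_plus:
  assumes "composable C (us @ f # vs)" "g \<in> Hom C (Dom C f) (Cod C f)" "x \<in> H (Dom C (last (f # vs)))"
  shows "prod_op \<delta> (us @ Plus C f g # vs) x = prod_op \<delta> (us @ f # vs) x + prod_op \<delta> (us @ g # vs) x"
  using assms(1)
proof (induction us)
  case Nil
  then have "prod_op \<delta> vs x \<in> H (Dom C f)" "f \<in> Arr C"
    using prod_op_mem_tail[OF \<delta>_letter] assms(3) by (auto simp: composable_iff_nth)
  then show ?case using \<delta>_letter assms(2) by (simp add: letter_def)
next
  case (Cons u us)
  have u: "u \<in> Arr C" using Cons.prems by (auto simp: composable_iff_nth)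
  have comp: "composable C (u # us @ f # vs)" "composable C (u # us @ g # vs)"
    using Cons.prems composable_replace[of C "u # us" f vs g] assms(2) by auto
  have "Dom C g = Dom C f" using assms(2) by (simp add: Hom_def)
  then have "prod_op \<delta> (us @ f # vs) x \<in> H (Dom C u)" "prod_op \<delta> (us @ g # vs) x \<in> H (Dom C u)"
    using prod_op_mem_tail[OF \<delta>_letter comp(1)] prod_op_mem_tail[OF \<delta>_letter comp(2)] assms(3)
    by (auto split: if_splits)
  then show ?case
    using Cons.IH composable_tl[OF comp(1)] bounded_ops_add[OF letter_bounded[OF \<delta>_letter u]] by simp
qed

lemma prod_op_scale:
  assumes "composable C (us @ f # vs)" "x \<in> H (Dom C (last (f # vs)))"
  shows "prod_op \<delta> (us @ Scale C r f # vs) x = r *\<^sub>C prod_op \<delta> (us @ f # vs) x"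
  using assms(1)
proof (induction us)
  case Nil
  then have "prod_op \<delta> vs x \<in> H (Dom C f)" "f \<in> Arr C"
    using prod_op_mem_tail[OF \<delta>_letter] assms(2) by (auto simp: composable_iff_nth)
  then show ?case using \<delta>_letter by (simp add: letter_def)
next
  case (Cons u us)
  have u: "u \<in> Arr C" using Cons.prems by (auto simp: composable_iff_nth)
  have comp: "composable C (u # us @ f # vs)" using Cons.prems by simp
  have "prod_op \<delta> (us @ f # vs) x \<in> H (Dom C u)"
    using prod_op_mem_tail[OF \<delta>_letter comp] assms(2) by auto
  then show ?case
    using Cons.IH composable_tl[OF comp] bounded_ops_scaleC[OF letter_bounded[OF \<delta>_letter u]] by simp
qed

text \<open>A changed head is handled by linearity of \<open>c\<close> in the morphism, a changed
  entry of the tail by linearity of \<open>prod_op\<close> in its entries. Each summand must be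
  traceable before the trace can be split.\<close>

lemma multilinear_letter_trace:
  assumes c: "letter c" and n: "q \<le> real n"
  shows "multilinear C n (letter_trace c)"
  unfolding multilinear_def
proof (intro conjI allI impI)
  fix us f vs assume fs: "us @ f # vs \<in> cyclic_tuples C n"
  note comp = cyclic_tuples_composable[OF fs]
  have f: "f \<in> Arr C" using comp(1) by (auto simp: composable_iff_nth)
  show "letter_trace c (us @ Plus C f g # vs) = letter_trace c (us @ f # vs) + letter_trace c (us @ g # vs)"
    if g: "g \<in> Hom C (Dom C f) (Cod C f)" for g
  proof -
    note gs = cyclic_tuples_replace[OF fs g]
    have g': "Cod C g = Cod C f" "Dom C g = Dom C f" using g by (auto simp: Hom_def)
    have P: "Cod C (Plus C f g) = Cod C f"
      using plus_hom[OF _ g] f by (simp add: Hom_def)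
    show ?thesis
    proof (cases us)
      case Nil
      have t: "traceable (H (Cod C f)) (\<lambda>x. c f (prod_op \<delta> vs x))" "traceable (H (Cod C f)) (\<lambda>x. c g (prod_op \<delta> vs x))"
        using letter_trace_traceable[of f vs, OF _ n c] letter_trace_traceable[of g vs, OF _ n c] fs gs g'
        by (auto simp: Nil)
      have "op_trace (H (Cod C f)) (\<lambda>x. c (Plus C f g) (prod_op \<delta> vs x))
          = op_trace (H (Cod C f)) (\<lambda>x. c f (prod_op \<delta> vs x) + c g (prod_op \<delta> vs x))"
      proof (rule op_trace_cong)
        fix x assume "x \<in> H (Cod C f)"
        then have "prod_op \<delta> vs x \<in> H (Dom C f)"
          using comp by (intro prod_op_mem_tail[OF \<delta>_letter]) (auto simp: Nil)
        then show "c (Plus C f g) (prod_op \<delta> vs x) = c f (prod_op \<delta> vs x) + c g (prod_op \<delta> vs x)"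
          using c f g by (simp add: letter_def)
      qed
      then show ?thesis using op_trace_add[OF H_Cod[OF f] t] by (simp add: Nil letter_trace_def P g')
    next
      case (Cons u us')
      have u: "u \<in> Arr C" using comp(1) by (auto simp: composable_iff_nth Cons)
      have t: "traceable (H (Cod C u)) (\<lambda>x. c u (prod_op \<delta> (us' @ f # vs) x))"
        "traceable (H (Cod C u)) (\<lambda>x. c u (prod_op \<delta> (us' @ g # vs) x))"
        using letter_trace_traceable[of u "us' @ f # vs", OF _ n c]
          letter_trace_traceable[of u "us' @ g # vs", OF _ n c] fs gs by (auto simp: Cons simp del: prod_op_append)
      have "op_trace (H (Cod C u)) (\<lambda>x. c u (prod_op \<delta> (us' @ Plus C f g # vs) x))
          = op_trace (H (Cod C u)) (\<lambda>x. c u (prod_op \<delta> (us' @ f # vs) x) + c u (prod_op \<delta> (us' @ g # vs) x))"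
      proof (rule op_trace_cong)
        fix x assume x: "x \<in> H (Cod C u)"
        have comp': "composable C (u # us' @ f # vs)" "composable C (u # us' @ g # vs)"
          using comp(1) cyclic_tuples_composable(1)[OF gs] by (auto simp: Cons)
        have last: "x \<in> H (Dom C (last (f # vs)))" using comp(2) x by (simp add: Cons)
        then have "prod_op \<delta> (us' @ f # vs) x \<in> H (Dom C u)" "prod_op \<delta> (us' @ g # vs) x \<in> H (Dom C u)"
          using prod_op_mem_tail[OF \<delta>_letter comp'(1)] prod_op_mem_tail[OF \<delta>_letter comp'(2)] g'
          by (auto split: if_splits)
        then show "c u (prod_op \<delta> (us' @ Plus C f g # vs) x)
            = c u (prod_op \<delta> (us' @ f # vs) x) + c u (prod_op \<delta> (us' @ g # vs) x)"
          unfolding prod_op_plus[OF composable_tl[OF comp'(1)] g last]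
          by (rule bounded_ops_add[OF letter_bounded[OF c u]])
      qed
      then show ?thesis
        using op_trace_add[OF H_Cod[OF u] t] by (simp add: Cons letter_trace_def del: prod_op_append)
    qed
  qed
  show "letter_trace c (us @ Scale C r f # vs) = r * letter_trace c (us @ f # vs)" for r
  proof -
    have S: "Cod C (Scale C r f) = Cod C f"
      using scale_hom[of f] f by (auto simp: Hom_def)
    show ?thesis
    proof (cases us)
      case Nil
      have t: "traceable (H (Cod C f)) (\<lambda>x. c f (prod_op \<delta> vs x))"
        using letter_trace_traceable[of f vs, OF _ n c] fs by (auto simp: Nil)
      have "op_trace (H (Cod C f)) (\<lambda>x. c (Scale C r f) (prod_op \<delta> vs x))
          = op_trace (H (Cod C f)) (\<lambda>x. r *\<^sub>C c f (prod_op \<delta> vs x))"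
      proof (rule op_trace_cong)
        fix x assume "x \<in> H (Cod C f)"
        then have "prod_op \<delta> vs x \<in> H (Dom C f)"
          using comp by (intro prod_op_mem_tail[OF \<delta>_letter]) (auto simp: Nil)
        then show "c (Scale C r f) (prod_op \<delta> vs x) = r *\<^sub>C c f (prod_op \<delta> vs x)"
          using c f by (simp add: letter_def)
      qed
      then show ?thesis using op_trace_scaleC[OF H_Cod[OF f] t] by (simp add: Nil letter_trace_def S)
    next
      case (Cons u us')
      have u: "u \<in> Arr C" using comp(1) by (auto simp: composable_iff_nth Cons)
      have t: "traceable (H (Cod C u)) (\<lambda>x. c u (prod_op \<delta> (us' @ f # vs) x))"
        using letter_trace_traceable[of u "us' @ f # vs", OF _ n c] fs by (auto simp: Cons simp del: prod_op_append)
      have "op_trace (H (Cod C u)) (\<lambda>x. c u (prod_op \<delta> (us' @ Scale C r f # vs) x))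
          = op_trace (H (Cod C u)) (\<lambda>x. r *\<^sub>C c u (prod_op \<delta> (us' @ f # vs) x))"
      proof (rule op_trace_cong)
        fix x assume x: "x \<in> H (Cod C u)"
        have comp': "composable C (u # us' @ f # vs)" using comp(1) by (auto simp: Cons)
        have last: "x \<in> H (Dom C (last (f # vs)))" using comp(2) x by (simp add: Cons)
        then have "prod_op \<delta> (us' @ f # vs) x \<in> H (Dom C u)"
          using prod_op_mem_tail[OF \<delta>_letter comp'] by auto
        then show "c u (prod_op \<delta> (us' @ Scale C r f # vs) x) = r *\<^sub>C c u (prod_op \<delta> (us' @ f # vs) x)"
          unfolding prod_op_scale[OF composable_tl[OF comp'] last]
          by (rule bounded_ops_scaleC[OF letter_bounded[OF c u]])
      qed
      then show ?thesis
        using op_trace_scaleC[OF H_Cod[OF u] t] by (simp add: Cons letter_trace_def del: prod_op_append)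
    qed
  qed
qed

text \<open>Plain cyclicity of the trace, hence no sign; this fits \<open>cyclic_op\<close> when the
  degree is even.\<close>

lemma letter_trace_rotate1:
  assumes fs: "fs \<in> cyclic_tuples C n" and n: "q \<le> real n"
  shows "letter_trace \<delta> (rotate1 fs) = letter_trace \<delta> fs"
proof -
  obtain f gs where fs': "fs = f # gs" using cyclic_tuples_length[OF fs] by (cases fs) auto
  note ne = tail_not_Nil[OF fs[unfolded fs'] n]
  note F = cyclic_Cons[OF fs[unfolded fs'] ne]
  obtain g hs where gs: "gs = g # hs" using ne by (cases gs) auto
  have T: "prod_op \<delta> gs \<in> trace_class (H (Cod C f)) (H (Dom C f))"
    using prod_op_trace_class[OF F(2) ne] F n by simp
  have "letter_trace \<delta> fs = op_trace (H (Cod C f)) (\<lambda>x. \<delta> f (prod_op \<delta> gs x))"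
    by (simp add: letter_trace_def fs')
  also have "\<dots> = op_trace (H (Dom C f)) (\<lambda>x. prod_op \<delta> gs (\<delta> f x))"
    by (rule op_trace_cyclic[OF T H_Cod[OF F(1)] H_Dom[OF F(1)] letter_bounded[OF \<delta>_letter F(1)]])
  also have "\<dots> = letter_trace \<delta> (rotate1 fs)"
    using F(3) by (simp add: letter_trace_def fs' gs)
  finally show ?thesis ..
qed

definition character :: "nat \<Rightarrow> 'm list \<Rightarrow> complex" where
  "character n fs = (if fs \<in> cyclic_tuples C n then letter_trace \<delta> fs else 0)"

lemma character_cyclic_cochain:
  assumes n: "q \<le> real n" "even n"
  shows "character n \<in> cyclic_cochains C n"
  unfolding cyclic_cochains_def
proof (intro CollectI conjI)
  show "character n \<in> cochains C n"
    unfolding character_def[abs_def]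
    by (intro cochains_restrict multilinear_letter_trace \<delta>_letter n)
  show "cyclic_op C n (character n) = character n"
  proof
    fix fs
    show "cyclic_op C n (character n) fs = character n fs"
    proof (cases "fs \<in> cyclic_tuples C n")
      case True
      define gs where "gs = last fs # butlast fs"
      have gs: "gs \<in> cyclic_tuples C n" and rot: "rotate1 gs = fs"
        using last_butlast_cyclic_tuples[OF True] by (simp_all add: gs_def)
      show ?thesis
        using True gs letter_trace_rotate1[OF gs n(1)] n(2) rot
        by (simp add: cyclic_op_def character_def gs_def)
    qed (simp add: cyclic_op_def character_def)
  qed
qed

text \<open>A contracted tail still has \<open>n\<close> letters \<open>\<delta>\<close>, so every
  summand has a trace; the alternating sum then moves inside, where
  \<open>prod_op_contract_sum\<close> evaluates it.\<close>

lemma letter_trace_contract_sum: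
  assumes fs: "f # gs \<in> cyclic_tuples C (Suc n)" and c: "letter c" and n: "q \<le> real n"
  shows "(\<Sum>k<length gs - 1. (-1) ^ k * op_trace (H (Cod C f)) (\<lambda>x. c f (prod_op \<delta> (contract C k gs) x)))
    = op_trace (H (Cod C f)) (\<lambda>x. c f (if even (length gs)
        then a (hd gs) (prod_op \<delta> (tl gs) x) + prod_op \<delta> (butlast gs) (b (last gs) x)
        else b (hd gs) (prod_op \<delta> (tl gs) x) - prod_op \<delta> (butlast gs) (b (last gs) x)))"
proof -
  have ne: "gs \<noteq> []" using cyclic_tuples_length[OF fs] by auto
  note F = cyclic_Cons[OF fs ne]
  have k: "composable C (contract C k gs)" "contract C k gs \<noteq> []"
    "Dom C (last (contract C k gs)) = Cod C f" "Cod C (hd (contract C k gs)) = Dom C f"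
    "length (contract C k gs) = n" if "k < length gs - 1" for k
    using composable_contract[OF linear_category_axioms F(2), of k] that F
    by (auto simp: contract_def min_def)
  have t: "traceable (H (Cod C f)) (\<lambda>x. c f (prod_op \<delta> (contract C k gs) x))" if "k < length gs - 1" for k
    using prod_op_traceable[OF k(1,2)[OF that], of "c f"] letter_bounded[OF c F(1)] k[OF that] n by simp
  have "(\<Sum>k<length gs - 1. (-1) ^ k * op_trace (H (Cod C f)) (\<lambda>x. c f (prod_op \<delta> (contract C k gs) x)))
      = op_trace (H (Cod C f)) (\<lambda>x. \<Sum>k<length gs - 1. (-1) ^ k *\<^sub>C c f (prod_op \<delta> (contract C k gs) x))"
    using op_trace_sum_scaleC[OF H_Cod[OF F(1)], of "{..<length gs - 1}"] t by simp
  also have "\<dots> = op_trace (H (Cod C f)) (\<lambda>x. c f (\<Sum>k<length gs - 1. (-1) ^ k *\<^sub>C prod_op \<delta> (contract C k gs) x))"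
  proof (rule op_trace_cong)
    fix x assume x: "x \<in> H (Cod C f)"
    have mem: "prod_op \<delta> (contract C k gs) x \<in> H (Dom C f)" if "k < length gs - 1" for k
    proof (rule prod_op_mem_tail[OF \<delta>_letter])
      show "composable C (f # contract C k gs)"
        using k[OF that] F(1) by (cases "contract C k gs") auto
      show "x \<in> H (Dom C (last (f # contract C k gs)))" using x k(2,3)[OF that] by simp
    qed
    show "(\<Sum>k<length gs - 1. (-1) ^ k *\<^sub>C c f (prod_op \<delta> (contract C k gs) x))
        = c f (\<Sum>k<length gs - 1. (-1) ^ k *\<^sub>C prod_op \<delta> (contract C k gs) x)"
    proof (subst bounded_ops_sum[OF letter_bounded[OF c F(1)] H_Dom_subspace[OF F(1)]])
      show "(-1) ^ k *\<^sub>C prod_op \<delta> (contract C k gs) x \<in> H (Dom C f)" if "k \<in> {..<length gs - 1}" for k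
        using mem that complex_vector.subspace_scale[OF H_Dom_subspace[OF F(1)]] by auto
    qed (use mem bounded_ops_scaleC[OF letter_bounded[OF c F(1)]] in \<open>auto intro!: sum.cong\<close>)
  qed
  also have "\<dots> = op_trace (H (Cod C f)) (\<lambda>x. c f (if even (length gs)
        then a (hd gs) (prod_op \<delta> (tl gs) x) + prod_op \<delta> (butlast gs) (b (last gs) x)
        else b (hd gs) (prod_op \<delta> (tl gs) x) - prod_op \<delta> (butlast gs) (b (last gs) x)))"
    using F by (intro op_trace_cong arg_cong[of _ _ "c f"] prod_op_contract_sum[OF F(2) ne]) simp
  finally show ?thesis .
qed

end

section \<open>Boundaries of trace forms: cocycle property and transgression\<close>

context quasi_hom
begin

text \<open>After two letters are taken off a tuple of degree \<open>n + 1\<close>, there remain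
  \<open>n\<close> letters \<open>\<delta>\<close>, enough for a trace class product.\<close>

lemma cyclic_Cons_Cons:
  assumes "l # g # mid \<in> cyclic_tuples C (Suc n)" "q \<le> real n"
  shows "l \<in> Arr C" "g \<in> Arr C" "Dom C l = Cod C g" "mid \<noteq> []" "composable C mid"
    "prod_op \<delta> mid \<in> trace_class (H (Cod C l)) (H (Dom C g))"
proof -
  note F = cyclic_Cons[OF assms(1) list.distinct(2)]
  show "l \<in> Arr C" "g \<in> Arr C" "Dom C l = Cod C g" using F by auto
  show ne: "mid \<noteq> []" using F(5) assms(2) q by auto
  show comp: "composable C mid" by (rule composable_tl[OF F(2)])
  have "Dom C g = Cod C (hd mid)" "Dom C (last mid) = Cod C l" "length mid = n"
    using F ne by (cases mid; simp)+
  then show "prod_op \<delta> mid \<in> trace_class (H (Cod C l)) (H (Dom C g))"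
    using prod_op_trace_class[OF comp ne] assms(2) by simp
qed

text \<open>The letter at the end of the word is carried to the front; the \<open>n\<close> letters
  \<open>\<delta>\<close> between the two outer ones are the trace class factor.\<close>

lemma letter_trace2_conjugate:
  assumes gs: "l # g # mid \<in> cyclic_tuples C (Suc n)" and n: "q \<le> real n"
    and u: "letter u" and v: "letter v"
  shows "op_trace (H (Cod C g)) (\<lambda>x. v g (prod_op \<delta> mid (u l x))) = letter_trace2 u v (l # g # mid)"
    "traceable (H (Cod C g)) (\<lambda>x. v g (prod_op \<delta> mid (u l x)))"
    "traceable (H (Cod C l)) (\<lambda>x. u l (v g (prod_op \<delta> mid x)))"
proof -
  note F = cyclic_Cons_Cons[OF gs n]
  have vb: "v g \<in> bounded_ops (H (Dom C g)) (H (Cod C g))" using letter_bounded[OF v F(2)] .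
  have ub: "u l \<in> bounded_ops (H (Cod C g)) (H (Cod C l))" using letter_bounded[OF u F(1)] F(3) by simp
  note conj = op_trace_conjugate[OF F(6) vb ub H_Cod[OF F(1)] H_Dom[OF F(2)] H_Cod[OF F(2)]]
  show "op_trace (H (Cod C g)) (\<lambda>x. v g (prod_op \<delta> mid (u l x))) = letter_trace2 u v (l # g # mid)"
    using conj(1) by (simp add: letter_trace2_def)
  show "traceable (H (Cod C g)) (\<lambda>x. v g (prod_op \<delta> mid (u l x)))" by (rule conj(2))
  show "traceable (H (Cod C l)) (\<lambda>x. u l (v g (prod_op \<delta> mid x)))" by (rule conj(3))
qed

lemma letter_trace2_linear:
  assumes gs: "l # g # mid \<in> cyclic_tuples C (Suc n)" and n: "q \<le> real n"
    and u: "letter u" "letter u'" and v: "letter v" "letter v'"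
  shows "letter_trace2 (\<lambda>f x. u f x + u' f x) v (l # g # mid)
      = letter_trace2 u v (l # g # mid) + letter_trace2 u' v (l # g # mid)"
    "letter_trace2 (\<lambda>f x. u f x - u' f x) v (l # g # mid)
      = letter_trace2 u v (l # g # mid) - letter_trace2 u' v (l # g # mid)"
    "letter_trace2 u (\<lambda>f x. v f x + v' f x) (l # g # mid)
      = letter_trace2 u v (l # g # mid) + letter_trace2 u v' (l # g # mid)"
    "letter_trace2 u (\<lambda>f x. v f x - v' f x) (l # g # mid)
      = letter_trace2 u v (l # g # mid) - letter_trace2 u v' (l # g # mid)"
proof -
  note F = cyclic_Cons_Cons[OF gs n]
  note V = H_Cod[OF F(1)]
  note tr = letter_trace2_conjugate(3)[OF gs n]
  have mem: "w g (prod_op \<delta> mid x) \<in> H (Dom C l)" if "letter w" "x \<in> H (Cod C l)" for w x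
    using letter_mem[OF that(1) F(2)] bounded_ops_mem[of "prod_op \<delta> mid" "H (Cod C l)" "H (Dom C g)"]
      F(3,6) that(2) by (auto simp: trace_class_def)
  show "letter_trace2 (\<lambda>f x. u f x + u' f x) v (l # g # mid)
      = letter_trace2 u v (l # g # mid) + letter_trace2 u' v (l # g # mid)"
    using op_trace_add[OF V tr tr] u v by (simp add: letter_trace2_def)
  show "letter_trace2 (\<lambda>f x. u f x - u' f x) v (l # g # mid)
      = letter_trace2 u v (l # g # mid) - letter_trace2 u' v (l # g # mid)"
    using op_trace_diff[OF V tr tr] u v by (simp add: letter_trace2_def)
  have "op_trace (H (Cod C l)) (\<lambda>x. u l (v g (prod_op \<delta> mid x) + v' g (prod_op \<delta> mid x)))
      = op_trace (H (Cod C l)) (\<lambda>x. u l (v g (prod_op \<delta> mid x)) + u l (v' g (prod_op \<delta> mid x)))"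
    by (intro op_trace_cong bounded_ops_add[OF letter_bounded[OF u(1) F(1)]] mem v)
  then show "letter_trace2 u (\<lambda>f x. v f x + v' f x) (l # g # mid)
      = letter_trace2 u v (l # g # mid) + letter_trace2 u v' (l # g # mid)"
    using op_trace_add[OF V tr tr] u v by (simp add: letter_trace2_def)
  have "op_trace (H (Cod C l)) (\<lambda>x. u l (v g (prod_op \<delta> mid x) - v' g (prod_op \<delta> mid x)))
      = op_trace (H (Cod C l)) (\<lambda>x. u l (v g (prod_op \<delta> mid x)) - u l (v' g (prod_op \<delta> mid x)))"
    by (intro op_trace_cong bounded_ops_diff[OF letter_bounded[OF u(1) F(1)] H_Dom_subspace[OF F(1)]] mem v)
  then show "letter_trace2 u (\<lambda>f x. v f x - v' f x) (l # g # mid)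
      = letter_trace2 u v (l # g # mid) - letter_trace2 u v' (l # g # mid)"
    using op_trace_diff[OF V tr tr] u v by (simp add: letter_trace2_def)
qed

text \<open>The face at 0 multiplies into the slot of \<open>c\<close> and is kept apart;
  \<open>prod_op_contract_sum\<close> evaluates the others. It leaves a letter \<open>b l\<close> at
  the end of the word, which cyclicity returns to the front, so that this term is read from the
  tuple before rotation.\<close>

lemma letter_trace_boundary:
  assumes gs: "l # g # mid \<in> cyclic_tuples C (Suc N)" and N: "q \<le> real N" and c: "letter c"
    and tail: "mid @ [l] = h # rest"
  shows "(\<Sum>k\<le>N. (-1) ^ k * letter_trace c (contract C k (g # mid @ [l])))
    = letter_trace c (Comp C g h # rest) - (if even (Suc N)
        then letter_trace2 c a (g # h # rest) + letter_trace2 b c (l # g # mid)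
        else letter_trace2 c b (g # h # rest) - letter_trace2 b c (l # g # mid))"
proof -
  note F = cyclic_Cons_Cons[OF gs N]
  have rot: "g # mid @ [l] \<in> cyclic_tuples C (Suc N)" using cyclic_tuples_rotate1[OF gs] by simp
  then have rot': "g # h # rest \<in> cyclic_tuples C (Suc N)" by (simp add: tail)
  note F' = cyclic_Cons_Cons[OF rot' N]
  have len: "length (mid @ [l]) = Suc N" using cyclic_tuples_length[OF gs] by simp
  have "(\<Sum>k\<le>N. (-1) ^ k * letter_trace c (contract C k (g # mid @ [l])))
      = letter_trace c (contract C 0 (g # mid @ [l]))
        + (\<Sum>k<N. (-1) ^ Suc k * letter_trace c (contract C (Suc k) (g # mid @ [l])))"
    unfolding lessThan_Suc_atMost[symmetric] by (subst sum.lessThan_Suc_shift) simp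
  also have "letter_trace c (contract C 0 (g # mid @ [l])) = letter_trace c (Comp C g h # rest)"
    by (simp only: tail contract_0)
  also have "(\<Sum>k<N. (-1) ^ Suc k * letter_trace c (contract C (Suc k) (g # mid @ [l])))
      = - (\<Sum>k<length (mid @ [l]) - 1. (-1) ^ k
            * op_trace (H (Cod C g)) (\<lambda>x. c g (prod_op \<delta> (contract C k (mid @ [l])) x)))"
    unfolding len by (simp add: contract_Suc letter_trace_def sum_negf)
  also have "(\<Sum>k<length (mid @ [l]) - 1. (-1) ^ k
            * op_trace (H (Cod C g)) (\<lambda>x. c g (prod_op \<delta> (contract C k (mid @ [l])) x)))
      = op_trace (H (Cod C g)) (\<lambda>x. c g (if even (length (mid @ [l]))
        then a (hd (mid @ [l])) (prod_op \<delta> (tl (mid @ [l])) x)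
          + prod_op \<delta> (butlast (mid @ [l])) (b (last (mid @ [l])) x)
        else b (hd (mid @ [l])) (prod_op \<delta> (tl (mid @ [l])) x)
          - prod_op \<delta> (butlast (mid @ [l])) (b (last (mid @ [l])) x)))"
    by (rule letter_trace_contract_sum[OF rot c N])
  also have "\<dots> = op_trace (H (Cod C g)) (\<lambda>x. c g (if even (Suc N)
        then a h (prod_op \<delta> rest x) + prod_op \<delta> mid (b l x)
        else b h (prod_op \<delta> rest x) - prod_op \<delta> mid (b l x)))"
  proof -
    have "hd (mid @ [l]) = h" "tl (mid @ [l]) = rest" unfolding tail by simp_all
    then show ?thesis by (simp only: len butlast_snoc last_snoc)
  qed
  also have "\<dots> = (if even (Suc N)
        then letter_trace2 c a (g # h # rest) + letter_trace2 b c (l # g # mid)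
        else letter_trace2 c b (g # h # rest) - letter_trace2 b c (l # g # mid))"
  proof -
    note t1 = letter_trace2_conjugate[OF gs N b_letter c]
    note t2 = letter_trace2_conjugate(3)[OF rot' N c]
    have memT: "prod_op \<delta> mid (b l x) \<in> H (Dom C g)" if "x \<in> H (Cod C g)" for x
    proof -
      have "b l x \<in> H (Cod C l)" using letter_mem[OF b_letter F(1)] F(3) that by simp
      then show ?thesis using F(6) bounded_ops_mem unfolding trace_class_def by blast
    qed
    have memR: "w h (prod_op \<delta> rest x) \<in> H (Dom C g)" if "letter w" "x \<in> H (Cod C g)" for w x
      using letter_mem[OF that(1) F'(2)] bounded_ops_mem[of "prod_op \<delta> rest" "H (Cod C g)" "H (Dom C h)"]
        F'(3,6) that(2) by (auto simp: trace_class_def)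
    note cb = letter_bounded[OF c F(2)] and sub = H_Dom_subspace[OF F(2)]
    show ?thesis
    proof (cases "even (Suc N)")
      case True
      have "op_trace (H (Cod C g)) (\<lambda>x. c g (a h (prod_op \<delta> rest x) + prod_op \<delta> mid (b l x)))
          = op_trace (H (Cod C g)) (\<lambda>x. c g (a h (prod_op \<delta> rest x)) + c g (prod_op \<delta> mid (b l x)))"
        by (intro op_trace_cong bounded_ops_add[OF cb] memT memR a_letter)
      then show ?thesis
        using True op_trace_add[OF H_Cod[OF F(2)] t2[OF a_letter] t1(2)] t1(1)
        by (simp add: letter_trace2_def)
    next
      case False
      have "op_trace (H (Cod C g)) (\<lambda>x. c g (b h (prod_op \<delta> rest x) - prod_op \<delta> mid (b l x)))
          = op_trace (H (Cod C g)) (\<lambda>x. c g (b h (prod_op \<delta> rest x)) - c g (prod_op \<delta> mid (b l x)))"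
        by (intro op_trace_cong bounded_ops_diff[OF cb sub] memT memR b_letter)
      then show ?thesis
        using False op_trace_diff[OF H_Cod[OF F(2)] t2[OF b_letter] t1(2)] t1(1)
        by (simp add: letter_trace2_def)
    qed
  qed
  finally show ?thesis by simp
qed

text \<open>The two products cover both Leibniz rules in use: \<open>a \<delta> + \<delta> b\<close>
  for \<open>\<delta>\<close>, and the derivation rule for derivatives of functors.\<close>

lemma letter_trace_Comp:
  assumes gs: "g # h # rest \<in> cyclic_tuples C (Suc N)" and N: "q \<le> real N"
    and letters: "letter u" "letter v" "letter u'" "letter v'"
    and c: "\<And>x. x \<in> H (Dom C h) \<Longrightarrow> c (Comp C g h) x = u g (v h x) + u' g (v' h x)"
  shows "letter_trace c (Comp C g h # rest)
    = letter_trace2 u v (g # h # rest) + letter_trace2 u' v' (g # h # rest)"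
proof -
  note F = cyclic_Cons_Cons[OF gs N]
  note tr = letter_trace2_conjugate(3)[OF gs N]
  have "letter_trace c (Comp C g h # rest) = op_trace (H (Cod C g)) (\<lambda>x. c (Comp C g h) (prod_op \<delta> rest x))"
    using comp_Hom[OF F(1-3)] by (simp add: letter_trace_def)
  also have "\<dots> = op_trace (H (Cod C g)) (\<lambda>x. u g (v h (prod_op \<delta> rest x)) + u' g (v' h (prod_op \<delta> rest x)))"
    using F(6) bounded_ops_mem unfolding trace_class_def by (intro op_trace_cong c) blast
  also have "\<dots> = letter_trace2 u v (g # h # rest) + letter_trace2 u' v' (g # h # rest)"
    using op_trace_add[OF H_Cod[OF F(1)] tr[OF letters(1,2)] tr[OF letters(3,4)]]
    by (simp add: letter_trace2_def)
  finally show ?thesis .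
qed

text \<open>Once the terms with \<open>\<delta> b\<close> on the rotated tuple cancel, everything
  can be read from the tuple starting at \<open>l\<close>. Combining \<open>a\<close> and
  \<open>b\<close> into \<open>\<delta>\<close> in either slot then gives
  \<open>letter_trace2 \<delta> \<delta>\<close> with both signs.\<close>

theorem character_cocycle:
  assumes n: "q \<le> real n" "even n"
  shows "character n \<in> cyclic_cocycles C n"
proof -
  have "coboundary C n (character n) fs = 0" for fs
  proof (cases "fs \<in> cyclic_tuples C (Suc n)")
    case True
    define gs where "gs = last fs # butlast fs"
    have gs: "gs \<in> cyclic_tuples C (Suc n)" "rotate1 gs = fs"
      using last_butlast_cyclic_tuples[OF True] by (simp_all add: gs_def)
    obtain l g mid where lgm: "gs = l # g # mid"
      using cyclic_tuples_length[OF gs(1)] by (metis length_Suc_conv)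
    note lcyc = gs(1)[unfolded lgm]
    have fs: "fs = g # mid @ [l]" using gs(2) lgm by simp
    obtain h rest where tail: "mid @ [l] = h # rest" by (cases "mid @ [l]") auto
    have fcyc: "g # h # rest \<in> cyclic_tuples C (Suc n)" using True fs tail by simp
    note F = cyclic_Cons_Cons[OF lcyc n(1)] and F' = cyclic_Cons_Cons[OF fcyc n(1)]
    have "coboundary C n (character n) fs
        = (\<Sum>k\<le>n. (-1) ^ k * letter_trace \<delta> (contract C k (g # mid @ [l]))) - letter_trace \<delta> (Comp C l g # mid)"
      unfolding coboundary_eq[OF True] using n(2) contract_cyclic_tuples[OF True]
        contract_last_cyclic_tuples[OF True] by (simp add: character_def fs)
    also have "(\<Sum>k\<le>n. (-1) ^ k * letter_trace \<delta> (contract C k (g # mid @ [l])))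
        = letter_trace \<delta> (Comp C g h # rest) - (letter_trace2 \<delta> b (g # h # rest) - letter_trace2 b \<delta> (l # g # mid))"
      using letter_trace_boundary[OF lcyc n(1) \<delta>_letter tail] n(2) by simp
    also have "letter_trace \<delta> (Comp C g h # rest) = letter_trace2 a \<delta> (g # h # rest) + letter_trace2 \<delta> b (g # h # rest)"
      by (intro letter_trace_Comp[OF fcyc n(1)] a_letter b_letter \<delta>_letter \<delta>_comp F'(1-3))
    \<comment> \<open>Cyclicity carries the final \<open>\<delta> l\<close> to the front: the same
      trace read from \<open>l\<close>.\<close>
    also have "letter_trace2 a \<delta> (g # h # rest) = letter_trace2 \<delta> a (l # g # mid)"
    proof -
      have "letter_trace2 a \<delta> (g # h # rest) = op_trace (H (Cod C g)) (\<lambda>x. a g (prod_op \<delta> (mid @ [l]) x))"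
        unfolding tail by (simp add: letter_trace2_def)
      then show ?thesis using letter_trace2_conjugate(1)[OF lcyc n(1) \<delta>_letter a_letter] by simp
    qed
    also have "letter_trace \<delta> (Comp C l g # mid) = letter_trace2 a \<delta> (l # g # mid) + letter_trace2 \<delta> b (l # g # mid)"
      by (intro letter_trace_Comp[OF lcyc n(1)] a_letter b_letter \<delta>_letter \<delta>_comp F(1-3))
    finally have "coboundary C n (character n) fs
        = (letter_trace2 \<delta> a (l # g # mid) - letter_trace2 \<delta> b (l # g # mid))
          - (letter_trace2 a \<delta> (l # g # mid) - letter_trace2 b \<delta> (l # g # mid))" by simp
    also have "\<dots> = letter_trace2 \<delta> \<delta> (l # g # mid) - letter_trace2 \<delta> \<delta> (l # g # mid)"
      using letter_trace2_linear(4)[OF lcyc n(1) \<delta>_letter \<delta>_letter a_letter b_letter]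
        letter_trace2_linear(2)[OF lcyc n(1) a_letter b_letter \<delta>_letter \<delta>_letter]
      by (simp only: \<delta>_def[abs_def, symmetric])
    finally show ?thesis by simp
  qed (simp add: coboundary_def)
  then show ?thesis
    using character_cyclic_cochain[OF n] by (simp add: cyclic_cocycles_def fun_eq_iff)
qed

text \<open>The rule obeyed by the derivative of a family of functors whose present value is
  \<open>e\<close>.\<close>

definition derivation :: "('m \<Rightarrow> 'h \<Rightarrow> 'h) \<Rightarrow> ('m \<Rightarrow> 'h \<Rightarrow> 'h) \<Rightarrow> bool" where
  "derivation e c \<longleftrightarrow> letter c \<and> (\<forall>f\<in>Arr C. \<forall>g\<in>Arr C. Dom C f = Cod C g
     \<longrightarrow> (\<forall>x\<in>H (Dom C g). c (Comp C f g) x = c f (e g x) + e f (c g x)))"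

definition transgression :: "('m \<Rightarrow> 'h \<Rightarrow> 'h) \<Rightarrow> nat \<Rightarrow> 'm list \<Rightarrow> complex" where
  "transgression c n fs = (if fs \<in> cyclic_tuples C n
     then \<Sum>j\<le>n. (-1) ^ (j * n) * letter_trace c (rotate j fs) else 0)"

lemma transgression_cyclic_cochain:
  assumes "letter c" "q \<le> real n"
  shows "transgression c n \<in> cyclic_cochains C n"
  unfolding transgression_def[abs_def]
  by (intro cyclic_sum_cyclic_cochain multilinear_letter_trace assms)

text \<open>
  In terms of the graded derivation \<open>\<nabla> = d + [a, \<cdot>]\<close> one has \<open>\<nabla>\<delta> = \<delta>\<^sup>2\<close>, \<open>\<nabla>a' = 0\<close> and
  \<open>\<nabla>b' = \<delta>b' + b'\<delta>\<close>; hence the cyclic cochain of \<open>(a' + b') \<delta>\<^sup>N\<close> bounds that of \<open>(a' - b') \<delta>\<^sup>N\<^sup>+\<^sup>1\<close>.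
\<close>

theorem coboundary_transgression:
  assumes a': "derivation a a'" and b': "derivation b b'"
    and N: "q \<le> real N" "odd N" and fs: "fs \<in> cyclic_tuples C (Suc N)"
  shows "coboundary C N (transgression (\<lambda>f x. a' f x + b' f x) N) fs
    = (\<Sum>r\<le>Suc N. letter_trace (\<lambda>f x. a' f x - b' f x) (rotate r fs))"
proof -
  let ?c = "\<lambda>f x. a' f x + b' f x"
  have la: "letter a'" and lb: "letter b'" using a' b' by (simp_all add: derivation_def)
  note lc = letter_add[OF la lb]
  have len: "length fs = Suc (Suc N)" using cyclic_tuples_length[OF fs] by simp
  define \<psi> where "\<psi> gs = (\<Sum>j\<le>N. (-1) ^ (j * N) * letter_trace ?c (rotate j gs))" for gs
  define B where "B gs = (\<Sum>k\<le>N. (-1) ^ k * letter_trace ?c (contract C k gs))" for gs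
  \<comment> \<open>The part of \<open>B\<close> belonging to the rotated tuple; the remaining term
    belongs to the tuple before rotation. After summation over all rotations the first part can be
    shifted back.\<close>
  define E where "E gs = letter_trace2 a a' gs - letter_trace2 b' \<delta> gs + letter_trace2 b b' gs" for gs
  have step: "B (rotate1 gs) = E (rotate1 gs) - letter_trace2 b ?c gs"
    if gs: "gs \<in> cyclic_tuples C (Suc N)" for gs
  proof -
    obtain l g mid where lgm: "gs = l # g # mid"
      using cyclic_tuples_length[OF gs] by (metis length_Suc_conv)
    note lcyc = gs[unfolded lgm]
    obtain h rest where tail: "mid @ [l] = h # rest" by (cases "mid @ [l]") auto
    have gcyc: "g # h # rest \<in> cyclic_tuples C (Suc N)"
      using cyclic_tuples_rotate1[OF lcyc] tail by simp
    note F' = cyclic_Cons_Cons[OF gcyc N(1)]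
    have rot: "rotate1 gs = g # h # rest" using lgm tail by simp
    have Ba: "B (g # h # rest) = letter_trace ?c (Comp C g h # rest)
        - (letter_trace2 ?c a (g # h # rest) + letter_trace2 b ?c (l # g # mid))"
      using letter_trace_boundary[OF lcyc N(1) lc tail] N(2) by (simp add: B_def tail)
    note lin = letter_trace2_linear[OF gcyc N(1)]
    have "letter_trace ?c (Comp C g h # rest)
        = letter_trace a' (Comp C g h # rest) + letter_trace b' (Comp C g h # rest)"
    proof -
      have t: "traceable (H (Cod C g)) (\<lambda>x. d (Comp C g h) (prod_op \<delta> rest x))" if "letter d" for d
      proof -
        note cc = comp_Hom[OF F'(1-3)]
        have "d (Comp C g h) \<in> bounded_ops (H (Dom C h)) (H (Cod C g))"
          using letter_bounded[OF that cc(1)] cc by simp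
        then show ?thesis
          by (rule trace_class_traceable(1)[OF F'(6) H_Cod[OF F'(1)] H_Dom[OF F'(2)]])
      qed
      show ?thesis
        using op_trace_add[OF H_Cod[OF F'(1)] t[OF la] t[OF lb]] comp_Hom[OF F'(1-3)]
        by (simp add: letter_trace_def)
    qed
    also have "letter_trace a' (Comp C g h # rest) = letter_trace2 a' a (g # h # rest) + letter_trace2 a a' (g # h # rest)"
      using a' F'(1-3) by (intro letter_trace_Comp[OF gcyc N(1)] a_letter la) (simp add: derivation_def)
    also have "letter_trace b' (Comp C g h # rest) = letter_trace2 b' b (g # h # rest) + letter_trace2 b b' (g # h # rest)"
      using b' F'(1-3) by (intro letter_trace_Comp[OF gcyc N(1)] b_letter lb) (simp add: derivation_def)
    finally have comp: "letter_trace ?c (Comp C g h # rest)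
        = letter_trace2 a' a (g # h # rest) + letter_trace2 a a' (g # h # rest)
          + (letter_trace2 b' b (g # h # rest) + letter_trace2 b b' (g # h # rest))" .
    have "letter_trace2 b' \<delta> (g # h # rest) = letter_trace2 b' a (g # h # rest) - letter_trace2 b' b (g # h # rest)"
      using lin(4)[OF lb lb a_letter b_letter] by (simp only: \<delta>_def[abs_def, symmetric])
    then show ?thesis
      unfolding rot Ba comp lin(1)[OF la lb a_letter a_letter] E_def by (simp add: lgm)
  qed
  \<comment> \<open>With both parts on the same tuple, the terms with \<open>a\<close> and
    \<open>b\<close> before \<open>a'\<close> combine to \<open>\<delta>\<close>, and those with
    \<open>b\<close> before \<open>b'\<close> cancel.\<close>
  have rearranged: "E gs - letter_trace2 b ?c gs = letter_trace a' (rotate1 gs) - letter_trace b' gs"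
    if gs: "gs \<in> cyclic_tuples C (Suc N)" for gs
  proof -
    obtain l g mid where lgm: "gs = l # g # mid"
      using cyclic_tuples_length[OF gs] by (metis length_Suc_conv)
    note lcyc = gs[unfolded lgm]
    have d: "letter_trace2 \<delta> a' gs = letter_trace2 a a' gs - letter_trace2 b a' gs"
      using letter_trace2_linear(2)[OF lcyc N(1) a_letter b_letter la la]
      by (simp only: lgm \<delta>_def[abs_def, symmetric])
    have s: "letter_trace2 b ?c gs = letter_trace2 b a' gs + letter_trace2 b b' gs"
      using letter_trace2_linear(3)[OF lcyc N(1) b_letter b_letter la lb] by (simp add: lgm)
    have "letter_trace a' (rotate1 gs) = letter_trace2 \<delta> a' gs"
      using letter_trace2_conjugate(1)[OF lcyc N(1) \<delta>_letter la] by (simp add: lgm letter_trace_def)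
    moreover have "letter_trace b' gs = letter_trace2 b' \<delta> gs"
      by (simp add: lgm letter_trace_def letter_trace2_def)
    ultimately show ?thesis unfolding E_def s using d by simp
  qed
  have "coboundary C N (transgression ?c N) fs
      = (\<Sum>i\<le>N. (-1) ^ i * \<psi> (contract C i fs)) + (-1) ^ Suc N * \<psi> (Comp C (last fs) (hd fs) # butlast (tl fs))"
    unfolding coboundary_eq[OF fs]
    using contract_cyclic_tuples[OF fs] contract_last_cyclic_tuples[OF fs]
    by (simp add: transgression_def \<psi>_def)
  also have "\<dots> = (\<Sum>r\<le>Suc N. (-1) ^ (r * Suc N) * B (rotate r fs))"
    unfolding B_def by (rule coboundary_cyclic_sum[OF len]) (simp add: \<psi>_def)
  \<comment> \<open>As \<open>N\<close> is odd, the cyclic sum in degree \<open>Suc N\<close>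
    carries no signs.\<close>
  also have "\<dots> = (\<Sum>r\<le>Suc N. B (rotate r fs))"
    using N(2) by (intro sum.cong) auto
  also have "\<dots> = (\<Sum>r\<le>Suc N. B (rotate (Suc r) fs))"
    by (rule sum_rotate_shift[OF len, symmetric])
  also have "\<dots> = (\<Sum>r\<le>Suc N. E (rotate (Suc r) fs)) - (\<Sum>r\<le>Suc N. letter_trace2 b ?c (rotate r fs))"
    using step[OF cyclic_tuples_rotate[OF fs]] by (simp only: rotate_Suc comp_apply sum_subtractf)
  also have "(\<Sum>r\<le>Suc N. E (rotate (Suc r) fs)) = (\<Sum>r\<le>Suc N. E (rotate r fs))"
    by (rule sum_rotate_shift[OF len])
  also have "(\<Sum>r\<le>Suc N. E (rotate r fs)) - (\<Sum>r\<le>Suc N. letter_trace2 b ?c (rotate r fs))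
      = (\<Sum>r\<le>Suc N. letter_trace a' (rotate (Suc r) fs)) - (\<Sum>r\<le>Suc N. letter_trace b' (rotate r fs))"
    using rearranged[OF cyclic_tuples_rotate[OF fs]]
    by (simp only: sum_subtractf[symmetric] rotate_Suc comp_apply)
  also have "(\<Sum>r\<le>Suc N. letter_trace a' (rotate (Suc r) fs)) = (\<Sum>r\<le>Suc N. letter_trace a' (rotate r fs))"
    by (rule sum_rotate_shift[OF len])
  also have "(\<Sum>r\<le>Suc N. letter_trace a' (rotate r fs)) - (\<Sum>r\<le>Suc N. letter_trace b' (rotate r fs))
      = (\<Sum>r\<le>Suc N. letter_trace (\<lambda>f x. a' f x - b' f x) (rotate r fs))"
    unfolding sum_subtractf[symmetric]
  proof (rule sum.cong)
    fix r
    obtain f gs where fgs: "rotate r fs = f # gs" using len by (cases "rotate r fs") auto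
    then have cyc: "f # gs \<in> cyclic_tuples C (Suc N)" using cyclic_tuples_rotate[OF fs, of r] by simp
    have N': "q \<le> real (Suc N)" using N(1) by simp
    have "f \<in> Arr C" using cyclic_Cons(1)[OF cyc tail_not_Nil[OF cyc N']] .
    from op_trace_diff[OF H_Cod[OF this] letter_trace_traceable[OF cyc N' la] letter_trace_traceable[OF cyc N' lb]]
    show "letter_trace a' (rotate r fs) - letter_trace b' (rotate r fs)
        = letter_trace (\<lambda>f x. a' f x - b' f x) (rotate r fs)"
      by (simp add: fgs letter_trace_def)
  qed simp
  finally show ?thesis .
qed

end

section \<open>Homotopies of pairs of functors\<close>

lemma singular_number_zero_op:
  assumes "complex_vector.subspace V" "complex_vector.subspace W"
  shows "singular_number V W (\<lambda>_. 0) n = 0"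
proof -
  have "op_norm V (\<lambda>_. 0 :: 'b) \<le> 0" using assms(1) by (intro op_norm_le) auto
  then show ?thesis
    using singular_number_le_op_norm[OF assms bounded_ops_zero_op[OF assms(2)], of n]
      singular_number_nonneg[OF assms bounded_ops_zero_op[OF assms(2)], of n] by linarith
qed

text \<open>\<open>u\<close> may take the value \<open>t\<close>, as for letters of a mixed word
  that are kept fixed. The punctured limit in the definition is therefore completed by the value 0
  at \<open>t\<close> itself.\<close>

lemma schatten_continuous_compose:
  assumes T: "schatten_continuous_on p V W I T" and t: "t \<in> I"
    and V: "complex_vector.subspace V" and W: "complex_vector.subspace W"
    and u: "(u \<longlongrightarrow> t) Fl" "\<forall>\<^sub>F s in Fl. u s \<in> I"
  shows "((\<lambda>s. schatten_norm p V W (\<lambda>x. T (u s) x - T t x)) \<longlongrightarrow> 0) Fl"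
proof -
  have zero: "schatten_norm p V W (\<lambda>x. T t x - T t x) = 0"
    by (simp add: schatten_norm_def singular_number_zero_op[OF V W])
  have "continuous (at t within I) (\<lambda>s. schatten_norm p V W (\<lambda>x. T s x - T t x))"
    unfolding continuous_within zero using T t by (simp add: schatten_continuous_on_def)
  from continuous_within_tendsto_compose[OF this u(2,1)] show ?thesis unfolding zero .
qed

lemma schatten_continuous_bounded:
  assumes T: "schatten_continuous_on p V W {0..1} T" and p: "0 < p"
    and V: "complex_vector.subspace V" and W: "complex_vector.subspace W"
  obtains B where "\<And>t. t \<in> {0..1} \<Longrightarrow> schatten_norm p V W (T t) \<le> B"
proof -
  define P where "P a b \<longleftrightarrow> (\<exists>B. \<forall>t\<in>{a..b} \<inter> {0..1}. schatten_norm p V W (T t) \<le> B)" for a b :: real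
  have "P 0 1"
  proof (rule Bolzano[of 0 1 P])
    fix a b c assume "P a b" "P b c" "a \<le> b" "b \<le> c"
    then obtain B B' where B: "\<And>t. t \<in> {a..b} \<inter> {0..1} \<Longrightarrow> schatten_norm p V W (T t) \<le> B"
      "\<And>t. t \<in> {b..c} \<inter> {0..1} \<Longrightarrow> schatten_norm p V W (T t) \<le> B'" unfolding P_def by blast
    have "schatten_norm p V W (T t) \<le> max B B'" if "t \<in> {a..c} \<inter> {0..1}" for t
      using B(1)[of t] B(2)[of t] that by (cases "t \<le> b") auto
    then show "P a c" unfolding P_def by blast
  next
    fix x :: real assume x: "0 \<le> x" "x \<le> 1"
    then have xI: "x \<in> {0..1}" by simp
    have "((\<lambda>s. schatten_norm p V W (\<lambda>v. T s v - T x v)) \<longlongrightarrow> 0) (at x within {0..1})"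
      using T xI by (simp add: schatten_continuous_on_def)
    then have "\<forall>\<^sub>F s in at x within {0..1}. schatten_norm p V W (\<lambda>v. T s v - T x v) < 1"
      by (rule order_tendstoD) simp
    then obtain d where d: "d > 0"
      "\<And>s. s \<in> {0..1} \<Longrightarrow> s \<noteq> x \<Longrightarrow> dist s x < d \<Longrightarrow> schatten_norm p V W (\<lambda>v. T s v - T x v) < 1"
      unfolding eventually_at by blast
    have Ts: "T s \<in> schatten p V W" if "s \<in> {0..1}" for s
      using T that by (simp add: schatten_continuous_on_def)
    define B where "B = max (schatten_norm p V W (T x)) ((2 * 2 powr p * (1 + schatten_norm p V W (T x) powr p)) powr (1 / p))"
    have "P a b" if ab: "a \<le> x \<and> x \<le> b \<and> b - a < d" for a b
      unfolding P_def
    proof (intro exI ballI)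
      fix t assume t: "t \<in> {a..b} \<inter> {0..1}"
      show "schatten_norm p V W (T t) \<le> B"
      proof (cases "t = x")
        case False
        have "dist t x < d" using t ab by (auto simp: dist_real_def)
        then have "schatten_norm p V W (\<lambda>v. T t v - T x v) \<le> 1" using d(2)[of t] t False by auto
        from schatten_norm_le_of_diff[OF p V W Ts Ts this] show ?thesis
          using t xI by (simp add: B_def)
      qed (simp add: B_def)
    qed
    then show "\<exists>d>0. \<forall>a b. a \<le> x \<and> x \<le> b \<and> b - a < d \<longrightarrow> P a b" using d(1) by blast
  qed simp
  then obtain B where "\<forall>t\<in>{0..1}. schatten_norm p V W (T t) \<le> B" unfolding P_def by auto
  then show ?thesis using that[of B] by blast
qed

text \<open>The two families may belong to different arrows and vectors, as when the additivity of a
  functor is differentiated.\<close>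

lemma op_deriv_transform:
  assumes "((\<lambda>s. T s x) has_vector_derivative D) (at_right t)" "t \<in> {0..<1}"
    and "\<And>s. s \<in> {0..1} \<Longrightarrow> T' s y = T s x"
  shows "op_deriv T' t y = D"
proof (rule op_deriv_eq)
  have "((\<lambda>s. (1 / (s - t)) *\<^sub>R (T s x - T t x)) \<longlongrightarrow> D) (at_right t)"
    using assms(1) by (simp only: has_vector_derivative_iff_quotient)
  then have "((\<lambda>s. (1 / (s - t)) *\<^sub>R (T' s y - T' t y)) \<longlongrightarrow> D) (at_right t)"
  proof (rule Lim_transform_eventually)
    have "\<forall>\<^sub>F s in at_right t. s \<in> {0..1}"
      using assms(2) by (auto simp: eventually_at_right_field intro!: exI[of _ 1])
    then show "\<forall>\<^sub>F s in at_right t. (1 / (s - t)) *\<^sub>R (T s x - T t x) = (1 / (s - t)) *\<^sub>R (T' s y - T' t y)"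
      by eventually_elim (use assms in auto)
  qed
  then show "((\<lambda>s. T' s y) has_vector_derivative D) (at_right t)"
    by (simp only: has_vector_derivative_iff_quotient)
qed

lemma bounded_linear_scaleC: "bounded_linear (\<lambda>y. c *\<^sub>C (y :: 'a::complex_inner))"
  by (rule bounded_linear_intro[where K = "cmod c"])
    (auto simp: scaleC_add_right scaleC_scaleR_commute norm_scaleC mult.commute)

text \<open>Continuity off a finite set gives measurability on its complement, where the constant
  \<open>B\<close> dominates; the finite set is null.\<close>

lemma integrable_continuous_off_finite:
  fixes g :: "real \<Rightarrow> complex"
  assumes S: "finite S" and g: "continuous_on ({a..b} - S) g"
    and B: "\<And>t. t \<in> {a..b} - S \<Longrightarrow> norm (g t) \<le> B"
  shows "g integrable_on {a..b}"
proof -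
  have neg: "negligible S" using S by (rule negligible_finite)
  have leb: "{a..b} - S \<in> sets lebesgue" using S by (intro sets.Diff) (auto simp: negligible_imp_sets neg)
  have "(\<lambda>_. B) integrable_on ({a..b} - S)"
    by (rule integrable_spike_set[of _ "{a..b}"]) (auto intro: negligible_subset[OF neg])
  then have "g integrable_on ({a..b} - S)"
    using B by (intro measurable_bounded_by_integrable_imp_integrable[OF
        continuous_imp_measurable_on_sets_lebesgue[OF g leb] _ _ leb])
  then show ?thesis
    by (rule integrable_spike_set) (auto intro: negligible_subset[OF neg])
qed

lemma (in linear_category) cyclic_cochains_integral:
  assumes G: "\<And>t. G t \<in> cyclic_cochains C n" and int: "\<And>gs. (\<lambda>t. G t gs) integrable_on X"
  shows "(\<lambda>gs. integral X (\<lambda>t. G t gs)) \<in> cyclic_cochains C n"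
proof -
  note G' = G[unfolded cyclic_cochains_def cochains_def mem_Collect_eq]
  show ?thesis
    unfolding cyclic_cochains_def cochains_def mem_Collect_eq
  proof (intro conjI allI ballI impI)
    show "integral X (\<lambda>t. G t fs) = 0" if "fs \<notin> cyclic_tuples C n" for fs
      using G' that by simp
    fix fs i assume fs: "fs \<in> cyclic_tuples C n" and i: "i \<le> n"
    show "integral X (\<lambda>t. G t (fs[i := Plus C (fs ! i) g]))
        = integral X (\<lambda>t. G t fs) + integral X (\<lambda>t. G t (fs[i := g]))"
      if g: "g \<in> Hom C (Dom C (fs ! i)) (Cod C (fs ! i))" for g
    proof -
      have "G t (fs[i := Plus C (fs ! i) g]) = G t fs + G t (fs[i := g])" for t
        using G'[of t] fs i g by blast
      then show ?thesis by (simp add: integral_add int)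
    qed
    show "integral X (\<lambda>t. G t (fs[i := Scale C r (fs ! i)])) = r * integral X (\<lambda>t. G t fs)" for r
    proof -
      have "G t (fs[i := Scale C r (fs ! i)]) = r * G t fs" for t
        using G'[of t] fs i by blast
      then show ?thesis by simp
    qed
  next
    show "cyclic_op C n (\<lambda>gs. integral X (\<lambda>t. G t gs)) = (\<lambda>gs. integral X (\<lambda>t. G t gs))"
    proof
      fix fs
      have "cyclic_op C n (G t) fs = G t fs" for t using G'[of t] by simp
      then have "integral X (\<lambda>t. G t fs) = integral X (\<lambda>t. cyclic_op C n (G t) fs)" by simp
      also have "\<dots> = cyclic_op C n (\<lambda>gs. integral X (\<lambda>t. G t gs)) fs"
        by (simp add: cyclic_op_def)
      finally show "cyclic_op C n (\<lambda>gs. integral X (\<lambda>t. G t gs)) fs = integral X (\<lambda>t. G t fs)" ..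
    qed
  qed
qed

lemma (in linear_category) coboundary_integral:
  assumes int: "\<And>gs. (\<lambda>t. G t gs) integrable_on X"
  shows "coboundary C n (\<lambda>gs. integral X (\<lambda>t. G t gs)) fs = integral X (\<lambda>t. coboundary C n (G t) fs)"
proof (cases "fs \<in> cyclic_tuples C (Suc n)")
  case True
  have i: "(\<lambda>t. r * G t gs) integrable_on X" for r gs
    using has_integral_mult_right[OF integrable_integral[OF int]] by (auto simp: integrable_on_def)
  show ?thesis
    unfolding coboundary_eq[OF True]
    by (subst integral_add) (auto intro!: integrable_sum i simp: integral_sum i simp del: power_Suc)
qed (simp add: coboundary_def)

locale homotopy = linear_category C
  for C :: "('o, 'm) linear_cat" +
  fixes H :: "'o \<Rightarrow> 'h::complex_inner set" and a b :: "real \<Rightarrow> 'm \<Rightarrow> 'h \<Rightarrow> 'h" and q :: real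
  assumes pair: "t \<in> {0..1} \<Longrightarrow> quasi_hom C H (a t) (b t) q"
    and schatten_continuous: "f \<in> Arr C
      \<Longrightarrow> schatten_continuous_on q (H (Dom C f)) (H (Cod C f)) {0..1} (\<lambda>t x. a t f x - b t f x)"
    and C1_a: "f \<in> Arr C \<Longrightarrow> \<exists>L S. C1_family (H (Dom C f)) (H (Cod C f)) L S (\<lambda>t. a t f)"
    and C1_b: "f \<in> Arr C \<Longrightarrow> \<exists>L S. C1_family (H (Dom C f)) (H (Cod C f)) L S (\<lambda>t. b t f)"
begin

definition d :: "(real \<Rightarrow> 'm \<Rightarrow> 'h \<Rightarrow> 'h) \<Rightarrow> real \<Rightarrow> 'm \<Rightarrow> 'h \<Rightarrow> 'h" where
  "d e t f = op_deriv (\<lambda>t. e t f) t"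

definition \<Delta> :: "real \<Rightarrow> 'm \<Rightarrow> 'h \<Rightarrow> 'h" where
  "\<Delta> t f x = a t f x - b t f x"

text \<open>\<open>letter_trace\<close> with the time as an argument, so that it can vary; within
  the locale of one pair of functors the time is fixed.\<close>

definition tr :: "('m \<Rightarrow> 'h \<Rightarrow> 'h) \<Rightarrow> real \<Rightarrow> 'm list \<Rightarrow> complex" where
  "tr c t fs = op_trace (H (Cod C (hd fs))) (\<lambda>x. c (hd fs) (prod_op (\<Delta> t) (tl fs) x))"

lemma \<delta>_eq: "t \<in> {0..1} \<Longrightarrow> quasi_hom.\<delta> (a t) (b t) = \<Delta> t"
  using quasi_hom.\<delta>_def[OF pair, of t] by (simp add: fun_eq_iff \<Delta>_def)

lemma letter_trace_eq: "t \<in> {0..1} \<Longrightarrow> quasi_hom.letter_trace C H (a t) (b t) c fs = tr c t fs"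
  using quasi_hom.letter_trace_def[OF pair, of t c fs] by (simp add: tr_def \<delta>_eq)

lemma pair0: "quasi_hom C H (a 0) (b 0) q"
  by (rule pair) simp

lemma q: "0 < q"
  and dc_Dom: "f \<in> Arr C \<Longrightarrow> dense_countable (H (Dom C f))"
  and dc_Cod: "f \<in> Arr C \<Longrightarrow> dense_countable (H (Cod C f))"
  and sub_Dom: "f \<in> Arr C \<Longrightarrow> complex_vector.subspace (H (Dom C f))"
  and sub_Cod: "f \<in> Arr C \<Longrightarrow> complex_vector.subspace (H (Cod C f))"
proof -
  interpret quasi_hom C H "a 0" "b 0" q by (rule pair0)
  show "0 < q" by (rule q)
  show "f \<in> Arr C \<Longrightarrow> dense_countable (H (Dom C f))" by (rule H_Dom)
  show "f \<in> Arr C \<Longrightarrow> dense_countable (H (Cod C f))" by (rule H_Cod)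
  show "f \<in> Arr C \<Longrightarrow> complex_vector.subspace (H (Dom C f))" by (rule H_Dom_subspace)
  show "f \<in> Arr C \<Longrightarrow> complex_vector.subspace (H (Cod C f))" by (rule H_Cod_subspace)
qed

lemma \<Delta>_schatten: "f \<in> Arr C \<Longrightarrow> t \<in> {0..1} \<Longrightarrow> \<Delta> t f \<in> schatten q (H (Dom C f)) (H (Cod C f))"
  using quasi_hom.\<delta>_schatten[OF pair, of t f] by (simp add: \<delta>_eq)

lemma \<Delta>_continuous: "f \<in> Arr C \<Longrightarrow> schatten_continuous_on q (H (Dom C f)) (H (Cod C f)) {0..1} (\<lambda>t. \<Delta> t f)"
  using schatten_continuous[of f] by (simp add: \<Delta>_def[abs_def])

text \<open>The functor identities hold at all times and are differentiated from the right; for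
  composition this is \<open>op_deriv_comp\<close>.\<close>

lemma derivation_d:
  assumes t: "t \<in> {0..<1}"
    and e: "\<And>s. s \<in> {0..1} \<Longrightarrow> linear_op_functor C H (e s)"
    and C1: "\<And>f. f \<in> Arr C \<Longrightarrow> \<exists>L S. C1_family (H (Dom C f)) (H (Cod C f)) L S (\<lambda>t. e t f)"
  shows "quasi_hom.derivation C H (e t) (d e t)"
proof -
  have t': "t \<in> {0..1}" using t by simp
  interpret quasi_hom C H "a t" "b t" q by (rule pair[OF t'])
  have der: "((\<lambda>s. e s f x) has_vector_derivative d e t f x) (at_right t)"
    if "f \<in> Arr C" "x \<in> H (Dom C f)" for f x
    using C1[OF that(1)] that(2) t unfolding C1_family_def d_def by blast
  show ?thesis
    unfolding derivation_def letter_def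
  proof (intro conjI ballI allI impI)
    fix f assume f: "f \<in> Arr C"
    show "d e t f \<in> bounded_ops (H (Dom C f)) (H (Cod C f))"
      using C1[OF f] t unfolding C1_family_def d_def by blast
    fix x assume x: "x \<in> H (Dom C f)"
    show "d e t (Plus C f g) x = d e t f x + d e t g x" if g: "g \<in> Hom C (Dom C f) (Cod C f)" for g
    proof -
      have g': "g \<in> Arr C" "x \<in> H (Dom C g)" using g x by (auto simp: Hom_def)
      show ?thesis
        unfolding d_def[of e t "Plus C f g"]
        using has_vector_derivative_add[OF der[OF f x] der[OF g']] t
      proof (rule op_deriv_transform[where T = "\<lambda>s x. e s f x + e s g x"])
        show "e s (Plus C f g) x = e s f x + e s g x" if "s \<in> {0..1}" for s
          using letter_functor[OF e[OF that]] f g x by (simp add: letter_def)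
      qed
    qed
    show "d e t (Scale C r f) x = r *\<^sub>C d e t f x" for r
      unfolding d_def[of e t "Scale C r f"]
      using bounded_linear.has_vector_derivative[OF bounded_linear_scaleC der[OF f x]] t
    proof (rule op_deriv_transform[where T = "\<lambda>s x. r *\<^sub>C e s f x"])
      show "e s (Scale C r f) x = r *\<^sub>C e s f x" if "s \<in> {0..1}" for s
        using letter_functor[OF e[OF that]] f x by (simp add: letter_def)
    qed
  next
    fix f g x assume f: "f \<in> Arr C" and g: "g \<in> Arr C" and fg: "Dom C f = Cod C g" and x: "x \<in> H (Dom C g)"
    obtain K S where K: "C1_family (H (Cod C g)) (H (Cod C f)) K S (\<lambda>t. e t f)"
      using C1[OF f] fg by auto
    obtain L S' where L: "C1_family (H (Dom C g)) (H (Cod C g)) L S' (\<lambda>t. e t g)"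
      using C1[OF g] by auto
    note eq = op_deriv_comp[OF K L sub_Cod[OF g] t x]
    have comp: "Comp C f g \<in> Arr C" "x \<in> H (Dom C (Comp C f g))"
      using comp_Hom[OF f g fg] x by auto
    have "op_deriv (\<lambda>t x. e t f (e t g x)) t x = d e t (Comp C f g) x"
      using der[OF comp] t
    proof (rule op_deriv_transform[where T = "\<lambda>s. e s (Comp C f g)"])
      show "e s f (e s g x) = e s (Comp C f g) x" if "s \<in> {0..1}" for s
        by (rule functor_comp[OF e[OF that] f g fg x, symmetric])
    qed
    then show "d e t (Comp C f g) x = d e t f (e t g x) + e t f (d e t g x)"
      using eq by (simp add: d_def)
  qed
qed

lemma functors: "t \<in> {0..1} \<Longrightarrow> linear_op_functor C H (a t)" "t \<in> {0..1} \<Longrightarrow> linear_op_functor C H (b t)"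
  using quasi_hom.functor_a[OF pair] quasi_hom.functor_b[OF pair] by blast+

lemma word_spaces:
  assumes fs: "f # gs \<in> cyclic_tuples C n" and n: "q \<le> real n"
  obtains Vs where "\<And>i. dense_countable (Vs i)"
    "\<And>i. i < n \<Longrightarrow> Vs i = H (Cod C (gs ! i))" "\<And>i. i < n \<Longrightarrow> Vs (Suc i) = H (Dom C (gs ! i))"
    "Vs 0 = H (Dom C f)" "Vs n = H (Cod C f)" "0 < n" "\<And>i. i < n \<Longrightarrow> gs ! i \<in> Arr C"
    "length gs = n" "f \<in> Arr C"
proof -
  interpret quasi_hom C H "a 0" "b 0" q by (rule pair0)
  note ne = tail_not_Nil[OF fs n]
  note F = cyclic_Cons[OF fs ne]
  have Arr: "gs ! i \<in> Arr C" if "i < n" for i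
    using F(2,5) that by (auto simp: composable_iff_nth)
  have last: "last gs = gs ! (n - 1)" "hd gs = gs ! 0" using ne F(5) by (auto simp: last_conv_nth hd_conv_nth)
  have n0: "0 < n" using ne F(5) by auto
  define Vs where "Vs i = (if i < n then H (Cod C (gs ! i)) else H (Cod C f))" for i
  have "Vs (Suc i) = H (Dom C (gs ! i))" if i: "i < n" for i
  proof (cases "Suc i < n")
    case True
    then show ?thesis using F(2,5) by (simp add: Vs_def composable_iff_nth)
  next
    case False
    then have "gs ! i = last gs" using i last by (metis Suc_lessI diff_Suc_1)
    then show ?thesis using False F(4) by (simp add: Vs_def)
  qed
  moreover have "dense_countable (Vs i)" for i
    using Arr F(1) by (auto simp: Vs_def intro!: dc_Cod)
  moreover have "Vs 0 = H (Dom C f)" using n0 F(3) last(2) by (simp add: Vs_def)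
  ultimately show ?thesis
    using that[of Vs] Arr n0 F(1,5) by (simp add: Vs_def)
qed

text \<open>Each letter has its own time \<open>u s i\<close>, as needed for the mixed words of a
  telescoped increment.\<close>

lemma word_trace_tendsto:
  assumes fs: "f # gs \<in> cyclic_tuples C n" and n: "q \<le> real n" and t: "t \<in> {0..1}"
    and u: "\<And>i. i < n \<Longrightarrow> ((\<lambda>s. u s i) \<longlongrightarrow> t) Fl" "\<And>i. i < n \<Longrightarrow> \<forall>\<^sub>F s in Fl. u s i \<in> {0..1}"
    and K: "0 \<le> K"
    and A: "\<forall>\<^sub>F s in Fl. A s \<in> bounded_ops (H (Dom C f)) (H (Cod C f))
      \<and> (\<forall>x\<in>H (Dom C f). norm (A s x) \<le> K * norm x)"
    and A0: "A0 \<in> bounded_ops (H (Dom C f)) (H (Cod C f))" "\<And>x. x \<in> H (Dom C f) \<Longrightarrow> norm (A0 x) \<le> K * norm x"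
    and lim: "\<And>x. x \<in> H (Dom C f) \<Longrightarrow> ((\<lambda>s. A s x) \<longlongrightarrow> A0 x) Fl"
  shows "((\<lambda>s. op_trace (H (Cod C f)) (\<lambda>x. A s (word (\<lambda>i. \<Delta> (u s i) (gs ! i)) n x)))
    \<longlongrightarrow> op_trace (H (Cod C f)) (\<lambda>x. A0 (prod_op (\<Delta> t) gs x))) Fl"
proof -
  obtain Vs where dc: "\<And>i. dense_countable (Vs i)"
    and Vs: "\<And>i. i < n \<Longrightarrow> Vs i = H (Cod C (gs ! i))" "\<And>i. i < n \<Longrightarrow> Vs (Suc i) = H (Dom C (gs ! i))"
    and ends: "Vs 0 = H (Dom C f)" "Vs n = H (Cod C f)" and n0: "0 < n"
    and Arr: "\<And>i. i < n \<Longrightarrow> gs ! i \<in> Arr C" and len: "length gs = n"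
    using word_spaces[OF fs n] by metis
  have "((\<lambda>s. op_trace (Vs n) (\<lambda>x. A s (word (\<lambda>i. \<Delta> (u s i) (gs ! i)) n x)))
      \<longlongrightarrow> op_trace (Vs n) (\<lambda>x. A0 (word (\<lambda>i. \<Delta> t (gs ! i)) n x))) Fl"
  proof (rule op_trace_word_tendsto[OF dc q _ _ _ n0 n K])
    fix i assume i: "i < n"
    show "\<forall>\<^sub>F s in Fl. \<Delta> (u s i) (gs ! i) \<in> schatten q (Vs (Suc i)) (Vs i)"
      using u(2)[OF i] unfolding Vs[OF i] by eventually_elim (rule \<Delta>_schatten[OF Arr[OF i]])
    show "\<Delta> t (gs ! i) \<in> schatten q (Vs (Suc i)) (Vs i)"
      unfolding Vs[OF i] by (rule \<Delta>_schatten[OF Arr[OF i] t])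
    show "((\<lambda>s. schatten_norm q (Vs (Suc i)) (Vs i) (\<lambda>x. \<Delta> (u s i) (gs ! i) x - \<Delta> t (gs ! i) x)) \<longlongrightarrow> 0) Fl"
      unfolding Vs[OF i]
      by (rule schatten_continuous_compose[OF \<Delta>_continuous[OF Arr[OF i]] t sub_Dom[OF Arr[OF i]]
            sub_Cod[OF Arr[OF i]] u[OF i]])
  qed (use A A0 lim in \<open>simp_all add: ends\<close>)
  moreover have "word (\<lambda>i. \<Delta> t (gs ! i)) n x = prod_op (\<Delta> t) gs x" for x
    by (simp add: prod_op_eq_word len)
  ultimately show ?thesis by (simp add: ends)
qed

end

section \<open>Bounds, continuity and increments of the trace forms in time\<close>

context homotopy
begin

definition d\<Delta> :: "real \<Rightarrow> 'm \<Rightarrow> 'h \<Rightarrow> 'h" where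
  "d\<Delta> t f x = d a t f x - d b t f x"

definition d\<Sigma> :: "real \<Rightarrow> 'm \<Rightarrow> 'h \<Rightarrow> 'h" where
  "d\<Sigma> t f x = d a t f x + d b t f x"

lemma derivations:
  assumes "t \<in> {0..<1}"
  shows "quasi_hom.derivation C H (a t) (d a t)" "quasi_hom.derivation C H (b t) (d b t)"
  using derivation_d[OF assms functors(1) C1_a] derivation_d[OF assms functors(2) C1_b] by blast+

lemma letters:
  assumes "t \<in> {0..<1}"
  shows "quasi_hom.letter C H (d\<Sigma> t)" "quasi_hom.letter C H (d\<Delta> t)"
proof -
  have "t \<in> {0..1}" using assms by simp
  then interpret quasi_hom C H "a t" "b t" q by (rule pair)
  have "letter (d a t)" "letter (d b t)" using derivations[OF assms] by (auto simp: derivation_def)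
  then show "letter (d\<Sigma> t)" "letter (d\<Delta> t)"
    unfolding d\<Sigma>_def[abs_def] d\<Delta>_def[abs_def] by (rule letter_add, rule letter_diff)
qed

lemma letters_bounded:
  assumes "t \<in> {0..<1}" "f \<in> Arr C"
  shows "d\<Sigma> t f \<in> bounded_ops (H (Dom C f)) (H (Cod C f))"
    "d\<Delta> t f \<in> bounded_ops (H (Dom C f)) (H (Cod C f))"
proof -
  have "t \<in> {0..1}" using assms by simp
  then interpret quasi_hom C H "a t" "b t" q by (rule pair)
  show "d\<Sigma> t f \<in> bounded_ops (H (Dom C f)) (H (Cod C f))"
    "d\<Delta> t f \<in> bounded_ops (H (Dom C f)) (H (Cod C f))"
    using letter_bounded[OF letters(1)[OF assms(1)] assms(2)]
      letter_bounded[OF letters(2)[OF assms(1)] assms(2)] .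
qed

lemma \<Delta>_C1:
  assumes f: "f \<in> Arr C"
  shows "\<exists>L S. 0 \<le> L \<and> finite S
    \<and> (\<forall>s\<in>{0..1}. \<forall>t\<in>{0..1}. \<forall>x\<in>H (Dom C f). norm (\<Delta> s f x - \<Delta> t f x) \<le> L * \<bar>s - t\<bar> * norm x)
    \<and> (\<forall>t\<in>{0<..<1} - S. \<forall>x\<in>H (Dom C f). ((\<lambda>s. \<Delta> s f x) has_vector_derivative d\<Delta> t f x) (at t))"
proof -
  obtain K S where A: "C1_family (H (Dom C f)) (H (Cod C f)) K S (\<lambda>t. a t f)" using C1_a[OF f] by blast
  obtain L S' where B: "C1_family (H (Dom C f)) (H (Cod C f)) L S' (\<lambda>t. b t f)" using C1_b[OF f] by blast
  note fam = C1_family_add_scaleR(1)[OF A B sub_Dom[OF f] sub_Cod[OF f], of "-1", unfolded C1_family_def]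
  show ?thesis
  proof (intro exI[of _ "K + L"] exI[of _ "S \<union> S'"] conjI ballI)
    show "0 \<le> K + L" "finite (S \<union> S')" using fam by auto
    fix s t :: real and x assume "s \<in> {0..1}" "t \<in> {0..1}" and x: "x \<in> H (Dom C f)"
    then show "norm (\<Delta> s f x - \<Delta> t f x) \<le> (K + L) * \<bar>s - t\<bar> * norm x"
      using fam by (simp add: \<Delta>_def)
  next
    fix t x assume t: "t \<in> {0<..<1} - (S \<union> S')" and x: "x \<in> H (Dom C f)"
    show "((\<lambda>s. \<Delta> s f x) has_vector_derivative d\<Delta> t f x) (at t)"
      unfolding \<Delta>_def[abs_def] d\<Delta>_def d_def
      using A B t x unfolding C1_family_def by (intro has_vector_derivative_diff) auto
  qed
qed

lemma d\<Sigma>_C1: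
  assumes f: "f \<in> Arr C"
  shows "\<exists>L S. 0 \<le> L \<and> finite S
    \<and> (\<forall>t\<in>{0..<1}. \<forall>x\<in>H (Dom C f). norm (d\<Sigma> t f x) \<le> L * norm x)
    \<and> (\<forall>t\<in>{0<..<1} - S. \<forall>x\<in>H (Dom C f). isCont (\<lambda>s. d\<Sigma> s f x) t)"
proof -
  obtain K S where A: "C1_family (H (Dom C f)) (H (Cod C f)) K S (\<lambda>t. a t f)" using C1_a[OF f] by blast
  obtain L S' where B: "C1_family (H (Dom C f)) (H (Cod C f)) L S' (\<lambda>t. b t f)" using C1_b[OF f] by blast
  note A' = A[unfolded C1_family_def] and B' = B[unfolded C1_family_def]
  show ?thesis
  proof (intro exI[of _ "K + L"] exI[of _ "S \<union> S'"] conjI ballI)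
    show "0 \<le> K + L" "finite (S \<union> S')" using A' B' by auto
    fix t x assume t: "t \<in> {0..<1::real}" and x: "x \<in> H (Dom C f)"
    have "norm (d\<Sigma> t f x) \<le> norm (d a t f x) + norm (d b t f x)"
      unfolding d\<Sigma>_def by (rule norm_triangle_ineq)
    also have "\<dots> \<le> K * norm x + L * norm x"
      using A' B' t x unfolding d_def by (intro add_mono) auto
    finally show "norm (d\<Sigma> t f x) \<le> (K + L) * norm x" by (simp add: distrib_right)
  next
    fix t x assume t: "t \<in> {0<..<1} - (S \<union> S')" and x: "x \<in> H (Dom C f)"
    show "isCont (\<lambda>s. d\<Sigma> s f x) t"
      unfolding d\<Sigma>_def d_def using A' B' t x by (intro continuous_intros) auto
  qed
qed

text \<open>The bound is uniform in \<open>t\<close> and in all \<open>A\<close> with constant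
  \<open>K\<close>; it dominates the integrand of the transgression.\<close>

lemma tr_bounded:
  assumes fs: "f # gs \<in> cyclic_tuples C n" and n: "q \<le> real n" and K: "0 \<le> K"
  obtains B where "\<And>t A. t \<in> {0..1} \<Longrightarrow> A \<in> bounded_ops (H (Dom C f)) (H (Cod C f))
    \<Longrightarrow> (\<And>x. x \<in> H (Dom C f) \<Longrightarrow> norm (A x) \<le> K * norm x)
    \<Longrightarrow> cmod (op_trace (H (Cod C f)) (\<lambda>x. A (prod_op (\<Delta> t) gs x))) \<le> B"
proof -
  obtain Vs where dc: "\<And>i. dense_countable (Vs i)"
    and Vs: "\<And>i. i < n \<Longrightarrow> Vs i = H (Cod C (gs ! i))" "\<And>i. i < n \<Longrightarrow> Vs (Suc i) = H (Dom C (gs ! i))"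
    and ends: "Vs 0 = H (Dom C f)" "Vs n = H (Cod C f)" and n0: "0 < n"
    and Arr: "\<And>i. i < n \<Longrightarrow> gs ! i \<in> Arr C" and len: "length gs = n"
    using word_spaces[OF fs n] by metis
  have "\<exists>B. \<forall>t\<in>{0..1}. schatten_norm q (Vs (Suc i)) (Vs i) (\<Delta> t (gs ! i)) \<le> B" if i: "i < n" for i
    using schatten_continuous_bounded[OF \<Delta>_continuous[OF Arr[OF i]] q sub_Dom[OF Arr[OF i]] sub_Cod[OF Arr[OF i]]]
    unfolding Vs[OF i] by metis
  then obtain B where B: "\<And>i t. i < n \<Longrightarrow> t \<in> {0..1}
      \<Longrightarrow> schatten_norm q (Vs (Suc i)) (Vs i) (\<Delta> t (gs ! i)) \<le> B i" by metis
  show ?thesis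
  proof (rule that[of "18 * K * (real n * real n * (\<Prod>i<n. B i))"])
    fix t A assume t: "t \<in> {0..1::real}" and A: "A \<in> bounded_ops (H (Dom C f)) (H (Cod C f))"
      "\<And>x. x \<in> H (Dom C f) \<Longrightarrow> norm (A x) \<le> K * norm x"
    have sch: "\<Delta> t (gs ! i) \<in> schatten q (Vs (Suc i)) (Vs i)" if i: "i < n" for i
      unfolding Vs[OF i] by (rule \<Delta>_schatten[OF Arr[OF i] t])
    have "cmod (op_trace (Vs n) (\<lambda>x. A (word (\<lambda>i. \<Delta> t (gs ! i)) n x)))
        \<le> 18 * K * (\<Sum>k. singular_number (Vs n) (Vs 0) (word (\<lambda>i. \<Delta> t (gs ! i)) n) k)"
      using A K by (intro op_trace_le[OF word_trace_class(1)[where Vs = Vs, OF dc q _ n0 n] dc dc] sch) (auto simp: ends)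
    also have "\<dots> \<le> 18 * K * (real n * real n * (\<Prod>i<n. schatten_norm q (Vs (Suc i)) (Vs i) (\<Delta> t (gs ! i))))"
      using mult_left_mono[OF word_trace_class(2)[where Vs = Vs and T = "\<lambda>i. \<Delta> t (gs ! i)", OF dc q sch n0 n], of "18 * K"] K by simp
    also have "\<dots> \<le> 18 * K * (real n * real n * (\<Prod>i<n. B i))"
      using K B t schatten_norm_nonneg[OF q] by (intro mult_left_mono prod_mono) auto
    finally show "cmod (op_trace (H (Cod C f)) (\<lambda>x. A (prod_op (\<Delta> t) gs x)))
        \<le> 18 * K * (real n * real n * (\<Prod>i<n. B i))"
      by (simp add: ends prod_op_eq_word len)
  qed
qed

text \<open>A mixed word contains letters of different kinds, so each operator is paired with its
  arrow, which keeps track of its spaces under rotation.\<close>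

lemma op_trace_rotate:
  assumes ws: "map snd ws \<in> cyclic_tuples C n" and n: "q \<le> real n"
    and sch: "\<And>T f. (T, f) \<in> set ws \<Longrightarrow> T \<in> schatten q (H (Dom C f)) (H (Cod C f))"
  shows "op_trace (H (Cod C (snd (hd (rotate i ws))))) (prod_op fst (rotate i ws))
    = op_trace (H (Cod C (snd (hd ws)))) (prod_op fst ws)"
proof (induction i)
  case (Suc i)
  define vs where "vs = rotate i ws"
  have vs: "map snd vs \<in> cyclic_tuples C n" "set vs = set ws"
    using cyclic_tuples_rotate[OF ws, of i] by (simp_all add: vs_def rotate_map)
  obtain T f us where vs': "vs = (T, f) # us"
    using cyclic_tuples_length[OF vs(1)] by (cases vs) auto
  have cyc: "f # map snd us \<in> cyclic_tuples C n" using vs(1) by (simp add: vs')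
  obtain Vs where dc: "\<And>i. dense_countable (Vs i)"
    and Vs: "\<And>i. i < n \<Longrightarrow> Vs i = H (Cod C (map snd us ! i))" "\<And>i. i < n \<Longrightarrow> Vs (Suc i) = H (Dom C (map snd us ! i))"
    and ends: "Vs 0 = H (Dom C f)" "Vs n = H (Cod C f)" and n0: "0 < n"
    and len: "length (map snd us) = n" and f: "f \<in> Arr C"
    using word_spaces[OF cyc n] by metis
  have "fst (us ! i) \<in> schatten q (Vs (Suc i)) (Vs i)" if i: "i < n" for i
  proof -
    have "us ! i \<in> set us" using len i by (intro nth_mem) simp
    then have "(fst (us ! i), snd (us ! i)) \<in> set ws" unfolding vs(2)[symmetric] vs' by simp
    from sch[OF this] show ?thesis unfolding Vs[OF i] using len i by simp
  qed
  from word_trace_class(1)[where Vs = Vs and m = n, OF dc q this n0 n]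
  have "word (\<lambda>i. fst (us ! i)) n \<in> trace_class (H (Cod C f)) (H (Dom C f))" by (simp add: ends)
  moreover have "word (\<lambda>i. fst (us ! i)) n = prod_op fst us"
    using len by (simp add: fun_eq_iff prod_op_eq_word)
  ultimately have P: "prod_op fst us \<in> trace_class (H (Cod C f)) (H (Dom C f))" by simp
  have T: "T \<in> bounded_ops (H (Dom C f)) (H (Cod C f))"
    by (rule schatten_bounded[OF sch]) (simp add: vs(2)[symmetric] vs')
  obtain w us' where us: "us = w # us'" using len n0 by (cases us) auto
  have hd: "H (Cod C (snd w)) = H (Dom C f)" using Vs(1)[of 0] ends n0 us by simp
  have "op_trace (H (Cod C f)) (\<lambda>x. T (prod_op fst us x)) = op_trace (H (Dom C f)) (\<lambda>x. prod_op fst us (T x))"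
    by (rule op_trace_cyclic[OF P dc_Cod[OF f] dc_Dom[OF f] T])
  moreover have "prod_op fst vs = (\<lambda>x. T (prod_op fst us x))" "prod_op fst (rotate1 vs) = (\<lambda>x. prod_op fst us (T x))"
    by (auto simp: vs' fun_eq_iff)
  ultimately have "op_trace (H (Cod C (snd (hd (rotate1 vs))))) (prod_op fst (rotate1 vs))
      = op_trace (H (Cod C (snd (hd vs)))) (prod_op fst vs)"
    by (simp only: vs' us) (simp add: hd)
  then show ?case using Suc.IH by (simp add: vs_def)
qed simp

text \<open>The head plays the strongly continuous factor and the remaining \<open>n\<close> letters
  the word. Continuity up to the end points is what integration needs, since the derivative is known
  only off a finite set in the interior.\<close>

lemma tr_continuous:
  assumes fs: "fs \<in> cyclic_tuples C n" and n: "q \<le> real n"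
  shows "continuous_on {0..1} (\<lambda>s. tr (\<Delta> s) s fs)"
  unfolding continuous_on_def
proof
  fix t :: real assume t: "t \<in> {0..1}"
  obtain f gs where fgs: "fs = f # gs" using cyclic_tuples_length[OF fs] by (cases fs) auto
  note cyc = fs[unfolded fgs]
  have f: "f \<in> Arr C" and len: "length gs = n" using cyc by (auto simp: cyclic_tuples_iff)
  obtain L S where L: "0 \<le> L" "finite S"
    "\<And>s t x. s \<in> {0..1} \<Longrightarrow> t \<in> {0..1} \<Longrightarrow> x \<in> H (Dom C f) \<Longrightarrow> norm (\<Delta> s f x - \<Delta> t f x) \<le> L * \<bar>s - t\<bar> * norm x"
    using \<Delta>_C1[OF f] by blast
  have b: "\<Delta> s f \<in> bounded_ops (H (Dom C f)) (H (Cod C f))" if "s \<in> {0..1}" for s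
    using schatten_bounded[OF \<Delta>_schatten[OF f that]] .
  obtain M where M: "M \<ge> 0" "\<And>x. x \<in> H (Dom C f) \<Longrightarrow> norm (\<Delta> t f x) \<le> M * norm x"
    using bounded_ops_nonneg_bound[OF b[OF t]] by blast
  have ev: "\<forall>\<^sub>F s in at t within {0..1}. s \<in> {0..1}"
    by (simp add: eventually_at_filter)
  have le: "norm (\<Delta> s f x) \<le> (M + L) * norm x" if s: "s \<in> {0..1}" and x: "x \<in> H (Dom C f)" for s x
  proof -
    have "\<bar>s - t\<bar> \<le> 1" using s t by auto
    then have "L * \<bar>s - t\<bar> * norm x \<le> L * 1 * norm x"
      using L(1) by (intro mult_right_mono mult_left_mono) auto
    then show ?thesis
      using L(3)[OF s t x] M(2)[OF x] norm_triangle_sub[of "\<Delta> s f x" "\<Delta> t f x"] by (simp add: distrib_right)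
  qed
  have "((\<lambda>s. op_trace (H (Cod C f)) (\<lambda>x. \<Delta> s f (word (\<lambda>i. \<Delta> s (gs ! i)) n x)))
      \<longlongrightarrow> op_trace (H (Cod C f)) (\<lambda>x. \<Delta> t f (prod_op (\<Delta> t) gs x))) (at t within {0..1})"
  proof (rule word_trace_tendsto[OF cyc n t])
    show "((\<lambda>s. s) \<longlongrightarrow> t) (at t within {0..1})" by (rule tendsto_ident_at)
    show "0 \<le> M + L" using M(1) L(1) by simp
    show "\<forall>\<^sub>F s in at t within {0..1}. \<Delta> s f \<in> bounded_ops (H (Dom C f)) (H (Cod C f))
        \<and> (\<forall>x\<in>H (Dom C f). norm (\<Delta> s f x) \<le> (M + L) * norm x)"
      using ev by eventually_elim (use b le in auto)
    show "\<Delta> t f \<in> bounded_ops (H (Dom C f)) (H (Cod C f))" by (rule b[OF t])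
    show "norm (\<Delta> t f x) \<le> (M + L) * norm x" if "x \<in> H (Dom C f)" for x by (rule le[OF t that])
    show "((\<lambda>s. \<Delta> s f x) \<longlongrightarrow> \<Delta> t f x) (at t within {0..1})" if x: "x \<in> H (Dom C f)" for x
    proof (rule LIM_zero_cancel, rule Lim_null_comparison)
      show "\<forall>\<^sub>F s in at t within {0..1}. norm (\<Delta> s f x - \<Delta> t f x) \<le> L * \<bar>s - t\<bar> * norm x"
        using ev by eventually_elim (rule L(3)[OF _ t x])
      have "((\<lambda>s. L * \<bar>s - t\<bar> * norm x) \<longlongrightarrow> L * \<bar>t - t\<bar> * norm x) (at t within {0..1})"
        by (intro tendsto_intros)
      then show "((\<lambda>s. L * \<bar>s - t\<bar> * norm x) \<longlongrightarrow> 0) (at t within {0..1})" by simp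
    qed
  qed (rule ev)
  then show "((\<lambda>s. tr (\<Delta> s) s fs) \<longlongrightarrow> tr (\<Delta> t) t fs) (at t within {0..1})"
    by (simp add: tr_def fgs prod_op_eq_word len)
qed

text \<open>The increment is telescoped and each summand rotated until the changed letter stands in
  front. Letter \<open>k\<close> behind it came from position
  \<open>(i + k + 1) mod (n + 1)\<close>, and it has time \<open>s\<close> if that position precedes
  \<open>i\<close>.\<close>

lemma tr_telescope:
  assumes fs: "fs \<in> cyclic_tuples C n" and n: "q \<le> real n" and s: "s \<in> {0..1}" and t: "t \<in> {0..1}"
  shows "tr (\<Delta> s) s fs - tr (\<Delta> t) t fs
    = (\<Sum>i<Suc n. op_trace (H (Cod C (fs ! i)))
        (\<lambda>x. (\<lambda>y. \<Delta> s (fs ! i) y - \<Delta> t (fs ! i) y)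
          (word (\<lambda>k. \<Delta> (if (i + Suc k) mod Suc n < i then s else t) (tl (rotate i fs) ! k)) n x)))"
proof -
  have len: "length fs = Suc n" using cyclic_tuples_length[OF fs] .
  have Arr: "fs ! i \<in> Arr C" if "i < Suc n" for i using fs that len by (auto simp: cyclic_tuples_iff)
  have hd: "hd fs = fs ! 0" using len by (intro hd_conv_nth) auto
  \<comment> \<open>Indices modulo \<open>Suc n\<close> make the last space equal to the first, so
    that telescoping applies with the identity as the outer factor.\<close>
  define Vs where "Vs i = H (Cod C (fs ! (i mod Suc n)))" for i
  have dc: "dense_countable (Vs i)" for i unfolding Vs_def by (intro dc_Cod Arr) simp
  have Vs: "Vs i = H (Cod C (fs ! i))" "Vs (Suc i) = H (Dom C (fs ! i))" if i: "i < Suc n" for i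
  proof -
    show "Vs i = H (Cod C (fs ! i))" using i by (simp add: Vs_def)
    show "Vs (Suc i) = H (Dom C (fs ! i))"
      using fs i by (cases "i = n") (auto simp: Vs_def cyclic_tuples_def)
  qed
  have ends: "Vs 0 = H (Cod C (hd fs))" "Vs (Suc n) = H (Cod C (hd fs))" by (simp_all add: Vs_def hd)
  have sch: "\<Delta> u (fs ! i) \<in> schatten q (Vs (Suc i)) (Vs i)" if "i < Suc n" "u \<in> {0..1}" for u i
    unfolding Vs[OF that(1)] by (rule \<Delta>_schatten[OF Arr[OF that(1)] that(2)])
  have n': "q \<le> real (Suc n)" using n by simp
  define E where "E i y = \<Delta> s (fs ! i) y - \<Delta> t (fs ! i) y" for i y
  define mix where "mix i = (\<lambda>j. if j < i then \<Delta> s (fs ! j) else \<Delta> t (fs ! j))(i := E i)" for i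
  have trw: "tr (\<Delta> u) u fs = op_trace (Vs (Suc n)) (word (\<lambda>i. \<Delta> u (fs ! i)) (Suc n))" for u
  proof -
    have "fs \<noteq> []" using len by auto
    then have "(\<lambda>x. \<Delta> u (hd fs) (prod_op (\<Delta> u) (tl fs) x)) = prod_op (\<Delta> u) fs"
      by (metis (no_types, lifting) ext list.collapse prod_op_Cons)
    moreover have "prod_op (\<Delta> u) fs = word (\<lambda>i. \<Delta> u (fs ! i)) (Suc n)"
      by (rule ext) (simp only: prod_op_eq_word len)
    ultimately show ?thesis by (simp only: tr_def ends)
  qed
  have idb: "(\<lambda>x. x) \<in> bounded_ops (Vs 0) (Vs (Suc n))" unfolding ends by (rule bounded_ops_id)
  have "tr (\<Delta> s) s fs - tr (\<Delta> t) t fs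
      = (\<Sum>i<Suc n. op_trace (Vs (Suc n)) (word (mix i) (Suc n)))"
    using op_trace_word_telescope[where Vs = Vs and m = "Suc n" and S = "\<lambda>i. \<Delta> s (fs ! i)"
        and T = "\<lambda>i. \<Delta> t (fs ! i)" and A = "\<lambda>x. x", OF dc q sch[OF _ s] sch[OF _ t] zero_less_Suc n' idb]
    unfolding trw mix_def E_def by (simp del: word.simps sum.lessThan_Suc)
  also have "\<dots> = (\<Sum>i<Suc n. op_trace (H (Cod C (fs ! i))) (\<lambda>x. E i
      (word (\<lambda>k. \<Delta> (if (i + Suc k) mod Suc n < i then s else t) (tl (rotate i fs) ! k)) n x)))"
  proof (rule sum.cong)
    fix i assume "i \<in> {..<Suc n}"
    then have i: "i < Suc n" by simp
    define ws where "ws = map (\<lambda>j. (mix i j, fs ! j)) [0..<Suc n]"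
    have ws: "map snd ws = fs" "length ws = Suc n"
      using len by (auto simp: ws_def list_eq_iff_nth_eq simp del: upt_Suc)
    have nth: "ws ! j = (mix i j, fs ! j)" if "j < Suc n" for j
      using that by (simp add: ws_def del: upt_Suc)
    have schw: "T \<in> schatten q (H (Dom C f)) (H (Cod C f))" if Tf: "(T, f) \<in> set ws" for T f
    proof -
      obtain j where j: "j < Suc n" "T = mix i j" "f = fs ! j"
        using Tf by (auto simp: ws_def simp del: upt_Suc)
      have "E i \<in> schatten q (H (Dom C (fs ! i))) (H (Cod C (fs ! i)))"
        unfolding E_def
        using schatten_diff[OF q sub_Dom[OF Arr[OF i]] sub_Cod[OF Arr[OF i]]
            \<Delta>_schatten[OF Arr[OF i] s] \<Delta>_schatten[OF Arr[OF i] t]] .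
      then show ?thesis
        using \<Delta>_schatten[OF Arr[OF j(1)] s] \<Delta>_schatten[OF Arr[OF j(1)] t] j by (auto simp: mix_def)
    qed
    have hdw: "snd (hd ws) = hd fs" using ws by (metis hd_map length_0_conv nat.distinct(1))
    have P: "prod_op fst ws = word (mix i) (Suc n)"
    proof -
      have "word (\<lambda>j. fst (ws ! j)) (Suc n) = word (mix i) (Suc n)"
        by (rule word_cong) (simp add: nth)
      moreover have "prod_op fst ws = word (\<lambda>j. fst (ws ! j)) (Suc n)"
        by (rule ext) (simp only: prod_op_eq_word ws(2))
      ultimately show ?thesis by simp
    qed
    obtain w vs where w: "rotate i ws = w # vs" using ws(2) by (cases "rotate i ws") auto
    have rnth: "rotate i ws ! k = ws ! ((i + k) mod Suc n)" if "k < Suc n" for k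
      using nth_rotate[of k ws i] that ws(2) by simp
    have w0: "w = (E i, fs ! i)"
      using rnth[of 0] nth[OF i] i by (simp add: w mix_def)
    have lvs: "length vs = n" using w ws(2) by (metis length_Cons length_rotate nat.inject)
    have vk: "fst (vs ! k) = \<Delta> (if (i + Suc k) mod Suc n < i then s else t) (tl (rotate i fs) ! k)"
      if k: "k < n" for k
    proof -
      let ?j = "(i + Suc k) mod Suc n"
      have j: "?j < Suc n" by simp
      have "?j \<noteq> i"
      proof
        assume "?j = i"
        then have "(i + Suc k) mod Suc n = i mod Suc n" using i by simp
        then have "Suc n dvd Suc k" by (simp add: mod_eq_dvd_iff_nat)
        then show False using k by (auto dest: dvd_imp_le)
      qed
      have v: "vs ! k = (mix i ?j, fs ! ?j)"
        using rnth[of "Suc k"] nth[OF j] k by (simp add: w)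
      have "tl (rotate i fs) ! k = fs ! ?j"
        using nth_rotate[of "Suc k" fs i] k len by (simp add: nth_tl)
      then show ?thesis using v \<open>?j \<noteq> i\<close> by (auto simp: mix_def)
    qed
    have "op_trace (Vs (Suc n)) (word (mix i) (Suc n)) = op_trace (H (Cod C (snd (hd ws)))) (prod_op fst ws)"
      by (simp only: P hdw ends)
    also have "\<dots> = op_trace (H (Cod C (snd (hd (rotate i ws))))) (prod_op fst (rotate i ws))"
      using ws fs schw n by (intro op_trace_rotate[symmetric]) auto
    also have "\<dots> = op_trace (H (Cod C (fs ! i))) (\<lambda>x. E i (prod_op fst vs x))"
    proof -
      have "prod_op fst (rotate i ws) = (\<lambda>x. E i (prod_op fst vs x))" by (simp add: w w0 fun_eq_iff)
      then show ?thesis by (simp add: w w0)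
    qed
    also have "prod_op fst vs = word (\<lambda>k. \<Delta> (if (i + Suc k) mod Suc n < i then s else t) (tl (rotate i fs) ! k)) n"
    proof -
      have "word (\<lambda>k. fst (vs ! k)) n
          = word (\<lambda>k. \<Delta> (if (i + Suc k) mod Suc n < i then s else t) (tl (rotate i fs) ! k)) n"
        by (rule word_cong) (rule vk)
      moreover have "prod_op fst vs = word (\<lambda>k. fst (vs ! k)) n"
        by (rule ext) (simp only: prod_op_eq_word lvs)
      ultimately show ?thesis by simp
    qed
    finally show "op_trace (Vs (Suc n)) (word (mix i) (Suc n)) = op_trace (H (Cod C (fs ! i))) (\<lambda>x. E i
      (word (\<lambda>k. \<Delta> (if (i + Suc k) mod Suc n < i then s else t) (tl (rotate i fs) ! k)) n x))" .
  qed simp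
  finally show ?thesis by (simp only: E_def)
qed

end

section \<open>Differentiating and integrating the character\<close>

context homotopy
begin

lemma word_traceable:
  assumes fs: "f # gs \<in> cyclic_tuples C n" and n: "q \<le> real n"
    and u: "\<And>i. i < n \<Longrightarrow> u i \<in> {0..1}" and A: "A \<in> bounded_ops (H (Dom C f)) (H (Cod C f))"
  shows "traceable (H (Cod C f)) (\<lambda>x. A (word (\<lambda>i. \<Delta> (u i) (gs ! i)) n x))"
proof -
  obtain Vs where dc: "\<And>i. dense_countable (Vs i)"
    and Vs: "\<And>i. i < n \<Longrightarrow> Vs i = H (Cod C (gs ! i))" "\<And>i. i < n \<Longrightarrow> Vs (Suc i) = H (Dom C (gs ! i))"
    and ends: "Vs 0 = H (Dom C f)" "Vs n = H (Cod C f)" and n0: "0 < n"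
    and Arr: "\<And>i. i < n \<Longrightarrow> gs ! i \<in> Arr C"
    using word_spaces[OF fs n] by metis
  have "\<Delta> (u i) (gs ! i) \<in> schatten q (Vs (Suc i)) (Vs i)" if i: "i < n" for i
    unfolding Vs[OF i] by (rule \<Delta>_schatten[OF Arr[OF i] u[OF i]])
  from word_trace_class(1)[where Vs = Vs and m = n, OF dc q this n0 n]
  have "word (\<lambda>i. \<Delta> (u i) (gs ! i)) n \<in> trace_class (Vs n) (Vs 0)" .
  from trace_class_traceable(1)[OF this dc dc, of A] A show ?thesis by (simp add: ends)
qed

text \<open>The quotient of the changed letter stands in front and converges only strongly, with the
  Lipschitz constant as a uniform bound; the letters behind it, at times \<open>s\<close> or
  \<open>t\<close>, converge in Schatten norm to those at \<open>t\<close>.\<close>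

lemma tr_has_derivative:
  assumes fs: "fs \<in> cyclic_tuples C n" and n: "q \<le> real n" and t: "t \<in> {0<..<1}"
    and der: "\<And>f x. f \<in> set fs \<Longrightarrow> x \<in> H (Dom C f)
      \<Longrightarrow> ((\<lambda>s. \<Delta> s f x) has_vector_derivative d\<Delta> t f x) (at t)"
  shows "((\<lambda>s. tr (\<Delta> s) s fs) has_vector_derivative (\<Sum>i<Suc n. tr (d\<Delta> t) t (rotate i fs))) (at t)"
proof -
  have len: "length fs = Suc n" using cyclic_tuples_length[OF fs] .
  have tI: "t \<in> {0..1}" and tI': "t \<in> {0..<1}" using t by auto
  have ev: "\<forall>\<^sub>F s in at t. s \<in> {0..1} \<and> s \<noteq> t"
    using eventually_at_in_open[of "{0<..<1}" t] t by (auto elim: eventually_mono)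
  let ?u = "\<lambda>i s k. if (i + Suc k) mod Suc n < i then s else t"
  let ?W = "\<lambda>i s. word (\<lambda>k. \<Delta> (?u i s k) (tl (rotate i fs) ! k)) n"
  define Q where "Q i s x = (1 / (s - t)) *\<^sub>R (\<Delta> s (fs ! i) x - \<Delta> t (fs ! i) x)" for i s x
  have rot: "rotate i fs = fs ! i # tl (rotate i fs)" if "i < Suc n" for i
  proof -
    have "rotate i fs \<noteq> []" using len by auto
    moreover have "hd (rotate i fs) = fs ! i"
      using nth_rotate[of 0 fs i] that len calculation by (simp add: hd_conv_nth)
    ultimately show ?thesis by (metis list.collapse)
  qed
  have cyc: "fs ! i # tl (rotate i fs) \<in> cyclic_tuples C n" if "i < Suc n" for i
    using cyclic_tuples_rotate[OF fs, of i] rot[OF that] by simp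
  have Arr: "fs ! i \<in> Arr C" "fs ! i \<in> set fs" if "i < Suc n" for i
    using fs that len by (auto simp: cyclic_tuples_iff)
  have b: "\<Delta> s (fs ! i) \<in> bounded_ops (H (Dom C (fs ! i))) (H (Cod C (fs ! i)))"
    if "i < Suc n" "s \<in> {0..1}" for i s
    using schatten_bounded[OF \<Delta>_schatten[OF Arr(1)[OF that(1)] that(2)]] .
  have lim: "((\<lambda>s. op_trace (H (Cod C (fs ! i))) (\<lambda>x. Q i s (?W i s x))) \<longlongrightarrow> tr (d\<Delta> t) t (rotate i fs)) (at t)"
    if i: "i < Suc n" for i
  proof -
    obtain L S where L: "0 \<le> L" "\<And>s t x. s \<in> {0..1} \<Longrightarrow> t \<in> {0..1} \<Longrightarrow> x \<in> H (Dom C (fs ! i))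
        \<Longrightarrow> norm (\<Delta> s (fs ! i) x - \<Delta> t (fs ! i) x) \<le> L * \<bar>s - t\<bar> * norm x"
      using \<Delta>_C1[OF Arr(1)[OF i]] by blast
    have Q_le: "norm (Q i s x) \<le> L * norm x" if "s \<in> {0..1}" "s \<noteq> t" "x \<in> H (Dom C (fs ! i))" for s x
    proof -
      have "norm (Q i s x) = norm (\<Delta> s (fs ! i) x - \<Delta> t (fs ! i) x) / \<bar>s - t\<bar>" by (simp add: Q_def)
      then show ?thesis using L(2)[OF that(1) tI that(3)] that(2) by (simp add: divide_le_eq mult_ac)
    qed
    have Q_b: "Q i s \<in> bounded_ops (H (Dom C (fs ! i))) (H (Cod C (fs ! i)))" if "s \<in> {0..1}" for s
    proof -
      have "(\<lambda>x. 0 + (1 / (s - t)) *\<^sub>R (\<Delta> s (fs ! i) x - \<Delta> t (fs ! i) x))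
          \<in> bounded_ops (H (Dom C (fs ! i))) (H (Cod C (fs ! i)))"
        by (intro bounded_ops_add_scaleR bounded_ops_diff_op bounded_ops_zero_op b i that tI
            sub_Cod Arr(1))
      then show ?thesis by (simp add: Q_def[abs_def])
    qed
    have Q_lim: "((\<lambda>s. Q i s x) \<longlongrightarrow> d\<Delta> t (fs ! i) x) (at t)" if "x \<in> H (Dom C (fs ! i))" for x
      using der[OF Arr(2)[OF i] that] unfolding Q_def by (simp only: has_vector_derivative_iff_quotient)
    have d_le: "norm (d\<Delta> t (fs ! i) x) \<le> L * norm x" if x: "x \<in> H (Dom C (fs ! i))" for x
    proof (rule tendsto_upperbound[OF tendsto_norm[OF Q_lim[OF x]]])
      show "\<forall>\<^sub>F s in at t. norm (Q i s x) \<le> L * norm x"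
        using ev by eventually_elim (use Q_le x in auto)
    qed simp
    have "((\<lambda>s. op_trace (H (Cod C (fs ! i))) (\<lambda>x. Q i s (?W i s x)))
        \<longlongrightarrow> op_trace (H (Cod C (fs ! i))) (\<lambda>x. d\<Delta> t (fs ! i) (prod_op (\<Delta> t) (tl (rotate i fs)) x))) (at t)"
    proof (rule word_trace_tendsto[OF cyc[OF i] n tI _ _ L(1) _ letters_bounded(2)[OF tI' Arr(1)[OF i]] d_le Q_lim])
      show "((\<lambda>s. ?u i s k) \<longlongrightarrow> t) (at t)" for k
        by (cases "(i + Suc k) mod Suc n < i") (simp_all only: if_True if_False tendsto_ident_at tendsto_const)
      show "\<forall>\<^sub>F s in at t. ?u i s k \<in> {0..1}" for k using ev by eventually_elim (use tI in auto)
      show "\<forall>\<^sub>F s in at t. Q i s \<in> bounded_ops (H (Dom C (fs ! i))) (H (Cod C (fs ! i)))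
          \<and> (\<forall>x\<in>H (Dom C (fs ! i)). norm (Q i s x) \<le> L * norm x)"
        using ev by eventually_elim (use Q_b Q_le in auto)
    qed
    then show ?thesis
      unfolding tr_def by (subst (1 2 3) rot[OF i]) simp
  qed
  have "((\<lambda>s. \<Sum>i<Suc n. op_trace (H (Cod C (fs ! i))) (\<lambda>x. Q i s (?W i s x)))
      \<longlongrightarrow> (\<Sum>i<Suc n. tr (d\<Delta> t) t (rotate i fs))) (at t)"
    by (intro tendsto_sum lim) simp
  then have "((\<lambda>s. (1 / (s - t)) *\<^sub>R (tr (\<Delta> s) s fs - tr (\<Delta> t) t fs))
      \<longlongrightarrow> (\<Sum>i<Suc n. tr (d\<Delta> t) t (rotate i fs))) (at t)"
  proof (rule Lim_transform_eventually)
    show "\<forall>\<^sub>F s in at t. (\<Sum>i<Suc n. op_trace (H (Cod C (fs ! i))) (\<lambda>x. Q i s (?W i s x)))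
        = (1 / (s - t)) *\<^sub>R (tr (\<Delta> s) s fs - tr (\<Delta> t) t fs)"
      using ev
    proof eventually_elim
      case (elim s)
      then have s: "s \<in> {0..1}" by simp
      have "op_trace (H (Cod C (fs ! i))) (\<lambda>x. Q i s (?W i s x))
          = (1 / (s - t)) *\<^sub>R op_trace (H (Cod C (fs ! i))) (\<lambda>x. \<Delta> s (fs ! i) (?W i s x) - \<Delta> t (fs ! i) (?W i s x))"
        if i: "i < Suc n" for i
      proof -
        have Eb: "(\<lambda>y. \<Delta> s (fs ! i) y - \<Delta> t (fs ! i) y) \<in> bounded_ops (H (Dom C (fs ! i))) (H (Cod C (fs ! i)))"
          by (intro bounded_ops_diff_op b i s tI sub_Cod Arr(1))
        have "traceable (H (Cod C (fs ! i))) (\<lambda>x. \<Delta> s (fs ! i) (?W i s x) - \<Delta> t (fs ! i) (?W i s x))"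
          using s tI by (intro word_traceable[OF cyc[OF i] n _ Eb]) auto
        from op_trace_scaleC[OF dc_Cod[OF Arr(1)[OF i]] this, of "complex_of_real (1 / (s - t))"]
        show ?thesis
          unfolding Q_def scaleR_eq_scaleC[of "1 / (s - t)" "_ :: 'h"]
          by (simp add: scaleR_conv_of_real)
      qed
      then show ?case
        unfolding tr_telescope[OF fs n s tI] scaleR_sum_right by (intro sum.cong) auto
    qed
  qed
  then show ?thesis by (simp only: has_vector_derivative_iff_quotient)
qed

lemma tr_d\<Sigma>_integrable:
  assumes fs: "fs \<in> cyclic_tuples C n" and n: "q \<le> real n" and \<tau>: "\<tau> \<in> {0..1}"
  shows "(\<lambda>t. if t \<in> {0..<1} then tr (d\<Sigma> t) t fs else 0) integrable_on {0..\<tau>}"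
proof -
  obtain f gs where fgs: "fs = f # gs" using cyclic_tuples_length[OF fs] by (cases fs) auto
  note cyc = fs[unfolded fgs]
  have f: "f \<in> Arr C" and len: "length gs = n" using cyc by (auto simp: cyclic_tuples_iff)
  obtain L S where L: "0 \<le> L" "finite S"
    "\<And>t x. t \<in> {0..<1} \<Longrightarrow> x \<in> H (Dom C f) \<Longrightarrow> norm (d\<Sigma> t f x) \<le> L * norm x"
    "\<And>t x. t \<in> {0<..<1} - S \<Longrightarrow> x \<in> H (Dom C f) \<Longrightarrow> isCont (\<lambda>s. d\<Sigma> s f x) t"
    using d\<Sigma>_C1[OF f] by blast
  obtain B where B: "\<And>t A. t \<in> {0..1} \<Longrightarrow> A \<in> bounded_ops (H (Dom C f)) (H (Cod C f))
    \<Longrightarrow> (\<And>x. x \<in> H (Dom C f) \<Longrightarrow> norm (A x) \<le> L * norm x)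
    \<Longrightarrow> cmod (op_trace (H (Cod C f)) (\<lambda>x. A (prod_op (\<Delta> t) gs x))) \<le> B"
    using tr_bounded[OF cyc n L(1)] by blast
  show ?thesis
  \<comment> \<open>The end points are excluded because the limits are two-sided and the right
    derivative is available only for \<open>t < 1\<close>.\<close>
  proof (rule integrable_continuous_off_finite[of "S \<union> {0, 1}" _ _ _ B])
    show "finite (S \<union> {0, 1})" using L(2) by simp
    show "norm (if t \<in> {0..<1} then tr (d\<Sigma> t) t fs else 0) \<le> B" if "t \<in> {0..\<tau>} - (S \<union> {0, 1})" for t
    proof -
      have t: "t \<in> {0..<1}" "t \<in> {0..1}" using that \<tau> by auto
      have "cmod (op_trace (H (Cod C f)) (\<lambda>x. d\<Sigma> t f (prod_op (\<Delta> t) gs x))) \<le> B"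
        by (rule B[OF t(2) letters_bounded(1)[OF t(1) f] L(3)[OF t(1)]])
      then show ?thesis using t(1) by (simp add: tr_def fgs)
    qed
    show "continuous_on ({0..\<tau>} - (S \<union> {0, 1})) (\<lambda>t. if t \<in> {0..<1} then tr (d\<Sigma> t) t fs else 0)"
    proof (rule continuous_at_imp_continuous_on, rule ballI)
      fix t assume "t \<in> {0..\<tau>} - (S \<union> {0, 1})"
      then have t: "t \<in> {0<..<1} - S" using \<tau> by auto
      then have tI: "t \<in> {0..1}" and tI': "t \<in> {0..<1}" by auto
      have ev: "\<forall>\<^sub>F s in at t. s \<in> {0<..<1}"
        using eventually_at_in_open[of "{0<..<1}" t] t by (auto elim: eventually_mono)
      have "((\<lambda>s. op_trace (H (Cod C f)) (\<lambda>x. d\<Sigma> s f (word (\<lambda>i. \<Delta> s (gs ! i)) n x)))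
          \<longlongrightarrow> op_trace (H (Cod C f)) (\<lambda>x. d\<Sigma> t f (prod_op (\<Delta> t) gs x))) (at t)"
      proof (rule word_trace_tendsto[OF cyc n tI tendsto_ident_at _ L(1) _ letters_bounded(1)[OF tI' f] L(3)[OF tI']])
        show "\<forall>\<^sub>F s in at t. s \<in> {0..1}" using ev by eventually_elim auto
        show "\<forall>\<^sub>F s in at t. d\<Sigma> s f \<in> bounded_ops (H (Dom C f)) (H (Cod C f))
            \<and> (\<forall>x\<in>H (Dom C f). norm (d\<Sigma> s f x) \<le> L * norm x)"
          using ev by eventually_elim (use L(3) letters_bounded(1)[OF _ f] in auto)
        show "((\<lambda>s. d\<Sigma> s f x) \<longlongrightarrow> d\<Sigma> t f x) (at t)" if "x \<in> H (Dom C f)" for x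
          using L(4)[OF t that] by (simp add: isCont_def)
      qed
      then have "((\<lambda>s. tr (d\<Sigma> s) s fs) \<longlongrightarrow> tr (d\<Sigma> t) t fs) (at t)"
        by (simp add: tr_def fgs prod_op_eq_word len)
      then have "((\<lambda>s. if s \<in> {0..<1} then tr (d\<Sigma> s) s fs else 0) \<longlongrightarrow> tr (d\<Sigma> t) t fs) (at t)"
        by (rule Lim_transform_eventually) (use ev in \<open>auto elim: eventually_mono\<close>)
      then show "isCont (\<lambda>s. if s \<in> {0..<1} then tr (d\<Sigma> s) s fs else 0) t"
        using tI' by (simp add: isCont_def)
    qed
  qed
qed

theorem character_homotopy:
  assumes N: "q \<le> real N" "odd N" and \<tau>: "\<tau> \<in> {0..1}"
  shows "\<exists>\<psi>\<in>cyclic_cochains C N. \<forall>fs. quasi_hom.character C H (a \<tau>) (b \<tau>) (Suc N) fs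
    - quasi_hom.character C H (a 0) (b 0) (Suc N) fs = coboundary C N \<psi> fs"
proof -
  \<comment> \<open>At \<open>t = 1\<close> no right derivative is available; the value 0 there
    affects no integral and keeps \<open>G t\<close> a cyclic cochain for every real
    \<open>t\<close>.\<close>
  define G where "G t = (if t \<in> {0..<1} then quasi_hom.transgression C H (a t) (b t) (d\<Sigma> t) N else (\<lambda>_. 0))" for t
  have char: "quasi_hom.character C H (a t) (b t) (Suc N) fs
      = (if fs \<in> cyclic_tuples C (Suc N) then tr (\<Delta> t) t fs else 0)" if "t \<in> {0..1}" for t fs
    using quasi_hom.character_def[OF pair[OF that]] that by (simp add: letter_trace_eq \<delta>_eq)
  have G_cyc: "G t fs = (if fs \<in> cyclic_tuples C N
      then \<Sum>j\<le>N. (-1) ^ (j * N) * (if t \<in> {0..<1} then tr (d\<Sigma> t) t (rotate j fs) else 0) else 0)" for t fs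
  proof (cases "t \<in> {0..<1}")
    case True
    then have t: "t \<in> {0..1}" by simp
    show ?thesis using True quasi_hom.transgression_def[OF pair[OF t]] t by (simp add: G_def letter_trace_eq)
  next
    case False
    show ?thesis unfolding G_def if_not_P[OF False] by simp
  qed
  have G_cochain: "G t \<in> cyclic_cochains C N" for t
  proof (cases "t \<in> {0..<1}")
    case True
    then have "t \<in> {0..1}" by simp
    then interpret quasi_hom C H "a t" "b t" q by (rule pair)
    show ?thesis using transgression_cyclic_cochain[OF letters(1)[OF True] N(1)] True by (simp add: G_def)
  next
    case False
    then show ?thesis
      by (auto simp: G_def cyclic_cochains_def cochains_def cyclic_op_def fun_eq_iff)
  qed
  have int: "(\<lambda>t. G t gs) integrable_on {0..\<tau>}" for gs
  proof (cases "gs \<in> cyclic_tuples C N")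
    case True
    have "(\<lambda>t. r * (if t \<in> {0..<1} then tr (d\<Sigma> t) t (rotate j gs) else 0)) integrable_on {0..\<tau>}" for r j
      using has_integral_mult_right[OF integrable_integral[OF tr_d\<Sigma>_integrable[OF cyclic_tuples_rotate[OF True] N(1) \<tau>]]]
      by (auto simp: integrable_on_def)
    then show ?thesis unfolding G_cyc using True by (simp add: integrable_sum)
  qed (simp add: G_cyc integrable_0)
  define \<psi> where "\<psi> gs = integral {0..\<tau>} (\<lambda>t. G t gs)" for gs
  have "\<psi> \<in> cyclic_cochains C N"
    unfolding \<psi>_def[abs_def] by (rule cyclic_cochains_integral[OF G_cochain int])
  moreover have "quasi_hom.character C H (a \<tau>) (b \<tau>) (Suc N) fs
      - quasi_hom.character C H (a 0) (b 0) (Suc N) fs = coboundary C N \<psi> fs" for fs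
  proof (cases "fs \<in> cyclic_tuples C (Suc N)")
    case True
    have N': "q \<le> real (Suc N)" using N(1) by simp
    \<comment> \<open>The exceptional times depend on the arrow, but a tuple has finitely many
      arrows, so a finite set remains for each \<open>fs\<close>.\<close>
    have "\<forall>f\<in>set fs. \<exists>S. finite S \<and> (\<forall>t\<in>{0<..<1} - S. \<forall>x\<in>H (Dom C f).
        ((\<lambda>s. \<Delta> s f x) has_vector_derivative d\<Delta> t f x) (at t))"
    proof
      fix f assume "f \<in> set fs"
      then have "f \<in> Arr C" using True by (auto simp: cyclic_tuples_iff)
      from \<Delta>_C1[OF this] show "\<exists>S. finite S \<and> (\<forall>t\<in>{0<..<1} - S. \<forall>x\<in>H (Dom C f).
        ((\<lambda>s. \<Delta> s f x) has_vector_derivative d\<Delta> t f x) (at t))" by blast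
    qed
    then obtain S where S: "\<And>f. f \<in> set fs \<Longrightarrow> finite (S f)"
      "\<And>f t x. f \<in> set fs \<Longrightarrow> t \<in> {0<..<1} - S f \<Longrightarrow> x \<in> H (Dom C f)
        \<Longrightarrow> ((\<lambda>s. \<Delta> s f x) has_vector_derivative d\<Delta> t f x) (at t)"
      unfolding bchoice_iff by blast
    have "((\<lambda>t. coboundary C N (G t) fs) has_integral (tr (\<Delta> \<tau>) \<tau> fs - tr (\<Delta> 0) 0 fs)) {0..\<tau>}"
    proof (rule fundamental_theorem_of_calculus_interior_strong[where S = "\<Union>f\<in>set fs. S f"])
      show "finite (\<Union>f\<in>set fs. S f)" using S(1) by simp
      show "0 \<le> \<tau>" using \<tau> by simp
      show "continuous_on {0..\<tau>} (\<lambda>t. tr (\<Delta> t) t fs)"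
        using tr_continuous[OF True N'] by (rule continuous_on_subset) (use \<tau> in auto)
      fix t assume "t \<in> {0<..<\<tau>} - (\<Union>f\<in>set fs. S f)"
      then have t: "t \<in> {0<..<1}" "\<And>f. f \<in> set fs \<Longrightarrow> t \<notin> S f" using \<tau> by auto
      have tI: "t \<in> {0..1}" and tI': "t \<in> {0..<1}" using t(1) by auto
      interpret quasi_hom C H "a t" "b t" q by (rule pair[OF tI])
      have "coboundary C N (G t) fs = coboundary C N (transgression (\<lambda>f x. d a t f x + d b t f x) N) fs"
        using tI' by (simp add: G_def d\<Sigma>_def[abs_def])
      also have "\<dots> = (\<Sum>r\<le>Suc N. letter_trace (\<lambda>f x. d a t f x - d b t f x) (rotate r fs))"
        by (rule coboundary_transgression[OF derivations[OF tI'] N True])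
      also have "\<dots> = (\<Sum>r<Suc (Suc N). tr (d\<Delta> t) t (rotate r fs))"
        unfolding letter_trace_eq[OF tI] d\<Delta>_def[abs_def] lessThan_Suc_atMost ..
      finally have "coboundary C N (G t) fs = (\<Sum>r<Suc (Suc N). tr (d\<Delta> t) t (rotate r fs))" .
      moreover have "((\<lambda>s. tr (\<Delta> s) s fs) has_vector_derivative
          (\<Sum>r<Suc (Suc N). tr (d\<Delta> t) t (rotate r fs))) (at t)"
        using t by (intro tr_has_derivative[OF True N' t(1)] S(2)) auto
      ultimately show "((\<lambda>s. tr (\<Delta> s) s fs) has_vector_derivative coboundary C N (G t) fs) (at t)"
        by (simp only:)
    qed
    then have "integral {0..\<tau>} (\<lambda>t. coboundary C N (G t) fs) = tr (\<Delta> \<tau>) \<tau> fs - tr (\<Delta> 0) 0 fs"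
      by (rule integral_unique)
    then show ?thesis
      unfolding \<psi>_def[abs_def] coboundary_integral[OF int] using \<tau> True by (simp add: char)
  next
    case False
    then show ?thesis using \<tau> by (simp add: char coboundary_def)
  qed
  ultimately show ?thesis by blast
qed

end

section \<open>Characters of invertible Fredholm modules\<close>

lemma bounded_ops_inl: "complex_vector.subspace W \<Longrightarrow> (\<lambda>x. (x, 0)) \<in> bounded_ops V (V \<times> W)"
  by (rule bounded_opsI[where K = 1]) (auto simp: complex_vector.subspace_0 scaleC_prod_def)

lemma bounded_ops_inr: "complex_vector.subspace V \<Longrightarrow> (\<lambda>x. (0, x)) \<in> bounded_ops W (V \<times> W)"
  by (rule bounded_opsI[where K = 1]) (auto simp: complex_vector.subspace_0 scaleC_prod_def)

lemma bounded_ops_fst: "fst \<in> bounded_ops (V \<times> W) V"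
  by (rule bounded_opsI[where K = 1]) (auto simp: scaleC_prod_def norm_fst_le)

lemma bounded_ops_snd: "snd \<in> bounded_ops (V \<times> W) W"
  by (rule bounded_opsI[where K = 1]) (auto simp: scaleC_prod_def norm_snd_le)

text \<open>Conjugation with the corners of \<open>F\<close> moves the odd half to the even one, so
  that both halves can be subtracted.\<close>

definition twisted_minus ::
  "('o, 'm) linear_cat \<Rightarrow> ('o \<Rightarrow> 'h \<Rightarrow> 'h) \<Rightarrow> ('o \<Rightarrow> 'h \<Rightarrow> 'h)
    \<Rightarrow> ('m \<Rightarrow> 'h \<times> 'h \<Rightarrow> 'h \<times> 'h) \<Rightarrow> 'm \<Rightarrow> 'h::complex_inner \<Rightarrow> 'h" where
  "twisted_minus C P Q R f x = Q (Cod C f) (minus_part (R f) (P (Dom C f) x))"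

locale invertible_module = linear_category C
  for C :: "('o, 'm) linear_cat" +
  fixes H :: "'o \<Rightarrow> 'h::complex_inner set" and P Q :: "'o \<Rightarrow> 'h \<Rightarrow> 'h"
    and R :: "'m \<Rightarrow> 'h \<times> 'h \<Rightarrow> 'h \<times> 'h" and F :: "'o \<Rightarrow> 'h \<times> 'h \<Rightarrow> 'h \<times> 'h" and q :: real
  assumes fredholm: "even_fredholm_module C q (\<lambda>X. double (H X)) R F"
    and F_eq: "X \<in> Obj C \<Longrightarrow> F X = offdiag (Q X) (P X)"
    and PQ: "X \<in> Obj C \<Longrightarrow> x \<in> H X \<Longrightarrow> P X (Q X x) = x"
    and QP: "X \<in> Obj C \<Longrightarrow> x \<in> H X \<Longrightarrow> Q X (P X x) = x"
    and schatten_diff: "f \<in> Arr C \<Longrightarrow> (\<lambda>x. plus_part (R f) x - twisted_minus C P Q R f x)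
      \<in> schatten q (H (Dom C f)) (H (Cod C f))"
    and q_pos: "0 < q"
begin

lemma dc: "X \<in> Obj C \<Longrightarrow> dense_countable (H X)"
  using fredholm by (auto simp: even_fredholm_module_def functor_SHilbZ2_def double_def
      intro: dense_countable_separable_hilbert)

lemma sub: "X \<in> Obj C \<Longrightarrow> complex_vector.subspace (H X)"
  using dc dense_countable_subspace by blast

lemma R_functor: "linear_op_functor C (\<lambda>X. H X \<times> H X) R"
  using fredholm by (simp add: even_fredholm_module_def functor_SHilbZ2_def double_def total_def)

lemma R_bounded: "f \<in> Hom C X Y \<Longrightarrow> R f \<in> bounded_ops (H X \<times> H X) (H Y \<times> H Y)"
proof -
  assume f: "f \<in> Hom C X Y"
  then have "X \<in> Obj C" "Y \<in> Obj C" using dom_obj cod_obj by (auto simp: Hom_def)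
  then show ?thesis
    by (rule R_functor[unfolded linear_op_functor_def, THEN conjunct1, rule_format, OF _ _ f])
qed

lemma plus_bounded: "f \<in> Hom C X Y \<Longrightarrow> plus_part (R f) \<in> bounded_ops (H X) (H Y)"
  and minus_bounded: "f \<in> Hom C X Y \<Longrightarrow> minus_part (R f) \<in> bounded_ops (H X) (H Y)"
proof -
  assume f: "f \<in> Hom C X Y"
  then have X: "X \<in> Obj C" using dom_obj by (auto simp: Hom_def)
  show "plus_part (R f) \<in> bounded_ops (H X) (H Y)"
    unfolding plus_part_def[abs_def]
    by (rule bounded_ops_comp[OF bounded_ops_fst bounded_ops_comp[OF R_bounded[OF f] bounded_ops_inl]])
      (rule sub[OF X])
  show "minus_part (R f) \<in> bounded_ops (H X) (H Y)"
    unfolding minus_part_def[abs_def]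
    by (rule bounded_ops_comp[OF bounded_ops_snd bounded_ops_comp[OF R_bounded[OF f] bounded_ops_inr]])
      (rule sub[OF X])
qed

lemma F_bounded: "X \<in> Obj C \<Longrightarrow> F X \<in> bounded_ops (H X \<times> H X) (H X \<times> H X)"
  using fredholm by (simp add: even_fredholm_module_def double_def total_def)

lemma F_apply: "X \<in> Obj C \<Longrightarrow> F X (x, y) = (Q X y, P X x)"
  by (simp add: F_eq offdiag_def)

lemma P_bounded: "X \<in> Obj C \<Longrightarrow> P X \<in> bounded_ops (H X) (H X)"
  and Q_bounded: "X \<in> Obj C \<Longrightarrow> Q X \<in> bounded_ops (H X) (H X)"
proof -
  assume X: "X \<in> Obj C"
  have "(\<lambda>x. snd (F X (x, 0))) \<in> bounded_ops (H X) (H X)"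
    by (rule bounded_ops_comp[OF bounded_ops_snd bounded_ops_comp[OF F_bounded[OF X] bounded_ops_inl]])
      (rule sub[OF X])
  then show "P X \<in> bounded_ops (H X) (H X)" by (simp add: F_apply[OF X])
  have "(\<lambda>x. fst (F X (0, x))) \<in> bounded_ops (H X) (H X)"
    by (rule bounded_ops_comp[OF bounded_ops_fst bounded_ops_comp[OF F_bounded[OF X] bounded_ops_inr]])
      (rule sub[OF X])
  then show "Q X \<in> bounded_ops (H X) (H X)" by (simp add: F_apply[OF X])
qed

lemma P_mem: "X \<in> Obj C \<Longrightarrow> x \<in> H X \<Longrightarrow> P X x \<in> H X"
  and Q_mem: "X \<in> Obj C \<Longrightarrow> x \<in> H X \<Longrightarrow> Q X x \<in> H X"
  using bounded_ops_mem[OF P_bounded] bounded_ops_mem[OF Q_bounded] by auto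

lemma R_apply:
  assumes f: "f \<in> Hom C X Y" and x: "x \<in> H X" "y \<in> H X"
  shows "R f (x, y) = (plus_part (R f) x, minus_part (R f) y)"
proof -
  have f': "f \<in> Arr C" "Dom C f = X" "X \<in> Obj C" using f dom_obj by (auto simp: Hom_def)
  have "0 \<in> H X" using complex_vector.subspace_0[OF sub[OF f'(3)]] .
  then have "R f ((x, 0) + (0, y)) = R f (x, 0) + R f (0, y)"
    using x by (intro bounded_ops_add[OF R_bounded[OF f]]) auto
  moreover have "snd (R f (x, 0)) = 0" "fst (R f (0, y)) = 0"
    using fredholm f' x by (auto simp: even_fredholm_module_def degree0_def double_def)
  ultimately show ?thesis by (simp add: plus_part_def minus_part_def prod_eq_iff)
qed

lemma R_parts:
  assumes f: "f \<in> Hom C X Y" and x: "x \<in> H X"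
  shows "R f (x, 0) = (plus_part (R f) x, 0)" "R f (0, x) = (0, minus_part (R f) x)"
proof -
  have X: "X \<in> Obj C" using f dom_obj by (auto simp: Hom_def)
  have "0 \<in> H X" using complex_vector.subspace_0[OF sub[OF X]] .
  then show "R f (x, 0) = (plus_part (R f) x, 0)" "R f (0, x) = (0, minus_part (R f) x)"
    using R_apply[OF f x, of 0] R_apply[OF f _ x, of 0]
      bounded_ops_zero[OF plus_bounded[OF f] sub[OF X]] bounded_ops_zero[OF minus_bounded[OF f] sub[OF X]]
    by auto
qed

lemma parts_functor:
  "linear_op_functor C H (\<lambda>f. plus_part (R f))" (is ?plus)
  "linear_op_functor C H (\<lambda>f. minus_part (R f))" (is ?minus)
proof -
  note RF = R_functor[unfolded linear_op_functor_def]
  have idn: "R (Idn C X) v = v" if "X \<in> Obj C" "v \<in> H X \<times> H X" for X v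
    using RF that by blast
  have comp: "R (Comp C g f) v = R g (R f v)"
    if "X \<in> Obj C" "Y \<in> Obj C" "Z \<in> Obj C" "f \<in> Hom C X Y" "g \<in> Hom C Y Z" "v \<in> H X \<times> H X" for X Y Z f g v
    using RF that by blast
  have plus: "R (Plus C f g) v = R f v + R g v"
    if "X \<in> Obj C" "Y \<in> Obj C" "f \<in> Hom C X Y" "g \<in> Hom C X Y" "v \<in> H X \<times> H X" for X Y f g v
    using RF that by blast
  have scale: "R (Scale C r f) v = r *\<^sub>C R f v"
    if "X \<in> Obj C" "Y \<in> Obj C" "f \<in> Hom C X Y" "v \<in> H X \<times> H X" for X Y f r v
    using RF that by blast
  have zero: "0 \<in> H X" if "X \<in> Obj C" for X
    using complex_vector.subspace_0[OF sub[OF that]] .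
  note mem = bounded_ops_mem[OF plus_bounded] bounded_ops_mem[OF minus_bounded]
  show ?plus
    unfolding linear_op_functor_def
  proof (intro conjI ballI allI)
    show "plus_part (R (Idn C X)) v = v" if "X \<in> Obj C" "v \<in> H X" for X v
      using that zero by (simp add: plus_part_def idn)
    show "plus_part (R (Comp C g f)) v = plus_part (R g) (plus_part (R f) v)"
      if h: "X \<in> Obj C" "Y \<in> Obj C" "Z \<in> Obj C" "f \<in> Hom C X Y" "g \<in> Hom C Y Z" "v \<in> H X" for X Y Z f g v
    proof -
      have "R (Comp C g f) (v, 0) = R g (R f (v, 0))" using h zero[OF h(1)] by (intro comp) auto
      then show ?thesis
        by (simp add: R_parts[OF comp_hom[OF h(4,5)] h(6)] R_parts[OF h(4,6)] R_parts[OF h(5) mem(1)[OF h(4,6)]])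
    qed
    show "plus_part (R (Plus C f g)) v = plus_part (R f) v + plus_part (R g) v"
      if "X \<in> Obj C" "Y \<in> Obj C" "f \<in> Hom C X Y" "g \<in> Hom C X Y" "v \<in> H X" for X Y f g v
      unfolding plus_part_def using plus[OF that(1-4), of "(v, 0)"] that(5) zero[OF that(1)] by simp
    show "plus_part (R (Scale C r f)) v = r *\<^sub>C plus_part (R f) v"
      if "X \<in> Obj C" "Y \<in> Obj C" "f \<in> Hom C X Y" "v \<in> H X" for X Y f r v
      unfolding plus_part_def using scale[OF that(1-3), of "(v, 0)"] that(4) zero[OF that(1)]
      by (simp add: scaleC_prod_def)
  qed (rule plus_bounded)
  show ?minus
    unfolding linear_op_functor_def
  proof (intro conjI ballI allI)
    show "minus_part (R (Idn C X)) v = v" if "X \<in> Obj C" "v \<in> H X" for X v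
      using that zero by (simp add: minus_part_def idn)
    show "minus_part (R (Comp C g f)) v = minus_part (R g) (minus_part (R f) v)"
      if h: "X \<in> Obj C" "Y \<in> Obj C" "Z \<in> Obj C" "f \<in> Hom C X Y" "g \<in> Hom C Y Z" "v \<in> H X" for X Y Z f g v
    proof -
      have "R (Comp C g f) (0, v) = R g (R f (0, v))" using h zero[OF h(1)] by (intro comp) auto
      then show ?thesis
        by (simp add: R_parts[OF comp_hom[OF h(4,5)] h(6)] R_parts[OF h(4,6)] R_parts[OF h(5) mem(2)[OF h(4,6)]])
    qed
    show "minus_part (R (Plus C f g)) v = minus_part (R f) v + minus_part (R g) v"
      if "X \<in> Obj C" "Y \<in> Obj C" "f \<in> Hom C X Y" "g \<in> Hom C X Y" "v \<in> H X" for X Y f g v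
      unfolding minus_part_def using plus[OF that(1-4), of "(0, v)"] that(5) zero[OF that(1)] by simp
    show "minus_part (R (Scale C r f)) v = r *\<^sub>C minus_part (R f) v"
      if "X \<in> Obj C" "Y \<in> Obj C" "f \<in> Hom C X Y" "v \<in> H X" for X Y f r v
      unfolding minus_part_def using scale[OF that(1-3), of "(0, v)"] that(4) zero[OF that(1)]
      by (simp add: scaleC_prod_def)
  qed (rule minus_bounded)
qed

lemma twisted_Hom: "f \<in> Hom C X Y \<Longrightarrow> twisted_minus C P Q R f x = Q Y (minus_part (R f) (P X x))"
  by (auto simp: twisted_minus_def Hom_def)

lemma twisted_bounded:
  assumes f: "f \<in> Hom C X Y"
  shows "twisted_minus C P Q R f \<in> bounded_ops (H X) (H Y)"
proof -
  have X: "X \<in> Obj C" "Y \<in> Obj C" using f dom_obj cod_obj by (auto simp: Hom_def)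
  have "twisted_minus C P Q R f = (\<lambda>x. Q Y (minus_part (R f) (P X x)))"
    by (simp add: fun_eq_iff twisted_Hom[OF f])
  then show ?thesis
    using bounded_ops_comp[OF Q_bounded[OF X(2)] bounded_ops_comp[OF minus_bounded[OF f] P_bounded[OF X(1)]]]
    by simp
qed

lemma twisted_functor: "linear_op_functor C H (twisted_minus C P Q R)"
proof -
  note MF = parts_functor(2)[unfolded linear_op_functor_def]
  note mem = bounded_ops_mem[OF minus_bounded]
  show ?thesis
    unfolding linear_op_functor_def
  proof (intro conjI ballI allI)
    show "twisted_minus C P Q R (Idn C X) v = v" if h: "X \<in> Obj C" "v \<in> H X" for X v
    proof -
      have "minus_part (R (Idn C X)) (P X v) = P X v" using MF h(1) P_mem[OF h] by blast
      then show ?thesis by (simp add: twisted_Hom[OF idn_hom[OF h(1)]] QP[OF h])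
    qed
    show "twisted_minus C P Q R (Comp C g f) v = twisted_minus C P Q R g (twisted_minus C P Q R f v)"
      if h: "X \<in> Obj C" "Y \<in> Obj C" "Z \<in> Obj C" "f \<in> Hom C X Y" "g \<in> Hom C Y Z" "v \<in> H X" for X Y Z f g v
    proof -
      have "minus_part (R (Comp C g f)) (P X v) = minus_part (R g) (minus_part (R f) (P X v))"
        using MF h(1-5) P_mem[OF h(1,6)] by blast
      then show ?thesis
        by (simp add: twisted_Hom[OF comp_hom[OF h(4,5)]] twisted_Hom[OF h(4)] twisted_Hom[OF h(5)]
            PQ[OF h(2) mem[OF h(4) P_mem[OF h(1,6)]]])
    qed
    show "twisted_minus C P Q R (Plus C f g) v = twisted_minus C P Q R f v + twisted_minus C P Q R g v"
      if h: "X \<in> Obj C" "Y \<in> Obj C" "f \<in> Hom C X Y" "g \<in> Hom C X Y" "v \<in> H X" for X Y f g v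
    proof -
      have "minus_part (R (Plus C f g)) (P X v) = minus_part (R f) (P X v) + minus_part (R g) (P X v)"
        using MF h(1-4) P_mem[OF h(1,5)] by blast
      then show ?thesis
        by (simp add: twisted_Hom[OF plus_hom[OF h(3,4)]] twisted_Hom[OF h(3)] twisted_Hom[OF h(4)]
            bounded_ops_add[OF Q_bounded[OF h(2)] mem[OF h(3) P_mem[OF h(1,5)]] mem[OF h(4) P_mem[OF h(1,5)]]])
    qed
    show "twisted_minus C P Q R (Scale C r f) v = r *\<^sub>C twisted_minus C P Q R f v"
      if h: "X \<in> Obj C" "Y \<in> Obj C" "f \<in> Hom C X Y" "v \<in> H X" for X Y f r v
    proof -
      have "minus_part (R (Scale C r f)) (P X v) = r *\<^sub>C minus_part (R f) (P X v)"
        using MF h(1-3) P_mem[OF h(1,4)] by blast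
      then show ?thesis
        by (simp add: twisted_Hom[OF scale_hom[OF h(3)]] twisted_Hom[OF h(3)]
            bounded_ops_scaleC[OF Q_bounded[OF h(2)] mem[OF h(3) P_mem[OF h(1,4)]]])
    qed
  qed (rule twisted_bounded)
qed

sublocale quasi_hom C H "\<lambda>f. plus_part (R f)" "twisted_minus C P Q R" q
  by unfold_locales (rule dc parts_functor(1) twisted_functor q_pos schatten_diff; assumption?)+

lemma Arr_Hom: "f \<in> Arr C \<Longrightarrow> f \<in> Hom C (Dom C f) (Cod C f)"
  by (simp add: Hom_def)

text \<open>\<open>P\<close> intertwines the twisted half with the original one, by
  \<open>P Q = 1\<close>.\<close>

lemma minus_P:
  assumes f: "f \<in> Arr C" and z: "z \<in> H (Dom C f)"
  shows "minus_part (R f) (P (Dom C f) z) = P (Cod C f) (twisted_minus C P Q R f z)"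
  unfolding twisted_minus_def
  by (rule PQ[symmetric, OF cod_obj[OF f] bounded_ops_mem[OF minus_bounded[OF Arr_Hom[OF f]] P_mem[OF dom_obj[OF f] z]]])

text \<open>In the coordinates \<open>(x, P z)\<close> the operator \<open>F\<close> swaps
  \<open>x\<close> and \<open>z\<close>, and \<open>R f\<close> acts by the two functors; the
  commutator becomes \<open>\<delta>\<close> combined with a quarter turn.\<close>

lemma fredholm_comm_apply:
  assumes f: "f \<in> Arr C" and x: "x \<in> H (Dom C f)" "z \<in> H (Dom C f)"
  shows "fredholm_comm C R F f (x, P (Dom C f) z) = (- \<delta> f z, P (Cod C f) (\<delta> f x))"
proof -
  note o = dom_obj[OF f] cod_obj[OF f]
  note mem = letter_mem[OF a_letter f] letter_mem[OF b_letter f]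
  show ?thesis
    unfolding fredholm_comm_def
    by (simp add: R_apply[OF Arr_Hom[OF f]] x P_mem o F_apply QP minus_P f \<delta>_def mem
        bounded_ops_diff[OF P_bounded sub])
qed

text \<open>The quarter turn squares to \<open>-1\<close>, so every two commutators contribute one
  sign, and an odd number leaves one turn. The arrow \<open>f\<close> names the target space, also
  for empty \<open>gs\<close>.\<close>

lemma prod_op_comm:
  assumes "composable C (f # gs)" "x \<in> H (Dom C (last (f # gs)))" "z \<in> H (Dom C (last (f # gs)))"
  shows "prod_op (fredholm_comm C R F) gs (x, P (Dom C (last (f # gs))) z)
    = (if even (length gs)
       then ((-1) ^ (length gs div 2) *\<^sub>R prod_op \<delta> gs x,
             P (Dom C f) ((-1) ^ (length gs div 2) *\<^sub>R prod_op \<delta> gs z))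
       else (- ((-1) ^ (length gs div 2) *\<^sub>R prod_op \<delta> gs z),
             P (Dom C f) ((-1) ^ (length gs div 2) *\<^sub>R prod_op \<delta> gs x)))"
  using assms
proof (induction gs arbitrary: f)
  case (Cons g ws)
  have g: "g \<in> Arr C" "Dom C f = Cod C g" "composable C (g # ws)"
    using Cons.prems(1) composable_tl[of C f "g # ws"] by (auto simp: composable_iff_nth)
  define s :: real where "s = (-1) ^ (length ws div 2)"
  have mem: "prod_op \<delta> ws x \<in> H (Dom C g)" "prod_op \<delta> ws z \<in> H (Dom C g)"
    using prod_op_mem_tail[OF \<delta>_letter g(3)] Cons.prems(2,3) by auto
  note subg = sub[OF dom_obj[OF g(1)]]
  have mem_s: "s *\<^sub>R prod_op \<delta> ws x \<in> H (Dom C g)" "s *\<^sub>R prod_op \<delta> ws z \<in> H (Dom C g)"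
    "- (s *\<^sub>R prod_op \<delta> ws z) \<in> H (Dom C g)"
    using mem by (auto intro!: subspace_scaleR[OF subg] subspace_uminus[OF subg])
  note \<delta>b = letter_bounded[OF \<delta>_letter g(1)]
  note sc = bounded_ops_scaleR[OF \<delta>b mem(1)] bounded_ops_scaleR[OF \<delta>b mem(2)]
    bounded_ops_minus[OF \<delta>b mem_s(2)]
  have IH: "prod_op (fredholm_comm C R F) ws (x, P (Dom C (last (g # ws))) z)
    = (if even (length ws) then (s *\<^sub>R prod_op \<delta> ws x, P (Dom C g) (s *\<^sub>R prod_op \<delta> ws z))
       else (- (s *\<^sub>R prod_op \<delta> ws z), P (Dom C g) (s *\<^sub>R prod_op \<delta> ws x)))"
    unfolding s_def using Cons.prems(2,3) by (intro Cons.IH[OF g(3)]) auto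
  have last: "last (f # g # ws) = last (g # ws)" by simp
  show ?case
  proof (cases "even (length ws)")
    case True
    then have "length (g # ws) div 2 = length ws div 2" by simp
    then show ?thesis
      unfolding last prod_op_Cons IH g(2) using True
      by (simp only: if_True fredholm_comm_apply[OF g(1) mem_s(1,2)] sc s_def[symmetric]) simp
  next
    case False
    then have "length (g # ws) div 2 = Suc (length ws div 2)" by simp
    then have s': "(-1 :: real) ^ (length (g # ws) div 2) = - s" by (simp add: s_def)
    show ?thesis
      unfolding last prod_op_Cons IH g(2) s' using False
      by (simp add: fredholm_comm_apply[OF g(1) mem_s(3,1)] sc)
  qed
qed simp

text \<open>In the coordinates \<open>(x, P z)\<close> the operator under the supertrace is
  \<open>(-1) ^ (n div 2)\<close> times the product of all \<open>\<delta>\<close> on each half.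
  Both halves have the same trace, and the factor 1/2 leaves one of them.\<close>

theorem fredholm_character_eq:
  assumes n: "q \<le> real n" "even n"
  shows "fredholm_character C n (\<lambda>X. double (H X)) R F fs = (-1) ^ (n div 2) * character n fs"
proof (cases "fs \<in> cyclic_tuples C n")
  case True
  obtain f gs where fs: "fs = f # gs" using cyclic_tuples_length[OF True] by (cases fs) auto
  note cyc = True[unfolded fs]
  note comp = cyclic_tuples_composable[OF cyc]
  have f: "f \<in> Arr C" and len: "length gs = n" using cyc by (auto simp: cyclic_tuples_iff)
  define X where "X = Cod C f"
  have X: "X \<in> Obj C" "Dom C (last (f # gs)) = X" using cod_obj[OF f] comp(2) by (auto simp: X_def)
  note subX = sub[OF X(1)] and oD = dom_obj[OF f] and subD = sub[OF dom_obj[OF f]]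
  define s :: real where "s = (-1) ^ (n div 2)"
  define T where "T = foldr (\<circ>) (R (hd fs) # map (fredholm_comm C R F) (tl fs)) id"
  define A where "A x = plus_part (R f) (s *\<^sub>R prod_op \<delta> gs x)" for x
  define B where "B x = twisted_minus C P Q R f (s *\<^sub>R prod_op \<delta> gs x)" for x
  define Z where "Z = prod_op \<delta> fs"
  have tail: "prod_op \<delta> gs x \<in> H (Dom C f)" if "x \<in> H X" for x
    using prod_op_mem_tail[OF \<delta>_letter comp(1)] that X(2) by simp
  then have tail_s: "s *\<^sub>R prod_op \<delta> gs x \<in> H (Dom C f)" if "x \<in> H X" for x
    using subspace_scaleR[OF subD] that by blast
  have AB: "A x \<in> H X" "B x \<in> H X" if "x \<in> H X" for x
    unfolding A_def B_def X_def
    by (rule letter_mem[OF a_letter f tail_s[OF that]], rule letter_mem[OF b_letter f tail_s[OF that]])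
  have AB_Z: "A x - B x = s *\<^sub>R Z x" if "x \<in> H X" for x
    using bounded_ops_scaleR[OF letter_bounded[OF \<delta>_letter f] tail[OF that], of s]
    by (simp add: A_def B_def Z_def fs \<delta>_def)
  have T: "T (x, P X z) = (A x, P X (B z))" if x: "x \<in> H X" "z \<in> H X" for x z
  proof -
    have "T (x, P X z) = R f (prod_op (fredholm_comm C R F) gs (x, P X z))"
      by (simp add: T_def fs prod_op_def)
    also have "prod_op (fredholm_comm C R F) gs (x, P X z)
        = (s *\<^sub>R prod_op \<delta> gs x, P (Dom C f) (s *\<^sub>R prod_op \<delta> gs z))"
      using prod_op_comm[OF comp(1), unfolded X(2), OF x] n(2) len by (simp add: s_def)
    also have "R f \<dots> = (A x, P X (B z))"
      unfolding A_def B_def X_def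
      by (simp add: R_apply[OF Arr_Hom[OF f] tail_s[OF x(1)] P_mem[OF oD tail_s[OF x(2)]]] minus_P[OF f tail_s[OF x(2)]])
    finally show ?thesis .
  qed
  have zero: "0 \<in> H X" "P X 0 = 0"
    using complex_vector.subspace_0[OF subX] bounded_ops_zero[OF P_bounded[OF X(1)] subX] by auto
  have AB0: "A 0 = 0" "B 0 = 0"
  proof -
    note ne = tail_not_Nil[OF cyc n(1)]
    note c = cyclic_Cons[OF cyc ne]
    have "prod_op \<delta> gs \<in> bounded_ops (H X) (H (Dom C f))"
      using prod_op_trace_class[OF c(2) ne] n(1) c by (simp add: trace_class_def X_def)
    then have "prod_op \<delta> gs 0 = 0" by (rule bounded_ops_zero[OF _ subX])
    then show "A 0 = 0" "B 0 = 0"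
      using bounded_ops_zero[OF letter_bounded[OF a_letter f] subD] bounded_ops_zero[OF letter_bounded[OF b_letter f] subD]
      by (simp_all add: A_def B_def)
  qed
  \<comment> \<open>An even number of commutators is block diagonal, so the degree is 0 and the
    graded commutator with \<open>F\<close> is the ordinary one.\<close>
  have "degree0 (double (H X)) T"
    unfolding degree0_def double_def
  proof (intro conjI ballI)
    fix x assume "x \<in> fst (H X, H X)"
    then have x: "x \<in> H X" by simp
    show "snd (T (x, 0)) = 0" using T[OF x zero(1)] zero AB0 by simp
  next
    fix y assume "y \<in> snd (H X, H X)"
    then have y: "y \<in> H X" by simp
    show "fst (T (0, y)) = 0" using T[OF zero(1) Q_mem[OF X(1) y]] AB0 by (simp add: PQ[OF X(1) y])
  qed
  then have deg: "op_degree (double (H X)) T = 0" by (simp add: op_degree_def)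
  have op: "grading (F X (F X (T v) - (-1) ^ op_degree (double (H X)) T *\<^sub>R T (F X v)))
      = complex_of_real s *\<^sub>C ((Z (fst v), 0) + (0, P X (Z (Q X (snd v)))))"
    if v: "v \<in> H X \<times> H X" for v
  proof -
    obtain x z where xz: "x \<in> H X" "z \<in> H X" "v = (x, P X z)" "Q X (snd v) = z"
      using v Q_mem[OF X(1)] PQ[OF X(1)] QP[OF X(1)] by (metis SigmaE snd_conv)
    note m = AB[OF xz(1)] AB[OF xz(2)]
    have FT: "F X (T v) = (B z, P X (A x))"
      by (simp add: xz T F_apply X(1) QP m)
    have TF: "T (F X v) = (A z, P X (B x))"
      by (simp add: xz F_apply X(1) QP T)
    have "P X (A x) - P X (B x) = P X (A x - B x)"
      using bounded_ops_diff[OF P_bounded[OF X(1)] subX] m by simp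
    then have "grading (F X (F X (T v) - (-1) ^ op_degree (double (H X)) T *\<^sub>R T (F X v)))
      = (A x - B x, - P X (B z - A z))"
      using complex_vector.subspace_diff[OF subX m(1,2)]
      by (simp add: FT TF deg F_apply X(1) grading_def QP)
    also have "- P X (B z - A z) = P X (A z - B z)"
      using bounded_ops_diff[OF P_bounded[OF X(1)] subX] m by simp
    also have "\<dots> = s *\<^sub>R P X (Z z)"
      unfolding AB_Z[OF xz(2)]
      by (rule bounded_ops_scaleR[OF P_bounded[OF X(1)]])
        (use letter_mem[OF \<delta>_letter f tail[OF xz(2)]] in \<open>simp add: Z_def fs X_def\<close>)
    finally show ?thesis
      unfolding AB_Z[OF xz(1)] scaleC_of_real by (simp add: xz QP X(1))
  qed
  have Z: "Z \<in> trace_class (H X) (H X)"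
    using prod_op_trace_class[OF comp(1)] n(1) len X(2) by (simp add: Z_def fs X_def)
  note dcX = dc[OF X(1)] and dcXX = dense_countable_Times[OF dc[OF X(1)] dc[OF X(1)]]
  \<comment> \<open>Each half is the inclusion, \<open>Z\<close> and the projection, with
    \<open>P\<close> and \<open>Q\<close> around \<open>Z\<close> on the odd side; cyclicity brings
    the outer factors together, where they cancel.\<close>
  note left = op_trace_conjugate[OF Z bounded_ops_inl[OF subX] bounded_ops_fst dcX dcX dcXX]
  note right = op_trace_conjugate[OF Z
      bounded_ops_comp[OF bounded_ops_inr[OF subX] P_bounded[OF X(1)]]
      bounded_ops_comp[OF Q_bounded[OF X(1)] bounded_ops_snd] dcX dcX dcXX]
  have Zt: "op_trace (H X) (\<lambda>x. Q X (snd (0 :: 'h, P X (Z x)))) = op_trace (H X) Z"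
    using bounded_ops_mem[of Z "H X" "H X"] Z QP[OF X(1)]
    unfolding trace_class_def by (intro op_trace_cong) auto
  have "op_trace (H X \<times> H X) (\<lambda>v. grading (F X (F X (T v) - (-1) ^ op_degree (double (H X)) T *\<^sub>R T (F X v))))
      = op_trace (H X \<times> H X) (\<lambda>v. complex_of_real s *\<^sub>C ((Z (fst v), 0) + (0, P X (Z (Q X (snd v))))))"
    by (rule op_trace_cong[OF op])
  also have "\<dots> = complex_of_real s * (op_trace (H X) Z + op_trace (H X) Z)"
    unfolding op_trace_scaleC[OF dcXX traceable_add[OF left(2) right(2)]]
      op_trace_add[OF dcXX left(2) right(2)] left(1) right(1) Zt by simp
  finally have "supertrace (double (H X)) (F X) T = complex_of_real s * op_trace (H X) Z"
    by (simp add: supertrace_def total_def double_def)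
  moreover have "op_trace (H X) Z = letter_trace \<delta> fs"
    by (simp add: letter_trace_def Z_def fs X_def prod_op_def comp_def)
  ultimately show ?thesis
    using True by (simp add: fredholm_character_def character_def T_def s_def X_def fs)
qed (simp add: fredholm_character_def character_def)

end

theorem theorem4p6:
  fixes C :: "('o, 'm) linear_cat"
    and H :: "'o \<Rightarrow> 'h::complex_inner set"
    and R :: "real \<Rightarrow> 'm \<Rightarrow> 'h \<times> 'h \<Rightarrow> 'h \<times> 'h"
    and P Q :: "real \<Rightarrow> 'o \<Rightarrow> 'h \<Rightarrow> 'h"
    and F :: "real \<Rightarrow> 'o \<Rightarrow> 'h \<times> 'h \<Rightarrow> 'h \<times> 'h"
    and p :: nat
  assumes "linear_category C"
    and "\<forall>t\<in>{0..1}. functor_SHilb2 C H (R t)"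
    and "even p" and "0 < p"
    and "\<forall>t\<in>{0..1}. \<forall>X\<in>Obj C. F t X = offdiag (Q t X) (P t X)"
    and "\<forall>t\<in>{0..1}. \<forall>X\<in>Obj C. \<forall>x\<in>H X. P t X (Q t X x) = x \<and> Q t X (P t X x) = x"
    and "\<forall>t\<in>{0..1}. even_fredholm_module C (real p) (\<lambda>X. double (H X)) (R t) (F t)"
    and "\<forall>X\<in>Obj C. \<forall>Y\<in>Obj C. \<forall>f\<in>Hom C X Y.
           schatten_continuous_on (real p) (H X) (H Y) {0..1}
             (\<lambda>t x. plus_part (R t f) x - Q t Y (minus_part (R t f) (P t X x)))"
    and "\<forall>X\<in>Obj C. \<forall>Y\<in>Obj C. \<forall>f\<in>Hom C X Y.
           piecewise_strongly_C1 (H X) (\<lambda>t. plus_part (R t f))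
           \<and> piecewise_strongly_C1 (H X) (\<lambda>t x. Q t Y (minus_part (R t f) (P t X x)))"
  shows "(\<forall>t\<in>{0..1}. chern_character C (p + 2) (\<lambda>X. double (H X)) (R t) (F t)
             \<in> cyclic_cohomology C (p + 2))
       \<and> (\<forall>t\<in>{0..1}. \<forall>t'\<in>{0..1}.
            chern_character C (p + 2) (\<lambda>X. double (H X)) (R t) (F t)
            = chern_character C (p + 2) (\<lambda>X. double (H X)) (R t') (F t'))"
proof -
  interpret linear_category C by fact
  let ?a = "\<lambda>t f. plus_part (R t f)" and ?b = "\<lambda>t. twisted_minus C (P t) (Q t) (R t)"
  \<comment> \<open>The bounding cochain lives in the odd degree \<open>p + 1\<close>; its words
    have \<open>p + 1\<close> letters \<open>\<delta>\<close> behind the distinguished one.\<close>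
  define N where "N = p + 1"
  have N: "real p \<le> real N" "odd N" "real p \<le> real (Suc N)" "even (Suc N)" "p + 2 = Suc N"
    using \<open>even p\<close> by (auto simp: N_def)
  have schatten: "schatten_continuous_on (real p) (H (Dom C f)) (H (Cod C f)) {0..1}
      (\<lambda>t x. ?a t f x - ?b t f x)" if "f \<in> Arr C" for f
    using assms(8) dom_obj[OF that] cod_obj[OF that] that by (auto simp: Hom_def twisted_minus_def)
  have module: "invertible_module C H (P t) (Q t) (R t) (F t) (real p)" if t: "t \<in> {0..1}" for t
  proof
    show "(\<lambda>x. ?a t f x - ?b t f x) \<in> schatten (real p) (H (Dom C f)) (H (Cod C f))" if "f \<in> Arr C" for f
      using schatten[OF that] t by (simp add: schatten_continuous_on_def)
  qed (use assms(4-7) t in auto)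
  have hilbert: "complex_vector.subspace (H X)" "complete (H X)" if "X \<in> Obj C" for X
    using assms(2) that by (force simp: functor_SHilb2_def separable_hilbert_def)+
  have C1: "\<exists>L S. C1_family (H (Dom C f)) (H (Cod C f)) L S (\<lambda>t. ?a t f)"
    "\<exists>L S. C1_family (H (Dom C f)) (H (Cod C f)) L S (\<lambda>t. ?b t f)" if f: "f \<in> Arr C" for f
  proof -
    have Hom: "f \<in> Hom C (Dom C f) (Cod C f)" using f by (simp add: Hom_def)
    note o = dom_obj[OF f] cod_obj[OF f]
    have pC1: "piecewise_strongly_C1 (H (Dom C f)) (\<lambda>t. ?a t f)"
      "piecewise_strongly_C1 (H (Dom C f)) (\<lambda>t. ?b t f)"
      using assms(9) o Hom by (auto simp: twisted_minus_def[abs_def])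
    show "\<exists>L S. C1_family (H (Dom C f)) (H (Cod C f)) L S (\<lambda>t. ?a t f)"
      by (rule piecewise_strongly_C1_family[OF hilbert[OF o(1)] hilbert[OF o(2)]
            invertible_module.plus_bounded[OF module Hom] pC1(1)]) blast+
    show "\<exists>L S. C1_family (H (Dom C f)) (H (Cod C f)) L S (\<lambda>t. ?b t f)"
      by (rule piecewise_strongly_C1_family[OF hilbert[OF o(1)] hilbert[OF o(2)]
            invertible_module.twisted_bounded[OF module Hom] pC1(2)]) blast+
  qed
  have pair: "quasi_hom C H (?a t) (?b t) (real p)" if "t \<in> {0..1}" for t
  proof -
    interpret invertible_module C H "P t" "Q t" "R t" "F t" "real p" by (rule module[OF that])
    show ?thesis by (rule quasi_hom_axioms)
  qed
  have hom: "homotopy C H ?a ?b (real p)"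
    by (intro homotopy.intro homotopy_axioms.intro linear_category_axioms pair schatten C1)
  define ch where "ch t = quasi_hom.character C H (?a t) (?b t) (Suc N)" for t
  define \<phi> where "\<phi> t = fredholm_character C (Suc N) (\<lambda>X. double (H X)) (R t) (F t)" for t
  have \<phi>: "\<phi> t = (\<lambda>fs. (-1) ^ (Suc N div 2) * ch t fs)" if "t \<in> {0..1}" for t
    using invertible_module.fredholm_character_eq[OF module[OF that] N(3,4)]
    by (simp add: \<phi>_def ch_def fun_eq_iff)
  have cocycle: "\<phi> t \<in> cyclic_cocycles C (Suc N)" if "t \<in> {0..1}" for t
    unfolding \<phi>[OF that] ch_def
    by (rule cyclic_cocycles_scale[OF quasi_hom.character_cocycle[OF pair[OF that] N(3,4)]])
  have "(\<phi> t, \<phi> 0) \<in> cohomologous C (Suc N)" if t: "t \<in> {0..1}" for t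
  proof -
    obtain \<psi> where \<psi>: "\<psi> \<in> cyclic_cochains C N" "\<And>fs. ch t fs - ch 0 fs = coboundary C N \<psi> fs"
      using homotopy.character_homotopy[OF hom N(1,2) t] unfolding ch_def by blast
    \<comment> \<open>The sign relating the two characters is the same for all \<open>t\<close> and
      is passed on to the bounding cochain.\<close>
    have "\<phi> t fs - \<phi> 0 fs = coboundary C N (\<lambda>fs. (-1) ^ (Suc N div 2) * \<psi> fs) fs" for fs
      using t by (simp add: \<phi> coboundary_scale \<psi>(2)[symmetric] right_diff_distrib)
    then have "(\<lambda>fs. \<phi> t fs - \<phi> 0 fs) \<in> cyclic_coboundaries C (Suc N)"
      using cyclic_cochains_scale[OF \<psi>(1)] unfolding cyclic_coboundaries_Suc by blast
    then show ?thesis using cocycle t by (simp add: cohomologous_def)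
  qed
  then have "cohomologous C (Suc N) `` {\<phi> t} = cohomologous C (Suc N) `` {\<phi> 0}" if "t \<in> {0..1}" for t
    using equiv_class_eq[OF equiv_cohomologous] that by blast
  moreover have "cohomologous C (Suc N) `` {\<phi> t} \<in> cyclic_cohomology C (Suc N)" if "t \<in> {0..1}" for t
    unfolding cyclic_cohomology_def by (rule quotientI[OF cocycle[OF that]])
  ultimately show ?thesis
    unfolding chern_character_def N(5) \<phi>_def[symmetric] by metis
qed

end
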